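(* Assume (A1) and (A2) (stated in the context) and let $T>0$. Then for every $\xi\in L^2(\Omega,\mathcal F_T,P;H)$ the backward linear stochastic differential equation $$dY_t=-(A^*Y_t+C^*Z_t)\,dt+Z_t\,dW_t,\quad t\in[0,T],\qquad Y_T=\xi,$$ has a unique mild solution $(Y,Z)$. Moreover, this solution satisfies $$\sup_{t\in[0,T]}E\big[|Y_t|^2\big]+E\Big[\int_0^T|Z_s|^2\,ds\Big]\le k\,E\big[|\xi|^2\big],$$ where $k>0$ is a constant that does not depend on the particular choice of $\xi$ but only on the operators $A$, $C$ and the time horizon $T$.
   Context: $H,\Xi$ are separable real Hilbert spaces; $\mathcal L(\Xi,H)$ is the space of bounded linear operators, $L_2(\Xi,H)=L_2(\Xi;H)$ the space of Hilbert–Schmidt operators, with their usual norms. $A:D(A)\subset H\to H$ is a linear dissipative operator generating a $C_0$-semigroup $(e^{tA})_{t\ge0}$; $A^*$ is its adjoint and $e^{tA^*}=(e^{tA})^*$. $C$ is a linear (possibly unbounded) operator from $H$ to $\mathcal L(\Xi,H)$; products such as $e^{tA}C$ or $Ce^{tA}$ that are said to be bounded are identified with the corresponding bounded operators on all of $H$. It is assumed that for all $t>0$, $e^{tA}C\in\mathcal L(H;L_2(\Xi,H))$ and $|e^{tA}C|_{\mathcal L(H;L_2(\Xi,H))}\le Lt^{-\gamma}$ for some constants $\gamma\in[0,\frac12)$, $L>0$; and that for all $t>0$, $Ce^{tA}$ maps $H$ into $L_2(\Xi;H)$, so that $(Ce^{tA})^*$ maps $L_2(\Xi;H)$ into $H$.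 $(\Omega,\mathcal F,P)$ is a complete probability space endowed with a filtration $(\mathcal F_t)_{t\ge0}$ satisfying the usual assumptions of completeness and right-continuity, and $W$ is a cylindrical $(\mathcal F_t)$-Wiener process with values in $\Xi$. Assumption (A1): $C=C_1+C_2$ with $C_1,C_2$ linear such that 1) $C_2$ is a bounded operator from $H$ to $L_2(\Xi;H)$; 2) for all $t>0$, $C_1e^{tA}\in\mathcal L(H;L_2(\Xi;H))$, and there exist $\gamma\in[0,\frac12)$ and $L>0$ with $|C_1e^{tA}|_{\mathcal L(H;L_2(\Xi;H))}\le Lt^{-\gamma}$ for all $t>0$; 3) there exists a constant $a>\frac12$ such that $A+a(C_1e^{\delta A})^*(C_1e^{\delta A})$ is dissipative for some sequence $\delta\searrow0$ (i.e. for all $\delta$ in some sequence of positive numbers decreasing to $0$). Assumption (A2): if $C_1\neq0$, then $-A^2$ is dissipative. A mild solution is a couple $(Y,Z)$ of progressively measurable processes with values in $H$ and $L_2(\Xi,H)$ respectively, such that $(Y,Z)\in C([0,T];L^2(\Omega;H))\times L^2([0,T]\times\Omega;L_2(\Xi;H))$, $\sup_{t\in[0,T]}E[|Y_t|^2]+E[\int_0^T|Z_t|^2dt]<\infty$, $\int_0^T|(Ce^{(s-t)A})^*Z_s|\,ds<\infty$ $P$-a.s. (the integrand being considered for $s>t$), and, for all $t\in[0,T]$, $$Y_t=e^{(T-t)A^*}\xi+\int_t^T(Ce^{(s-t)A})^*Z_s\,ds-\int_t^Te^{(s-t)A^*}Z_s\,dW_s .$$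
   Formalization: The filtration is additionally assumed to be the augmented filtration generated by W (otherwise existence can fail, e.g. A = 0, C = 0 and ξ independent of W); the constant k is uniform over all stochastic bases on a given sample set Ω. *)

theory Defs
  imports "HOL-Probability.Probability"
begin

section \<open>Orthonormal bases\<close>

definition orthonormal :: "'a::real_inner set \<Rightarrow> bool" where
  "orthonormal E \<longleftrightarrow> pairwise orthogonal E \<and> (\<forall>e\<in>E. norm e = 1)"

definition onb :: "'a::real_inner set \<Rightarrow> bool" where
  "onb B \<longleftrightarrow> orthonormal B \<and> closure (span B) = UNIV"

lemma orthonormal_subset: "orthonormal B \<Longrightarrow> E \<subseteq> B \<Longrightarrow> orthonormal E"
  unfolding orthonormal_def by (auto intro: pairwise_subset)

lemma orthonormal_inner:
  "orthonormal E \<Longrightarrow> e \<in> E \<Longrightarrow> f \<in> E \<Longrightarrow> e \<bullet> f = (if e = f then 1 else 0)"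
  unfolding orthonormal_def pairwise_def orthogonal_def
  by (metis dot_square_norm power_one)

lemma orthonormal_sum_inner:
  assumes "orthonormal E" "finite E" "e \<in> E"
  shows "(\<Sum>f\<in>E. c f *\<^sub>R f) \<bullet> e = c e"
proof -
  have "(\<Sum>f\<in>E. c f *\<^sub>R f) \<bullet> e = (\<Sum>f\<in>E. if f = e then c f else 0)"
    unfolding inner_sum_left inner_scaleR_left
    by (intro sum.cong refl) (simp add: orthonormal_inner[OF assms(1) _ assms(3)])
  then show ?thesis using assms by simp
qed

lemma orthonormal_norm_sum:
  assumes "orthonormal E" "finite E"
  shows "(norm (\<Sum>e\<in>E. c e *\<^sub>R e))\<^sup>2 = (\<Sum>e\<in>E. (c e)\<^sup>2)"
proof -
  have "(norm (\<Sum>e\<in>E. c e *\<^sub>R e))\<^sup>2 = (\<Sum>e\<in>E. c e *\<^sub>R e) \<bullet> (\<Sum>e\<in>E. c e *\<^sub>R e)"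
    by (simp add: power2_norm_eq_inner)
  also have "\<dots> = (\<Sum>e\<in>E. c e * ((\<Sum>f\<in>E. c f *\<^sub>R f) \<bullet> e))"
    by (simp add: inner_sum_right)
  also have "\<dots> = (\<Sum>e\<in>E. (c e)\<^sup>2)"
    by (intro sum.cong refl) (simp add: orthonormal_sum_inner[OF assms] power2_eq_square)
  finally show ?thesis .
qed

lemma orthonormal_dist_sum:
  assumes "orthonormal E" "finite E"
  shows "(norm (x - (\<Sum>e\<in>E. c e *\<^sub>R e)))\<^sup>2
    = (norm x)\<^sup>2 - (\<Sum>e\<in>E. (x \<bullet> e)\<^sup>2) + (\<Sum>e\<in>E. (c e - x \<bullet> e)\<^sup>2)"
proof -
  have "(norm (x - (\<Sum>e\<in>E. c e *\<^sub>R e)))\<^sup>2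
      = (norm x)\<^sup>2 - 2 * (x \<bullet> (\<Sum>e\<in>E. c e *\<^sub>R e)) + (norm (\<Sum>e\<in>E. c e *\<^sub>R e))\<^sup>2"
    by (simp add: power2_norm_eq_inner algebra_simps inner_commute)
  also have "\<dots> = (norm x)\<^sup>2 - (\<Sum>e\<in>E. (x \<bullet> e)\<^sup>2) + (\<Sum>e\<in>E. (c e - x \<bullet> e)\<^sup>2)"
    unfolding orthonormal_norm_sum[OF assms]
    by (simp add: inner_sum_right power2_diff sum.distrib sum_subtractf sum_distrib_left mult.assoc)
  finally show ?thesis .
qed

lemma bessel:
  assumes "orthonormal E" "finite E"
  shows "(\<Sum>e\<in>E. (x \<bullet> e)\<^sup>2) \<le> (norm x)\<^sup>2"
proof -
  have "0 \<le> (norm (x - (\<Sum>e\<in>E. (x \<bullet> e) *\<^sub>R e)))\<^sup>2" by simp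
  also have "\<dots> = (norm x)\<^sup>2 - (\<Sum>e\<in>E. (x \<bullet> e)\<^sup>2)"
    by (subst orthonormal_dist_sum[OF assms]) simp
  finally show ?thesis by simp
qed

lemma gram_schmidt_step:
  assumes "orthonormal E" "finite E"
  shows "\<exists>E'. orthonormal E' \<and> finite E' \<and> E \<subseteq> E' \<and> d \<in> span E'"
proof -
  define p where "p = (\<Sum>e\<in>E. (d \<bullet> e) *\<^sub>R e)"
  have p: "p \<in> span E"
    unfolding p_def by (intro span_sum span_scale span_base)
  have orth: "(d - p) \<bullet> e = 0" if "e \<in> E" for e
    using orthonormal_sum_inner[OF assms that] by (simp add: p_def inner_diff_left)
  show ?thesis
  proof (cases "d = p")
    case True
    then show ?thesis using assms p by blast
  next
    case False
    define u where "u = (1 / norm (d - p)) *\<^sub>R (d - p)"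
    have u: "norm u = 1" "\<And>e. e \<in> E \<Longrightarrow> orthogonal u e \<and> orthogonal e u"
      using False orth by (auto simp: u_def orthogonal_def inner_commute)
    have "orthonormal (insert u E)"
      using assms(1) u unfolding orthonormal_def by (auto simp: pairwise_insert)
    moreover have "d = p + norm (d - p) *\<^sub>R u"
      using False by (simp add: u_def)
    then have "d \<in> span (insert u E)"
      by (metis insertI1 p span_add span_base span_mono span_scale subset_insertI subsetD)
    ultimately show ?thesis using assms(2) by blast
  qed
qed

lemma finite_orthonormal_span:
  assumes "finite D"
  shows "\<exists>E. orthonormal E \<and> finite E \<and> D \<subseteq> span E"
  using assms
proof (induction D)
  case empty
  show ?case by (intro exI[of _ "{}"]) (simp add: orthonormal_def)
next
  case (insert d D)
  then obtain E where E: "orthonormal E" "finite E" "D \<subseteq> span E" by blast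
  obtain E' where "orthonormal E'" "finite E'" "E \<subseteq> E'" "d \<in> span E'"
    using gram_schmidt_step[OF E(1,2)] by blast
  then show ?case using E(3) span_mono by blast
qed

lemma onb_exists: "\<exists>B::'a::{real_inner, second_countable_topology} set. onb B"
proof -
  obtain D :: "'a set" where D: "countable D" "\<And>X. open X \<Longrightarrow> X \<noteq> {} \<Longrightarrow> \<exists>d\<in>D. d \<in> X"
    by (rule countable_dense_setE) blast
  have ne: "D \<noteq> {}" using D(2)[of UNIV] by auto
  define d where "d = from_nat_into D"
  have "\<exists>E. \<forall>n. (orthonormal (E n) \<and> finite (E n)) \<and> (E n \<subseteq> E (Suc n) \<and> d n \<in> span (E (Suc n)))"
  proof (rule dependent_nat_choice)
    show "\<exists>E::'a set. orthonormal E \<and> finite E"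
      by (intro exI[of _ "{}"]) (simp add: orthonormal_def)
  next
    fix E :: "'a set" and n assume "orthonormal E \<and> finite E"
    then show "\<exists>E'. (orthonormal E' \<and> finite E') \<and> E \<subseteq> E' \<and> d n \<in> span E'"
      using gram_schmidt_step[of E "d n"] by blast
  qed
  then obtain E where E: "\<And>n. orthonormal (E n)" "\<And>n. E n \<subseteq> E (Suc n)" "\<And>n. d n \<in> span (E (Suc n))"
    by blast
  have mono: "E m \<subseteq> E n" if "m \<le> n" for m n
    using lift_Suc_mono_le[of E] E(2) that by blast
  define B where "B = (\<Union>n. E n)"
  have "orthonormal B"
    unfolding orthonormal_def pairwise_def
  proof safe
    fix x y assume "x \<in> B" "y \<in> B" "x \<noteq> y"
    then obtain m n where "x \<in> E m" "y \<in> E n" by (auto simp: B_def)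
    then have "x \<in> E (max m n)" "y \<in> E (max m n)"
      using mono by (meson max.cobounded1 max.cobounded2 subsetD)+
    with E(1)[of "max m n"] \<open>x \<noteq> y\<close> show "orthogonal x y"
      by (auto simp: orthonormal_def pairwise_def)
  next
    fix x assume "x \<in> B"
    then show "norm x = 1" using E(1) by (auto simp: B_def orthonormal_def)
  qed
  moreover have "D \<subseteq> span B"
  proof
    fix x assume "x \<in> D"
    then obtain n where "x = d n"
      using from_nat_into_surj[OF D(1)] unfolding d_def by metis
    then have "x \<in> span (E (Suc n))" using E(3) by simp
    then show "x \<in> span B" using span_mono[of "E (Suc n)" B] by (auto simp: B_def)
  qed
  then have "closure (span B) = UNIV"
  proof -
    have "x \<in> closure (span B)" for x
      unfolding closure_approachable
    proof safe
      fix e :: real assume "e > 0"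
      then obtain y where "y \<in> D" "y \<in> ball x e" using D(2)[of "ball x e"] by auto
      then show "\<exists>y\<in>span B. dist y x < e"
        using \<open>D \<subseteq> span B\<close> by (auto simp: dist_commute)
    qed
    then show ?thesis by blast
  qed
  ultimately show ?thesis unfolding onb_def by blast
qed

lemma onb_countable:
  fixes B :: "'a::{real_inner, second_countable_topology} set"
  assumes "orthonormal B"
  shows "countable B"
proof -
  have sep: "dist e f \<ge> 1" if "e \<in> B" "f \<in> B" "e \<noteq> f" for e f
  proof -
    have "(norm (e - f))\<^sup>2 = 2"
      using orthonormal_inner[OF assms that(1,2)] orthonormal_inner[OF assms that(1,1)]
        orthonormal_inner[OF assms that(2,2)] that(3)
      by (simp add: power2_norm_eq_inner algebra_simps inner_commute)
    then show ?thesis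
      unfolding dist_norm by (smt (verit) norm_ge_zero power_le_one)
  qed
  obtain D :: "'a set" where D: "countable D" "\<And>X. open X \<Longrightarrow> X \<noteq> {} \<Longrightarrow> \<exists>d\<in>D. d \<in> X"
    by (rule countable_dense_setE) blast
  have "\<exists>d\<in>D. d \<in> ball e (1/2)" for e
    using D(2)[of "ball e (1/2)"] by (simp del: mem_ball)
  then obtain g where g: "\<And>e. g e \<in> D" "\<And>e. g e \<in> ball e (1/2)" by metis
  have "inj_on g B"
  proof (rule inj_onI, rule ccontr)
    fix e f assume *: "e \<in> B" "f \<in> B" "g e = g f" "e \<noteq> f"
    have "dist e f \<le> dist e (g e) + dist f (g e)" by (rule dist_triangle2)
    also have "\<dots> < 1" using g(2)[of e] g(2)[of f] *(3) by simp
    finally show False using sep[OF *(1,2,4)] by simp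
  qed
  moreover have "countable (g ` B)" using D(1) g(1) by (meson countable_subset image_subsetI)
  ultimately show ?thesis using countable_image_inj_eq by blast
qed

lemma onb_expansion:
  assumes "onb B"
  shows "((\<lambda>e. (x \<bullet> e) *\<^sub>R e) has_sum x) B"
  unfolding has_sum_def tendsto_iff eventually_finite_subsets_at_top
proof (intro allI impI)
  fix \<epsilon> :: real assume "\<epsilon> > 0"
  have "x \<in> closure (span B)" using assms by (simp add: onb_def)
  then obtain y where y: "y \<in> span B" "dist y x < \<epsilon>"
    using \<open>\<epsilon> > 0\<close> by (auto simp: closure_approachable)
  obtain E0 r where E0: "finite E0" "E0 \<subseteq> B" "y = (\<Sum>e\<in>E0. r e *\<^sub>R e)"
    using y(1) unfolding span_explicit by auto
  have "dist (\<Sum>e\<in>E. (x \<bullet> e) *\<^sub>R e) x < \<epsilon>" if E: "finite E" "E0 \<subseteq> E" "E \<subseteq> B" for E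
  proof -
    have on: "orthonormal E" using assms E(3) orthonormal_subset by (auto simp: onb_def)
    define c where "c e = (if e \<in> E0 then r e else 0)" for e
    have "y = (\<Sum>e\<in>E. c e *\<^sub>R e)"
      unfolding E0(3) c_def by (rule sum.mono_neutral_cong_left) (use E in auto)
    then have "(norm (x - (\<Sum>e\<in>E. (x \<bullet> e) *\<^sub>R e)))\<^sup>2 \<le> (norm (x - y))\<^sup>2"
      by (simp add: orthonormal_dist_sum[OF on E(1)] sum_nonneg)
    then show ?thesis
      using y(2) by (smt (verit) dist_commute dist_norm norm_ge_zero power2_le_imp_le)
  qed
  with E0(1,2) show "\<exists>X. finite X \<and> X \<subseteq> B \<and>
      (\<forall>Y. finite Y \<and> X \<subseteq> Y \<and> Y \<subseteq> B \<longrightarrow> dist (\<Sum>e\<in>Y. (x \<bullet> e) *\<^sub>R e) x < \<epsilon>)"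
    by blast
qed

lemma hs_sum_finite_bound:
  fixes T :: "'a::real_inner \<Rightarrow> 'b::real_inner"
  assumes T: "linear T" and E: "orthonormal E" "finite E" and E': "orthonormal E'" "finite E'"
  shows "(\<Sum>e'\<in>E'. (norm (T (\<Sum>e\<in>E. (e' \<bullet> e) *\<^sub>R e)))\<^sup>2) \<le> (\<Sum>e\<in>E. (norm (T e))\<^sup>2)"
proof -
  obtain F where F: "orthonormal F" "finite F" "T ` E \<subseteq> span F"
    using finite_orthonormal_span[of "T ` E"] E(2) by blast
  have parseval: "(norm y)\<^sup>2 = (\<Sum>f\<in>F. (y \<bullet> f)\<^sup>2)" if "y \<in> span F" for y
  proof -
    obtain c where c: "y = (\<Sum>f\<in>F. c f *\<^sub>R f)" using \<open>y \<in> span F\<close> span_finite[OF F(2)] by auto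
    then have "y \<bullet> f = c f" if "f \<in> F" for f using orthonormal_sum_inner[OF F(1,2) that] by simp
    then show ?thesis using orthonormal_norm_sum[OF F(1,2), of c] c by simp
  qed
  define v where "v f = (\<Sum>e\<in>E. (T e \<bullet> f) *\<^sub>R e)" for f
  have TP: "T (\<Sum>e\<in>E. (x \<bullet> e) *\<^sub>R e) = (\<Sum>e\<in>E. (x \<bullet> e) *\<^sub>R T e)" for x
    using T by (simp add: linear_sum linear_scale)
  have "(\<Sum>e'\<in>E'. (norm (T (\<Sum>e\<in>E. (e' \<bullet> e) *\<^sub>R e)))\<^sup>2)
      = (\<Sum>e'\<in>E'. \<Sum>f\<in>F. (e' \<bullet> v f)\<^sup>2)"
  proof (intro sum.cong refl)
    fix e'
    have "T (\<Sum>e\<in>E. (e' \<bullet> e) *\<^sub>R e) \<in> span F"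
      unfolding TP using F(3) by (intro span_sum span_scale) auto
    then have "(norm (T (\<Sum>e\<in>E. (e' \<bullet> e) *\<^sub>R e)))\<^sup>2 = (\<Sum>f\<in>F. (T (\<Sum>e\<in>E. (e' \<bullet> e) *\<^sub>R e) \<bullet> f)\<^sup>2)"
      by (rule parseval)
    also have "\<dots> = (\<Sum>f\<in>F. (e' \<bullet> v f)\<^sup>2)"
      unfolding TP v_def by (simp add: inner_sum_left inner_sum_right mult.commute)
    finally show "(norm (T (\<Sum>e\<in>E. (e' \<bullet> e) *\<^sub>R e)))\<^sup>2 = (\<Sum>f\<in>F. (e' \<bullet> v f)\<^sup>2)" .
  qed
  also have "\<dots> = (\<Sum>f\<in>F. \<Sum>e'\<in>E'. (v f \<bullet> e')\<^sup>2)"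
    by (subst sum.swap) (simp add: inner_commute)
  also have "\<dots> \<le> (\<Sum>f\<in>F. (norm (v f))\<^sup>2)"
    by (intro sum_mono bessel[OF E'])
  also have "\<dots> = (\<Sum>f\<in>F. \<Sum>e\<in>E. (T e \<bullet> f)\<^sup>2)"
    unfolding v_def by (simp add: orthonormal_norm_sum[OF E])
  also have "\<dots> = (\<Sum>e\<in>E. \<Sum>f\<in>F. (T e \<bullet> f)\<^sup>2)"
    by (rule sum.swap)
  also have "\<dots> = (\<Sum>e\<in>E. (norm (T e))\<^sup>2)"
    using F(3) by (intro sum.cong refl parseval[symmetric]) auto
  finally show ?thesis .
qed

lemma hs_sum_bound:
  fixes T :: "'a::real_inner \<Rightarrow> 'b::real_inner"
  assumes T: "bounded_linear T" and B: "onb B" and s: "(\<lambda>e. (norm (T e))\<^sup>2) summable_on B"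
    and E': "orthonormal E'" "finite E'"
  shows "(\<Sum>e'\<in>E'. (norm (T e'))\<^sup>2) \<le> (\<Sum>\<^sub>\<infinity>e\<in>B. (norm (T e))\<^sup>2)"
proof (rule tendsto_upperbound)
  have *: "((\<lambda>E. \<Sum>e\<in>E. (e' \<bullet> e) *\<^sub>R e) \<longlongrightarrow> e') (finite_subsets_at_top B)" for e'
    using onb_expansion[OF B] by (simp add: has_sum_def)
  show "((\<lambda>E. \<Sum>e'\<in>E'. (norm (T (\<Sum>e\<in>E. (e' \<bullet> e) *\<^sub>R e)))\<^sup>2) \<longlongrightarrow> (\<Sum>e'\<in>E'. (norm (T e'))\<^sup>2))
      (finite_subsets_at_top B)"
    by (intro tendsto_intros bounded_linear.tendsto[OF T] *)
  have "(\<Sum>e'\<in>E'. (norm (T (\<Sum>e\<in>E. (e' \<bullet> e) *\<^sub>R e)))\<^sup>2) \<le> (\<Sum>\<^sub>\<infinity>e\<in>B. (norm (T e))\<^sup>2)"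
    if E: "finite E" "E \<subseteq> B" for E
  proof -
    have "orthonormal E" using B E(2) orthonormal_subset by (auto simp: onb_def)
    then have "(\<Sum>e'\<in>E'. (norm (T (\<Sum>e\<in>E. (e' \<bullet> e) *\<^sub>R e)))\<^sup>2) \<le> (\<Sum>e\<in>E. (norm (T e))\<^sup>2)"
      using hs_sum_finite_bound[OF bounded_linear.linear[OF T]] E(1) E' by blast
    also have "\<dots> \<le> (\<Sum>\<^sub>\<infinity>e\<in>B. (norm (T e))\<^sup>2)"
      using s E by (intro finite_sum_le_infsum) auto
    finally show ?thesis .
  qed
  then show "\<forall>\<^sub>F E in finite_subsets_at_top B.
      (\<Sum>e'\<in>E'. (norm (T (\<Sum>e\<in>E. (e' \<bullet> e) *\<^sub>R e)))\<^sup>2) \<le> (\<Sum>\<^sub>\<infinity>e\<in>B. (norm (T e))\<^sup>2)"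
    by (simp add: eventually_finite_subsets_at_top_weakI)
qed simp

lemma hs_summable_indep:
  fixes T :: "'a::real_inner \<Rightarrow> 'b::real_inner"
  assumes T: "bounded_linear T" and B: "onb B" and s: "(\<lambda>e. (norm (T e))\<^sup>2) summable_on B"
    and B': "onb B'"
  shows "(\<lambda>e. (norm (T e))\<^sup>2) summable_on B'"
    and "(\<Sum>\<^sub>\<infinity>e\<in>B'. (norm (T e))\<^sup>2) = (\<Sum>\<^sub>\<infinity>e\<in>B. (norm (T e))\<^sup>2)"
proof -
  have le: "(\<Sum>e\<in>F. (norm (T e))\<^sup>2) \<le> (\<Sum>\<^sub>\<infinity>e\<in>C. (norm (T e))\<^sup>2)"
    if "onb C" "(\<lambda>e. (norm (T e))\<^sup>2) summable_on C" "onb C'" "finite F" "F \<subseteq> C'" for C C' F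
    using hs_sum_bound[OF T that(1,2) _ that(4)] that(3,5) orthonormal_subset by (auto simp: onb_def)
  show s': "(\<lambda>e. (norm (T e))\<^sup>2) summable_on B'"
    by (rule nonneg_bdd_above_summable_on)
      (use le[OF B s B'] in \<open>auto intro!: bdd_aboveI2\<close>)
  show "(\<Sum>\<^sub>\<infinity>e\<in>B'. (norm (T e))\<^sup>2) = (\<Sum>\<^sub>\<infinity>e\<in>B. (norm (T e))\<^sup>2)"
    by (intro antisym infsum_le_finite_sums s s' le[OF B s B'] le[OF B' s' B])
qed


section \<open>Hilbert--Schmidt operators\<close>

definition hilbert_schmidt :: "('a::real_inner \<Rightarrow>\<^sub>L 'b::real_inner) \<Rightarrow> bool" where
  "hilbert_schmidt T \<longleftrightarrow> (\<exists>B. onb B \<and> (\<lambda>e. (norm (T e))\<^sup>2) summable_on B)"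

lemma hilbert_schmidt_summable:
  "hilbert_schmidt T \<Longrightarrow> onb B \<Longrightarrow> (\<lambda>e. (norm (T e))\<^sup>2) summable_on B"
  unfolding hilbert_schmidt_def
  using hs_summable_indep(1)[OF blinfun.bounded_linear_right] by blast

lemma hilbert_schmidtI:
  fixes T :: "'a::real_inner \<Rightarrow>\<^sub>L 'b::real_inner"
  assumes "onb B" "\<And>E. finite E \<Longrightarrow> E \<subseteq> B \<Longrightarrow> (\<Sum>e\<in>E. (norm (T e))\<^sup>2) \<le> c"
  shows "hilbert_schmidt T"
  unfolding hilbert_schmidt_def
  by (intro exI[of _ B] conjI assms(1) nonneg_bdd_above_summable_on)
    (use assms(2) in \<open>auto intro!: bdd_aboveI2\<close>)

lemma hilbert_schmidt_le:
  fixes S :: "'a::{real_inner, second_countable_topology} \<Rightarrow>\<^sub>L 'c::real_inner"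
    and T :: "'a::{real_inner, second_countable_topology} \<Rightarrow>\<^sub>L 'b::real_inner"
  assumes T: "hilbert_schmidt T" and le: "\<And>x. norm (S x) \<le> c * norm (T x)"
  shows "hilbert_schmidt S"
proof -
  obtain B :: "'a set" where B: "onb B" using onb_exists by blast
  show ?thesis
  proof (rule hilbert_schmidtI[OF B])
    fix E assume E: "finite E" "E \<subseteq> B"
    have "(\<Sum>e\<in>E. (norm (S e))\<^sup>2) \<le> (\<Sum>e\<in>E. c\<^sup>2 * (norm (T e))\<^sup>2)"
      by (intro sum_mono) (metis le norm_ge_zero power_mono power_mult_distrib)
    also have "\<dots> \<le> c\<^sup>2 * (\<Sum>\<^sub>\<infinity>e\<in>B. (norm (T e))\<^sup>2)"
      unfolding sum_distrib_left[symmetric]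
      by (intro mult_left_mono finite_sum_le_infsum hilbert_schmidt_summable T B E) auto
    finally show "(\<Sum>e\<in>E. (norm (S e))\<^sup>2) \<le> c\<^sup>2 * (\<Sum>\<^sub>\<infinity>e\<in>B. (norm (T e))\<^sup>2)" .
  qed
qed

lemma hilbert_schmidt_zero:
  "hilbert_schmidt (0 :: 'a::{real_inner, second_countable_topology} \<Rightarrow>\<^sub>L 'b::real_inner)"
  unfolding hilbert_schmidt_def using onb_exists by auto

lemma hilbert_schmidt_add:
  fixes S T :: "'a::{real_inner, second_countable_topology} \<Rightarrow>\<^sub>L 'b::real_inner"
  assumes "hilbert_schmidt S" "hilbert_schmidt T"
  shows "hilbert_schmidt (S + T)"
proof -
  obtain B :: "'a set" where B: "onb B" using onb_exists by blast
  have le: "(norm (x + y))\<^sup>2 \<le> 2 * (norm x)\<^sup>2 + 2 * (norm y)\<^sup>2" for x y :: 'b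
  proof -
    have "(norm (x + y))\<^sup>2 + (norm (x - y))\<^sup>2 = 2 * (norm x)\<^sup>2 + 2 * (norm y)\<^sup>2"
      by (simp add: power2_norm_eq_inner algebra_simps)
    then show ?thesis by (smt (verit) zero_le_power2)
  qed
  show ?thesis
  proof (rule hilbert_schmidtI[OF B])
    fix E assume E: "finite E" "E \<subseteq> B"
    have "(\<Sum>e\<in>E. (norm ((S + T) e))\<^sup>2)
        \<le> 2 * (\<Sum>e\<in>E. (norm (S e))\<^sup>2) + 2 * (\<Sum>e\<in>E. (norm (T e))\<^sup>2)"
      unfolding sum_distrib_left sum.distrib[symmetric]
      by (intro sum_mono) (simp add: blinfun.add_left le)
    also have "\<dots> \<le> 2 * (\<Sum>\<^sub>\<infinity>e\<in>B. (norm (S e))\<^sup>2) + 2 * (\<Sum>\<^sub>\<infinity>e\<in>B. (norm (T e))\<^sup>2)"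
      by (intro add_mono mult_left_mono finite_sum_le_infsum hilbert_schmidt_summable assms B E) auto
    finally show "(\<Sum>e\<in>E. (norm ((S + T) e))\<^sup>2) \<le> \<dots>" .
  qed
qed

lemma hilbert_schmidt_scaleR:
  fixes T :: "'a::{real_inner, second_countable_topology} \<Rightarrow>\<^sub>L 'b::real_inner"
  shows "hilbert_schmidt T \<Longrightarrow> hilbert_schmidt (r *\<^sub>R T)"
  by (rule hilbert_schmidt_le[where c = "\<bar>r\<bar>"]) (auto simp: blinfun.scaleR_left)

lemma hilbert_schmidt_minus:
  fixes S T :: "'a::{real_inner, second_countable_topology} \<Rightarrow>\<^sub>L 'b::real_inner"
  shows "hilbert_schmidt S \<Longrightarrow> hilbert_schmidt T \<Longrightarrow> hilbert_schmidt (S - T)"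
  using hilbert_schmidt_add[of S "(-1) *\<^sub>R T"] hilbert_schmidt_scaleR[of T "-1"] by simp

lemma hilbert_schmidt_compose:
  fixes T :: "'a::{real_inner, second_countable_topology} \<Rightarrow>\<^sub>L 'b::real_inner"
    and S :: "'b \<Rightarrow>\<^sub>L 'c::real_inner"
  shows "hilbert_schmidt T \<Longrightarrow> hilbert_schmidt (S o\<^sub>L T)"
  by (rule hilbert_schmidt_le[where c = "norm S"]) (auto simp: norm_blinfun)

lemma hilbert_schmidt_inner_summable:
  fixes S T :: "'a::{real_inner, second_countable_topology} \<Rightarrow>\<^sub>L 'b::real_inner"
  assumes "hilbert_schmidt S" "hilbert_schmidt T" "onb B"
  shows "(\<lambda>e. S e \<bullet> T e) summable_on B"
proof -
  have "(\<lambda>e. (1/4) * ((norm ((S + T) e))\<^sup>2 + (-1) * (norm ((S - T) e))\<^sup>2)) summable_on B"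
    by (intro summable_on_add summable_on_cmult_right hilbert_schmidt_summable
        hilbert_schmidt_add hilbert_schmidt_minus assms)
  then show ?thesis
    by (simp add: blinfun.add_left blinfun.diff_left power2_norm_eq_inner algebra_simps inner_commute)
qed

lemma hilbert_schmidt_apply_le:
  fixes T :: "'a::{real_inner, second_countable_topology} \<Rightarrow>\<^sub>L 'b::real_inner"
  assumes T: "hilbert_schmidt T" and B: "onb B"
  shows "(norm (T x))\<^sup>2 \<le> (\<Sum>\<^sub>\<infinity>e\<in>B. (norm (T e))\<^sup>2) * (norm x)\<^sup>2"
proof (cases "x = 0")
  case False
  define u where "u = x /\<^sub>R norm x"
  have "orthonormal {u}" using False by (simp add: orthonormal_def u_def)
  then have "(norm (T u))\<^sup>2 \<le> (\<Sum>\<^sub>\<infinity>e\<in>B. (norm (T e))\<^sup>2)"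
    using hs_sum_bound[OF blinfun.bounded_linear_right[of T] B
        hilbert_schmidt_summable[OF T B], of "{u}"] by simp
  moreover have "x = norm x *\<^sub>R u" using False by (simp add: u_def)
  then have "norm (T x) = norm x * norm (T u)"
    by (metis abs_norm_cancel blinfun.scaleR_right norm_scaleR)
  ultimately show ?thesis
    by (simp add: power_mult_distrib mult.commute mult_left_mono)
qed simp

typedef (overloaded) ('a::"{real_inner, second_countable_topology}", 'b::real_inner) hs =
  "{T :: 'a \<Rightarrow>\<^sub>L 'b. hilbert_schmidt T}"
  morphisms blinfun_of_hs Abs_hs
  using hilbert_schmidt_zero by blast

setup_lifting type_definition_hs

lemma hilbert_schmidt_hs [simp]: "hilbert_schmidt (blinfun_of_hs T)"
  using blinfun_of_hs by blast

text \<open>The choice of the basis in the inner product is immaterial, see \<open>inner_hs_onb\<close> below.\<close>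

definition some_onb :: "'a::real_inner set" where
  "some_onb = (SOME B. onb B)"

lemma onb_some_onb: "onb (some_onb :: 'a::{real_inner, second_countable_topology} set)"
  unfolding some_onb_def using onb_exists by (rule someI_ex)

instantiation hs :: ("{real_inner, second_countable_topology}", real_inner) real_inner
begin

lift_definition zero_hs :: "('a, 'b) hs" is 0
  by (rule hilbert_schmidt_zero)
lift_definition plus_hs :: "('a, 'b) hs \<Rightarrow> ('a, 'b) hs \<Rightarrow> ('a, 'b) hs" is "(+)"
  by (rule hilbert_schmidt_add)
lift_definition minus_hs :: "('a, 'b) hs \<Rightarrow> ('a, 'b) hs \<Rightarrow> ('a, 'b) hs" is "(-)"
  by (rule hilbert_schmidt_minus)
lift_definition uminus_hs :: "('a, 'b) hs \<Rightarrow> ('a, 'b) hs" is "uminus"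
  using hilbert_schmidt_scaleR[of _ "-1"] by simp
lift_definition scaleR_hs :: "real \<Rightarrow> ('a, 'b) hs \<Rightarrow> ('a, 'b) hs" is "scaleR"
  by (rule hilbert_schmidt_scaleR)

definition inner_hs :: "('a, 'b) hs \<Rightarrow> ('a, 'b) hs \<Rightarrow> real" where
  "inner_hs S T = (\<Sum>\<^sub>\<infinity>e\<in>some_onb. blinfun_of_hs S e \<bullet> blinfun_of_hs T e)"

definition norm_hs :: "('a, 'b) hs \<Rightarrow> real" where
  "norm_hs T = sqrt (T \<bullet> T)"

definition dist_hs :: "('a, 'b) hs \<Rightarrow> ('a, 'b) hs \<Rightarrow> real" where
  "dist_hs S T = norm (S - T)"

definition sgn_hs :: "('a, 'b) hs \<Rightarrow> ('a, 'b) hs" where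
  "sgn_hs T = scaleR (inverse (norm T)) T"

definition [code del]:
  "(uniformity :: (('a, 'b) hs \<times> ('a, 'b) hs) filter) =
    (INF e\<in>{0 <..}. principal {(S, T). dist S T < e})"

definition open_hs :: "('a, 'b) hs set \<Rightarrow> bool" where [code del]:
  "open_hs U \<longleftrightarrow> (\<forall>S\<in>U. \<forall>\<^sub>F (S', T) in uniformity. S' = S \<longrightarrow> T \<in> U)"

instance
proof
  fix R S T :: "('a, 'b) hs" and r q :: real
  show "R + S + T = R + (S + T)" "S + T = T + S" "0 + S = S" "- S + S = 0" "S - T = S + - T"
    by (transfer, simp)+
  show "r *\<^sub>R (S + T) = r *\<^sub>R S + r *\<^sub>R T" "(r + q) *\<^sub>R S = r *\<^sub>R S + q *\<^sub>R S"
    "r *\<^sub>R q *\<^sub>R S = (r * q) *\<^sub>R S" "1 *\<^sub>R S = S"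
    by (transfer, simp add: algebra_simps)+
  show "sgn S = scaleR (inverse (norm S)) S" "dist S T = norm (S - T)" "norm S = sqrt (S \<bullet> S)"
    by (simp_all add: sgn_hs_def dist_hs_def norm_hs_def)
  show "(uniformity :: (('a, 'b) hs \<times> ('a, 'b) hs) filter) =
      (INF e\<in>{0 <..}. principal {(S, T). dist S T < e})"
    by (rule uniformity_hs_def)
  show "open U = (\<forall>S\<in>U. \<forall>\<^sub>F (S', T) in uniformity. S' = S \<longrightarrow> T \<in> U)" for U :: "('a, 'b) hs set"
    by (rule open_hs_def)
  show "S \<bullet> T = T \<bullet> S"
    by (simp add: inner_hs_def inner_commute)
  show "(S + T) \<bullet> R = S \<bullet> R + T \<bullet> R"
    unfolding inner_hs_def plus_hs.rep_eq blinfun.add_left inner_add_left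
    by (intro infsum_add hilbert_schmidt_inner_summable onb_some_onb hilbert_schmidt_hs)
  show "(r *\<^sub>R S) \<bullet> T = r * (S \<bullet> T)"
    by (simp add: inner_hs_def scaleR_hs.rep_eq blinfun.scaleR_left infsum_cmult_right')
  show pos: "0 \<le> S \<bullet> S"
    unfolding inner_hs_def by (intro infsum_nonneg) simp
  show "(S \<bullet> S = 0) = (S = 0)"
  proof
    assume 0: "S \<bullet> S = 0"
    have "blinfun_of_hs S x = 0" for x
      using hilbert_schmidt_apply_le[OF hilbert_schmidt_hs onb_some_onb, of S x] 0
      by (simp add: inner_hs_def power2_norm_eq_inner[symmetric])
    then show "S = 0" by transfer (simp add: blinfun_eqI)
  next
    assume "S = 0"
    then show "S \<bullet> S = 0" by (simp add: inner_hs_def zero_hs.rep_eq)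
  qed
qed

end

lemma norm_hs_onb:
  assumes "onb B"
  shows "(norm T)\<^sup>2 = (\<Sum>\<^sub>\<infinity>e\<in>B. (norm (blinfun_of_hs T e))\<^sup>2)"
  unfolding power2_norm_eq_inner[of T] inner_hs_def unfolding power2_norm_eq_inner[symmetric]
  by (intro hs_summable_indep(2) blinfun.bounded_linear_right assms onb_some_onb
      hilbert_schmidt_summable hilbert_schmidt_hs)

lemma inner_hs_onb:
  assumes "onb B"
  shows "S \<bullet> T = (\<Sum>\<^sub>\<infinity>e\<in>B. blinfun_of_hs S e \<bullet> blinfun_of_hs T e)"
proof -
  let ?s = "blinfun_of_hs S" and ?t = "blinfun_of_hs T"
  have "(norm S)\<^sup>2 + (2 * (S \<bullet> T) + (norm T)\<^sup>2) = (norm (S + T))\<^sup>2"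
    by (simp add: power2_norm_eq_inner algebra_simps inner_commute)
  also have "\<dots> = (\<Sum>\<^sub>\<infinity>e\<in>B. (norm (?s e))\<^sup>2 + (2 * (?s e \<bullet> ?t e) + (norm (?t e))\<^sup>2))"
    unfolding norm_hs_onb[OF assms]
    by (simp add: plus_hs.rep_eq blinfun.add_left power2_norm_eq_inner algebra_simps inner_commute)
  also have "\<dots> = (norm S)\<^sup>2 + (2 * (\<Sum>\<^sub>\<infinity>e\<in>B. ?s e \<bullet> ?t e) + (norm T)\<^sup>2)"
    unfolding norm_hs_onb[OF assms] infsum_cmult_right'[symmetric]
    by (intro infsum_add arg_cong2[where f = "(+)"] refl
        | (subst infsum_add | intro summable_on_add summable_on_cmult_right
            hilbert_schmidt_inner_summable hilbert_schmidt_summable assms hilbert_schmidt_hs))+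
  finally show ?thesis by simp
qed

lemma norm_blinfun_of_hs: "norm (blinfun_of_hs T x) \<le> norm T * norm x"
proof (rule power2_le_imp_le)
  show "(norm (blinfun_of_hs T x))\<^sup>2 \<le> (norm T * norm x)\<^sup>2"
    using hilbert_schmidt_apply_le[OF hilbert_schmidt_hs onb_some_onb, of T x]
    by (simp add: power_mult_distrib norm_hs_onb[OF onb_some_onb])
qed simp

lemma norm_hs_leI:
  assumes B: "onb B" and c: "c \<ge> 0"
    and le: "\<And>E. finite E \<Longrightarrow> E \<subseteq> B \<Longrightarrow> (\<Sum>e\<in>E. (norm (blinfun_of_hs T e))\<^sup>2) \<le> c\<^sup>2"
  shows "norm T \<le> c"
proof (rule power2_le_imp_le[OF _ c])
  show "(norm T)\<^sup>2 \<le> c\<^sup>2"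
    unfolding norm_hs_onb[OF B]
    by (intro infsum_le_finite_sums hilbert_schmidt_summable B le) auto
qed

lemma sum_le_norm_hs:
  assumes "onb B" "finite E" "E \<subseteq> B"
  shows "(\<Sum>e\<in>E. (norm (blinfun_of_hs T e))\<^sup>2) \<le> (norm T)\<^sup>2"
  unfolding norm_hs_onb[OF assms(1)]
  by (intro finite_sum_le_infsum hilbert_schmidt_summable assms) auto

instance hs :: ("{real_inner, second_countable_topology}", "{real_inner, banach}") banach
proof
  fix X :: "nat \<Rightarrow> ('a, 'b) hs" assume X: "Cauchy X"
  obtain B :: "'a set" where B: "onb B" using onb_exists by blast
  have "norm (blinfun_of_hs S - blinfun_of_hs T) \<le> norm (S - T)" for S T :: "('a, 'b) hs"
    using norm_blinfun_of_hs[of "S - T"]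
    by (intro norm_blinfun_bound) (auto simp: minus_hs.rep_eq)
  then have "Cauchy (\<lambda>n. blinfun_of_hs (X n))"
    using X unfolding Cauchy_def dist_norm by (meson le_less_trans)
  then obtain T where T: "(\<lambda>n. blinfun_of_hs (X n)) \<longlonglongrightarrow> T"
    using Cauchy_convergent convergent_def by blast
  have Te: "(\<lambda>n. blinfun_of_hs (X n) e) \<longlonglongrightarrow> T e" for e
    by (intro tendsto_intros T)
  have lim: "(\<Sum>e\<in>E. (norm (blinfun_of_hs (X m) e - T e))\<^sup>2) \<le> \<epsilon>\<^sup>2"
    if "finite E" "E \<subseteq> B" "m \<ge> N" "\<forall>m\<ge>N. \<forall>n\<ge>N. dist (X m) (X n) < \<epsilon>" for E m N \<epsilon>
  proof (rule tendsto_upperbound)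
    show "(\<lambda>n. \<Sum>e\<in>E. (norm (blinfun_of_hs (X m) e - blinfun_of_hs (X n) e))\<^sup>2)
        \<longlonglongrightarrow> (\<Sum>e\<in>E. (norm (blinfun_of_hs (X m) e - T e))\<^sup>2)"
      by (intro tendsto_intros Te)
    have "(\<Sum>e\<in>E. (norm (blinfun_of_hs (X m) e - blinfun_of_hs (X n) e))\<^sup>2) \<le> \<epsilon>\<^sup>2" if "n \<ge> N" for n
    proof -
      have "(\<Sum>e\<in>E. (norm (blinfun_of_hs (X m - X n) e))\<^sup>2) \<le> (norm (X m - X n))\<^sup>2"
        by (rule sum_le_norm_hs[OF B \<open>finite E\<close> \<open>E \<subseteq> B\<close>])
      also have "\<dots> \<le> \<epsilon>\<^sup>2"
        using \<open>\<forall>m\<ge>N. \<forall>n\<ge>N. dist (X m) (X n) < \<epsilon>\<close> \<open>m \<ge> N\<close> that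
        by (intro power_mono) (auto simp: dist_norm less_imp_le)
      finally show ?thesis by (simp add: minus_hs.rep_eq blinfun.diff_left)
    qed
    then show "\<forall>\<^sub>F n in sequentially.
        (\<Sum>e\<in>E. (norm (blinfun_of_hs (X m) e - blinfun_of_hs (X n) e))\<^sup>2) \<le> \<epsilon>\<^sup>2"
      by (auto simp: eventually_sequentially)
  qed simp
  obtain N1 where N1: "\<forall>m\<ge>N1. \<forall>n\<ge>N1. dist (X m) (X n) < 1"
    using X unfolding Cauchy_def by (meson zero_less_one)
  have "hilbert_schmidt (blinfun_of_hs (X N1) - T)"
    by (rule hilbert_schmidtI[OF B, where c = "1\<^sup>2"])
      (use lim[OF _ _ order_refl N1] in \<open>simp add: blinfun.diff_left\<close>)
  then have "hilbert_schmidt (blinfun_of_hs (X N1) - (blinfun_of_hs (X N1) - T))"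
    by (rule hilbert_schmidt_minus[OF hilbert_schmidt_hs])
  then have T_hs: "hilbert_schmidt T" by simp
  have T_eq: "blinfun_of_hs (Abs_hs T) = T" using T_hs by (simp add: Abs_hs_inverse)
  have "X \<longlonglongrightarrow> Abs_hs T"
  proof (rule LIMSEQ_I)
    fix r :: real assume r: "r > 0"
    then obtain N where N: "\<forall>m\<ge>N. \<forall>n\<ge>N. dist (X m) (X n) < r/2"
      using X unfolding Cauchy_def by (meson half_gt_zero)
    have "norm (X m - Abs_hs T) < r" if "m \<ge> N" for m
    proof -
      have "norm (X m - Abs_hs T) \<le> r/2"
        by (rule norm_hs_leI[OF B])
          (use r lim[OF _ _ that N] in \<open>auto simp: minus_hs.rep_eq T_eq blinfun.diff_left\<close>)
      then show ?thesis using r by simp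
    qed
    then show "\<exists>N. \<forall>m\<ge>N. norm (X m - Abs_hs T) < r" by blast
  qed
  then show "convergent X" by (auto simp: convergent_def)
qed

lift_definition hs_compose ::
  "('b::real_inner \<Rightarrow>\<^sub>L 'c::real_inner) \<Rightarrow> ('a::{real_inner, second_countable_topology}, 'b) hs \<Rightarrow> ('a, 'c) hs"
  is "\<lambda>S T. S o\<^sub>L T"
  by (rule hilbert_schmidt_compose)

lemma hilbert_schmidt_rank_one:
  fixes \<phi> :: "'a::{real_inner, second_countable_topology}" and h :: "'b::real_inner"
  shows "hilbert_schmidt (blinfun_scaleR_left h o\<^sub>L blinfun_inner_left \<phi>)"
proof -
  obtain B :: "'a set" where B: "onb B" using onb_exists by blast
  show ?thesis
  proof (rule hilbert_schmidtI[OF B])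
    fix E assume E: "finite E" "E \<subseteq> B"
    have "(\<Sum>e\<in>E. (norm ((blinfun_scaleR_left h o\<^sub>L blinfun_inner_left \<phi>) e))\<^sup>2)
        = (norm h)\<^sup>2 * (\<Sum>e\<in>E. (\<phi> \<bullet> e)\<^sup>2)"
      by (simp add: sum_distrib_left power_mult_distrib inner_commute mult.commute)
    also have "\<dots> \<le> (norm h)\<^sup>2 * (norm \<phi>)\<^sup>2"
      using B E orthonormal_subset by (intro mult_left_mono bessel) (auto simp: onb_def)
    finally show "(\<Sum>e\<in>E. (norm ((blinfun_scaleR_left h o\<^sub>L blinfun_inner_left \<phi>) e))\<^sup>2) \<le> \<dots>" .
  qed
qed

lift_definition rank_one ::
  "'b::real_inner \<Rightarrow> 'a::{real_inner, second_countable_topology} \<Rightarrow> ('a, 'b) hs"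
  is "\<lambda>h \<phi>. blinfun_scaleR_left h o\<^sub>L blinfun_inner_left \<phi>"
  by (rule hilbert_schmidt_rank_one)

lemma rank_one_apply [simp]: "blinfun_of_hs (rank_one h \<phi>) x = (\<phi> \<bullet> x) *\<^sub>R h"
  by transfer (simp add: inner_commute)

lemma norm_rank_one_onb:
  assumes "e \<in> B" "onb B"
  shows "norm (rank_one h e) \<le> norm h"
proof (rule norm_hs_leI[OF assms(2)])
  fix E assume E: "finite E" "E \<subseteq> B"
  have "(\<Sum>f\<in>E. (norm (blinfun_of_hs (rank_one h e) f))\<^sup>2) = (norm h)\<^sup>2 * (\<Sum>f\<in>E. (e \<bullet> f)\<^sup>2)"
    by (simp add: sum_distrib_left power_mult_distrib mult.commute)
  also have "\<dots> \<le> (norm h)\<^sup>2 * (norm e)\<^sup>2"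
    using assms E orthonormal_subset by (intro mult_left_mono bessel) (auto simp: onb_def)
  also have "norm e = 1" using assms by (auto simp: onb_def orthonormal_def)
  finally show "(\<Sum>f\<in>E. (norm (blinfun_of_hs (rank_one h e) f))\<^sup>2) \<le> (norm h)\<^sup>2" by simp
qed simp

lemma rank_one_diff: "rank_one (h - k) e = rank_one h e - rank_one k e"
  by transfer (simp add: blinfun_eqI blinfun.diff_left scaleR_diff_right)

lemma blinfun_of_hs_sum:
  "blinfun_of_hs (\<Sum>i\<in>I. f i) x = (\<Sum>i\<in>I. blinfun_of_hs (f i) x)"
  by (induction I rule: infinite_finite_induct)
    (simp_all add: zero_hs.rep_eq plus_hs.rep_eq blinfun.add_left)

lemma hs_finite_rank_approx:
  assumes B: "onb B" and \<epsilon>: "\<epsilon> > 0"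
  shows "\<exists>E. finite E \<and> E \<subseteq> B \<and> norm (T - (\<Sum>e\<in>E. rank_one (blinfun_of_hs T e) e)) \<le> \<epsilon>"
proof -
  let ?t = "\<lambda>e. (norm (blinfun_of_hs T e))\<^sup>2"
  have "(?t has_sum (norm T)\<^sup>2) B"
    unfolding norm_hs_onb[OF B]
    by (intro has_sum_infsum hilbert_schmidt_summable B hilbert_schmidt_hs)
  then obtain E where E: "finite E" "E \<subseteq> B" "dist (\<Sum>e\<in>E. ?t e) ((norm T)\<^sup>2) \<le> \<epsilon>\<^sup>2"
    using has_sum_finite_approximation[of ?t B "(norm T)\<^sup>2" "\<epsilon>\<^sup>2"] \<epsilon> by auto
  have onE: "orthonormal B" using B by (simp add: onb_def)
  let ?D = "T - (\<Sum>e\<in>E. rank_one (blinfun_of_hs T e) e)"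
  have D: "blinfun_of_hs ?D f = (if f \<in> E then 0 else blinfun_of_hs T f)" if "f \<in> B" for f
  proof -
    have "(\<Sum>e\<in>E. (e \<bullet> f) *\<^sub>R blinfun_of_hs T e) = (\<Sum>e\<in>E. if e = f then blinfun_of_hs T e else 0)"
      using E(2) that by (intro sum.cong refl) (auto simp: orthonormal_inner[OF onE])
    then show ?thesis
      using E(1) by (simp add: minus_hs.rep_eq blinfun.diff_left blinfun_of_hs_sum)
  qed
  have "norm ?D \<le> \<epsilon>"
  proof (rule norm_hs_leI[OF B])
    fix F assume F: "finite F" "F \<subseteq> B"
    have "(\<Sum>f\<in>F. (norm (blinfun_of_hs ?D f))\<^sup>2) = (\<Sum>f\<in>F. if f \<in> E then 0 else ?t f)"
      using F(2) by (intro sum.cong refl) (auto simp: D)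
    also have "\<dots> = (\<Sum>f\<in>F - E. ?t f)"
      using F(1) by (simp add: sum.If_cases Diff_eq)
    also have "\<dots> = (\<Sum>f\<in>(F - E) \<union> E. ?t f) - (\<Sum>e\<in>E. ?t e)"
      using E(1) F(1) by (subst sum.union_disjoint) auto
    also have "\<dots> \<le> (norm T)\<^sup>2 - (\<Sum>e\<in>E. ?t e)"
      using E(1,2) F by (intro diff_right_mono sum_le_norm_hs[OF B]) auto
    also have "\<dots> \<le> \<epsilon>\<^sup>2" using E(3) by (simp add: dist_real_def)
    finally show "(\<Sum>f\<in>F. (norm (blinfun_of_hs ?D f))\<^sup>2) \<le> \<epsilon>\<^sup>2" .
  qed (use \<epsilon> in simp)
  with E show ?thesis by blast
qed

lemma countable_dense_imp_countable_basis:
  fixes G :: "'a::metric_space set"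
  assumes G: "countable G" and dense: "\<And>x \<epsilon>. \<epsilon> > 0 \<Longrightarrow> \<exists>g\<in>G. dist x g < \<epsilon>"
  shows "\<exists>B::'a set set. countable B \<and> open = generate_topology B"
proof -
  let ?B = "(\<lambda>(g, n). ball g (1 / Suc n)) ` (G \<times> (UNIV :: nat set))"
  have "topological_basis ?B"
  proof (rule topological_basisI)
    fix U and x :: 'a assume "open U" "x \<in> U"
    then obtain \<epsilon> where \<epsilon>: "\<epsilon> > 0" "ball x \<epsilon> \<subseteq> U" by (auto simp: open_contains_ball)
    obtain n where n: "1 / Suc n < \<epsilon> / 2"
      using nat_approx_posE[of "\<epsilon> / 2"] \<epsilon>(1) by auto
    obtain g where g: "g \<in> G" "dist x g < 1 / Suc n" using dense[of "1 / Suc n" x] by auto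
    have "ball g (1 / Suc n) \<subseteq> ball x \<epsilon>"
    proof
      fix y assume "y \<in> ball g (1 / Suc n)"
      then show "y \<in> ball x \<epsilon>"
        using g(2) n dist_triangle[of x y g] by auto
    qed
    then show "\<exists>V\<in>?B. x \<in> V \<and> V \<subseteq> U"
      using g \<epsilon>(2) by (intro bexI[of _ "ball g (1 / Suc n)"]) (auto simp: dist_commute)
  qed auto
  moreover have "countable ?B" using G by auto
  ultimately show ?thesis using topological_basis_imp_subbasis by blast
qed

instance hs :: ("{real_inner, second_countable_topology}", "{real_inner, second_countable_topology}")
  second_countable_topology
proof
  obtain B :: "'a set" where B: "onb B" using onb_exists by blast
  have cB: "countable B" using B onb_countable by (auto simp: onb_def)
  obtain D :: "'b set" where D: "countable D" "\<And>X. open X \<Longrightarrow> X \<noteq> {} \<Longrightarrow> \<exists>d\<in>D. d \<in> X"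
    by (rule countable_dense_setE) blast
  define G :: "('a, 'b) hs set" where
    "G = (\<lambda>xs. \<Sum>(e, d)\<leftarrow>xs. rank_one d e) ` lists (B \<times> D)"
  have "countable G" unfolding G_def using cB D(1) by auto
  moreover have "\<exists>g\<in>G. dist T g < \<epsilon>" if \<epsilon>: "\<epsilon> > 0" for T :: "('a, 'b) hs" and \<epsilon>
  proof -
    obtain E where E: "finite E" "E \<subseteq> B"
      "norm (T - (\<Sum>e\<in>E. rank_one (blinfun_of_hs T e) e)) \<le> \<epsilon> / 2"
      using hs_finite_rank_approx[OF B, of "\<epsilon> / 2" T] \<epsilon> by auto
    define \<delta> where "\<delta> = \<epsilon> / (4 * (real (card E) + 1))"
    have \<delta>: "\<delta> > 0" using \<epsilon> by (simp add: \<delta>_def)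
    have "\<exists>d\<in>D. norm (blinfun_of_hs T e - d) < \<delta>" for e
      using D(2)[of "ball (blinfun_of_hs T e) \<delta>"] \<delta> by (auto simp: dist_norm)
    then obtain d where d: "\<And>e. d e \<in> D" "\<And>e. norm (blinfun_of_hs T e - d e) < \<delta>" by metis
    obtain es where es: "set es = E" "distinct es" using finite_distinct_list[OF E(1)] by blast
    define g where "g = (\<Sum>e\<in>E. rank_one (d e) e)"
    have "g = (\<Sum>(e, d)\<leftarrow>map (\<lambda>e. (e, d e)) es. rank_one d e)"
      unfolding g_def es(1)[symmetric]
      by (simp add: sum_list_distinct_conv_sum_set[OF es(2), symmetric] o_def)
    moreover have "map (\<lambda>e. (e, d e)) es \<in> lists (B \<times> D)"
      using es(1) E(2) d(1) by auto
    ultimately have "g \<in> G" unfolding G_def by blast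
    have "norm ((\<Sum>e\<in>E. rank_one (blinfun_of_hs T e) e) - g)
        = norm (\<Sum>e\<in>E. rank_one (blinfun_of_hs T e - d e) e)"
      by (simp add: g_def rank_one_diff sum_subtractf)
    also have "\<dots> \<le> (\<Sum>e\<in>E. norm (rank_one (blinfun_of_hs T e - d e) e))" by (rule norm_sum)
    also have "\<dots> \<le> (\<Sum>e\<in>E. \<delta>)"
    proof (rule sum_mono)
      fix e assume "e \<in> E"
      then have "norm (rank_one (blinfun_of_hs T e - d e) e) \<le> norm (blinfun_of_hs T e - d e)"
        using norm_rank_one_onb[OF _ B] E(2) by blast
      then show "norm (rank_one (blinfun_of_hs T e - d e) e) \<le> \<delta>" using d(2)[of e] by linarith
    qed
    also have "\<dots> < \<epsilon> / 2" using \<epsilon> by (simp add: \<delta>_def field_simps add_pos_nonneg)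
    finally have *: "norm ((\<Sum>e\<in>E. rank_one (blinfun_of_hs T e) e) - g) < \<epsilon> / 2" .
    have "dist T g < \<epsilon>"
      using norm_triangle_ineq[of "T - (\<Sum>e\<in>E. rank_one (blinfun_of_hs T e) e)"
          "(\<Sum>e\<in>E. rank_one (blinfun_of_hs T e) e) - g"] * E(3)
      by (simp add: dist_norm)
    with \<open>g \<in> G\<close> show ?thesis by blast
  qed
  ultimately show "\<exists>B::('a, 'b) hs set set. countable B \<and> open = generate_topology B"
    by (rule countable_dense_imp_countable_basis)
qed


section \<open>Adjoints of bounded operators\<close>

lemma riesz_representation:
  fixes f :: "'a::{real_inner, banach} \<Rightarrow> real"
  assumes "bounded_linear f"
  shows "\<exists>y. \<forall>x. f x = y \<bullet> x"
proof -
  interpret f: bounded_linear f by fact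
  define J where "J x = (norm x)\<^sup>2 / 2 - f x" for x
  obtain K where K: "\<And>x. norm (f x) \<le> norm x * K" using f.bounded by blast
  have "- (K\<^sup>2) / 2 \<le> J x" for x
  proof -
    have "0 \<le> (norm x - K)\<^sup>2" by simp
    then have "norm x * K \<le> (norm x)\<^sup>2 / 2 + K\<^sup>2 / 2"
      by (simp add: power2_diff)
    then show ?thesis using K[of x] by (simp add: J_def)
  qed
  then have bdd: "bdd_below (range J)" by (intro bdd_belowI2) auto
  define m where "m = (INF x. J x)"
  have m: "m \<le> J x" for x unfolding m_def by (rule cINF_lower[OF bdd]) simp
  have "\<exists>x. J x < m + 1 / Suc n" for n
    using cINF_less_iff[of UNIV J "m + 1 / Suc n"] bdd by (auto simp: m_def)
  then obtain u where u: "\<And>n. J (u n) < m + 1 / Suc n" by metis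
  have par: "(norm (x - y))\<^sup>2 / 4 = J x + J y - 2 * J ((1/2) *\<^sub>R (x + y))" for x y
    unfolding J_def f.scaleR f.add
    by (simp add: power2_norm_eq_inner algebra_simps inner_commute) (simp add: field_simps)
  have "Cauchy u"
  proof (rule metric_CauchyI)
    fix \<epsilon> :: real assume \<epsilon>: "\<epsilon> > 0"
    obtain N where N: "1 / Suc N < \<epsilon>\<^sup>2 / 8" using nat_approx_posE[of "\<epsilon>\<^sup>2 / 8"] \<epsilon> by auto
    have "dist (u i) (u j) < \<epsilon>" if "i \<ge> N" "j \<ge> N" for i j
    proof -
      have le: "1 / real (Suc k) \<le> 1 / Suc N" if "k \<ge> N" for k
        using that by (intro divide_left_mono) auto
      have "(norm (u i - u j))\<^sup>2 / 4 < 1 / Suc i + 1 / Suc j"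
        unfolding par using u[of i] u[of j] m[of "(1/2) *\<^sub>R (u i + u j)"] by linarith
      then have "(norm (u i - u j))\<^sup>2 < \<epsilon>\<^sup>2" using le[OF that(1)] le[OF that(2)] N by linarith
      then show ?thesis using \<epsilon> by (simp add: dist_norm power2_less_imp_less)
    qed
    then show "\<exists>M. \<forall>m\<ge>M. \<forall>n\<ge>M. dist (u m) (u n) < \<epsilon>" by blast
  qed
  then obtain y where y: "u \<longlonglongrightarrow> y" using Cauchy_convergent convergent_def by blast
  have Jy: "J y \<le> m"
  proof (rule LIMSEQ_le)
    show "(\<lambda>n. J (u n)) \<longlonglongrightarrow> J y"
      unfolding J_def by (intro tendsto_intros f.tendsto y) simp
    show "(\<lambda>n. m + 1 / Suc n) \<longlonglongrightarrow> m"
      using LIMSEQ_inverse_real_of_nat_add[of m] by (simp add: field_simps)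
    show "\<exists>N. \<forall>n\<ge>N. J (u n) \<le> m + 1 / Suc n" using u less_imp_le by blast
  qed
  have "f x = y \<bullet> x" for x
  proof -
    define c where "c = y \<bullet> x - f x"
    have *: "0 \<le> t * c + t\<^sup>2 * ((norm x)\<^sup>2 / 2)" for t
    proof -
      have "0 \<le> J (y + t *\<^sub>R x) - J y" using m[of "y + t *\<^sub>R x"] Jy by linarith
      also have "\<dots> = t * c + t\<^sup>2 * ((norm x)\<^sup>2 / 2)"
      proof -
        have "(norm (y + t *\<^sub>R x))\<^sup>2 = (norm y)\<^sup>2 + 2 * t * (y \<bullet> x) + t\<^sup>2 * (norm x)\<^sup>2"
          unfolding power2_norm_eq_inner
          by (simp add: inner_add_left inner_add_right inner_commute power2_eq_square)
        then show ?thesis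
          unfolding J_def c_def f.add f.scaleR by (simp add: field_simps)
      qed
      finally show ?thesis .
    qed
    define q where "q = (norm x)\<^sup>2 / 2 + 1"
    have q: "q > 0" by (simp add: q_def add_nonneg_pos)
    have "0 \<le> - (c / q) * c + (c / q)\<^sup>2 * (q - 1)"
      using *[of "- (c / q)"] by (simp add: q_def)
    also have "\<dots> = - ((c / q)\<^sup>2)"
      using q by (simp add: power2_eq_square field_simps)
    finally have "c / q = 0" by simp
    then show ?thesis using q by (simp add: c_def)
  qed
  then show ?thesis by blast
qed

definition blinfun_adj :: "('a::{real_inner, banach} \<Rightarrow>\<^sub>L 'b::real_inner) \<Rightarrow> 'b \<Rightarrow>\<^sub>L 'a" where
  "blinfun_adj K = Blinfun (adjoint (blinfun_apply K))"

lemma blinfun_adj: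
  fixes K :: "'a::{real_inner, banach} \<Rightarrow>\<^sub>L 'b::real_inner"
  shows blinfun_adj_apply: "blinfun_adj K y = adjoint (blinfun_apply K) y"
    and inner_blinfun_adj: "x \<bullet> blinfun_adj K y = K x \<bullet> y"
proof -
  have "\<exists>z. \<forall>x. K x \<bullet> y = z \<bullet> x" for y
    by (rule riesz_representation) (intro bounded_linear_intros)
  then obtain g where g: "\<And>x y. K x \<bullet> y = g y \<bullet> x" by metis
  then have adj: "adjoint (blinfun_apply K) = g"
    by (intro adjoint_unique) (simp add: inner_commute)
  have "bounded_linear g"
  proof (rule bounded_linear_intro[where K = "norm K"])
    show "g (y + z) = g y + g z" for y z
      by (rule vector_eq_rdot[THEN iffD1]) (simp add: g[symmetric] inner_add_left inner_add_right)
    show "g (r *\<^sub>R y) = r *\<^sub>R g y" for r y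
      by (rule vector_eq_rdot[THEN iffD1]) (simp add: g[symmetric])
    show "norm (g y) \<le> norm y * norm K" for y
    proof (cases "g y = 0")
      case False
      have "norm (g y) * norm (g y) = K (g y) \<bullet> y"
        by (simp add: g norm_eq_sqrt_inner)
      also have "\<dots> \<le> norm (K (g y)) * norm y" by (rule norm_cauchy_schwarz)
      also have "\<dots> \<le> norm K * norm (g y) * norm y" by (intro mult_right_mono norm_blinfun) simp
      finally show ?thesis using False by (simp add: mult_ac)
    qed simp
  qed
  then show "blinfun_adj K y = adjoint (blinfun_apply K) y"
    by (simp add: blinfun_adj_def adj bounded_linear_Blinfun_apply)
  then show "x \<bullet> blinfun_adj K y = K x \<bullet> y"
    using g[of x y] adj by (metis inner_commute)
qed


section \<open>Unbounded operators and strongly continuous semigroups\<close>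

definition linear_operator :: "'a::real_vector set \<Rightarrow> ('a \<Rightarrow> 'b::real_vector) \<Rightarrow> bool" where
  "linear_operator D A \<longleftrightarrow> subspace D \<and>
    (\<forall>x\<in>D. \<forall>y\<in>D. A (x + y) = A x + A y) \<and> (\<forall>c. \<forall>x\<in>D. A (c *\<^sub>R x) = c *\<^sub>R A x)"

definition dissipative :: "'a::real_inner set \<Rightarrow> ('a \<Rightarrow> 'a) \<Rightarrow> bool" where
  "dissipative D A \<longleftrightarrow> (\<forall>x\<in>D. A x \<bullet> x \<le> 0)"

definition C0_semigroup :: "(real \<Rightarrow> 'a::real_normed_vector \<Rightarrow>\<^sub>L 'a) \<Rightarrow> bool" where
  "C0_semigroup S \<longleftrightarrow> S 0 = id_blinfun \<and> (\<forall>s\<ge>0. \<forall>t\<ge>0. S (s + t) = S s o\<^sub>L S t) \<and>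
    (\<forall>x. ((\<lambda>t. S t x) \<longlongrightarrow> x) (at_right 0))"

definition generates ::
  "'a::real_normed_vector set \<Rightarrow> ('a \<Rightarrow> 'a) \<Rightarrow> (real \<Rightarrow> 'a \<Rightarrow>\<^sub>L 'a) \<Rightarrow> bool" where
  "generates D A S \<longleftrightarrow> C0_semigroup S \<and>
    D = {x. \<exists>y. ((\<lambda>t. (S t x - x) /\<^sub>R t) \<longlongrightarrow> y) (at_right 0)} \<and>
    (\<forall>x\<in>D. ((\<lambda>t. (S t x - x) /\<^sub>R t) \<longlongrightarrow> A x) (at_right 0))"

text \<open>A densely defined map \<open>f\<close> from \<open>D\<close> into the bounded operators is identified with a bounded
  operator \<open>K\<close> from the whole space into the Hilbert--Schmidt operators if \<open>K\<close> extends \<open>f\<close>.\<close>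

definition bounded_extension ::
  "'a::real_normed_vector set \<Rightarrow> ('a \<Rightarrow> 'k \<Rightarrow>\<^sub>L 'b) \<Rightarrow>
    ('a \<Rightarrow>\<^sub>L ('k::{real_inner, second_countable_topology}, 'b::real_inner) hs) \<Rightarrow> bool" where
  "bounded_extension D f K \<longleftrightarrow> closure D = UNIV \<and> (\<forall>x\<in>D. f x = blinfun_of_hs (K x))"

lemma bounded_extension_unique:
  assumes "bounded_extension D f K" "bounded_extension D f K'"
  shows "K = K'"
proof (rule blinfun_eqI)
  fix x
  have D: "closure D = UNIV" using assms by (simp add: bounded_extension_def)
  have "closed {x. K x = K' x}"
    by (intro closed_Collect_eq continuous_intros)
  moreover have "D \<subseteq> {x. K x = K' x}"
    using assms unfolding bounded_extension_def
    by (metis (mono_tags, lifting) blinfun_of_hs_inject mem_Collect_eq subsetI)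
  ultimately have "closure D \<subseteq> {x. K x = K' x}" by (rule closure_minimal[rotated])
  then show "K x = K' x" using D by auto
qed

definition bounded_ext ::
  "'a::real_normed_vector set \<Rightarrow> ('a \<Rightarrow> 'k \<Rightarrow>\<^sub>L 'b) \<Rightarrow>
    ('a \<Rightarrow>\<^sub>L ('k::{real_inner, second_countable_topology}, 'b::real_inner) hs)" where
  "bounded_ext D f = (THE K. bounded_extension D f K)"

lemma bounded_ext_eq: "bounded_extension D f K \<Longrightarrow> bounded_ext D f = K"
  unfolding bounded_ext_def by (blast intro: the_equality bounded_extension_unique)

text \<open>The bounded operator \<open>C e\<^sup>t\<^sup>A\<close>. The product is originally defined only where \<open>e\<^sup>t\<^sup>A x\<close> lies in
  the domain of \<open>C\<close>.\<close>

definition has_op_exp ::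
  "'a::real_normed_vector set \<Rightarrow> ('a \<Rightarrow> 'k \<Rightarrow>\<^sub>L 'b) \<Rightarrow> (real \<Rightarrow> 'a \<Rightarrow>\<^sub>L 'a) \<Rightarrow> real \<Rightarrow>
    ('a \<Rightarrow>\<^sub>L ('k::{real_inner, second_countable_topology}, 'b::real_inner) hs) \<Rightarrow> bool" where
  "has_op_exp D C S t = bounded_extension {x. S t x \<in> D} (\<lambda>x. C (S t x))"

definition op_exp ::
  "'a::real_normed_vector set \<Rightarrow> ('a \<Rightarrow> 'k \<Rightarrow>\<^sub>L 'b) \<Rightarrow> (real \<Rightarrow> 'a \<Rightarrow>\<^sub>L 'a) \<Rightarrow> real \<Rightarrow>
    ('a \<Rightarrow>\<^sub>L ('k::{real_inner, second_countable_topology}, 'b::real_inner) hs)" where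
  "op_exp D C S t = bounded_ext {x. S t x \<in> D} (\<lambda>x. C (S t x))"

lemma op_exp_eq: "has_op_exp D C S t K \<Longrightarrow> op_exp D C S t = K"
  unfolding has_op_exp_def op_exp_def by (rule bounded_ext_eq)

text \<open>The bounded operator \<open>e\<^sup>t\<^sup>A C\<close>, where \<open>e\<^sup>t\<^sup>A\<close> acts on the values of the operators \<open>C x\<close>.\<close>

definition has_exp_op ::
  "'a::real_inner set \<Rightarrow> ('a \<Rightarrow> 'k \<Rightarrow>\<^sub>L 'a) \<Rightarrow> (real \<Rightarrow> 'a \<Rightarrow>\<^sub>L 'a) \<Rightarrow> real \<Rightarrow>
    ('a \<Rightarrow>\<^sub>L ('k::{real_inner, second_countable_topology}, 'a) hs) \<Rightarrow> bool" where
  "has_exp_op D C S t = bounded_extension D (\<lambda>x. S t o\<^sub>L C x)"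

definition assumption_A1 ::
  "'h::{real_inner, banach} set \<Rightarrow> ('h \<Rightarrow> 'h) \<Rightarrow> (real \<Rightarrow> 'h \<Rightarrow>\<^sub>L 'h) \<Rightarrow> 'h set \<Rightarrow>
    ('h \<Rightarrow> 'k \<Rightarrow>\<^sub>L 'h) \<Rightarrow> ('h \<Rightarrow> 'k \<Rightarrow>\<^sub>L 'h) \<Rightarrow>
    ('h \<Rightarrow>\<^sub>L ('k::{real_inner, second_countable_topology}, 'h) hs) \<Rightarrow> bool" where
  "assumption_A1 DA A S DC C C1 C2 \<longleftrightarrow>
    linear_operator DC C1 \<and> (\<forall>x\<in>DC. C x = C1 x + blinfun_of_hs (C2 x)) \<and>
    (\<exists>\<gamma> L. 0 \<le> \<gamma> \<and> \<gamma> < 1/2 \<and> L > 0 \<and>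
      (\<forall>t>0. \<exists>K. has_op_exp DC C1 S t K \<and> norm K \<le> L * t powr (- \<gamma>))) \<and>
    (\<exists>a > 1/2. \<exists>\<delta> :: nat \<Rightarrow> real. decseq \<delta> \<and> (\<forall>n. \<delta> n > 0) \<and> \<delta> \<longlonglongrightarrow> 0 \<and>
      (\<forall>n. let K = op_exp DC C1 S (\<delta> n) in
        dissipative DA (\<lambda>x. A x + a *\<^sub>R blinfun_adj K (K x))))"

definition assumption_A2 ::
  "'h::real_inner set \<Rightarrow> ('h \<Rightarrow> 'h) \<Rightarrow> 'h set \<Rightarrow> ('h \<Rightarrow> 'k::real_normed_vector \<Rightarrow>\<^sub>L 'h) \<Rightarrow> bool" where
  "assumption_A2 DA A DC C1 \<longleftrightarrow>
    (\<exists>x\<in>DC. C1 x \<noteq> 0) \<longrightarrow> dissipative {x\<in>DA. A x \<in> DA} (\<lambda>x. - A (A x))"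


section \<open>Stochastic bases and cylindrical Wiener processes\<close>

text \<open>Time runs over \<open>[0,\<infinity>)\<close>; the values of families indexed by \<open>real\<close> at negative times are
  irrelevant. Of the measure \<open>F t\<close> only the \<open>\<sigma>\<close>-algebra matters.\<close>

definition usual_filtration :: "'w measure \<Rightarrow> (real \<Rightarrow> 'w measure) \<Rightarrow> bool" where
  "usual_filtration M F \<longleftrightarrow>
    (\<forall>t\<ge>0. subalgebra M (F t)) \<and>
    (\<forall>s\<ge>0. \<forall>t\<ge>s. sets (F s) \<subseteq> sets (F t)) \<and>
    null_sets M \<subseteq> sets (F 0) \<and>
    (\<forall>t\<ge>0. sets (F t) = (\<Inter>u\<in>{t<..}. sets (F u)))"

definition stochastic_basis :: "'w measure \<Rightarrow> (real \<Rightarrow> 'w measure) \<Rightarrow> bool" where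
  "stochastic_basis M F \<longleftrightarrow> prob_space M \<and> complete_measure M \<and> usual_filtration M F"

definition cylindrical_wiener ::
  "'w measure \<Rightarrow> (real \<Rightarrow> 'w measure) \<Rightarrow> (real \<Rightarrow> 'k::real_inner \<Rightarrow> 'w \<Rightarrow> real) \<Rightarrow> bool" where
  "cylindrical_wiener M F W \<longleftrightarrow>
    (\<forall>t\<ge>0. \<forall>\<phi>. W t \<phi> \<in> borel_measurable (F t)) \<and>
    (\<forall>t\<ge>0. \<forall>\<phi> \<psi> a b. AE \<omega> in M. W t (a *\<^sub>R \<phi> + b *\<^sub>R \<psi>) \<omega> = a * W t \<phi> \<omega> + b * W t \<psi> \<omega>) \<and>
    (\<forall>\<phi>. AE \<omega> in M. W 0 \<phi> \<omega> = 0) \<and>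
    (\<forall>\<phi>. AE \<omega> in M. continuous_on {0..} (\<lambda>t. W t \<phi> \<omega>)) \<and>
    (\<forall>\<phi> s t. \<phi> \<noteq> 0 \<longrightarrow> 0 \<le> s \<longrightarrow> s < t \<longrightarrow>
      distributed M lborel (\<lambda>\<omega>. W t \<phi> \<omega> - W s \<phi> \<omega>) (normal_density 0 (norm \<phi> * sqrt (t - s)))) \<and>
    (\<forall>\<phi> s t. 0 \<le> s \<longrightarrow> s < t \<longrightarrow>
      prob_space.indep_set M (sets (F s))
        {(\<lambda>\<omega>. W t \<phi> \<omega> - W s \<phi> \<omega>) -` B \<inter> space M |B. B \<in> sets borel})"

text \<open>The filtration is the augmented filtration of \<open>W\<close>. In a larger filtration, terminal values
  independent of \<open>W\<close> are not stochastic integrals, and the equation with \<open>A = 0\<close>, \<open>C = 0\<close> is not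
  solvable for them.\<close>

definition generated_by_wiener ::
  "'w measure \<Rightarrow> (real \<Rightarrow> 'w measure) \<Rightarrow> (real \<Rightarrow> 'k \<Rightarrow> 'w \<Rightarrow> real) \<Rightarrow> bool" where
  "generated_by_wiener M F W \<longleftrightarrow> (\<forall>t\<ge>0. sets (F t) = sigma_sets (space M)
    (null_sets M \<union> {W s \<phi> -` B \<inter> space M |s \<phi> B. 0 \<le> s \<and> s \<le> t \<and> B \<in> sets borel}))"

definition progressive ::
  "real \<Rightarrow> (real \<Rightarrow> 'w measure) \<Rightarrow> (real \<Rightarrow> 'w \<Rightarrow> 'b::topological_space) \<Rightarrow> bool" where
  "progressive T F X \<longleftrightarrow> (\<forall>t\<in>{0..T}.
    (\<lambda>(s, \<omega>). X s \<omega>) \<in> borel_measurable (restrict_space borel {0..t} \<Otimes>\<^sub>M F t))"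


section \<open>The stochastic integral of square integrable integrands\<close>

text \<open>An elementary integrand is a finite sum of terms \<open>1\<^bsub>(s,t]\<^esub> 1\<^bsub>G\<^esub> \<langle>\<phi>, \<cdot>\<rangle> h\<close> with \<open>G \<in> F s\<close>, encoded
  by tuples \<open>(s, t, G, \<phi>, h)\<close>. These are dense in the square integrable progressive processes,
  and the integral is the corresponding limit in mean square; it is unique up to null sets.\<close>

type_synonym ('w, 'k, 'h) elementary = "(real \<times> real \<times> 'w set \<times> 'k \<times> 'h) list"

definition elementary_on ::
  "(real \<Rightarrow> 'w measure) \<Rightarrow> real \<Rightarrow> real \<Rightarrow> ('w, 'k, 'h) elementary \<Rightarrow> bool" where
  "elementary_on F a b xs \<longleftrightarrow>
    (\<forall>(s, t, G, \<phi>, h)\<in>set xs. a \<le> s \<and> s \<le> t \<and> t \<le> b \<and> G \<in> sets (F s))"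

definition elementary_process ::
  "('w, 'k::{real_inner, second_countable_topology}, 'h::real_inner) elementary \<Rightarrow>
    real \<Rightarrow> 'w \<Rightarrow> ('k, 'h) hs" where
  "elementary_process xs r \<omega> =
    (\<Sum>(s, t, G, \<phi>, h)\<leftarrow>xs. (indicator {s<..t} r * indicator G \<omega>) *\<^sub>R rank_one h \<phi>)"

definition elementary_integral ::
  "(real \<Rightarrow> 'k \<Rightarrow> 'w \<Rightarrow> real) \<Rightarrow> ('w, 'k, 'h::real_vector) elementary \<Rightarrow> 'w \<Rightarrow> 'h" where
  "elementary_integral W xs \<omega> =
    (\<Sum>(s, t, G, \<phi>, h)\<leftarrow>xs. (indicator G \<omega> * (W t \<phi> \<omega> - W s \<phi> \<omega>)) *\<^sub>R h)"

definition has_ito_integral ::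
  "'w measure \<Rightarrow> (real \<Rightarrow> 'w measure) \<Rightarrow> (real \<Rightarrow> 'k \<Rightarrow> 'w \<Rightarrow> real) \<Rightarrow> real \<Rightarrow> real \<Rightarrow>
    (real \<Rightarrow> 'w \<Rightarrow> ('k::{real_inner, second_countable_topology}, 'h::real_inner) hs) \<Rightarrow>
    ('w \<Rightarrow> 'h) \<Rightarrow> bool" where
  "has_ito_integral M F W a b \<Phi> I \<longleftrightarrow>
    (\<lambda>(r, \<omega>). \<Phi> r \<omega>) \<in> borel_measurable (restrict_space borel {a..b} \<Otimes>\<^sub>M M) \<and>
    I \<in> borel_measurable M \<and>
    (\<exists>xs. (\<forall>n. elementary_on F a b (xs n)) \<and>
      (\<lambda>n. \<integral>\<^sup>+\<omega>. (\<integral>\<^sup>+r\<in>{a..b}. ennreal ((norm (elementary_process (xs n) r \<omega> - \<Phi> r \<omega>))\<^sup>2) \<partial>lborel) \<partial>M)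
        \<longlonglongrightarrow> 0 \<and>
      (\<lambda>n. \<integral>\<^sup>+\<omega>. ennreal ((norm (elementary_integral W (xs n) \<omega> - I \<omega>))\<^sup>2) \<partial>M) \<longlonglongrightarrow> 0)"


section \<open>Mild solutions of the backward equation\<close>

definition L2_variable :: "'w measure \<Rightarrow> 'w measure \<Rightarrow> ('w \<Rightarrow> 'h::real_normed_vector) \<Rightarrow> bool" where
  "L2_variable M G \<xi> \<longleftrightarrow> \<xi> \<in> borel_measurable G \<and> (\<integral>\<^sup>+\<omega>. ennreal ((norm (\<xi> \<omega>))\<^sup>2) \<partial>M) < \<infinity>"

definition solution_norm_sq ::
  "'w measure \<Rightarrow> real \<Rightarrow> (real \<Rightarrow> 'w \<Rightarrow> 'h::real_normed_vector) \<Rightarrow>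
    (real \<Rightarrow> 'w \<Rightarrow> 'z::real_normed_vector) \<Rightarrow> ennreal" where
  "solution_norm_sq M T Y Z =
    (SUP t\<in>{0..T}. \<integral>\<^sup>+\<omega>. ennreal ((norm (Y t \<omega>))\<^sup>2) \<partial>M) +
    (\<integral>\<^sup>+\<omega>. (\<integral>\<^sup>+s\<in>{0..T}. ennreal ((norm (Z s \<omega>))\<^sup>2) \<partial>lborel) \<partial>M)"

definition mild_solution ::
  "'w measure \<Rightarrow> (real \<Rightarrow> 'w measure) \<Rightarrow> (real \<Rightarrow> 'k \<Rightarrow> 'w \<Rightarrow> real) \<Rightarrow>
    (real \<Rightarrow> 'h \<Rightarrow>\<^sub>L 'h) \<Rightarrow> 'h set \<Rightarrow> ('h \<Rightarrow> 'k \<Rightarrow>\<^sub>L 'h) \<Rightarrow> real \<Rightarrow> ('w \<Rightarrow> 'h) \<Rightarrow>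
    (real \<Rightarrow> 'w \<Rightarrow> 'h::{real_inner, banach, second_countable_topology}) \<Rightarrow>
    (real \<Rightarrow> 'w \<Rightarrow> ('k::{real_inner, second_countable_topology}, 'h) hs) \<Rightarrow> bool" where
  "mild_solution M F W S DC C T \<xi> Y Z \<longleftrightarrow>
    progressive T F Y \<and> progressive T F Z \<and>
    (\<forall>t\<in>{0..T}. ((\<lambda>s. \<integral>\<^sup>+\<omega>. ennreal ((norm (Y s \<omega> - Y t \<omega>))\<^sup>2) \<partial>M) \<longlongrightarrow> 0) (at t within {0..T})) \<and>
    solution_norm_sq M T Y Z < \<infinity> \<and>
    (\<forall>t\<in>{0..T}. AE \<omega> in M.
      set_integrable lborel {t<..T} (\<lambda>s. blinfun_adj (op_exp DC C S (s - t)) (Z s \<omega>))) \<and>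
    (\<forall>t\<in>{0..T}. \<exists>I.
      has_ito_integral M F W t T (\<lambda>s \<omega>. hs_compose (blinfun_adj (S (s - t))) (Z s \<omega>)) I \<and>
      (AE \<omega> in M. Y t \<omega> = blinfun_adj (S (T - t)) (\<xi> \<omega>)
        + (LINT s:{t<..T}|lborel. blinfun_adj (op_exp DC C S (s - t)) (Z s \<omega>)) - I \<omega>))"

text \<open>Equality in \<open>C([0,T]; L\<^sup>2(\<Omega>)) \<times> L\<^sup>2([0,T] \<times> \<Omega>)\<close>.\<close>

definition same_solution ::
  "'w measure \<Rightarrow> real \<Rightarrow> (real \<Rightarrow> 'w \<Rightarrow> 'h) \<Rightarrow> (real \<Rightarrow> 'w \<Rightarrow> 'z) \<Rightarrow>
    (real \<Rightarrow> 'w \<Rightarrow> 'h) \<Rightarrow> (real \<Rightarrow> 'w \<Rightarrow> 'z) \<Rightarrow> bool" where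
  "same_solution M T Y Z Y' Z' \<longleftrightarrow>
    (\<forall>t\<in>{0..T}. AE \<omega> in M. Y t \<omega> = Y' t \<omega>) \<and>
    (AE (s, \<omega>) in restrict_space lborel {0..T} \<Otimes>\<^sub>M M. Z s \<omega> = Z' s \<omega>)"

end

(* The function |x|^2 / (2 a) is a Lyapunov function: dissipativity of A + a (C1 e^(dA))' (C1 e^(dA)), with ' for the
   adjoint, gives after integration along the semigroup and d -> 0 an energy bound for C1 e^(tA) x with constant
   1 / (2 a) < 1. The bounded part C2 costs arbitrarily little under the weight exp (- lam t), so K_t = C e^(tA) satisfies
   int_0^T exp (- 2 lam t) |K_t x|^2 dt <= q^2 |x|^2 with some q < 1.

   Freeze the drift integrand zeta. For a partition with points t_i let J_i be the stochastic integral in the equation at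
   time t_i, restricted to [t_i, t_(i+1)]. It is orthogonal to Y at t_i and to all later integrals, so its squared norm is
   its inner product with e^((T - t_i) A') xi + int K_(s - t_i)' zeta_s ds. Moving the operators to the J_i, which are
   orthogonal to each other, bounds the weighted sum of these inner products by |xi| and |zeta| times the norm of an
   orthogonal sum. In the limit |Z| <= e^(lam T) |xi| + q |zeta| in the norm with weight exp (lam s); this yields
   uniqueness, the estimate, and a contraction for the existence.

   For frozen zeta the solution is explicit when the randomness of the data is a single increment of W; the general case
   follows by linearity, the a priori estimate and density. The density is the martingale representation: a compensated
   exponential exp (i x + v / 2) of a short increment x of variance v is 1 + i x up to an orthogonal error of second
   order, so products of such exponentials are limits of stochastic integrals, and they determine the filtration. *)
theory Submission
  imports Defs
begin

section \<open>Strongly continuous semigroups\<close>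

text \<open>The drift contains Z but not Y, so an estimate for Z alone closes the argument, and Y is
  read off from the equation afterwards. The obstacle is that the mild form cannot simply be
  differentiated to get an identity for |Y|^2: its kernels depend on the initial time t as well as
  on s, and the equation at time t shows Z only through e^((s - t) A') Z_s. A partition takes the
  place of such an identity. On a short interval e^((s - t_i) A') is strongly close to the identity,
  so the J_i recover Z in the limit. Orthogonality of J_i to the past survives when bounded
  operators are applied on both sides (\<open>ip_blinfun_orthogonal\<close>,
  \<open>KU_orthogonal\<close>); therefore moving the operators from the data to the J_i costs one
  operator bound and no factor that grows with the number of intervals. Passing from the weight at
  t_i to the weight exp (lam s) leaves the factor exp (- lam (s - t_i)) on the kernel, which is
  exactly the weight of the energy bound; this is how the constant q < 1 reaches the stochastic
  estimate.\<close>

lemma uniform_boundedness: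
  fixes f :: "nat \<Rightarrow> 'a::banach \<Rightarrow>\<^sub>L 'b::real_normed_vector"
  assumes "\<And>x. bounded (range (\<lambda>n. f n x))"
  shows "bounded (range f)"
proof -
  \<comment> \<open>Baire: these closed sets cover the space, so one of them contains a ball around
    x of radius e. All \<open>f n\<close> are bounded by m on the ball, hence by 2 m on differences
    from its centre; rescaling vectors to length e / 2 produces the constant 4 m / e.\<close>
  define E where "E = (\<lambda>m::nat. {x. \<forall>n. norm (f n x) \<le> real m})"
  have cl: "closed (E m)" for m
    unfolding E_def by (intro closed_Collect_all closed_Collect_le continuous_intros)
  have un: "(\<Union>m. E m) = UNIV"
  proof -
    have "\<exists>m. x \<in> E m" for x
    proof -
      obtain B where "\<And>n. norm (f n x) \<le> B"
        using assms[of x] by (auto simp: bounded_iff)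
      moreover obtain m :: nat where "B \<le> real m" using real_arch_simple by blast
      ultimately have "\<forall>n. norm (f n x) \<le> real m" by (meson order_trans)
      then show ?thesis unfolding E_def by blast
    qed
    then show ?thesis by auto
  qed
  have "\<exists>m. interior (E m) \<noteq> {}"
  proof (rule ccontr)
    assume "\<not> ?thesis"
    then have "\<And>T. T \<in> range E \<Longrightarrow>
        closedin Met_TC.mtopology T \<and> Met_TC.mtopology interior_of T = {}"
      using cl by auto
    then have "Met_TC.mtopology interior_of \<Union>(range E) = {}"
      by (intro Met_TC.metric_Baire_category_alt) (auto simp: complete_UNIV)
    then show False using un by simp
  qed
  then obtain m x e where e: "e > 0" "ball x e \<subseteq> E m"
    by (metis ex_in_conv interior_subset mem_interior)
  have "norm (f n) \<le> 4 * real m / e" for n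
  proof (rule norm_blinfun_bound)
    fix y
    show "norm (f n y) \<le> 4 * real m / e * norm y"
    proof (cases "y = 0")
      case False
      define c where "c = e / (2 * norm y)"
      have c: "c > 0" using e False by (simp add: c_def)
      have "norm (f n (x + c *\<^sub>R y)) \<le> m" "norm (f n x) \<le> m"
        using e False by (auto simp: E_def subset_iff dist_norm c_def)
      then have "norm (f n (c *\<^sub>R y)) \<le> 2 * real m"
        using norm_triangle_ineq4[of "f n (x + c *\<^sub>R y)" "f n x"] by (simp add: blinfun.add_right)
      then have "norm (f n y) \<le> 2 * real m / c"
        using c by (simp add: blinfun.scaleR_right field_simps)
      then show ?thesis using False e by (simp add: c_def field_simps)
    qed simp
  qed (use e in auto)
  then show ?thesis by (auto simp: bounded_iff)
qed

text \<open>Otherwise there are times t n tending to 0 with norm of S (t n) above n, while S (t n) x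
  converges to x for every x. This contradicts uniform boundedness.\<close>

lemma C0_semigroup_bounded_near_0:
  fixes S :: "real \<Rightarrow> 'h::banach \<Rightarrow>\<^sub>L 'h"
  assumes "C0_semigroup S"
  shows "\<exists>d>0. \<exists>B. \<forall>t\<in>{0..d}. norm (S t) \<le> B"
proof (rule ccontr)
  assume "\<not> ?thesis"
  then have "\<exists>t\<in>{0..1 / real (Suc n)}. norm (S t) > real n" for n
    by (metis (no_types, opaque_lifting) not_le of_nat_0_less_iff zero_less_Suc zero_less_divide_1_iff)
  then obtain t where t: "\<And>n. t n \<in> {0..1 / real (Suc n)}" "\<And>n. norm (S (t n)) > real n"
    by metis
  have S0: "S 0 = id_blinfun" and lim: "\<And>x. ((\<lambda>t. S t x) \<longlongrightarrow> x) (at_right 0)"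
    using assms by (auto simp: C0_semigroup_def)
  have "((\<lambda>t. S t x) \<longlongrightarrow> x) (at 0 within {0..})" for x
    using lim[of x] by (simp add: at_within_Ici_at_right)
  then have c: "continuous (at 0 within {0..}) (\<lambda>t. S t x)" for x
    by (simp add: continuous_within S0)
  have "t \<longlonglongrightarrow> 0"
    by (rule real_tendsto_sandwich[of "\<lambda>_. 0" _ _ "\<lambda>n. 1 / real (Suc n)"])
      (use t(1) LIMSEQ_inverse_real_of_nat in \<open>auto simp: field_simps\<close>)
  then have "(\<lambda>n. S (t n) x) \<longlonglongrightarrow> x" for x
    using c[of x] t(1) unfolding continuous_within_sequentially by (simp add: o_def S0)
  then have "bounded (range (\<lambda>n. S (t n) x))" for x
    by (meson convergent_def convergent_imp_bounded)
  then have "bounded (range (\<lambda>n. S (t n)))" by (rule uniform_boundedness)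
  then obtain B where "\<And>n. norm (S (t n)) \<le> B" by (auto simp: bounded_iff)
  moreover obtain n :: nat where "B \<le> real n" using real_arch_simple by blast
  ultimately show False using t(2)[of n] by (smt (verit))
qed

lemma C0_semigroup_locally_bounded:
  fixes S :: "real \<Rightarrow> 'h::banach \<Rightarrow>\<^sub>L 'h"
  assumes S: "C0_semigroup S"
  shows "\<exists>B. \<forall>t\<in>{0..b}. norm (S t) \<le> B"
proof -
  obtain d B where d: "d > 0" "\<And>t. t \<in> {0..d} \<Longrightarrow> norm (S t) \<le> B"
    using C0_semigroup_bounded_near_0[OF S] by blast
  have "\<exists>B'. \<forall>t\<in>{0..real n * d}. norm (S t) \<le> B'" for n
  proof (induction n)
    case 0
    show ?case by auto
  next
    case (Suc n)
    then obtain B' where B': "\<And>t. t \<in> {0..real n * d} \<Longrightarrow> norm (S t) \<le> B'" by blast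
    have "norm (S t) \<le> max (B * B') B'" if "t \<in> {0..real (Suc n) * d}" for t
    proof (cases "t \<le> real n * d")
      case False
      let ?r = "t - real n * d"
      have "S (?r + real n * d) = S ?r o\<^sub>L S (real n * d)"
        using S False d(1) unfolding C0_semigroup_def
        by (meson diff_ge_0_iff_ge less_imp_le mult_nonneg_nonneg not_le of_nat_0_le_iff)
      then have "norm (S t) \<le> norm (S ?r) * norm (S (real n * d))"
        using norm_blinfun_compose[of "S ?r" "S (real n * d)"] by simp
      also have "\<dots> \<le> B * B'"
        using False that d by (intro mult_mono' d(2) B') (auto simp: algebra_simps)
      finally show ?thesis by simp
    qed (use B' that in \<open>simp add: le_max_iff_disj\<close>)
    then show ?case by blast
  qed
  moreover obtain n :: nat where "b / d \<le> real n" using real_arch_simple by blast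
  then have "{0..b} \<subseteq> {0..real n * d}" using d(1) by (auto simp: field_simps)
  ultimately show ?thesis by (meson subsetD)
qed

text \<open>With q the smaller of two times, the increment factors as S q applied to S (r - q) x -
  x. Right continuity at 0 controls the second factor and local boundedness the first, so continuity
  from the left comes out as well.\<close>

lemma C0_semigroup_continuous_on:
  fixes S :: "real \<Rightarrow> 'h::banach \<Rightarrow>\<^sub>L 'h"
  assumes S: "C0_semigroup S"
  shows "continuous_on {0..} (\<lambda>t. S t x)"
  unfolding continuous_on_iff
proof (intro ballI allI impI)
  fix t e :: real assume t: "t \<in> {0..}" and e: "e > 0"
  obtain B where B: "\<And>s. s \<in> {0..t+1} \<Longrightarrow> norm (S s) \<le> B"
    using C0_semigroup_locally_bounded[OF S] by blast
  have B0: "B \<ge> 0" using order_trans[OF norm_ge_zero B[of 0]] t by simp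
  have "((\<lambda>t. S t x) \<longlongrightarrow> x) (at_right 0)" using S by (simp add: C0_semigroup_def)
  then have "eventually (\<lambda>h. dist (S h x) x < e / (B + 1)) (at_right 0)"
    using e B0 by (intro tendstoD) auto
  then obtain d where d: "d > 0" "\<And>h. 0 < h \<Longrightarrow> h < d \<Longrightarrow> dist (S h x) x < e / (B + 1)"
    unfolding eventually_at_right_field by auto
  have sg: "S (a + c) = S a o\<^sub>L S c" if "a \<ge> 0" "c \<ge> 0" for a c
    using S that by (simp add: C0_semigroup_def)
  have key: "dist (S r x) (S q x) < e" if "0 \<le> q" "q < r" "q \<le> t + 1" "r - q < d" for q r
  proof -
    have "S r x - S q x = S q (S (r - q) x - x)"
      using sg[of q "r - q"] that by (simp add: blinfun.diff_right)
    then have "dist (S r x) (S q x) \<le> norm (S q) * norm (S (r - q) x - x)"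
      by (simp add: dist_norm norm_blinfun)
    also have "\<dots> \<le> B * (e / (B + 1))"
      using d(2)[of "r - q"] that B[of q] B0 by (intro mult_mono) (auto simp: dist_norm)
    also have "\<dots> < e" using e B0 by (simp add: field_simps)
    finally show ?thesis .
  qed
  show "\<exists>d>0. \<forall>s\<in>{0..}. dist s t < d \<longrightarrow> dist (S s x) (S t x) < e"
  proof (intro exI[of _ "min d 1"] conjI ballI impI)
    fix s assume "s \<in> {0..}" "dist s t < min d 1"
    then show "dist (S s x) (S t x) < e"
      using key[of t s] key[of s t] t e
      by (cases s t rule: linorder_cases) (auto simp: dist_real_def dist_commute)
  qed (use d in auto)
qed

lemma C0_semigroup_add:
  "C0_semigroup S \<Longrightarrow> s \<ge> 0 \<Longrightarrow> t \<ge> 0 \<Longrightarrow> S (s + t) x = S s (S t x)"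
  by (simp add: C0_semigroup_def)

text \<open>The generator is defined by one-sided difference quotients, whereas the fundamental
  theorem of calculus delivers derivatives relative to an interval. This is the bridge between the
  two.\<close>

lemma has_vector_derivative_right_quotient:
  fixes F :: "real \<Rightarrow> 'a::real_normed_vector"
  assumes "(F has_vector_derivative d) (at h within {h..b})" "h < b"
  shows "((\<lambda>t. (F (h + t) - F h) /\<^sub>R t) \<longlongrightarrow> d) (at_right 0)"
proof -
  have "((\<lambda>y. norm ((F y - F h) - (y - h) *\<^sub>R d) / norm (y - h)) \<longlongrightarrow> 0) (at h within {h..b})"
    using assms(1) unfolding has_vector_derivative_def has_derivative_iff_norm by simp
  then have "((\<lambda>y. norm ((F y - F h) - (y - h) *\<^sub>R d) / norm (y - h)) \<longlongrightarrow> 0) (at_right h)"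
    using assms(2) by (simp add: at_within_Icc_at_right)
  then have "((\<lambda>t. norm ((F (h + t) - F h) - t *\<^sub>R d) / norm t) \<longlongrightarrow> 0) (at_right 0)"
    by (subst (asm) filterlim_at_right_to_0) (simp add: add.commute)
  moreover have "norm ((F (h + t) - F h) - t *\<^sub>R d) / norm t = norm ((F (h + t) - F h) /\<^sub>R t - d)"
    if "t > 0" for t
  proof -
    have "(F (h + t) - F h) /\<^sub>R t - d = ((F (h + t) - F h) - t *\<^sub>R d) /\<^sub>R t"
      using that by (simp add: scaleR_diff_right)
    then show ?thesis using that by (simp add: divide_inverse_commute)
  qed
  then have "eventually (\<lambda>t. norm ((F (h + t) - F h) - t *\<^sub>R d) / norm t
      = norm ((F (h + t) - F h) /\<^sub>R t - d)) (at_right 0)"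
    by (auto simp: eventually_at_right_field intro: exI[of _ 1])
  ultimately have "((\<lambda>t. norm ((F (h + t) - F h) /\<^sub>R t - d)) \<longlongrightarrow> 0) (at_right 0)"
    by (rule Lim_transform_eventually)
  then show ?thesis using Lim_null tendsto_norm_zero_iff by blast
qed

text \<open>The means of S s x over [0, h] lie in D and tend to x. They lie in D because S t shifts
  the interval of integration, so the increment of the integral under S t is the integral over
  [h, h + t] minus the one over [0, t], and both have a difference quotient that converges.\<close>

lemma generator_dense:
  fixes S :: "real \<Rightarrow> 'h::banach \<Rightarrow>\<^sub>L 'h"
  assumes gen: "generates D A S"
  shows "closure D = UNIV"
proof -
  have S: "C0_semigroup S" using gen by (simp add: generates_def)
  have S0: "S 0 = id_blinfun" using S by (simp add: C0_semigroup_def)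
  have "x \<in> closure D" for x
  proof -
    have co: "continuous_on {0..b} (\<lambda>t. S t x)" for b
      by (rule continuous_on_subset[OF C0_semigroup_continuous_on[OF S]]) auto
    define F where "F u = integral {0..u} (\<lambda>s. S s x)" for u
    have int: "(\<lambda>s. S s x) integrable_on {a..b}" if "a \<ge> 0" for a b
      by (intro integrable_continuous_interval continuous_on_subset[OF C0_semigroup_continuous_on[OF S]])
        (use that in auto)
    have F': "((\<lambda>t. (F (h + t) - F h) /\<^sub>R t) \<longlongrightarrow> S h x) (at_right 0)" if "h \<ge> 0" for h
    proof -
      have "(F has_vector_derivative S h x) (at h within {0..h+1})"
        unfolding F_def by (rule integral_has_vector_derivative[OF co]) (use that in auto)
      then have "(F has_vector_derivative S h x) (at h within {h..h+1})"
        by (rule has_vector_derivative_within_subset) (use that in auto)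
      then show ?thesis by (rule has_vector_derivative_right_quotient) simp
    qed
    have inD: "F h /\<^sub>R h \<in> D" if h: "h > 0" for h
    proof -
      have "S t (F h) - F h = (F (h + t) - F h) - F t" if t: "t > 0" for t
      proof -
        have "S t (F h) = integral {0..h} (\<lambda>s. S t (S s x))"
          unfolding F_def
          by (rule integral_linear[OF int blinfun.bounded_linear_right, unfolded o_def, symmetric]) simp
        also have "\<dots> = integral {0..h} (\<lambda>s. S (s + t) x)"
          by (intro integral_cong) (simp add: add.commute[of _ t] C0_semigroup_add[OF S] less_imp_le[OF t])
        also have "\<dots> = integral {t..h + t} (\<lambda>s. S s x)"
          using integral_shift_Icc_real[of 0 h "\<lambda>s. S s x" t] by (simp add: o_def add.commute)
        also have "\<dots> = F (h + t) - F t"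
          using Henstock_Kurzweil_Integration.integral_combine[of 0 t "h + t" "\<lambda>s. S s x"]
            int[of 0 "h + t"] h t by (simp add: F_def algebra_simps)
        finally show ?thesis by simp
      qed
      then have "eventually (\<lambda>t. (F (h + t) - F h) /\<^sub>R t - (F (0 + t) - F 0) /\<^sub>R t = (S t (F h) - F h) /\<^sub>R t)
          (at_right 0)"
        unfolding eventually_at_right_field
        by (intro exI[of _ 1]) (auto simp: F_def scaleR_diff_right)
      moreover have "((\<lambda>t. (F (h + t) - F h) /\<^sub>R t - (F (0 + t) - F 0) /\<^sub>R t) \<longlongrightarrow> S h x - S 0 x) (at_right 0)"
        using that by (intro tendsto_diff F') auto
      ultimately have "((\<lambda>t. (S t (F h) - F h) /\<^sub>R t) \<longlongrightarrow> S h x - S 0 x) (at_right 0)"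
        by (rule Lim_transform_eventually[rotated])
      then have "((\<lambda>t. ((S t (F h) - F h) /\<^sub>R t) /\<^sub>R h) \<longlongrightarrow> (S h x - S 0 x) /\<^sub>R h) (at_right 0)"
        by (intro tendsto_intros)
      then have "((\<lambda>t. (S t (F h /\<^sub>R h) - F h /\<^sub>R h) /\<^sub>R t) \<longlongrightarrow> (S h x - S 0 x) /\<^sub>R h) (at_right 0)"
        by (simp add: blinfun.scaleR_right scaleR_diff_right mult.commute)
      then show ?thesis using gen by (auto simp: generates_def)
    qed
    have "((\<lambda>t. (F (0 + t) - F 0) /\<^sub>R t) \<longlongrightarrow> S 0 x) (at_right 0)" by (rule F') simp
    then have lim: "((\<lambda>t. F t /\<^sub>R t) \<longlongrightarrow> x) (at_right 0)" by (simp add: F_def S0)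
    show ?thesis
      by (rule Lim_in_closed_set[OF closed_closure _ _ lim])
        (use inD in \<open>auto simp: eventually_at_right_field intro!: exI[of _ 1] closure_subset[THEN subsetD]\<close>)
  qed
  then show ?thesis by auto
qed

text \<open>A barrier argument: f is compared with a line of positive slope e through f 0. At the
  last time at which f is not above the line, a right derivative at most 0 keeps it below for a
  little longer, so this last time must be b.\<close>

lemma nonincreasing_right_derivative:
  fixes f :: "real \<Rightarrow> real"
  assumes b: "0 \<le> b" and f: "continuous_on {0..b} f"
    and d: "\<And>t. 0 \<le> t \<Longrightarrow> t < b \<Longrightarrow> \<exists>d\<le>0. ((\<lambda>h. (f (t + h) - f t) / h) \<longlongrightarrow> d) (at_right 0)"
  shows "f b \<le> f 0"
proof (rule field_le_epsilon)
  fix e0 :: real assume e0: "e0 > 0"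
  \<comment> \<open>The denominator b + 1 keeps the total rise e b below e0 and also covers b =
    0.\<close>
  define e where "e = e0 / (b + 1)"
  have e: "e > 0" "e * b \<le> e0" using e0 b by (auto simp: e_def field_simps)
  define g where "g t = f t - f 0 - e * t" for t
  define X where "X = {t\<in>{0..b}. g t \<le> 0}"
  have gc: "continuous_on {0..b} g" unfolding g_def by (intro continuous_intros f)
  have X: "closed X" "0 \<in> X" "bdd_above X"
  proof -
    show "closed X"
      unfolding X_def by (rule continuous_on_closed_Collect_le[OF gc continuous_on_const closed_atLeastAtMost])
  qed (use b in \<open>auto simp: X_def g_def[of 0] intro!: bdd_aboveI[of _ b]\<close>)
  define \<tau> where "\<tau> = Sup X"
  have \<tau>: "\<tau> \<in> X" unfolding \<tau>_def using closed_contains_Sup X by blast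
  have "\<tau> = b"
  proof (rule ccontr)
    assume "\<tau> \<noteq> b"
    then have t: "0 \<le> \<tau>" "\<tau> < b" using \<tau> by (auto simp: X_def)
    then obtain d where "d \<le> 0" "((\<lambda>h. (f (\<tau> + h) - f \<tau>) / h) \<longlongrightarrow> d) (at_right 0)"
      using d by blast
    then have "eventually (\<lambda>h. (f (\<tau> + h) - f \<tau>) / h < e) (at_right 0)"
      using e by (intro order_tendstoD(2)[of _ d]) auto
    then obtain c where c: "c > 0" "\<And>h. 0 < h \<Longrightarrow> h < c \<Longrightarrow> (f (\<tau> + h) - f \<tau>) / h < e"
      unfolding eventually_at_right_field by auto
    define h where "h = min (c / 2) (b - \<tau>)"
    have h: "0 < h" "h < c" "\<tau> + h \<le> b" using c t by (auto simp: h_def)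
    have "f (\<tau> + h) - f \<tau> < e * h" using c(2)[OF h(1,2)] h(1) by (simp add: field_simps)
    then have "\<tau> + h \<in> X" using \<tau> h by (auto simp: X_def g_def algebra_simps)
    then have "\<tau> + h \<le> \<tau>" unfolding \<tau>_def using X by (intro cSup_upper) auto
    then show False using h by simp
  qed
  then show "f b \<le> f 0 + e0" using \<tau> e by (auto simp: X_def g_def)
qed

lemma generator_invariant:
  fixes S :: "real \<Rightarrow> 'h::banach \<Rightarrow>\<^sub>L 'h"
  assumes gen: "generates D A S" and x: "x \<in> D" and t: "t \<ge> 0"
  shows "S t x \<in> D" and "((\<lambda>h. (S (t + h) x - S t x) /\<^sub>R h) \<longlongrightarrow> A (S t x)) (at_right 0)"
proof -
  have S: "C0_semigroup S" using gen by (simp add: generates_def)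
  have "((\<lambda>h. (S h x - x) /\<^sub>R h) \<longlongrightarrow> A x) (at_right 0)" using gen x by (simp add: generates_def)
  then have "((\<lambda>h. S t ((S h x - x) /\<^sub>R h)) \<longlongrightarrow> S t (A x)) (at_right 0)" by (intro tendsto_intros)
  moreover have "eventually (\<lambda>h. S t ((S h x - x) /\<^sub>R h) = (S h (S t x) - S t x) /\<^sub>R h) (at_right 0)"
    unfolding eventually_at_right_field
  proof (intro exI[of _ 1] conjI allI impI)
    fix h :: real assume "h > 0"
    then show "S t ((S h x - x) /\<^sub>R h) = (S h (S t x) - S t x) /\<^sub>R h"
      using C0_semigroup_add[OF S, of t h x] C0_semigroup_add[OF S, of h t x] t
      by (simp add: blinfun.scaleR_right blinfun.diff_right add.commute)
  qed simp
  ultimately have lim: "((\<lambda>h. (S h (S t x) - S t x) /\<^sub>R h) \<longlongrightarrow> S t (A x)) (at_right 0)"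
    by (rule Lim_transform_eventually)
  then show D: "S t x \<in> D" using gen by (auto simp: generates_def)
  then have "((\<lambda>h. (S h (S t x) - S t x) /\<^sub>R h) \<longlongrightarrow> A (S t x)) (at_right 0)"
    using gen by (simp add: generates_def)
  moreover have "eventually (\<lambda>h. (S h (S t x) - S t x) /\<^sub>R h = (S (t + h) x - S t x) /\<^sub>R h) (at_right 0)"
    unfolding eventually_at_right_field
    using C0_semigroup_add[OF S, of _ t x] t by (intro exI[of _ 1]) (auto simp: add.commute)
  ultimately show "((\<lambda>h. (S (t + h) x - S t x) /\<^sub>R h) \<longlongrightarrow> A (S t x)) (at_right 0)"
    by (rule Lim_transform_eventually)
qed

text \<open>The right derivative of \<open>f\<close> at u is 2 (A y . y + c |P y|^2) with y = S u x,
  which \<open>dis\<close> makes nonpositive. The generator provides right derivatives only, hence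
  the appeal to \<open>nonincreasing_right_derivative\<close>.\<close>

lemma energy_on_domain:
  fixes S :: "real \<Rightarrow> 'h::{real_inner, banach} \<Rightarrow>\<^sub>L 'h" and P :: "'h \<Rightarrow>\<^sub>L 'b::real_normed_vector"
  assumes gen: "generates D A S"
    and dis: "\<And>y. y \<in> D \<Longrightarrow> A y \<bullet> y + c * (norm (P y))\<^sup>2 \<le> 0"
    and x: "x \<in> D" and t: "t \<ge> 0"
  shows "(norm (S t x))\<^sup>2 + integral {0..t} (\<lambda>s. 2 * c * (norm (P (S s x)))\<^sup>2) \<le> (norm x)\<^sup>2"
proof -
  have S: "C0_semigroup S" using gen by (simp add: generates_def)
  have S0: "S 0 = id_blinfun" using S by (simp add: C0_semigroup_def)
  have co: "continuous_on {a..b} (\<lambda>t. S t x)" if "a \<ge> 0" for a b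
    by (rule continuous_on_subset[OF C0_semigroup_continuous_on[OF S]]) (use that in auto)
  define G where "G u = integral {0..u} (\<lambda>s. 2 * c * (norm (P (S s x)))\<^sup>2)" for u
  define f where "f u = (norm (S u x))\<^sup>2 + G u" for u
  have coP: "continuous_on {0..b} (\<lambda>s. 2 * c * (norm (P (S s x)))\<^sup>2)" for b
    by (intro continuous_intros co) simp
  have "f t \<le> f 0"
  proof (rule nonincreasing_right_derivative[OF t])
    show "continuous_on {0..t} f"
      unfolding f_def G_def
      by (intro continuous_intros co indefinite_integral_continuous_1
          integrable_continuous_interval coP) simp
    fix u assume u: "0 \<le> u" "u < t"
    have "(G has_vector_derivative 2 * c * (norm (P (S u x)))\<^sup>2) (at u within {0..u+1})"
      unfolding G_def by (rule integral_has_vector_derivative[OF coP]) (use u in auto)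
    then have "(G has_vector_derivative 2 * c * (norm (P (S u x)))\<^sup>2) (at u within {u..u+1})"
      by (rule has_vector_derivative_within_subset) (use u in auto)
    then have G': "((\<lambda>h. (G (u + h) - G u) /\<^sub>R h) \<longlongrightarrow> 2 * c * (norm (P (S u x)))\<^sup>2) (at_right 0)"
      by (rule has_vector_derivative_right_quotient) simp
    have 1: "((\<lambda>h. (S (u + h) x - S u x) /\<^sub>R h) \<longlongrightarrow> A (S u x)) (at_right 0)"
      and 2: "S u x \<in> D" using generator_invariant[OF gen x u(1)] by auto
    have "((\<lambda>h. S u x + h *\<^sub>R ((S (u + h) x - S u x) /\<^sub>R h)) \<longlongrightarrow> S u x + 0 *\<^sub>R A (S u x)) (at_right 0)"
      by (intro tendsto_intros 1)
    moreover have "eventually (\<lambda>h. S u x + h *\<^sub>R ((S (u + h) x - S u x) /\<^sub>R h) = S (u + h) x) (at_right 0)"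
      unfolding eventually_at_right_field by (intro exI[of _ 1]) auto
    ultimately have 3: "((\<lambda>h. S (u + h) x) \<longlongrightarrow> S u x) (at_right 0)"
      by (simp add: Lim_transform_eventually)
    have "((\<lambda>h. ((S (u + h) x - S u x) /\<^sub>R h) \<bullet> (S (u + h) x + S u x) + (G (u + h) - G u) /\<^sub>R h)
        \<longlongrightarrow> A (S u x) \<bullet> (S u x + S u x) + 2 * c * (norm (P (S u x)))\<^sup>2) (at_right 0)"
      by (intro tendsto_intros 1 3 G')
    moreover have "((S (u + h) x - S u x) /\<^sub>R h) \<bullet> (S (u + h) x + S u x) + (G (u + h) - G u) /\<^sub>R h
        = (f (u + h) - f u) / h" for h
    proof -
      \<comment> \<open>The difference of squared norms is factored so that one factor is the
        difference quotient of the orbit and the other converges by right continuity.\<close>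
      have *: "(y - z) \<bullet> (y + z) = (norm y)\<^sup>2 - (norm z)\<^sup>2" for y z :: 'h
        by (simp add: power2_norm_eq_inner algebra_simps inner_commute)
      show ?thesis
        unfolding f_def inner_scaleR_left * by (simp add: divide_inverse algebra_simps)
    qed
    ultimately have "((\<lambda>h. (f (u + h) - f u) / h)
        \<longlongrightarrow> A (S u x) \<bullet> (S u x + S u x) + 2 * c * (norm (P (S u x)))\<^sup>2) (at_right 0)" by simp
    moreover have "A (S u x) \<bullet> (S u x + S u x) + 2 * c * (norm (P (S u x)))\<^sup>2 \<le> 0"
      using dis[OF 2] by (simp add: inner_add_right)
    ultimately show "\<exists>d\<le>0. ((\<lambda>h. (f (u + h) - f u) / h) \<longlongrightarrow> d) (at_right 0)" by blast
  qed
  then show ?thesis by (simp add: f_def G_def S0)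
qed

text \<open>The energy estimate with P = 0 gives the bound on D; the set where it holds is closed
  and D is dense.\<close>

lemma dissipative_contraction:
  fixes S :: "real \<Rightarrow> 'h::{real_inner, banach} \<Rightarrow>\<^sub>L 'h"
  assumes gen: "generates D A S" and dis: "dissipative D A" and t: "t \<ge> 0"
  shows "norm (S t x) \<le> norm x"
proof -
  have "norm (S t y) \<le> norm y" if "y \<in> D" for y
    using energy_on_domain[OF gen, of 0 "0 :: 'h \<Rightarrow>\<^sub>L 'h", OF _ that t] dis
    by (simp add: dissipative_def power2_le_iff_abs_le)
  then have "D \<subseteq> {y. norm (S t y) \<le> norm y}" by auto
  moreover have "closed {y. norm (S t y) \<le> norm y}"
    by (intro closed_Collect_le continuous_intros)
  ultimately have "closure D \<subseteq> {y. norm (S t y) \<le> norm y}" by (rule closure_minimal)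
  then show ?thesis using generator_dense[OF gen] by auto
qed

text \<open>For x in D this is the energy estimate without its term |S t x|^2. Fatou's lemma extends
  it along a sequence from D: the integrand converges pointwise and the right-hand side depends
  continuously on x.\<close>

lemma energy_nn_integral:
  fixes S :: "real \<Rightarrow> 'h::{real_inner, banach} \<Rightarrow>\<^sub>L 'h" and P :: "'h \<Rightarrow>\<^sub>L 'b::real_normed_vector"
  assumes gen: "generates D A S" and c: "c > 0"
    and dis: "\<And>y. y \<in> D \<Longrightarrow> A y \<bullet> y + c * (norm (P y))\<^sup>2 \<le> 0"
  shows "(\<integral>\<^sup>+s\<in>{0..t}. ennreal ((norm (P (S s x)))\<^sup>2) \<partial>lborel) \<le> ennreal ((norm x)\<^sup>2 / (2 * c))"
proof (cases "t \<ge> 0")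
  case t: True
  have S: "C0_semigroup S" using gen by (simp add: generates_def)
  have co: "continuous_on {0..t} (\<lambda>s. (norm (P (S s x)))\<^sup>2)" for x
    by (intro continuous_intros continuous_on_subset[OF C0_semigroup_continuous_on[OF S]]) auto
  have onD: "(\<integral>\<^sup>+s\<in>{0..t}. ennreal ((norm (P (S s y)))\<^sup>2) \<partial>lborel) \<le> ennreal ((norm y)\<^sup>2 / (2 * c))"
    if y: "y \<in> D" for y
  proof -
    have "((\<lambda>s. (norm (P (S s y)))\<^sup>2) has_integral integral {0..t} (\<lambda>s. (norm (P (S s y)))\<^sup>2)) {0..t}"
      by (intro integrable_integral integrable_continuous_interval co)
    then have "((\<lambda>s. indicator {0..t} s * (norm (P (S s y)))\<^sup>2) has_integral
        integral {0..t} (\<lambda>s. (norm (P (S s y)))\<^sup>2)) UNIV"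
      by (subst (asm) has_integral_restrict_UNIV[symmetric])
        (auto simp: indicator_def if_distrib cong: if_cong intro: has_integral_eq_rhs elim!: has_integral_eq[rotated])
    then have "(\<integral>\<^sup>+s. ennreal (indicator {0..t} s * (norm (P (S s y)))\<^sup>2) \<partial>lborel)
        = ennreal (integral {0..t} (\<lambda>s. (norm (P (S s y)))\<^sup>2))"
      by (intro nn_integral_has_integral_lborel)
        (use borel_measurable_continuous_on_indicator[OF _ co] in auto)
    moreover have "integral {0..t} (\<lambda>s. (norm (P (S s y)))\<^sup>2) \<le> (norm y)\<^sup>2 / (2 * c)"
      using energy_on_domain[OF gen dis y t] c by (simp add: field_simps)
        (smt (verit) zero_le_power2)
    ultimately show ?thesis
      by (simp add: ennreal_leI ennreal_mult ennreal_indicator mult.commute)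
  qed
  have "x \<in> closure D" using generator_dense[OF gen] by simp
  then obtain y where y: "\<And>n. y n \<in> D" "y \<longlonglongrightarrow> x" unfolding closure_sequential by blast
  have "(\<integral>\<^sup>+s\<in>{0..t}. ennreal ((norm (P (S s x)))\<^sup>2) \<partial>lborel)
      = (\<integral>\<^sup>+s. liminf (\<lambda>n. ennreal ((norm (P (S s (y n))))\<^sup>2) * indicator {0..t} s) \<partial>lborel)"
  proof (intro nn_integral_cong)
    fix s
    have "(\<lambda>n. ennreal ((norm (P (S s (y n))))\<^sup>2) * indicator {0..t} s) \<longlonglongrightarrow>
        ennreal ((norm (P (S s x)))\<^sup>2) * indicator {0..t} s"
      unfolding ennreal_indicator[symmetric]
      by (subst (1 2) ennreal_mult[symmetric]) (auto intro!: tendsto_intros y)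
    then show "ennreal ((norm (P (S s x)))\<^sup>2) * indicator {0..t} s
        = liminf (\<lambda>n. ennreal ((norm (P (S s (y n))))\<^sup>2) * indicator {0..t} s)"
      by (simp add: lim_imp_Liminf)
  qed
  also have "\<dots> \<le> liminf (\<lambda>n. \<integral>\<^sup>+s\<in>{0..t}. ennreal ((norm (P (S s (y n))))\<^sup>2) \<partial>lborel)"
  proof (rule nn_integral_liminf)
    fix n
    have "(\<lambda>s. ennreal (indicator {0..t} s *\<^sub>R (norm (P (S s (y n))))\<^sup>2)) \<in> borel_measurable lborel"
      using borel_measurable_continuous_on_indicator[OF _ co, of "y n"] by simp
    then show "(\<lambda>s. ennreal ((norm (P (S s (y n))))\<^sup>2) * indicator {0..t} s) \<in> borel_measurable lborel"
      by (simp add: ennreal_mult ennreal_indicator mult.commute)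
  qed
  also have "\<dots> \<le> liminf (\<lambda>n. ennreal ((norm (y n))\<^sup>2 / (2 * c)))"
    by (intro Liminf_mono always_eventually allI onD y)
  also have "(\<lambda>n. ennreal ((norm (y n))\<^sup>2 / (2 * c))) \<longlonglongrightarrow> ennreal ((norm x)\<^sup>2 / (2 * c))"
    using c by (intro tendsto_intros y) auto
  then have "liminf (\<lambda>n. ennreal ((norm (y n))\<^sup>2 / (2 * c))) = ennreal ((norm x)\<^sup>2 / (2 * c))"
    by (simp add: lim_imp_Liminf)
  finally show ?thesis .
qed simp

section \<open>The kernel of the drift\<close>

text \<open>Both \<open>K'\<close> and the composition of K with S v extend the map that sends x to
  C (S (u + v) x) from one and the same dense set, and bounded extensions are unique. The density of
  that set is part of the assumption on \<open>K'\<close>.\<close>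

lemma has_op_exp_add:
  assumes S: "C0_semigroup S" and u: "u \<ge> 0" and v: "v \<ge> 0"
    and K: "has_op_exp D C S u K" and K': "has_op_exp D C S (u + v) K'"
  shows "K' x = K (S v x)"
proof -
  have "bounded_extension {x. S (u + v) x \<in> D} (\<lambda>x. C (S (u + v) x)) (K o\<^sub>L S v)"
    using K K' C0_semigroup_add[OF S u v]
    unfolding has_op_exp_def bounded_extension_def by simp
  then have "K' = K o\<^sub>L S v"
    using K' bounded_extension_unique unfolding has_op_exp_def by blast
  then show ?thesis by simp
qed

lemma has_op_exp_plus_bounded:
  fixes C2 :: "'h::real_inner \<Rightarrow>\<^sub>L ('k::{real_inner, second_countable_topology}, 'h) hs"
  assumes C: "\<And>x. x \<in> D \<Longrightarrow> C x = C1 x + blinfun_of_hs (C2 x)" and K: "has_op_exp D C1 S u K1"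
  shows "has_op_exp D C S u (K1 + (C2 o\<^sub>L S u))"
  using K C unfolding has_op_exp_def bounded_extension_def
  by (simp add: blinfun.add_left plus_hs.rep_eq)

lemma norm_blinfun_adj_le:
  fixes K :: "'a::{real_inner, banach} \<Rightarrow>\<^sub>L 'b::real_inner"
  assumes "norm K \<le> c"
  shows "norm (blinfun_adj K y) \<le> c * norm y"
proof (cases "blinfun_adj K y = 0")
  case False
  let ?z = "blinfun_adj K y"
  have "norm ?z * norm ?z = K ?z \<bullet> y" by (simp add: inner_blinfun_adj[symmetric] dot_square_norm power2_eq_square)
  also have "\<dots> \<le> norm (K ?z) * norm y" by (rule norm_cauchy_schwarz)
  also have "\<dots> \<le> (norm K * norm ?z) * norm y" by (intro mult_right_mono norm_blinfun) simp
  also have "\<dots> \<le> (c * norm ?z) * norm y" using assms by (intro mult_right_mono) auto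
  finally show ?thesis using False by (simp add: mult_ac)
qed (use assms order_trans[OF norm_ge_zero assms] in simp)

text \<open>The identity K (\<delta> + s) x = K \<delta> (S s x) turns the energy estimate for P = K
  \<delta> into a bound over [\<delta>, \<delta> + T] that does not depend on \<delta>. Every u in
  (0, T] belongs to these intervals for all large n, so Fatou's lemma carries the bound over to (0,
  T].\<close>

lemma energy_kernel:
  fixes S :: "real \<Rightarrow> 'h::{real_inner, banach} \<Rightarrow>\<^sub>L 'h"
    and K :: "real \<Rightarrow> 'h \<Rightarrow>\<^sub>L ('k::{real_inner, second_countable_topology}, 'h) hs"
  assumes gen: "generates DA A S" and a: "a > 0"
    and K: "\<And>u v x. u > 0 \<Longrightarrow> v \<ge> 0 \<Longrightarrow> K (u + v) x = K u (S v x)"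
    and \<delta>: "\<And>n. \<delta> n > 0" "\<delta> \<longlonglongrightarrow> 0"
    and dis: "\<And>n. dissipative DA (\<lambda>x. A x + a *\<^sub>R blinfun_adj (K (\<delta> n)) (K (\<delta> n) x))"
  shows "continuous_on {0<..} (\<lambda>u. K u x)"
    and "(\<integral>\<^sup>+u\<in>{0<..T}. ennreal ((norm (K u x))\<^sup>2) \<partial>lborel) \<le> ennreal ((norm x)\<^sup>2 / (2 * a))"
proof -
  have S: "C0_semigroup S" using gen by (simp add: generates_def)
  have "isCont (\<lambda>u. K u x) u" if u: "u > 0" for u
  proof -
    \<comment> \<open>Started at u / 2 > 0, where K is one fixed bounded operator, the kernel
      inherits continuity from the orbit of S.\<close>
    have "continuous_on {u/2<..} (\<lambda>w. K (u/2) (S (w - u/2) x))"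
      by (intro continuous_intros continuous_on_compose2[OF C0_semigroup_continuous_on[OF S]]) auto
    then have "continuous_on {u/2<..} (\<lambda>w. K w x)"
    proof (rule continuous_on_cong[THEN iffD1, rotated -1])
      show "K (u/2) (S (w - u/2) x) = K w x" if "w \<in> {u/2<..}" for w
        using K[of "u/2" "w - u/2" x] u that by simp
    qed simp
    then show ?thesis using u by (simp add: continuous_on_eq_continuous_at)
  qed
  then show co: "continuous_on {0<..} (\<lambda>u. K u x)"
    by (simp add: continuous_on_eq_continuous_at)
  let ?f = "\<lambda>u. ennreal ((norm (K u x))\<^sup>2)"
  have meas: "(\<lambda>u. ?f u * indicator {c..d} u) \<in> borel_measurable borel" if "c > 0" for c d
  proof -
    have "continuous_on {c..d} (\<lambda>u. (norm (K u x))\<^sup>2)"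
      by (intro continuous_intros continuous_on_subset[OF co]) (use that in auto)
    from borel_measurable_continuous_on_indicator[OF _ this]
    have "(\<lambda>s. ennreal (indicator {c..d} s *\<^sub>R (norm (K s x))\<^sup>2)) \<in> borel_measurable lborel" by simp
    then show ?thesis by (simp add: ennreal_mult ennreal_indicator mult.commute)
  qed
  have bound: "(\<integral>\<^sup>+u. ?f u * indicator {\<delta> n..\<delta> n + T} u \<partial>lborel) \<le> ennreal ((norm x)\<^sup>2 / (2 * a))" for n
  proof -
    have "(\<integral>\<^sup>+u. ?f u * indicator {\<delta> n..\<delta> n + T} u \<partial>lborel)
        = (\<integral>\<^sup>+s. ?f (\<delta> n + s) * indicator {\<delta> n..\<delta> n + T} (\<delta> n + s) \<partial>lborel)"
      by (subst nn_integral_real_affine[where c = 1 and t = "\<delta> n"]) (simp_all add: meas \<delta>)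
    also have "\<dots> = (\<integral>\<^sup>+s\<in>{0..T}. ennreal ((norm (K (\<delta> n) (S s x)))\<^sup>2) \<partial>lborel)"
      by (intro nn_integral_cong) (auto simp: indicator_def K[OF \<delta>(1)])
    also have "\<dots> \<le> ennreal ((norm x)\<^sup>2 / (2 * a))"
    proof (rule energy_nn_integral[OF gen a])
      fix y assume "y \<in> DA"
      then show "A y \<bullet> y + a * (norm (K (\<delta> n) y))\<^sup>2 \<le> 0"
        using bspec[OF dis[of n, unfolded dissipative_def] \<open>y \<in> DA\<close>] inner_blinfun_adj[of y "K (\<delta> n)" "K (\<delta> n) y"]
        by (simp add: inner_add_left inner_add_right inner_commute dot_square_norm)
    qed
    finally show ?thesis .
  qed
  have "(\<integral>\<^sup>+u\<in>{0<..T}. ?f u \<partial>lborel)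
      \<le> (\<integral>\<^sup>+u. liminf (\<lambda>n. ?f u * indicator {\<delta> n..\<delta> n + T} u) \<partial>lborel)"
  proof (rule nn_integral_mono)
    fix u :: real
    show "?f u * indicator {0<..T} u \<le> liminf (\<lambda>n. ?f u * indicator {\<delta> n..\<delta> n + T} u)"
    proof (cases "u \<in> {0<..T}")
      case True
      then have "eventually (\<lambda>n. \<delta> n < u) sequentially" using \<delta>(2) by (intro order_tendstoD) auto
      then have "eventually (\<lambda>n. ?f u \<le> ?f u * indicator {\<delta> n..\<delta> n + T} u) sequentially"
      proof (rule eventually_mono)
        fix n assume "\<delta> n < u"
        then show "?f u \<le> ?f u * indicator {\<delta> n..\<delta> n + T} u"
          using True \<delta>(1)[of n] by (auto simp: indicator_def)
      qed
      then show ?thesis using True by (simp add: Liminf_bounded)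
    qed simp
  qed
  also have "\<dots> \<le> liminf (\<lambda>n. \<integral>\<^sup>+u. ?f u * indicator {\<delta> n..\<delta> n + T} u \<partial>lborel)"
    by (intro nn_integral_liminf) (simp add: meas \<delta>)
  also have "\<dots> \<le> ennreal ((norm x)\<^sup>2 / (2 * a))"
    using Liminf_mono[OF always_eventually[OF allI[OF bound]], of sequentially]
    by (simp add: Liminf_const)
  finally show "(\<integral>\<^sup>+u\<in>{0<..T}. ?f u \<partial>lborel) \<le> ennreal ((norm x)\<^sup>2 / (2 * a))" .
qed

lemma nn_integral_exp_le:
  assumes "lam > 0"
  shows "(\<integral>\<^sup>+u\<in>{0<..T}. ennreal (exp (- 2 * lam * u)) \<partial>lborel) \<le> ennreal (1 / (2 * lam))"
proof (cases "T \<ge> 0")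
  case True
  have "(\<integral>\<^sup>+u\<in>{0<..T}. ennreal (exp (- 2 * lam * u)) \<partial>lborel)
      \<le> (\<integral>\<^sup>+u\<in>{0..T}. ennreal (exp (- 2 * lam * u)) \<partial>lborel)"
    by (intro nn_integral_mono) (auto simp: indicator_def)
  also have "\<dots> = ennreal (- exp (- 2 * lam * T) / (2 * lam) - (- exp (- 2 * lam * 0) / (2 * lam)))"
    using assms True by (intro nn_integral_FTC_Icc) (auto intro!: derivative_eq_intros)
  also have "\<dots> \<le> ennreal (1 / (2 * lam))" using assms by (intro ennreal_leI) simp
  finally show ?thesis .
qed simp

text \<open>The squared singularity has exponent - 2 \<gamma> > - 1; this is the place of the
  condition \<gamma> < 1/2.\<close>

lemma nn_integral_powr_finite:
  assumes "\<gamma> < 1/2" "T \<ge> 0"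
  shows "(\<integral>\<^sup>+u\<in>{0<..T}. ennreal ((u powr (- \<gamma>))\<^sup>2) \<partial>lborel) < \<infinity>"
proof -
  have "((\<lambda>u. u powr (- 2 * \<gamma>)) has_integral (T powr (- 2 * \<gamma> + 1) / (- 2 * \<gamma> + 1))) {0..T}"
    using assms by (intro has_integral_powr_from_0) auto
  then have "((\<lambda>u. indicator {0..T} u * u powr (- 2 * \<gamma>)) has_integral (T powr (- 2 * \<gamma> + 1) / (- 2 * \<gamma> + 1))) UNIV"
    by (subst (asm) has_integral_restrict_UNIV[symmetric])
      (auto simp: indicator_def if_distrib cong: if_cong elim!: has_integral_eq[rotated])
  then have "(\<integral>\<^sup>+u. ennreal (indicator {0..T} u * u powr (- 2 * \<gamma>)) \<partial>lborel) = ennreal (T powr (- 2 * \<gamma> + 1) / (- 2 * \<gamma> + 1))"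
    by (intro nn_integral_has_integral_lborel) auto
  moreover have "(\<integral>\<^sup>+u\<in>{0<..T}. ennreal ((u powr (- \<gamma>))\<^sup>2) \<partial>lborel)
      \<le> (\<integral>\<^sup>+u. ennreal (indicator {0..T} u * u powr (- 2 * \<gamma>)) \<partial>lborel)"
    by (intro nn_integral_mono) (auto simp: indicator_def power2_eq_square powr_add[symmetric])
  ultimately show ?thesis by (simp add: order_le_less_trans)
qed

text \<open>Young's inequality for the mixed term. The free parameter \<eta> lets the first summand
  keep a factor close to 1, at the price of a large factor on the second.\<close>

lemma norm_add_square_le:
  fixes x y :: "'a::real_inner"
  assumes "\<eta> > 0"
  shows "(norm (x + y))\<^sup>2 \<le> (1 + \<eta>) * (norm x)\<^sup>2 + (1 + 1/\<eta>) * (norm y)\<^sup>2"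
proof -
  have "0 \<le> (norm (sqrt \<eta> *\<^sub>R x - (1 / sqrt \<eta>) *\<^sub>R y))\<^sup>2" by simp
  also have "\<dots> = \<eta> * (norm x)\<^sup>2 + (norm y)\<^sup>2 / \<eta> - 2 * (x \<bullet> y)"
    using assms unfolding power2_norm_eq_inner
    by (simp add: inner_diff_left inner_diff_right inner_commute field_simps real_sqrt_mult_self)
  finally show ?thesis
    unfolding power2_norm_eq_inner
    by (simp add: inner_add_left inner_add_right inner_commute algebra_simps)
qed

text \<open>The properties of A and C that enter the stochastic part; K u stands for C e^(uA). The
  two bounds on K serve different ends. The majorant \<open>kap\<close> of the operator norm is
  square integrable but carries no smallness; it makes the drift integral exist. The bound
  \<open>K_energy\<close>, for each x separately, carries the constant q < 1 behind the
  contraction.\<close>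

locale kernel =
  fixes S :: "real \<Rightarrow> 'h::{real_inner, banach, second_countable_topology} \<Rightarrow>\<^sub>L 'h"
    and K :: "real \<Rightarrow> 'h \<Rightarrow>\<^sub>L ('k::{real_inner, banach, second_countable_topology}, 'h) hs"
    and T lam q :: real and kap :: "real \<Rightarrow> real"
  assumes T: "T > 0" and S0: "S 0 = id_blinfun"
    and S_add: "\<And>s t x. s \<ge> 0 \<Longrightarrow> t \<ge> 0 \<Longrightarrow> S (s + t) x = S s (S t x)"
    and S_contraction: "\<And>t x. t \<ge> 0 \<Longrightarrow> norm (S t x) \<le> norm x"
    and S_continuous: "\<And>x. continuous_on {0..} (\<lambda>t. S t x)"
    and K_add: "\<And>u v x. u > 0 \<Longrightarrow> v \<ge> 0 \<Longrightarrow> K (u + v) x = K u (S v x)"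
    and lam: "lam > 0" and q: "0 \<le> q" "q < 1"
    and K_energy: "\<And>x. (\<integral>\<^sup>+u\<in>{0<..T}. ennreal (exp (- 2 * lam * u) * (norm (K u x))\<^sup>2) \<partial>lborel)
        \<le> ennreal (q\<^sup>2 * (norm x)\<^sup>2)"
    and kap_nonneg: "\<And>u. 0 \<le> kap u"
    and kap_measurable [measurable]: "kap \<in> borel_measurable borel"
    and K_bound: "\<And>u. u > 0 \<Longrightarrow> norm (K u) \<le> kap u"
    and kap_square: "(\<integral>\<^sup>+u\<in>{0<..T}. ennreal ((kap u)\<^sup>2) \<partial>lborel) < \<infinity>"

theorem kernel_exists:
  fixes S :: "real \<Rightarrow> 'h::{real_inner, banach, second_countable_topology} \<Rightarrow>\<^sub>L 'h"
    and C :: "'h \<Rightarrow> 'k::{real_inner, banach, second_countable_topology} \<Rightarrow>\<^sub>L 'h"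
  assumes dA: "dissipative DA A" and gen: "generates DA A S"
    and A1: "assumption_A1 DA A S DC C C1 C2" and T: "T > 0"
  shows "\<exists>lam q kap. kernel S (op_exp DC C S) T lam q kap"
proof -
  have S: "C0_semigroup S" using gen by (simp add: generates_def)
  define K where "K = op_exp DC C S"
  define K1 where "K1 = op_exp DC C1 S"
  have C: "\<And>x. x \<in> DC \<Longrightarrow> C x = C1 x + blinfun_of_hs (C2 x)"
    using A1 by (simp add: assumption_A1_def)
  obtain \<gamma> L where g: "0 \<le> \<gamma>" "\<gamma> < 1/2" "L > 0"
    and ex: "\<And>t. t > 0 \<Longrightarrow> \<exists>K. has_op_exp DC C1 S t K \<and> norm K \<le> L * t powr (- \<gamma>)"
    using A1 unfolding assumption_A1_def by blast
  obtain a \<delta> where a: "a > 1/2" and \<delta>: "\<And>n::nat. \<delta> n > (0::real)" "\<delta> \<longlonglongrightarrow> 0"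
    and dis: "\<And>n. dissipative DA (\<lambda>x. A x + a *\<^sub>R blinfun_adj (K1 (\<delta> n)) (K1 (\<delta> n) x))"
    using A1 unfolding assumption_A1_def K1_def by (auto simp: Let_def)
  have K1: "has_op_exp DC C1 S t (K1 t)" "norm (K1 t) \<le> L * t powr (- \<gamma>)" if "t > 0" for t
    using ex[OF that] op_exp_eq unfolding K1_def by metis+
  have hasK: "has_op_exp DC C S t (K1 t + (C2 o\<^sub>L S t))" if "t > 0" for t
    by (rule has_op_exp_plus_bounded[OF C K1(1)[OF that]])
  then have Keq: "K t = K1 t + (C2 o\<^sub>L S t)" if "t > 0" for t
    using that op_exp_eq unfolding K_def by metis
  have K1_add: "K1 (u + v) x = K1 u (S v x)" if "u > 0" "v \<ge> 0" for u v x
    using has_op_exp_add[OF S _ that(2) K1(1) K1(1)] that by simp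
  have contr: "norm (S t x) \<le> norm x" if "t \<ge> 0" for t x
    by (rule dissipative_contraction[OF gen dA that])
  \<comment> \<open>With this value (1 + \<eta>) / (2 a) = 1 - (2 a - 1) / (4 a), which spends half
    of the gap between 1 / (2 a) and 1.\<close>
  define \<eta> where "\<eta> = (2 * a - 1) / 2"
  have \<eta>: "\<eta> > 0" using a by (simp add: \<eta>_def)
  define b where "b = (1 + 1/\<eta>) * (norm C2)\<^sup>2"
  have b: "b \<ge> 0" using \<eta> by (simp add: b_def)
  \<comment> \<open>Large enough that b / (2 lam) is at most (2 a - 1) / (8 a), a quarter of the
    gap. The summand 1 keeps lam positive when b = 0.\<close>
  define lam where "lam = b * 4 * a / (2 * a - 1) + 1"
  have lam: "lam > 0" using a b by (simp add: lam_def add_nonneg_pos)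
  \<comment> \<open>The remaining quarter of the gap separates q^2 from 1.\<close>
  define q where "q = sqrt (1 - (2 * a - 1) / (8 * a))"
  have q2: "q\<^sup>2 = 1 - (2 * a - 1) / (8 * a)" and q: "0 \<le> q" "q < 1"
    using a by (auto simp: q_def field_simps)
  have "b / (2 * lam) \<le> (2 * a - 1) / (8 * a)"
    using a b lam zero_le_power2[of "2 * a - 1"] by (simp add: lam_def field_simps power2_eq_square)
  then have qb: "(1 + \<eta>) / (2 * a) + b / (2 * lam) \<le> q\<^sup>2"
  proof -
    have "(1 + \<eta>) / (2 * a) = 1 - (2 * a - 1) / (4 * a)" using a by (simp add: \<eta>_def field_simps)
    moreover have "(2 * a - 1) / (4 * a) = 2 * ((2 * a - 1) / (8 * a))" using a by (simp add: field_simps)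
    ultimately show ?thesis using \<open>b / (2 * lam) \<le> (2 * a - 1) / (8 * a)\<close> unfolding q2 by linarith
  qed
  define kap where "kap u = L * u powr (- \<gamma>) + norm C2" for u
  have energy1: "(\<integral>\<^sup>+u\<in>{0<..T}. ennreal ((norm (K1 u x))\<^sup>2) \<partial>lborel) \<le> ennreal ((norm x)\<^sup>2 / (2 * a))"
    and cont1: "continuous_on {0<..} (\<lambda>u. K1 u x)" for x
    using energy_kernel[where K = K1 and \<delta> = \<delta>, OF gen _ K1_add \<delta> dis] a by auto
  have "kernel S K T lam q kap"
  proof
    show "kap \<in> borel_measurable borel" unfolding kap_def[abs_def] by measurable
    show "K (u + v) x = K u (S v x)" if "u > 0" "v \<ge> 0" for u v x
      using that K1_add[OF that] C0_semigroup_add[OF S, of u v x] by (simp add: Keq blinfun.add_left)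
    show "norm (K u) \<le> kap u" if u: "u > 0" for u
    proof -
      have "norm (C2 o\<^sub>L S u) \<le> norm C2"
      proof (rule norm_blinfun_bound)
        fix x
        have "norm (C2 (S u x)) \<le> norm C2 * norm (S u x)" by (rule norm_blinfun)
        also have "\<dots> \<le> norm C2 * norm x" using contr u by (intro mult_left_mono) auto
        finally show "norm ((C2 o\<^sub>L S u) x) \<le> norm C2 * norm x" by simp
      qed simp
      then show ?thesis
        using norm_triangle_ineq[of "K1 u" "C2 o\<^sub>L S u"] K1(2)[OF u] by (simp add: Keq[OF u] kap_def)
    qed
    show "(\<integral>\<^sup>+u\<in>{0<..T}. ennreal ((kap u)\<^sup>2) \<partial>lborel) < \<infinity>"
    proof -
      have "(\<integral>\<^sup>+u\<in>{0<..T}. ennreal ((kap u)\<^sup>2) \<partial>lborel)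
          \<le> (\<integral>\<^sup>+u. ennreal (2 * L\<^sup>2) * (ennreal ((u powr (- \<gamma>))\<^sup>2) * indicator {0<..T} u)
            + ennreal (2 * (norm C2)\<^sup>2) * indicator {0<..T} u \<partial>lborel)"
      proof (intro nn_integral_mono)
        fix u
        have "(kap u)\<^sup>2 \<le> 2 * L\<^sup>2 * (u powr (- \<gamma>))\<^sup>2 + 2 * (norm C2)\<^sup>2"
          using norm_add_square_le[of 1 "L * u powr (- \<gamma>)" "norm C2"]
          by (simp add: kap_def power_mult_distrib)
        then have "ennreal ((kap u)\<^sup>2) \<le> ennreal (2 * L\<^sup>2) * ennreal ((u powr (- \<gamma>))\<^sup>2) + ennreal (2 * (norm C2)\<^sup>2)"
          by (simp add: ennreal_mult[symmetric] ennreal_plus[symmetric] ennreal_leI del: ennreal_plus)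
        then show "ennreal ((kap u)\<^sup>2) * indicator {0<..T} u
            \<le> ennreal (2 * L\<^sup>2) * (ennreal ((u powr (- \<gamma>))\<^sup>2) * indicator {0<..T} u)
            + ennreal (2 * (norm C2)\<^sup>2) * indicator {0<..T} u"
          by (auto simp: indicator_def)
      qed
      also have "\<dots> = ennreal (2 * L\<^sup>2) * (\<integral>\<^sup>+u\<in>{0<..T}. ennreal ((u powr (- \<gamma>))\<^sup>2) \<partial>lborel)
          + ennreal (2 * (norm C2)\<^sup>2) * emeasure lborel {0<..T}"
        by (subst nn_integral_add) (auto simp: nn_integral_cmult nn_integral_cmult_indicator)
      also have "\<dots> < \<infinity>"
        using nn_integral_powr_finite[OF g(2), of T] T by (auto simp: ennreal_mult_less_top)
      finally show ?thesis .
    qed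
    fix x
    define G where "G u = indicator {0<..} u *\<^sub>R K1 u x" for u
    have [measurable]: "G \<in> borel_measurable borel" unfolding G_def
      by (rule borel_measurable_continuous_on_indicator[OF _ cont1]) simp
    have "(\<integral>\<^sup>+u\<in>{0<..T}. ennreal (exp (- 2 * lam * u) * (norm (K u x))\<^sup>2) \<partial>lborel)
        \<le> (\<integral>\<^sup>+u. ennreal (1 + \<eta>) * (ennreal ((norm (G u))\<^sup>2) * indicator {0<..T} u)
          + ennreal (b * (norm x)\<^sup>2) * (ennreal (exp (- 2 * lam * u)) * indicator {0<..T} u) \<partial>lborel)"
    proof (intro nn_integral_mono)
      fix u :: real
      show "ennreal (exp (- 2 * lam * u) * (norm (K u x))\<^sup>2) * indicator {0<..T} u
        \<le> ennreal (1 + \<eta>) * (ennreal ((norm (G u))\<^sup>2) * indicator {0<..T} u)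
          + ennreal (b * (norm x)\<^sup>2) * (ennreal (exp (- 2 * lam * u)) * indicator {0<..T} u)"
      proof (cases "u \<in> {0<..T}")
        case True
        then have u: "u > 0" by simp
        have "norm (C2 (S u x)) \<le> norm C2 * norm x"
          using norm_blinfun[of C2 "S u x"] contr[of u x] u
          by (meson less_imp_le mult_left_mono norm_ge_zero order_trans)
        then have "(norm (C2 (S u x)))\<^sup>2 \<le> (norm C2)\<^sup>2 * (norm x)\<^sup>2"
          by (metis norm_ge_zero power_mono power_mult_distrib)
        then have "(1 + 1/\<eta>) * (norm (C2 (S u x)))\<^sup>2 \<le> (1 + 1/\<eta>) * ((norm C2)\<^sup>2 * (norm x)\<^sup>2)"
          using \<eta> by (intro mult_left_mono) auto
        then have 1: "(norm (K u x))\<^sup>2 \<le> (1 + \<eta>) * (norm (K1 u x))\<^sup>2 + b * (norm x)\<^sup>2"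
          using norm_add_square_le[OF \<eta>, of "K1 u x" "C2 (S u x)"]
          by (simp add: Keq[OF u] blinfun.add_left b_def)
        \<comment> \<open>The weight is simply dropped on the part of C1, whose energy is already
          below 1 / (2 a). It is kept on the bounded part, where its integral, at most 1 / (2 lam),
          provides the smallness.\<close>
        have e: "exp (- 2 * lam * u) \<le> 1" using lam u by simp
        have "exp (- 2 * lam * u) * (norm (K u x))\<^sup>2
            \<le> exp (- 2 * lam * u) * ((1 + \<eta>) * (norm (K1 u x))\<^sup>2) + exp (- 2 * lam * u) * (b * (norm x)\<^sup>2)"
          using mult_left_mono[OF 1, of "exp (- 2 * lam * u)"] by (simp add: distrib_left)
        also have "\<dots> \<le> (1 + \<eta>) * (norm (K1 u x))\<^sup>2 + b * (norm x)\<^sup>2 * exp (- 2 * lam * u)"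
          using mult_right_mono[OF e, of "(1 + \<eta>) * (norm (K1 u x))\<^sup>2"] \<eta> by (simp add: mult_ac)
        finally have "ennreal (exp (- 2 * lam * u) * (norm (K u x))\<^sup>2)
            \<le> ennreal ((1 + \<eta>) * (norm (K1 u x))\<^sup>2 + b * (norm x)\<^sup>2 * exp (- 2 * lam * u))"
          by (rule ennreal_leI)
        also have "\<dots> = ennreal (1 + \<eta>) * ennreal ((norm (K1 u x))\<^sup>2) + ennreal (b * (norm x)\<^sup>2) * ennreal (exp (- 2 * lam * u))"
          using \<eta> b by (simp add: ennreal_mult[symmetric] ennreal_plus[symmetric] del: ennreal_plus)
        finally show ?thesis using True by (simp add: G_def)
      qed simp
    qed
    also have "\<dots> = ennreal (1 + \<eta>) * (\<integral>\<^sup>+u\<in>{0<..T}. ennreal ((norm (G u))\<^sup>2) \<partial>lborel)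
        + ennreal (b * (norm x)\<^sup>2) * (\<integral>\<^sup>+u\<in>{0<..T}. ennreal (exp (- 2 * lam * u)) \<partial>lborel)"
      by (subst nn_integral_add) (auto simp: nn_integral_cmult)
    also have "(\<integral>\<^sup>+u\<in>{0<..T}. ennreal ((norm (G u))\<^sup>2) \<partial>lborel)
        = (\<integral>\<^sup>+u\<in>{0<..T}. ennreal ((norm (K1 u x))\<^sup>2) \<partial>lborel)"
      by (intro nn_integral_cong) (auto simp: indicator_def G_def)
    also have "ennreal (1 + \<eta>) * \<dots> + ennreal (b * (norm x)\<^sup>2) * (\<integral>\<^sup>+u\<in>{0<..T}. ennreal (exp (- 2 * lam * u)) \<partial>lborel)
        \<le> ennreal (1 + \<eta>) * ennreal ((norm x)\<^sup>2 / (2 * a)) + ennreal (b * (norm x)\<^sup>2) * ennreal (1 / (2 * lam))"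
      by (intro add_mono mult_left_mono energy1 nn_integral_exp_le lam) auto
    also have "\<dots> = ennreal (((1 + \<eta>) / (2 * a) + b / (2 * lam)) * (norm x)\<^sup>2)"
      using \<eta> b a lam
      by (simp add: ennreal_mult[symmetric] ennreal_plus[symmetric] del: ennreal_plus)
        (simp add: field_simps)
    also have "\<dots> \<le> ennreal (q\<^sup>2 * (norm x)\<^sup>2)"
      using qb by (intro ennreal_leI mult_right_mono) auto
    finally show "(\<integral>\<^sup>+u\<in>{0<..T}. ennreal (exp (- 2 * lam * u) * (norm (K u x))\<^sup>2) \<partial>lborel)
        \<le> ennreal (q\<^sup>2 * (norm x)\<^sup>2)" .
  qed (use T S C0_semigroup_add[OF S] contr C0_semigroup_continuous_on[OF S] lam q g
      in \<open>auto simp: kap_def C0_semigroup_def\<close>)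
  then show ?thesis unfolding K_def by blast
qed

section \<open>Square integrable functions\<close>

definition L2 :: "'a measure \<Rightarrow> ('a \<Rightarrow> 'b::{real_inner, banach, second_countable_topology}) \<Rightarrow> bool" where
  "L2 N f \<longleftrightarrow> f \<in> borel_measurable N \<and> integrable N (\<lambda>x. (norm (f x))\<^sup>2)"

text \<open>Functions are used instead of classes, so equality almost everywhere takes the form
  \<open>n2 N (\<lambda>x. f x - g x) = 0\<close>. Outside \<open>L2\<close> the Bochner integral
  has the default value 0; this is why the estimates carry \<open>L2\<close> as an
  assumption.\<close>

definition n2 :: "'a measure \<Rightarrow> ('a \<Rightarrow> 'b::{real_inner, banach, second_countable_topology}) \<Rightarrow> real" where
  "n2 N f = sqrt (\<integral>x. (norm (f x))\<^sup>2 \<partial>N)"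

definition ip :: "'a measure \<Rightarrow> ('a \<Rightarrow> 'b::{real_inner, banach, second_countable_topology}) \<Rightarrow> ('a \<Rightarrow> 'b) \<Rightarrow> real" where
  "ip N f g = (\<integral>x. f x \<bullet> g x \<partial>N)"

lemma L2_measurable [measurable_dest]: "L2 N f \<Longrightarrow> f \<in> borel_measurable N"
  by (simp add: L2_def)

lemma n2_nonneg [simp]: "0 \<le> n2 N f"
  by (simp add: n2_def)

lemma n2_power2: "(n2 N f)\<^sup>2 = (\<integral>x. (norm (f x))\<^sup>2 \<partial>N)"
  by (simp add: n2_def)

lemma L2_iff_nn:
  "L2 N f \<longleftrightarrow> f \<in> borel_measurable N \<and> (\<integral>\<^sup>+x. ennreal ((norm (f x))\<^sup>2) \<partial>N) < \<infinity>"
  unfolding L2_def by (auto simp: integrable_iff_bounded)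

lemma n2_nn: "L2 N f \<Longrightarrow> (\<integral>\<^sup>+x. ennreal ((norm (f x))\<^sup>2) \<partial>N) = ennreal ((n2 N f)\<^sup>2)"
  unfolding n2_power2 L2_def by (intro nn_integral_eq_integral) auto

lemma L2_nn_le:
  assumes "f \<in> borel_measurable N" "(\<integral>\<^sup>+x. ennreal ((norm (f x))\<^sup>2) \<partial>N) \<le> ennreal (c\<^sup>2)" "c \<ge> 0"
  shows "L2 N f" "n2 N f \<le> c"
proof -
  have "(\<integral>\<^sup>+x. ennreal ((norm (f x))\<^sup>2) \<partial>N) < \<infinity>"
    using assms(2) by (rule le_less_trans) simp
  then show L: "L2 N f" unfolding L2_iff_nn using assms(1) by blast
  have "ennreal ((n2 N f)\<^sup>2) \<le> ennreal (c\<^sup>2)" using assms(2) n2_nn[OF L] by metis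
  then have "(n2 N f)\<^sup>2 \<le> c\<^sup>2" by simp
  then show "n2 N f \<le> c" using assms(3) by (rule power2_le_imp_le)
qed

lemma L2_bound:
  assumes f: "f \<in> borel_measurable N" and g: "L2 N g" and le: "AE x in N. norm (f x) \<le> c * norm (g x)" and c: "c \<ge> 0"
  shows "L2 N f" "n2 N f \<le> c * n2 N g"
proof -
  have "(\<integral>\<^sup>+x. ennreal ((norm (f x))\<^sup>2) \<partial>N) \<le> (\<integral>\<^sup>+x. ennreal (c\<^sup>2) * ennreal ((norm (g x))\<^sup>2) \<partial>N)"
  proof (rule nn_integral_mono_AE, use le in eventually_elim)
    fix x assume "norm (f x) \<le> c * norm (g x)"
    then have "(norm (f x))\<^sup>2 \<le> (c * norm (g x))\<^sup>2" by (intro power_mono) auto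
    then show "ennreal ((norm (f x))\<^sup>2) \<le> ennreal (c\<^sup>2) * ennreal ((norm (g x))\<^sup>2)"
      by (simp add: ennreal_mult[symmetric] power_mult_distrib ennreal_leI)
  qed
  also have "\<dots> = ennreal (c\<^sup>2) * ennreal ((n2 N g)\<^sup>2)"
    using g by (subst nn_integral_cmult) (auto simp: n2_nn)
  also have "\<dots> = ennreal ((c * n2 N g)\<^sup>2)" by (simp add: ennreal_mult[symmetric] power_mult_distrib)
  finally have *: "(\<integral>\<^sup>+x. ennreal ((norm (f x))\<^sup>2) \<partial>N) \<le> ennreal ((c * n2 N g)\<^sup>2)" .
  show "L2 N f" "n2 N f \<le> c * n2 N g" using L2_nn_le[OF f *] c by auto
qed

lemma L2_inner_integrable:
  assumes f: "L2 N f" and g: "L2 N g"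
  shows "integrable N (\<lambda>x. f x \<bullet> g x)"
proof (rule Bochner_Integration.integrable_bound)
  show "integrable N (\<lambda>x. (norm (f x))\<^sup>2 + (norm (g x))\<^sup>2)"
    using f g by (auto simp: L2_def)
  show "(\<lambda>x. f x \<bullet> g x) \<in> borel_measurable N" using f g by (auto simp: L2_def)
  have "\<bar>y \<bullet> z\<bar> \<le> (norm y)\<^sup>2 + (norm z)\<^sup>2" for y z :: 'b
  proof -
    have "\<bar>y \<bullet> z\<bar> \<le> norm y * norm z" by (rule Cauchy_Schwarz_ineq2)
    moreover have "2 * (norm y * norm z) \<le> (norm y)\<^sup>2 + (norm z)\<^sup>2"
      using sum_squares_bound[of "norm y" "norm z"] by simp
    moreover have "0 \<le> norm y * norm z" by simp
    ultimately show ?thesis by linarith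
  qed
  then show "AE x in N. norm (f x \<bullet> g x) \<le> norm ((norm (f x))\<^sup>2 + (norm (g x))\<^sup>2)" by simp
qed

lemma L2_zero [simp]: "L2 N (\<lambda>x. 0)" by (simp add: L2_def)

lemma L2_scaleR [intro]: "L2 N f \<Longrightarrow> L2 N (\<lambda>x. c *\<^sub>R f x)"
  by (rule L2_bound(1)[of _ _ f "\<bar>c\<bar>"]) (auto simp: L2_def)

lemma L2_add [intro]:
  assumes "L2 N f" "L2 N g"
  shows "L2 N (\<lambda>x. f x + g x)"
proof -
  have "integrable N (\<lambda>x. (norm (f x))\<^sup>2 + 2 * (f x \<bullet> g x) + (norm (g x))\<^sup>2)"
    using assms L2_inner_integrable[OF assms] by (auto simp: L2_def)
  moreover have "(norm (f x + g x))\<^sup>2 = (norm (f x))\<^sup>2 + 2 * (f x \<bullet> g x) + (norm (g x))\<^sup>2" for x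
    by (simp add: power2_norm_eq_inner inner_add_left inner_add_right inner_commute)
  ultimately show ?thesis
    using borel_measurable_add[OF L2_measurable[OF assms(1)] L2_measurable[OF assms(2)]]
    by (simp add: L2_def)
qed

lemma L2_diff [intro]: "L2 N f \<Longrightarrow> L2 N g \<Longrightarrow> L2 N (\<lambda>x. f x - g x)"
  using L2_add[of N f "\<lambda>x. (-1) *\<^sub>R g x"] L2_scaleR[of N g "-1"] by simp

lemma L2_sum [intro]: "(\<And>i. i \<in> I \<Longrightarrow> L2 N (f i)) \<Longrightarrow> L2 N (\<lambda>x. \<Sum>i\<in>I. f i x)"
  by (induction I rule: infinite_finite_induct) auto

lemma L2_linear:
  assumes "L2 N f" "bounded_linear g"
  shows "L2 N (\<lambda>x. g (f x))"
proof -
  obtain c where "c \<ge> 0" "\<And>x. norm (g x) \<le> norm x * c"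
    using bounded_linear.nonneg_bounded[OF assms(2)] by blast
  moreover have "g \<in> borel_measurable borel"
    by (intro borel_measurable_continuous_onI linear_continuous_on assms(2))
  then have "(\<lambda>x. g (f x)) \<in> borel_measurable N"
    by (rule measurable_compose[OF L2_measurable[OF assms(1)]])
  ultimately show ?thesis
    by (intro L2_bound(1)[OF _ assms(1), of _ c] AE_I2) (simp_all add: mult.commute)
qed

lemma L2_cong_AE:
  assumes "L2 N f" "AE x in N. f x = g x" "g \<in> borel_measurable N"
  shows "L2 N g" "n2 N g = n2 N f"
proof -
  have "AE x in N. (norm (f x))\<^sup>2 = (norm (g x))\<^sup>2" using assms(2) by eventually_elim simp
  then show "L2 N g" "n2 N g = n2 N f"
    using assms integrable_cong_AE[of "\<lambda>x. (norm (f x))\<^sup>2" N "\<lambda>x. (norm (g x))\<^sup>2"]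
      integral_cong_AE[of "\<lambda>x. (norm (f x))\<^sup>2" N "\<lambda>x. (norm (g x))\<^sup>2"]
    by (auto simp: L2_def n2_def)
qed

lemma ip_commute: "ip N f g = ip N g f"
  by (simp add: ip_def inner_commute)

lemma ip_add_left: "L2 N f \<Longrightarrow> L2 N g \<Longrightarrow> L2 N h \<Longrightarrow> ip N (\<lambda>x. f x + g x) h = ip N f h + ip N g h"
  unfolding ip_def inner_add_left by (intro Bochner_Integration.integral_add L2_inner_integrable)

lemma ip_add_right: "L2 N f \<Longrightarrow> L2 N g \<Longrightarrow> L2 N h \<Longrightarrow> ip N h (\<lambda>x. f x + g x) = ip N h f + ip N h g"
  using ip_add_left[of N f g h] by (simp add: ip_commute)

lemma ip_diff_left: "L2 N f \<Longrightarrow> L2 N g \<Longrightarrow> L2 N h \<Longrightarrow> ip N (\<lambda>x. f x - g x) h = ip N f h - ip N g h"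
  unfolding ip_def inner_diff_left by (intro Bochner_Integration.integral_diff L2_inner_integrable)

lemma ip_diff_right: "L2 N f \<Longrightarrow> L2 N g \<Longrightarrow> L2 N h \<Longrightarrow> ip N h (\<lambda>x. f x - g x) = ip N h f - ip N h g"
  using ip_diff_left[of N f g h] by (simp add: ip_commute)

lemma ip_scaleR_left: "ip N (\<lambda>x. c *\<^sub>R f x) g = c * ip N f g"
  by (simp add: ip_def)

lemma ip_scaleR_right: "ip N f (\<lambda>x. c *\<^sub>R g x) = c * ip N f g"
  by (simp add: ip_def)

lemma ip_zero [simp]: "ip N (\<lambda>x. 0) g = 0" "ip N g (\<lambda>x. 0) = 0"
  by (simp_all add: ip_def)

lemma ip_sum_left:
  assumes "\<And>i. i \<in> I \<Longrightarrow> L2 N (f i)" "L2 N g"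
  shows "ip N (\<lambda>x. \<Sum>i\<in>I. f i x) g = (\<Sum>i\<in>I. ip N (f i) g)"
  unfolding ip_def inner_sum_left
  by (intro Bochner_Integration.integral_sum L2_inner_integrable assms)

lemma ip_sum_right:
  assumes "\<And>i. i \<in> I \<Longrightarrow> L2 N (f i)" "L2 N g"
  shows "ip N g (\<lambda>x. \<Sum>i\<in>I. f i x) = (\<Sum>i\<in>I. ip N g (f i))"
  using ip_sum_left[OF assms] by (simp add: ip_commute)

lemma ip_self: "ip N f f = (n2 N f)\<^sup>2"
  by (simp add: ip_def n2_power2 power2_norm_eq_inner)

lemma ip_cong_AE:
  assumes "AE x in N. f x = f' x" "AE x in N. g x = g' x"
    "L2 N f" "L2 N f'" "L2 N g" "L2 N g'"
  shows "ip N f g = ip N f' g'"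
  unfolding ip_def
  by (rule integral_cong_AE) (use assms in \<open>auto simp: L2_def elim: eventually_elim2\<close>)

lemma n2_scaleR: "n2 N (\<lambda>x. c *\<^sub>R f x) = \<bar>c\<bar> * n2 N f"
  by (simp add: n2_def power_mult_distrib real_sqrt_mult)

lemma n2_zero [simp]: "n2 N (\<lambda>x. 0) = 0"
  by (simp add: n2_def)

lemma n2_minus_commute: "n2 N (\<lambda>x. f x - g x) = n2 N (\<lambda>x. g x - f x)"
  by (simp add: n2_def norm_minus_commute)

text \<open>The quadratic form (s, t) given by the squared norm of s f - t g is nonnegative; s =
  |g|^2 and t = p give the inequality up to a factor |g|^2, which may be cancelled unless it
  vanishes.\<close>

lemma ip_le:
  assumes f: "L2 N f" and g: "L2 N g"
  shows "\<bar>ip N f g\<bar> \<le> n2 N f * n2 N g"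
proof -
  define p where "p = ip N f g"
  have *: "0 \<le> s\<^sup>2 * (n2 N f)\<^sup>2 - 2 * s * t * p + t\<^sup>2 * (n2 N g)\<^sup>2" for s t
  proof -
    let ?h = "\<lambda>x. s *\<^sub>R f x - t *\<^sub>R g x"
    have "0 \<le> ip N ?h ?h" by (simp add: ip_self)
    also have "\<dots> = s\<^sup>2 * (n2 N f)\<^sup>2 - 2 * s * t * p + t\<^sup>2 * (n2 N g)\<^sup>2"
      using f g by (simp add: ip_diff_left ip_diff_right L2_scaleR L2_diff ip_scaleR_left ip_scaleR_right
          ip_self[of N f] ip_self[of N g] ip_commute[of N g f] p_def[symmetric] power2_eq_square algebra_simps)
    finally show ?thesis .
  qed
  have "p\<^sup>2 \<le> (n2 N f)\<^sup>2 * (n2 N g)\<^sup>2"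
  proof (cases "(n2 N g)\<^sup>2 = 0")
    case True
    have "p = 0"
    proof (rule ccontr)
      assume p: "p \<noteq> 0"
      \<comment> \<open>For |g| = 0 the form is affine in t, and this t would make its value -
        1.\<close>
      have "0 \<le> (n2 N f)\<^sup>2 - 2 * (((n2 N f)\<^sup>2 + 1) / (2 * p)) * p"
        using *[of 1 "((n2 N f)\<^sup>2 + 1) / (2 * p)"] True by simp
      then show False using p by simp
    qed
    then show ?thesis by simp
  next
    case False
    then have pos: "(n2 N g)\<^sup>2 > 0" by simp
    have "0 \<le> (n2 N g)\<^sup>2 * ((n2 N g)\<^sup>2 * (n2 N f)\<^sup>2 - p\<^sup>2)"
      using *[of "(n2 N g)\<^sup>2" p] by (simp add: power2_eq_square algebra_simps)
    then show ?thesis using pos by (simp add: zero_le_mult_iff mult.commute)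
  qed
  then have "\<bar>p\<bar>\<^sup>2 \<le> (n2 N f * n2 N g)\<^sup>2" by (simp add: power_mult_distrib)
  then show ?thesis unfolding p_def by (rule power2_le_imp_le) simp
qed

lemma n2_add_power2:
  assumes "L2 N f" "L2 N g"
  shows "(n2 N (\<lambda>x. f x + g x))\<^sup>2 = (n2 N f)\<^sup>2 + 2 * ip N f g + (n2 N g)\<^sup>2"
  unfolding ip_self[symmetric]
  using assms by (simp add: ip_add_left ip_add_right L2_add ip_commute[of N g f])

lemma n2_triangle:
  assumes "L2 N f" "L2 N g"
  shows "n2 N (\<lambda>x. f x + g x) \<le> n2 N f + n2 N g"
proof (rule power2_le_imp_le)
  show "(n2 N (\<lambda>x. f x + g x))\<^sup>2 \<le> (n2 N f + n2 N g)\<^sup>2"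
    using n2_add_power2[OF assms] ip_le[OF assms] by (simp add: power2_sum)
qed simp

lemma n2_triangle_diff:
  assumes "L2 N f" "L2 N g"
  shows "n2 N (\<lambda>x. f x - g x) \<le> n2 N f + n2 N g"
  using n2_triangle[OF assms(1) L2_scaleR[OF assms(2)], of "-1"] n2_scaleR[of N "-1" g] by simp

lemma n2_triangle3:
  assumes "L2 N f" "L2 N g" "L2 N h"
  shows "n2 N (\<lambda>x. f x - h x) \<le> n2 N (\<lambda>x. f x - g x) + n2 N (\<lambda>x. g x - h x)"
  using n2_triangle[of N "\<lambda>x. f x - g x" "\<lambda>x. g x - h x"] assms by (simp add: L2_diff)

lemma n2_diff_le:
  assumes "L2 N f" "L2 N g"
  shows "\<bar>n2 N f - n2 N g\<bar> \<le> n2 N (\<lambda>x. f x - g x)"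
  using n2_triangle3[OF assms L2_zero] n2_triangle3[OF assms(2,1) L2_zero] n2_minus_commute[of N f g]
  by simp

lemma n2_sum_orthogonal:
  assumes "finite I" "\<And>i. i \<in> I \<Longrightarrow> L2 N (f i)"
    and "\<And>i j. i \<in> I \<Longrightarrow> j \<in> I \<Longrightarrow> i \<noteq> j \<Longrightarrow> ip N (f i) (f j) = 0"
  shows "(n2 N (\<lambda>x. \<Sum>i\<in>I. f i x))\<^sup>2 = (\<Sum>i\<in>I. (n2 N (f i))\<^sup>2)"
  using assms
proof (induction I rule: finite_induct)
  case (insert i I)
  have "ip N (f i) (\<lambda>x. \<Sum>i\<in>I. f i x) = 0"
    using insert by (subst ip_sum_right) (auto intro!: sum.neutral)
  then show ?case using insert n2_add_power2[of N "f i" "\<lambda>x. \<Sum>i\<in>I. f i x"] by (simp add: L2_sum)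
qed simp

lemma n2_eq_0_AE: "L2 N f \<Longrightarrow> n2 N f = 0 \<longleftrightarrow> (AE x in N. f x = 0)"
  unfolding n2_def L2_def by (simp add: integral_nonneg_eq_0_iff_AE)

lemma n2_diff_0_AE: "L2 N f \<Longrightarrow> L2 N g \<Longrightarrow> n2 N (\<lambda>x. f x - g x) = 0 \<longleftrightarrow> (AE x in N. f x = g x)"
  using n2_eq_0_AE[OF L2_diff, of N f g] by simp

section \<open>Convergence in mean square and completeness\<close>

definition tends2 :: "'a measure \<Rightarrow> (nat \<Rightarrow> 'a \<Rightarrow> 'b::{real_inner, banach, second_countable_topology}) \<Rightarrow> ('a \<Rightarrow> 'b) \<Rightarrow> bool" where
  "tends2 N f g \<longleftrightarrow> (\<forall>n. L2 N (f n)) \<and> L2 N g \<and> (\<lambda>n. n2 N (\<lambda>x. f n x - g x)) \<longlonglongrightarrow> 0"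

lemma tends2_L2: "tends2 N f g \<Longrightarrow> L2 N (f n)" "tends2 N f g \<Longrightarrow> L2 N g"
  by (auto simp: tends2_def)

lemma tends2_const: "L2 N f \<Longrightarrow> tends2 N (\<lambda>n. f) f"
  by (simp add: tends2_def)

lemma tends2I:
  assumes "\<And>n. L2 N (f n)" "L2 N g" "\<And>n. n2 N (\<lambda>x. f n x - g x) \<le> e n" "e \<longlonglongrightarrow> 0"
  shows "tends2 N f g"
  unfolding tends2_def using assms
  by (auto intro!: real_tendsto_sandwich[OF _ _ tendsto_const assms(4)])

lemma tends2_n2: "tends2 N f g \<Longrightarrow> (\<lambda>n. n2 N (f n)) \<longlonglongrightarrow> n2 N g"
  unfolding tends2_def
  by (rule LIM_zero_cancel, rule Lim_null_comparison[where g = "\<lambda>n. n2 N (\<lambda>x. f n x - g x)"])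
    (auto simp: n2_diff_le)

lemma tends2_ip:
  assumes "tends2 N f g" "L2 N h"
  shows "(\<lambda>n. ip N (f n) h) \<longlonglongrightarrow> ip N g h"
proof (rule LIM_zero_cancel, rule Lim_null_comparison[where g = "\<lambda>n. n2 N (\<lambda>x. f n x - g x) * n2 N h"])
  show "\<forall>\<^sub>F n in sequentially. norm (ip N (f n) h - ip N g h) \<le> n2 N (\<lambda>x. f n x - g x) * n2 N h"
    using ip_le[OF L2_diff assms(2), of "f _" g] assms
    by (auto simp: tends2_def ip_diff_left[symmetric])
  show "(\<lambda>n. n2 N (\<lambda>x. f n x - g x) * n2 N h) \<longlonglongrightarrow> 0"
    using assms(1) tendsto_mult_left_zero unfolding tends2_def by blast
qed

lemma tends2_add:
  assumes "tends2 N f g" "tends2 N f' g'"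
  shows "tends2 N (\<lambda>n x. f n x + f' n x) (\<lambda>x. g x + g' x)"
proof (rule tends2I)
  show "(\<lambda>n. n2 N (\<lambda>x. f n x - g x) + n2 N (\<lambda>x. f' n x - g' x)) \<longlonglongrightarrow> 0"
    using assms tendsto_add_zero by (fastforce simp: tends2_def)
  show "n2 N (\<lambda>x. f n x + f' n x - (g x + g' x)) \<le> n2 N (\<lambda>x. f n x - g x) + n2 N (\<lambda>x. f' n x - g' x)" for n
    using n2_triangle[of N "\<lambda>x. f n x - g x" "\<lambda>x. f' n x - g' x"] assms
    by (simp add: tends2_def L2_diff algebra_simps)
qed (use assms in \<open>auto simp: tends2_def\<close>)

lemma tends2_linear:
  assumes "tends2 N f g" "bounded_linear h"
  shows "tends2 N (\<lambda>n x. h (f n x)) (\<lambda>x. h (g x))"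
proof -
  obtain c where c: "c \<ge> 0" "\<And>x. norm (h x) \<le> norm x * c"
    using bounded_linear.nonneg_bounded[OF assms(2)] by blast
  have L: "L2 N (f n)" "L2 N g" for n using assms by (auto simp: tends2_def)
  show ?thesis
  proof (rule tends2I)
    show "(\<lambda>n. c * n2 N (\<lambda>x. f n x - g x)) \<longlonglongrightarrow> 0"
      using assms(1) tendsto_mult_right_zero unfolding tends2_def by blast
    have h: "h (f n x) - h (g x) = h (f n x - g x)" for n x
      using assms(2) by (simp add: linear_diff bounded_linear.linear)
    show "n2 N (\<lambda>x. h (f n x) - h (g x)) \<le> c * n2 N (\<lambda>x. f n x - g x)" for n
      unfolding h
      by (rule L2_bound(2)) (use c in \<open>auto simp: mult.commute
        intro!: L2_measurable[OF L2_linear[OF L2_diff assms(2)]] L2_diff L\<close>)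
  qed (auto intro!: L2_linear[OF _ assms(2)] L)
qed

lemma tends2_unique:
  assumes "tends2 N f g" "tends2 N f g'"
  shows "AE x in N. g x = g' x"
proof -
  have "n2 N (\<lambda>x. g x - g' x) \<le> n2 N (\<lambda>x. f n x - g x) + n2 N (\<lambda>x. f n x - g' x)" for n
    using n2_triangle3[of N g "f n" g'] assms by (simp add: tends2_def n2_minus_commute[of N g])
  moreover have "(\<lambda>n. n2 N (\<lambda>x. f n x - g x) + n2 N (\<lambda>x. f n x - g' x)) \<longlonglongrightarrow> 0"
    using assms tendsto_add_zero by (fastforce simp: tends2_def)
  ultimately have "n2 N (\<lambda>x. g x - g' x) \<le> 0"
    by (intro LIMSEQ_le_const) auto
  then show ?thesis using n2_diff_0_AE[of N g g'] assms by (simp add: tends2_def order_antisym)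
qed

lemma tends2_cong_AE:
  assumes "tends2 N f g" "\<And>n. AE x in N. f n x = f' n x" "AE x in N. g x = g' x"
    "\<And>n. L2 N (f' n)" "L2 N g'"
  shows "tends2 N f' g'"
proof -
  have "n2 N (\<lambda>x. f' n x - g' x) = n2 N (\<lambda>x. f n x - g x)" for n
  proof (rule L2_cong_AE(2))
    show "L2 N (\<lambda>x. f n x - g x)" using assms(1) by (auto simp: tends2_def)
    show "AE x in N. f n x - g x = f' n x - g' x" using assms(2)[of n] assms(3) by eventually_elim simp
    show "(\<lambda>x. f' n x - g' x) \<in> borel_measurable N" using assms(4,5) by (auto dest: L2_measurable)
  qed
  then show ?thesis using assms by (simp add: tends2_def)
qed

lemma ennreal_not_infinite_imp_real: "v \<noteq> \<infinity> \<Longrightarrow> \<exists>c\<ge>0. v = ennreal c"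
  by (cases v) auto

lemma ennreal_le_suminf: "a n \<le> (\<Sum>n. a n :: ennreal)"
  using sum_le_suminf[OF summableI, of "{n}" a] by simp

lemma ennreal_power2_summable:
  fixes c :: "nat \<Rightarrow> real"
  assumes "\<And>n. 0 \<le> c n" "\<And>n. c n \<le> (1/2)^n"
  shows "(\<Sum>n. ennreal (c n)) < \<infinity>"
proof -
  have "summable c"
    by (rule summable_comparison_test'[of "\<lambda>n. (1/2)^n" 0]) (use assms in \<open>auto intro: summable_geometric\<close>)
  then show ?thesis using assms by (simp add: suminf_ennreal2)
qed

text \<open>The weight \<open>4 ^ n\<close> makes the increments of a fast Cauchy sequence pointwise summable.\<close>

lemma AE_fast_bound:
  fixes f :: "nat \<Rightarrow> 'a \<Rightarrow> 'b::{real_inner, banach, second_countable_topology}"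
  assumes L: "\<And>n. L2 N (f n)" and b: "\<And>n. n2 N (f n) \<le> (1/8)^n"
  shows "AE x in N. \<exists>c. \<forall>n. norm (f n x) \<le> c * (1/2)^n"
proof -
  have [measurable]: "f n \<in> borel_measurable N" for n using L by (simp add: L2_def)
  have "(\<integral>\<^sup>+x. (\<Sum>n. ennreal (4^n * (norm (f n x))\<^sup>2)) \<partial>N) = (\<Sum>n. \<integral>\<^sup>+x. ennreal (4^n * (norm (f n x))\<^sup>2) \<partial>N)"
    by (intro nn_integral_suminf) auto
  also have "\<dots> = (\<Sum>n. ennreal (4^n * (n2 N (f n))\<^sup>2))"
    by (intro suminf_cong) (simp add: ennreal_mult nn_integral_cmult n2_nn[OF L])
  also have "\<dots> < \<infinity>"
  proof (rule ennreal_power2_summable)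
    fix n
    have "4^n * (n2 N (f n))\<^sup>2 \<le> 4^n * ((1/8)^n)\<^sup>2"
      using b[of n] by (intro mult_left_mono power_mono) auto
    also have "\<dots> = (1/16)^n"
      by (simp add: power_mult_distrib[symmetric] power2_eq_square)
    also have "\<dots> \<le> (1/2 :: real)^n" by (intro power_mono) auto
    finally show "4^n * (n2 N (f n))\<^sup>2 \<le> (1/2)^n" .
  qed simp
  finally have "AE x in N. (\<Sum>n. ennreal (4^n * (norm (f n x))\<^sup>2)) \<noteq> \<infinity>"
    by (intro nn_integral_PInf_AE) auto
  then show ?thesis
  proof eventually_elim
    fix x assume "(\<Sum>n. ennreal (4^n * (norm (f n x))\<^sup>2)) \<noteq> \<infinity>"
    then obtain c where c: "c \<ge> 0" "(\<Sum>n. ennreal (4^n * (norm (f n x))\<^sup>2)) = ennreal c"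
      using ennreal_not_infinite_imp_real by blast
    have "norm (f n x) \<le> sqrt c * (1/2)^n" for n
    proof -
      have "ennreal (4^n * (norm (f n x))\<^sup>2) \<le> ennreal c"
        using ennreal_le_suminf[of "\<lambda>n. ennreal (4^n * (norm (f n x))\<^sup>2)" n] by (simp only: c(2))
      then have "4^n * (norm (f n x))\<^sup>2 \<le> c" using c(1) by simp
      then have "sqrt (4^n * (norm (f n x))\<^sup>2) \<le> sqrt c" by simp
      moreover have "sqrt (4^n) = (2::real)^n"
        by (intro real_sqrt_unique) (simp_all add: power2_eq_square power_mult_distrib[symmetric])
      ultimately show ?thesis by (simp add: real_sqrt_mult field_simps power_divide)
    qed
    then show "\<exists>c. \<forall>n. norm (f n x) \<le> c * (1/2)^n" by blast
  qed
qed

text \<open>A subsequence whose increments are below (1/8)^i converges almost everywhere by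
  \<open>AE_fast_bound\<close>, and Fatou's lemma shows that its limit is also the limit in mean
  square of the whole sequence. The limit is exposed as a pointwise \<open>lim\<close> of the
  subsequence, so that measurability for a smaller sigma-algebra, and later progressive
  measurability, can be read off from the members.\<close>

lemma L2_complete:
  fixes f :: "nat \<Rightarrow> 'a \<Rightarrow> 'b::{real_inner, banach, second_countable_topology}"
  assumes L: "\<And>n. L2 N (f n)"
    and C: "\<And>e. e > 0 \<Longrightarrow> \<exists>k. \<forall>m\<ge>k. \<forall>n\<ge>k. n2 N (\<lambda>x. f m x - f n x) < e"
  obtains r where "strict_mono (r :: nat \<Rightarrow> nat)" "tends2 N f (\<lambda>x. lim (\<lambda>n. f (r n) x))"
    "AE x in N. convergent (\<lambda>n. f (r n) x)"
proof -
  have [measurable]: "f n \<in> borel_measurable N" for n using L by (simp add: L2_def)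
  have "\<exists>k\<ge>j. \<forall>m\<ge>k. \<forall>n\<ge>k. n2 N (\<lambda>x. f m x - f n x) < (1/8)^i" for i j
  proof -
    obtain k where "\<forall>m\<ge>k. \<forall>n\<ge>k. n2 N (\<lambda>x. f m x - f n x) < (1/8)^i"
      using C[of "(1/8)^i"] by auto
    then show ?thesis by (intro exI[of _ "max j k"]) auto
  qed
  then have "\<exists>r. \<forall>i. (\<forall>m\<ge>r i. \<forall>n\<ge>r i. n2 N (\<lambda>x. f m x - f n x) < (1/8)^i) \<and> r i < r (Suc i)"
    by (intro dependent_nat_choice) (blast, metis Suc_le_eq)
  then obtain r where r: "\<And>i m n. m \<ge> r i \<Longrightarrow> n \<ge> r i \<Longrightarrow> n2 N (\<lambda>x. f m x - f n x) < (1/8)^i"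
    and r': "\<And>i. r i < r (Suc i)" by blast
  have mono: "strict_mono r" using r' by (simp add: strict_mono_Suc_iff)
  then have mon: "i \<le> j \<Longrightarrow> r i \<le> r j" for i j by (simp add: strict_mono_less_eq)
  have "AE x in N. \<exists>c. \<forall>n. norm (f (r (Suc n)) x - f (r n) x) \<le> c * (1/2)^n"
    using r mon by (intro AE_fast_bound) (auto intro!: less_imp_le L2_diff L)
  then have conv: "AE x in N. convergent (\<lambda>n. f (r n) x)"
  proof eventually_elim
    fix x assume "\<exists>c. \<forall>n. norm (f (r (Suc n)) x - f (r n) x) \<le> c * (1/2)^n"
    then obtain c where c: "\<And>n. norm (f (r (Suc n)) x - f (r n) x) \<le> c * (1/2)^n" by blast
    have "summable (\<lambda>n. c * (1/2)^n :: real)" by (intro summable_mult summable_geometric) simp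
    then have "summable (\<lambda>n. f (r (Suc n)) x - f (r n) x)"
      using c by (rule summable_comparison_test'[where N = 0])
    then have "convergent (\<lambda>n. f (r n) x - f (r 0) x)"
      by (simp add: summable_iff_convergent sum_lessThan_telescope[of "\<lambda>n. f (r n) x"])
    then have "convergent (\<lambda>n. (f (r n) x - f (r 0) x) + f (r 0) x)"
      by (intro convergent_add convergent_const)
    then show "convergent (\<lambda>n. f (r n) x)" by simp
  qed
  define g where "g x = lim (\<lambda>n. f (r n) x)" for x
  have [measurable]: "g \<in> borel_measurable N" unfolding g_def by measurable
  have key: "L2 N (\<lambda>x. f m x - g x) \<and> n2 N (\<lambda>x. f m x - g x) \<le> (1/8)^i" if m: "m \<ge> r i" for m i
  proof -
    have "(\<integral>\<^sup>+x. ennreal ((norm (f m x - g x))\<^sup>2) \<partial>N)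
        = (\<integral>\<^sup>+x. liminf (\<lambda>n. ennreal ((norm (f m x - f (r n) x))\<^sup>2)) \<partial>N)"
    proof (rule nn_integral_cong_AE, use conv in eventually_elim)
      fix x assume "convergent (\<lambda>n. f (r n) x)"
      then have "(\<lambda>n. f (r n) x) \<longlonglongrightarrow> g x" by (simp add: g_def convergent_LIMSEQ_iff)
      then have "(\<lambda>n. ennreal ((norm (f m x - f (r n) x))\<^sup>2)) \<longlonglongrightarrow> ennreal ((norm (f m x - g x))\<^sup>2)"
        by (intro tendsto_intros) auto
      then show "ennreal ((norm (f m x - g x))\<^sup>2) = liminf (\<lambda>n. ennreal ((norm (f m x - f (r n) x))\<^sup>2))"
        by (rule lim_imp_Liminf[OF sequentially_bot, symmetric])
    qed
    also have "\<dots> \<le> liminf (\<lambda>n. \<integral>\<^sup>+x. ennreal ((norm (f m x - f (r n) x))\<^sup>2) \<partial>N)"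
      by (intro nn_integral_liminf) auto
    also have "\<dots> \<le> liminf (\<lambda>n. ennreal (((1/8)^i)\<^sup>2))"
    proof (intro Liminf_mono)
      show "\<forall>\<^sub>F n in sequentially. (\<integral>\<^sup>+x. ennreal ((norm (f m x - f (r n) x))\<^sup>2) \<partial>N) \<le> ennreal (((1/8)^i)\<^sup>2)"
        unfolding eventually_sequentially
      proof (intro exI[of _ i] allI impI)
        fix n assume "i \<le> n"
        then have "n2 N (\<lambda>x. f m x - f (r n) x) < (1/8)^i" using m mon by (intro r) auto
        then show "(\<integral>\<^sup>+x. ennreal ((norm (f m x - f (r n) x))\<^sup>2) \<partial>N) \<le> ennreal (((1/8)^i)\<^sup>2)"
          using n2_nn[OF L2_diff[OF L L], of m "r n"] by (auto intro!: ennreal_leI power_mono)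
      qed
    qed
    finally have *: "(\<integral>\<^sup>+x. ennreal ((norm (f m x - g x))\<^sup>2) \<partial>N) \<le> ennreal (((1/8)^i)\<^sup>2)"
      by (simp add: Liminf_const)
    show ?thesis using L2_nn_le[OF _ *] by auto
  qed
  have "L2 N (\<lambda>x. f (r 0) x - (f (r 0) x - g x))"
    by (intro L2_diff L conjunct1[OF key[OF order_refl]])
  then have g: "L2 N g" by (simp add: algebra_simps)
  have "(\<lambda>n. n2 N (\<lambda>x. f n x - g x)) \<longlonglongrightarrow> 0"
  proof (rule LIMSEQ_I)
    fix e :: real assume "e > 0"
    then obtain i where i: "(1/8)^i < e" using real_arch_pow_inv[of e "1/8"] by auto
    have "norm (n2 N (\<lambda>x. f n x - g x) - 0) < e" if "n \<ge> r i" for n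
      using key[OF that] i by simp
    then show "\<exists>k. \<forall>n\<ge>k. norm (n2 N (\<lambda>x. f n x - g x) - 0) < e" by blast
  qed
  then have "tends2 N f g" using L g by (simp add: tends2_def)
  then show thesis using that[OF mono _ conv] by (simp add: g_def[abs_def])
qed

lemma tends2_Cauchy:
  assumes "tends2 N f g" "e > 0"
  shows "\<exists>k. \<forall>m\<ge>k. \<forall>n\<ge>k. n2 N (\<lambda>x. f m x - f n x) < e"
proof -
  have "eventually (\<lambda>n. n2 N (\<lambda>x. f n x - g x) < e / 2) sequentially"
    using assms by (intro order_tendstoD(2)[of _ 0]) (auto simp: tends2_def)
  then obtain k where k: "\<And>n. n \<ge> k \<Longrightarrow> n2 N (\<lambda>x. f n x - g x) < e / 2"
    by (auto simp: eventually_sequentially)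
  have "n2 N (\<lambda>x. f m x - f n x) < e" if "m \<ge> k" "n \<ge> k" for m n
    using n2_triangle3[of N "f m" g "f n"] k[OF that(1)] k[OF that(2)] assms(1)
      n2_minus_commute[of N g "f n"] by (simp add: tends2_def)
  then show ?thesis by blast
qed

text \<open>Connects \<open>n2\<close> with the extended integrals in which the definitions are
  phrased. In the direction from right to left a single finite distance already gives the square
  integrability of g.\<close>

lemma tends2_nn_iff:
  assumes "\<And>n. L2 N (f n)" "g \<in> borel_measurable N"
  shows "tends2 N f g \<longleftrightarrow> (\<lambda>n. \<integral>\<^sup>+x. ennreal ((norm (f n x - g x))\<^sup>2) \<partial>N) \<longlonglongrightarrow> 0"
proof
  assume t: "tends2 N f g"
  then have "(\<lambda>n. ennreal ((n2 N (\<lambda>x. f n x - g x))\<^sup>2)) \<longlonglongrightarrow> ennreal (0\<^sup>2)"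
    unfolding tends2_def by (intro tendsto_intros) auto
  then show "(\<lambda>n. \<integral>\<^sup>+x. ennreal ((norm (f n x - g x))\<^sup>2) \<partial>N) \<longlonglongrightarrow> 0"
    using t by (simp add: n2_nn L2_diff tends2_def)
next
  assume l: "(\<lambda>n. \<integral>\<^sup>+x. ennreal ((norm (f n x - g x))\<^sup>2) \<partial>N) \<longlonglongrightarrow> 0"
  have "eventually (\<lambda>n. (\<integral>\<^sup>+x. ennreal ((norm (f n x - g x))\<^sup>2) \<partial>N) < 1) sequentially"
    using l by (rule order_tendstoD) simp
  then obtain k where k: "(\<integral>\<^sup>+x. ennreal ((norm (f k x - g x))\<^sup>2) \<partial>N) < 1"
    by (auto simp: eventually_sequentially)
  have "L2 N (\<lambda>x. f k x - g x)"
    unfolding L2_iff_nn using k L2_measurable[OF assms(1)] assms(2)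
    by (auto intro: less_trans)
  then have "L2 N g" using L2_diff[OF assms(1)[of k]] by fastforce
  then have L: "L2 N (\<lambda>x. f n x - g x)" for n using assms by (intro L2_diff)
  have "(\<lambda>n. ennreal ((n2 N (\<lambda>x. f n x - g x))\<^sup>2)) \<longlonglongrightarrow> ennreal 0"
    using l by (simp add: n2_nn[OF L])
  then have "(\<lambda>n. (n2 N (\<lambda>x. f n x - g x))\<^sup>2) \<longlonglongrightarrow> 0"
    by (subst (asm) tendsto_ennreal_iff) auto
  then have "(\<lambda>n. sqrt ((n2 N (\<lambda>x. f n x - g x))\<^sup>2)) \<longlonglongrightarrow> sqrt 0" by (rule tendsto_real_sqrt)
  then show "tends2 N f g" using assms(1) \<open>L2 N g\<close> by (simp add: tends2_def)
qed

section \<open>Increments of the cylindrical Wiener process\<close>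

locale wiener_filtration = prob_space M
  for M :: "'w measure" and F :: "real \<Rightarrow> 'w measure"
    and W :: "real \<Rightarrow> 'k::{real_inner, banach, second_countable_topology} \<Rightarrow> 'w \<Rightarrow> real" +
  assumes complete: "complete_measure M"
    and filtration: "usual_filtration M F"
    and wiener: "cylindrical_wiener M F W"
    and generated: "generated_by_wiener M F W"
begin

abbreviation D :: "real \<Rightarrow> real \<Rightarrow> 'k \<Rightarrow> 'w \<Rightarrow> real" where
  "D s t \<phi> \<equiv> \<lambda>\<omega>. W t \<phi> \<omega> - W s \<phi> \<omega>"

lemma F_subalgebra: "t \<ge> 0 \<Longrightarrow> subalgebra M (F t)"
  using filtration by (simp add: usual_filtration_def)

lemma space_F: "t \<ge> 0 \<Longrightarrow> space (F t) = space M"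
  using F_subalgebra by (simp add: subalgebra_def)

lemma F_subset: "t \<ge> 0 \<Longrightarrow> sets (F t) \<subseteq> sets M"
  using F_subalgebra by (simp add: subalgebra_def)

lemma F_mono: "0 \<le> s \<Longrightarrow> s \<le> t \<Longrightarrow> sets (F s) \<subseteq> sets (F t)"
  using filtration unfolding usual_filtration_def by blast

lemma F_measurable: "f \<in> measurable (F t) N \<Longrightarrow> t \<ge> 0 \<Longrightarrow> f \<in> measurable M N"
  using measurable_from_subalg F_subalgebra by blast

lemma F_measurable_mono:
  assumes "f \<in> measurable (F s) N" "0 \<le> s" "s \<le> t"
  shows "f \<in> measurable (F t) N"
  using assms F_mono[of s t] space_F[of s] space_F[of t] unfolding measurable_def by auto

lemma null_sets_F: "N \<in> null_sets M \<Longrightarrow> t \<ge> 0 \<Longrightarrow> N \<in> sets (F t)"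
  using filtration F_mono[of 0 t] unfolding usual_filtration_def by blast

text \<open>The two functions differ inside a null set, all of whose subsets belong to F t: they are
  null sets by completeness of M, and F 0 contains the null sets. This allows mean square limits and
  stochastic integrals to be changed on null sets without loss of adaptedness.\<close>

lemma F_measurable_AE:
  fixes f g :: "'w \<Rightarrow> 'b::topological_space"
  assumes f: "f \<in> borel_measurable (F t)" and t: "t \<ge> 0" and ae: "AE \<omega> in M. f \<omega> = g \<omega>"
  shows "g \<in> borel_measurable (F t)"
proof (rule measurableI)
  fix B :: "'b set" assume B: "B \<in> sets borel"
  obtain N where N: "N \<in> null_sets M" "{\<omega> \<in> space M. f \<omega> \<noteq> g \<omega>} \<subseteq> N"
    using ae by (auto simp: eventually_ae_filter)
  have sub: "Y \<in> sets (F t)" if "Y \<subseteq> N" for Y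
    using complete_measure.complete[OF complete that N(1)] N(1) that null_sets_F[OF _ t]
    by (meson null_sets_subset)
  have eq: "f x = g x" if "x \<in> space M" "x \<notin> N" for x using N(2) that by blast
  have "g -` B \<inter> space M = (f -` B \<inter> space M - (f -` B \<inter> N)) \<union> (g -` B \<inter> N \<inter> space M)"
    using eq by (intro set_eqI) (case_tac "x \<in> N", auto)
  moreover have "f -` B \<inter> space M \<in> sets (F t)"
    using measurable_sets[OF f B] space_F[OF t] by simp
  moreover have "f -` B \<inter> N \<in> sets (F t)" "g -` B \<inter> N \<inter> space M \<in> sets (F t)"
    by (auto intro: sub)
  ultimately show "g -` B \<inter> space (F t) \<in> sets (F t)"
    unfolding space_F[OF t] by auto
qed simp

lemma W_measurable: "t \<ge> 0 \<Longrightarrow> W t \<phi> \<in> borel_measurable (F t)"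
  using wiener by (simp add: cylindrical_wiener_def)

lemma D_measurable: "0 \<le> s \<Longrightarrow> s \<le> t \<Longrightarrow> D s t \<phi> \<in> borel_measurable (F t)"
  using W_measurable[of t \<phi>] F_measurable_mono[OF W_measurable[of s \<phi>], of t] by simp

lemma D_measurable_M: "0 \<le> s \<Longrightarrow> s \<le> t \<Longrightarrow> D s t \<phi> \<in> borel_measurable M"
  using D_measurable F_measurable by (meson order_trans)

lemma W_linear:
  "t \<ge> 0 \<Longrightarrow> AE \<omega> in M. W t (a *\<^sub>R \<phi> + b *\<^sub>R \<psi>) \<omega> = a * W t \<phi> \<omega> + b * W t \<psi> \<omega>"
  using wiener by (simp add: cylindrical_wiener_def)

lemma W_add: "t \<ge> 0 \<Longrightarrow> AE \<omega> in M. W t (\<phi> + \<psi>) \<omega> = W t \<phi> \<omega> + W t \<psi> \<omega>"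
  using W_linear[of t 1 \<phi> 1 \<psi>] by simp

lemma W_zero: "t \<ge> 0 \<Longrightarrow> AE \<omega> in M. W t 0 \<omega> = 0"
  using W_linear[of t 0 0 0 0] by simp

lemma W_0: "AE \<omega> in M. W 0 \<phi> \<omega> = 0"
  using wiener by (simp add: cylindrical_wiener_def)

lemma D_add:
  assumes "0 \<le> s" "s \<le> t"
  shows "AE \<omega> in M. D s t (\<phi> + \<psi>) \<omega> = D s t \<phi> \<omega> + D s t \<psi> \<omega>"
  using W_add[of s \<phi> \<psi>] W_add[of t \<phi> \<psi>] assms by (auto elim: eventually_elim2)

lemma D_distributed:
  "\<phi> \<noteq> 0 \<Longrightarrow> 0 \<le> s \<Longrightarrow> s < t \<Longrightarrow>
    distributed M lborel (D s t \<phi>) (normal_density 0 (norm \<phi> * sqrt (t - s)))"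
  using wiener by (simp add: cylindrical_wiener_def)

text \<open>The axiom for W concerns sets. The preimages under U and under g of the increment are
  intersection stable subfamilies of the two independent families, so the generated sigma-algebras
  are independent as well.\<close>

lemma D_indep:
  assumes s: "0 \<le> s" "s < t" and U: "U \<in> measurable (F s) N" and g: "g \<in> measurable borel N'"
  shows "indep_var N U N' (\<lambda>\<omega>. g (D s t \<phi> \<omega>))"
proof -
  let ?Y = "\<lambda>\<omega>. g (D s t \<phi> \<omega>)"
  have Dm: "D s t \<phi> \<in> borel_measurable M" using D_measurable_M s by simp
  have Ym: "?Y \<in> measurable M N'" by (rule measurable_compose[OF Dm g])
  have ind: "indep_set (sets (F s)) {D s t \<phi> -` B \<inter> space M |B. B \<in> sets borel}"
    using wiener s unfolding cylindrical_wiener_def by blast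
  have "indep_set (sigma_sets (space M) {U -` A \<inter> space M | A. A \<in> sets N})
      (sigma_sets (space M) {?Y -` B \<inter> space M |B. B \<in> sets N'})"
  proof (rule indep_set_sigma_sets)
    show "indep_set {U -` A \<inter> space M | A. A \<in> sets N} {?Y -` B \<inter> space M |B. B \<in> sets N'}"
      unfolding indep_set_def
    proof (rule indep_sets_mono_sets[OF ind[unfolded indep_set_def]])
      fix b :: bool
      have 1: "U -` A \<inter> space M \<in> sets (F s)" if "A \<in> sets N" for A
        using measurable_sets[OF U that] space_F[OF s(1)] by simp
      have 2: "\<exists>B'. ?Y -` B \<inter> space M = D s t \<phi> -` B' \<inter> space M \<and> B' \<in> sets borel" if "B \<in> sets N'" for B
        using measurable_sets[OF g that] by (intro exI[of _ "g -` B"]) auto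
      show "case_bool {U -` A \<inter> space M |A. A \<in> sets N} {?Y -` B \<inter> space M |B. B \<in> sets N'} b
        \<subseteq> case_bool (sets (F s)) {D s t \<phi> -` B \<inter> space M |B. B \<in> sets borel} b"
        using 1 2 by (cases b) auto
    qed
    show "Int_stable {U -` A \<inter> space M | A. A \<in> sets N}"
      unfolding Int_stable_def
    proof safe
      fix B C assume "B \<in> sets N" "C \<in> sets N"
      then show "\<exists>B'. U -` B \<inter> space M \<inter> (U -` C \<inter> space M) = U -` B' \<inter> space M \<and> B' \<in> sets N"
        by (intro exI[of _ "B \<inter> C"]) auto
    qed
    show "Int_stable {?Y -` B \<inter> space M | B. B \<in> sets N'}"
      unfolding Int_stable_def
    proof safe
      fix B C assume "B \<in> sets N'" "C \<in> sets N'"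
      then show "\<exists>B'. ?Y -` B \<inter> space M \<inter> (?Y -` C \<inter> space M) = ?Y -` B' \<inter> space M \<and> B' \<in> sets N'"
        by (intro exI[of _ "B \<inter> C"]) auto
    qed
  qed
  then show ?thesis
    unfolding indep_var_eq using F_measurable[OF U s(1)] Ym by auto
qed

lemma D_moments:
  assumes s: "0 \<le> s" "s \<le> t"
  shows "integrable M (\<lambda>\<omega>. (D s t \<phi> \<omega>)\<^sup>2)" "expectation (\<lambda>\<omega>. (D s t \<phi> \<omega>)\<^sup>2) = (norm \<phi>)\<^sup>2 * (t - s)"
    "integrable M (D s t \<phi>)" "expectation (D s t \<phi>) = 0"
proof -
  have "integrable M (\<lambda>\<omega>. (D s t \<phi> \<omega>)\<^sup>2) \<and> expectation (\<lambda>\<omega>. (D s t \<phi> \<omega>)\<^sup>2) = (norm \<phi>)\<^sup>2 * (t - s)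
      \<and> integrable M (D s t \<phi>) \<and> expectation (D s t \<phi>) = 0"
  proof (cases "s < t \<and> \<phi> \<noteq> 0")
    case True
    let ?\<sigma> = "norm \<phi> * sqrt (t - s)"
    have \<sigma>: "?\<sigma> > 0" using True by simp
    note d = D_distributed[OF conjunct2[OF True] s(1) conjunct1[OF True]]
    have E: "expectation (D s t \<phi>) = 0"
      using normal_distributed_expectation[OF \<sigma> d] .
    have i1: "integrable M (D s t \<phi>)"
      using integrable_normal_moment[OF \<sigma>, of 0 1] distributed_integrable[OF d, of "\<lambda>x. x"]
      by simp
    have i2: "integrable M (\<lambda>\<omega>. (D s t \<phi> \<omega>)\<^sup>2)"
      using integrable_normal_moment[OF \<sigma>, of 0 2] distributed_integrable[OF d, of "\<lambda>x. x\<^sup>2"]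
      by simp
    have "expectation (\<lambda>\<omega>. (D s t \<phi> \<omega>)\<^sup>2) = variance (D s t \<phi>)" using E by simp
    also have "\<dots> = ?\<sigma>\<^sup>2" using normal_distributed_variance[OF \<sigma> d] .
    also have "\<dots> = (norm \<phi>)\<^sup>2 * (t - s)" using True by (simp add: power_mult_distrib)
    finally show ?thesis using E i1 i2 by simp
  next
    case False
    \<comment> \<open>The Gaussian density degenerates for s = t and for \<phi> = 0. The increment
      then vanishes almost surely, in the second case by linearity of W.\<close>
    have z: "AE \<omega> in M. D s t \<phi> \<omega> = 0"
    proof (cases "s = t")
      case False
      then have "\<phi> = 0" using \<open>\<not> (s < t \<and> \<phi> \<noteq> 0)\<close> s by auto
      then show ?thesis using W_zero[of s] W_zero[of t] s by (auto elim: eventually_elim2)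
    qed simp
    then have z2: "AE \<omega> in M. (D s t \<phi> \<omega>)\<^sup>2 = 0" by eventually_elim simp
    have m[measurable]: "D s t \<phi> \<in> borel_measurable M" using D_measurable_M s by blast
    have "integrable M (D s t \<phi>) \<longleftrightarrow> integrable M (\<lambda>_. 0::real)"
      by (rule integrable_cong_AE[OF m _ z]) simp
    moreover have "expectation (D s t \<phi>) = expectation (\<lambda>_. 0::real)"
      by (rule integral_cong_AE[OF m _ z]) simp
    moreover have "integrable M (\<lambda>\<omega>. (D s t \<phi> \<omega>)\<^sup>2) \<longleftrightarrow> integrable M (\<lambda>_. 0::real)"
      by (rule integrable_cong_AE[OF _ _ z2]) simp_all
    moreover have "expectation (\<lambda>\<omega>. (D s t \<phi> \<omega>)\<^sup>2) = expectation (\<lambda>_. 0::real)"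
      by (rule integral_cong_AE[OF _ _ z2]) simp_all
    ultimately show ?thesis using False s by auto
  qed
  then show "integrable M (\<lambda>\<omega>. (D s t \<phi> \<omega>)\<^sup>2)" "expectation (\<lambda>\<omega>. (D s t \<phi> \<omega>)\<^sup>2) = (norm \<phi>)\<^sup>2 * (t - s)"
    "integrable M (D s t \<phi>)" "expectation (D s t \<phi>) = 0" by auto
qed

lemma D_L2: "0 \<le> s \<Longrightarrow> s \<le> t \<Longrightarrow> L2 M (D s t \<phi>)"
  using D_moments(1) D_measurable_M by (simp add: L2_def)

lemma indep_product:
  fixes U :: "'w \<Rightarrow> 'c::{real_normed_field, banach, second_countable_topology}" and g :: "real \<Rightarrow> 'c"
  assumes s: "0 \<le> s" "s \<le> t" and U: "U \<in> borel_measurable (F s)" "integrable M U"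
    and g: "g \<in> borel_measurable borel" "integrable M (\<lambda>\<omega>. g (D s t \<phi> \<omega>))"
  shows "integrable M (\<lambda>\<omega>. U \<omega> * g (D s t \<phi> \<omega>))"
    and "expectation (\<lambda>\<omega>. U \<omega> * g (D s t \<phi> \<omega>)) = expectation U * expectation (\<lambda>\<omega>. g (D s t \<phi> \<omega>))"
proof -
  have "integrable M (\<lambda>\<omega>. U \<omega> * g (D s t \<phi> \<omega>)) \<and>
      expectation (\<lambda>\<omega>. U \<omega> * g (D s t \<phi> \<omega>)) = expectation U * expectation (\<lambda>\<omega>. g (D s t \<phi> \<omega>))"
  proof (cases "s < t")
    case True
    have "indep_var borel U borel (\<lambda>\<omega>. g (D s t \<phi> \<omega>))"
      by (rule D_indep[OF s(1) True U(1) g(1)])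
    then show ?thesis using indep_var_integrable indep_var_lebesgue_integral U g by blast
  next
    case False
    then show ?thesis using s U by (simp add: prob_space)
  qed
  then show "integrable M (\<lambda>\<omega>. U \<omega> * g (D s t \<phi> \<omega>))"
    "expectation (\<lambda>\<omega>. U \<omega> * g (D s t \<phi> \<omega>)) = expectation U * expectation (\<lambda>\<omega>. g (D s t \<phi> \<omega>))" by auto
qed

lemma D_orthogonal_past:
  assumes s: "0 \<le> s" "s \<le> t" and U: "U \<in> borel_measurable (F s)" "integrable M U"
  shows "integrable M (\<lambda>\<omega>. U \<omega> * D s t \<phi> \<omega>)" "expectation (\<lambda>\<omega>. U \<omega> * D s t \<phi> \<omega>) = 0"
  using indep_product[OF s U, of "\<lambda>x. x"] D_moments(3,4)[OF s] by simp_all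

text \<open>Polarization in the direction of the increment: the product is half of the square for
  \<phi> + \<psi> minus the two squares, and each square is independent of G.\<close>

lemma D_covariance_past:
  assumes s: "0 \<le> s" "s \<le> t" and G: "G \<in> sets (F s)"
  shows "integrable M (\<lambda>\<omega>. indicator G \<omega> * (D s t \<phi> \<omega> * D s t \<psi> \<omega>))"
    "expectation (\<lambda>\<omega>. indicator G \<omega> * (D s t \<phi> \<omega> * D s t \<psi> \<omega>)) = prob G * (t - s) * (\<phi> \<bullet> \<psi>)"
proof -
  have GM: "G \<in> sets M" using G F_subset s by blast
  have U: "(indicator G :: 'w \<Rightarrow> real) \<in> borel_measurable (F s)" using G by simp
  have Ui: "integrable M (indicator G :: 'w \<Rightarrow> real)" using GM by (simp add: integrable_real_indicator emeasure_eq_measure)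
  have sq: "integrable M (\<lambda>\<omega>. indicator G \<omega> * (D s t \<phi> \<omega>)\<^sup>2)"
    "expectation (\<lambda>\<omega>. indicator G \<omega> * (D s t \<phi> \<omega>)\<^sup>2) = prob G * ((norm \<phi>)\<^sup>2 * (t - s))" for \<phi>
    using indep_product[OF s U Ui, of "\<lambda>x. x\<^sup>2"] D_moments(1,2)[OF s] GM by simp_all
  have m: "D s t \<phi> \<in> borel_measurable M" for \<phi> using D_measurable_M s by blast
  have ae: "AE \<omega> in M. indicator G \<omega> * (D s t \<phi> \<omega> * D s t \<psi> \<omega>)
      = (indicator G \<omega> * (D s t (\<phi> + \<psi>) \<omega>)\<^sup>2 - indicator G \<omega> * (D s t \<phi> \<omega>)\<^sup>2 - indicator G \<omega> * (D s t \<psi> \<omega>)\<^sup>2) / 2"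
    using D_add[OF s, of \<phi> \<psi>]
  proof eventually_elim
    fix \<omega> assume *: "D s t (\<phi> + \<psi>) \<omega> = D s t \<phi> \<omega> + D s t \<psi> \<omega>"
    show "indicator G \<omega> * (D s t \<phi> \<omega> * D s t \<psi> \<omega>)
      = (indicator G \<omega> * (D s t (\<phi> + \<psi>) \<omega>)\<^sup>2 - indicator G \<omega> * (D s t \<phi> \<omega>)\<^sup>2 - indicator G \<omega> * (D s t \<psi> \<omega>)\<^sup>2) / 2"
      unfolding * by (simp add: power2_eq_square algebra_simps)
  qed
  have m1: "(\<lambda>\<omega>. indicator G \<omega> * (D s t \<phi> \<omega> * D s t \<psi> \<omega>)) \<in> borel_measurable M"
    using m[of \<phi>] m[of \<psi>] GM by simp
  have i: "integrable M (\<lambda>\<omega>. (indicator G \<omega> * (D s t (\<phi> + \<psi>) \<omega>)\<^sup>2 - indicator G \<omega> * (D s t \<phi> \<omega>)\<^sup>2 - indicator G \<omega> * (D s t \<psi> \<omega>)\<^sup>2) / 2)"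
    by (intro integrable_divide_zero Bochner_Integration.integrable_diff sq)
  show "integrable M (\<lambda>\<omega>. indicator G \<omega> * (D s t \<phi> \<omega> * D s t \<psi> \<omega>))"
    using integrable_cong_AE[OF m1 _ ae] i by (auto dest: borel_measurable_integrable)
  have "expectation (\<lambda>\<omega>. indicator G \<omega> * (D s t \<phi> \<omega> * D s t \<psi> \<omega>))
      = expectation (\<lambda>\<omega>. (indicator G \<omega> * (D s t (\<phi> + \<psi>) \<omega>)\<^sup>2 - indicator G \<omega> * (D s t \<phi> \<omega>)\<^sup>2 - indicator G \<omega> * (D s t \<psi> \<omega>)\<^sup>2) / 2)"
    using integral_cong_AE[OF m1 _ ae] i by (auto dest: borel_measurable_integrable)
  also have "\<dots> = (prob G * ((norm (\<phi> + \<psi>))\<^sup>2 * (t - s)) - prob G * ((norm \<phi>)\<^sup>2 * (t - s)) - prob G * ((norm \<psi>)\<^sup>2 * (t - s))) / 2"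
    by (subst integral_divide_zero, subst Bochner_Integration.integral_diff, (intro Bochner_Integration.integrable_diff sq)+,
        subst Bochner_Integration.integral_diff, (intro sq)+) (simp only: sq)
  also have "(norm (\<phi> + \<psi>))\<^sup>2 = (norm \<phi>)\<^sup>2 + 2 * (\<phi> \<bullet> \<psi>) + (norm \<psi>)\<^sup>2"
    by (simp add: power2_norm_eq_inner inner_add_left inner_add_right inner_commute)
  also have "(prob G * (((norm \<phi>)\<^sup>2 + 2 * (\<phi> \<bullet> \<psi>) + (norm \<psi>)\<^sup>2) * (t - s)) - prob G * ((norm \<phi>)\<^sup>2 * (t - s))
      - prob G * ((norm \<psi>)\<^sup>2 * (t - s))) / 2 = prob G * (t - s) * (\<phi> \<bullet> \<psi>)"
    by (simp add: field_simps)
  finally show "expectation (\<lambda>\<omega>. indicator G \<omega> * (D s t \<phi> \<omega> * D s t \<psi> \<omega>)) = prob G * (t - s) * (\<phi> \<bullet> \<psi>)" .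
qed

lemma D_mult_integrable:
  assumes "0 \<le> s" "s \<le> t" "0 \<le> s'" "s' \<le> t'" "G \<in> sets M"
  shows "integrable M (\<lambda>\<omega>. indicator G \<omega> * (D s t \<phi> \<omega> * D s' t' \<psi> \<omega>))"
  using integrable_real_mult_indicator[OF assms(5) L2_inner_integrable[OF D_L2[of s t \<phi>] D_L2[of s' t' \<psi>]]] assms
  by (simp add: mult.commute)

text \<open>Both increments are split at s' and at t, the end points of the overlap. Among the
  products only the one with the overlap in both factors has nonzero mean; in the others the later
  increment is independent of everything before it. The two claims are the two possible orders of
  the right end points.\<close>

lemma D_covariance_ordered:
  assumes s: "0 \<le> s" "s \<le> s'" "s' \<le> t" "s' \<le> t'" and t: "t \<le> t'" and G: "G \<in> sets (F s')"
  shows "expectation (\<lambda>\<omega>. indicator G \<omega> * (D s t \<phi> \<omega> * D s' t' \<psi> \<omega>)) = prob G * (t - s') * (\<phi> \<bullet> \<psi>)"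
    and "expectation (\<lambda>\<omega>. indicator G \<omega> * (D s t' \<phi> \<omega> * D s' t \<psi> \<omega>)) = prob G * (t - s') * (\<phi> \<bullet> \<psi>)"
proof -
  have s'0: "0 \<le> s'" "0 \<le> t" using s by auto
  have GM: "G \<in> sets M" using G F_subset s'0 by blast
  have Gm: "(indicator G :: 'w \<Rightarrow> real) \<in> borel_measurable (F s')" using G by simp
  have Ii: "integrable M (\<lambda>\<omega>. indicator G \<omega> * D a b \<phi> \<omega>)" if "0 \<le> a" "a \<le> b" for a b \<phi>
    using integrable_real_mult_indicator[OF GM D_moments(3)[OF that]] by (simp add: mult.commute)
  have zero: "expectation (\<lambda>\<omega>. indicator G \<omega> * (D a b \<phi> \<omega> * D c d \<psi> \<omega>)) = 0"
    if "0 \<le> a" "a \<le> b" "b \<le> c" "s' \<le> c" "c \<le> d" for a b c d \<phi> \<psi>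
  proof -
    have "(\<lambda>\<omega>. indicator G \<omega> * D a b \<phi> \<omega>) \<in> borel_measurable (F c)"
      using F_measurable_mono[OF Gm s'0(1) that(4)] F_measurable_mono[OF D_measurable[OF that(1,2)] _ that(3)] that
      by simp
    from D_orthogonal_past(2)[OF _ that(5) this Ii[OF that(1,2)]] show ?thesis
      using that by (simp add: mult.assoc)
  qed
  note int = D_mult_integrable[OF _ _ _ _ GM]
  have "expectation (\<lambda>\<omega>. indicator G \<omega> * (D s t \<phi> \<omega> * D s' t' \<psi> \<omega>))
      = expectation (\<lambda>\<omega>. indicator G \<omega> * (D s s' \<phi> \<omega> * D s' t' \<psi> \<omega>)
        + (indicator G \<omega> * (D s' t \<phi> \<omega> * D s' t \<psi> \<omega>) + indicator G \<omega> * (D s' t \<phi> \<omega> * D t t' \<psi> \<omega>)))"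
    by (intro Bochner_Integration.integral_cong) (auto simp: algebra_simps)
  also have "\<dots> = expectation (\<lambda>\<omega>. indicator G \<omega> * (D s s' \<phi> \<omega> * D s' t' \<psi> \<omega>))
        + (expectation (\<lambda>\<omega>. indicator G \<omega> * (D s' t \<phi> \<omega> * D s' t \<psi> \<omega>)) + expectation (\<lambda>\<omega>. indicator G \<omega> * (D s' t \<phi> \<omega> * D t t' \<psi> \<omega>)))"
    using s t s'0 by (subst Bochner_Integration.integral_add Bochner_Integration.integral_add, (intro int Bochner_Integration.integrable_add; simp)+)+ simp
  also have "\<dots> = prob G * (t - s') * (\<phi> \<bullet> \<psi>)"
    using s t s'0 D_covariance_past(2)[OF s'0(1) s(3) G] by (simp add: zero)
  finally show "expectation (\<lambda>\<omega>. indicator G \<omega> * (D s t \<phi> \<omega> * D s' t' \<psi> \<omega>)) = prob G * (t - s') * (\<phi> \<bullet> \<psi>)" .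
  have "expectation (\<lambda>\<omega>. indicator G \<omega> * (D s t' \<phi> \<omega> * D s' t \<psi> \<omega>))
      = expectation (\<lambda>\<omega>. indicator G \<omega> * (D s s' \<phi> \<omega> * D s' t \<psi> \<omega>)
        + (indicator G \<omega> * (D s' t \<phi> \<omega> * D s' t \<psi> \<omega>) + indicator G \<omega> * (D s' t \<psi> \<omega> * D t t' \<phi> \<omega>)))"
    by (intro Bochner_Integration.integral_cong) (auto simp: algebra_simps)
  also have "\<dots> = expectation (\<lambda>\<omega>. indicator G \<omega> * (D s s' \<phi> \<omega> * D s' t \<psi> \<omega>))
        + (expectation (\<lambda>\<omega>. indicator G \<omega> * (D s' t \<phi> \<omega> * D s' t \<psi> \<omega>)) + expectation (\<lambda>\<omega>. indicator G \<omega> * (D s' t \<psi> \<omega> * D t t' \<phi> \<omega>)))"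
    using s t s'0 by (subst Bochner_Integration.integral_add Bochner_Integration.integral_add, (intro int Bochner_Integration.integrable_add; simp)+)+ simp
  also have "\<dots> = prob G * (t - s') * (\<phi> \<bullet> \<psi>)"
    using s t s'0 D_covariance_past(2)[OF s'0(1) s(3) G] by (simp add: zero)
  finally show "expectation (\<lambda>\<omega>. indicator G \<omega> * (D s t' \<phi> \<omega> * D s' t \<psi> \<omega>)) = prob G * (t - s') * (\<phi> \<bullet> \<psi>)" .
qed

lemma D_covariance:
  assumes s: "0 \<le> s" "s \<le> t" "0 \<le> s'" "s' \<le> t'" and G: "G \<in> sets (F s)" and G': "G' \<in> sets (F s')"
  shows "expectation (\<lambda>\<omega>. (indicator G \<omega> * D s t \<phi> \<omega>) * (indicator G' \<omega> * D s' t' \<psi> \<omega>))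
    = max 0 (min t t' - max s s') * prob (G \<inter> G') * (\<phi> \<bullet> \<psi>)"
proof -
  have main: "expectation (\<lambda>\<omega>. (indicator G \<omega> * D s t \<phi> \<omega>) * (indicator G' \<omega> * D s' t' \<psi> \<omega>))
      = max 0 (min t t' - max s s') * prob (G \<inter> G') * (\<phi> \<bullet> \<psi>)"
    if s: "0 \<le> s" "s \<le> t" "0 \<le> s'" "s' \<le> t'" and G: "G \<in> sets (F s)" and G': "G' \<in> sets (F s')"
      and le: "s \<le> s'" for s t s' t' G G' \<phi> \<psi>
  proof -
    \<comment> \<open>The intersection is known at the later of the two left end points, so it can
      be treated as part of the past of the overlap.\<close>
    have GG: "G \<inter> G' \<in> sets (F s')" using F_mono[OF s(1) le] G G' by auto
    have "expectation (\<lambda>\<omega>. (indicator G \<omega> * D s t \<phi> \<omega>) * (indicator G' \<omega> * D s' t' \<psi> \<omega>))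
        = expectation (\<lambda>\<omega>. indicator (G \<inter> G') \<omega> * (D s t \<phi> \<omega> * D s' t' \<psi> \<omega>))"
      by (intro Bochner_Integration.integral_cong) (auto simp: indicator_inter_arith)
    also have "\<dots> = max 0 (min t t' - max s s') * prob (G \<inter> G') * (\<phi> \<bullet> \<psi>)"
    proof (cases "t \<le> s'")
      case True
      have GM: "G \<inter> G' \<in> sets M" using GG F_subset s by blast
      have "(\<lambda>\<omega>. indicator (G \<inter> G') \<omega> * D s t \<phi> \<omega>) \<in> borel_measurable (F s')"
        using GG F_measurable_mono[OF D_measurable[OF s(1,2)] _ True] s by simp
      moreover have "integrable M (\<lambda>\<omega>. indicator (G \<inter> G') \<omega> * D s t \<phi> \<omega>)"
        using integrable_real_mult_indicator[OF GM D_moments(3)[OF s(1,2)]] by (simp add: mult.commute)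
      ultimately have "expectation (\<lambda>\<omega>. (indicator (G \<inter> G') \<omega> * D s t \<phi> \<omega>) * D s' t' \<psi> \<omega>) = 0"
        by (intro D_orthogonal_past(2) s)
      then show ?thesis using True s le by (simp add: mult.assoc)
    next
      case False
      then have a: "s' \<le> t" by simp
      show ?thesis
      proof (cases "t \<le> t'")
        case True
        then show ?thesis using D_covariance_ordered(1)[OF s(1) le a s(4) True GG] le a
          by (simp add: max_def min_def mult.commute mult.left_commute)
      next
        case False
        then show ?thesis using D_covariance_ordered(2)[OF s(1) le s(4) a _ GG] le s(4)
          by (simp add: max_def min_def mult.commute mult.left_commute)
      qed
    qed
    finally show ?thesis .
  qed
  show ?thesis
  proof (cases "s \<le> s'")
    case True
    then show ?thesis using main[OF s G G'] by simp
  next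
    case False
    then show ?thesis
      using main[OF s(3,4,1,2) G' G, of \<psi> \<phi>]
      by (simp add: max.commute min.commute Int_commute inner_commute mult.commute)
  qed
qed

end

section \<open>Isometry for elementary integrands\<close>

lemma inner_rank_one: "rank_one h \<phi> \<bullet> rank_one h' \<phi>' = (h \<bullet> h') * (\<phi> \<bullet> \<phi>')"
proof -
  have "((\<lambda>e. ((\<phi> \<bullet> e) *\<^sub>R e) \<bullet> \<phi>') has_sum \<phi> \<bullet> \<phi>') some_onb"
    using has_sum_bounded_linear[OF bounded_linear_inner_left onb_expansion[OF onb_some_onb, of \<phi>], of \<phi>']
    by (simp add: o_def)
  then have "((\<lambda>e. (h \<bullet> h') * (((\<phi> \<bullet> e) *\<^sub>R e) \<bullet> \<phi>')) has_sum (h \<bullet> h') * (\<phi> \<bullet> \<phi>')) some_onb"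
    by (rule has_sum_cmult_right)
  then have "((\<lambda>e. ((\<phi> \<bullet> e) *\<^sub>R h) \<bullet> ((\<phi>' \<bullet> e) *\<^sub>R h')) has_sum (h \<bullet> h') * (\<phi> \<bullet> \<phi>')) some_onb"
    by (simp add: inner_commute mult_ac)
  then show ?thesis
    unfolding inner_hs_onb[OF onb_some_onb] by (simp add: infsumI)
qed

lemma hs_compose_rank_one: "hs_compose B (rank_one h \<phi>) = rank_one (B h) \<phi>"
  by transfer (simp add: blinfun_eqI blinfun.scaleR_right)

lemma hs_compose_apply [simp]: "blinfun_of_hs (hs_compose B Z) x = B (blinfun_of_hs Z x)"
  by transfer simp

lemma hs_eqI: "(\<And>x. blinfun_of_hs Y x = blinfun_of_hs Z x) \<Longrightarrow> Y = Z"
  by (simp add: blinfun_eqI blinfun_of_hs_inject[symmetric])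

lemma hs_compose_add: "hs_compose B (Y + Z) = hs_compose B Y + hs_compose B Z"
  by (rule hs_eqI) (simp add: plus_hs.rep_eq blinfun.add_left blinfun.add_right)

lemma hs_compose_scaleR: "hs_compose B (c *\<^sub>R Z) = c *\<^sub>R hs_compose B Z"
  by (rule hs_eqI) (simp add: scaleR_hs.rep_eq blinfun.scaleR_left blinfun.scaleR_right)

lemma hs_compose_zero [simp]: "hs_compose B 0 = 0"
  using hs_compose_scaleR[of B 0 0] by simp

lemma norm_hs_compose:
  assumes "\<And>x. norm (blinfun_apply B x) \<le> c * norm x" "c \<ge> 0"
  shows "norm (hs_compose B Z) \<le> c * norm Z"
proof (rule norm_hs_leI[OF onb_some_onb])
  fix E :: "'c set" assume E: "finite E" "E \<subseteq> some_onb"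
  have "(\<Sum>e\<in>E. (norm (blinfun_of_hs (hs_compose B Z) e))\<^sup>2) \<le> (\<Sum>e\<in>E. c\<^sup>2 * (norm (blinfun_of_hs Z e))\<^sup>2)"
    unfolding hs_compose_apply
    by (intro sum_mono) (metis assms(1) norm_ge_zero power_mono power_mult_distrib)
  also have "\<dots> \<le> c\<^sup>2 * (norm Z)\<^sup>2"
    unfolding sum_distrib_left[symmetric] by (intro mult_left_mono sum_le_norm_hs[OF onb_some_onb E]) simp
  finally show "(\<Sum>e\<in>E. (norm (blinfun_of_hs (hs_compose B Z) e))\<^sup>2) \<le> (c * norm Z)\<^sup>2"
    by (simp add: power_mult_distrib)
qed (use assms in auto)

lemma bounded_linear_hs_compose: "bounded_linear (hs_compose B)"
  by (rule bounded_linear_intro[where K = "norm B"])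
    (use norm_hs_compose[of B "norm B", OF norm_blinfun] in
      \<open>simp_all add: hs_compose_add hs_compose_scaleR mult.commute\<close>)

lemma L2_indicator:
  assumes "A \<in> sets N" "emeasure N A < \<infinity>"
  shows "L2 N (\<lambda>x. indicator A x *\<^sub>R c)"
proof -
  have "integrable N (\<lambda>x. indicator A x * (norm c)\<^sup>2)"
    using assms by (intro integrable_mult_left) (simp add: integrable_indicator_iff)
  moreover have "(norm (indicator A x *\<^sub>R c))\<^sup>2 = indicator A x * (norm c)\<^sup>2" for x
    by (simp add: indicator_def)
  ultimately show ?thesis using assms(1) by (simp add: L2_def)
qed

lemma ip_indicator:
  assumes "A \<in> sets N" "B \<in> sets N"
  shows "ip N (\<lambda>x. indicator A x *\<^sub>R c) (\<lambda>x. indicator B x *\<^sub>R d) = measure N (A \<inter> B) * (c \<bullet> d)"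
proof -
  have "ip N (\<lambda>x. indicator A x *\<^sub>R c) (\<lambda>x. indicator B x *\<^sub>R d) = (\<integral>x. indicator (A \<inter> B) x * (c \<bullet> d) \<partial>N)"
    unfolding ip_def by (intro Bochner_Integration.integral_cong) (auto simp: indicator_def)
  then show ?thesis using assms sets.sets_into_space[OF assms(1)] by (simp add: Int_absorb2 le_infI1)
qed

lemma elementary_process_Nil [simp]: "elementary_process [] r \<omega> = 0"
  by (simp add: elementary_process_def)

lemma elementary_integral_Nil [simp]: "elementary_integral W [] = (\<lambda>\<omega>. 0)"
  by (simp add: elementary_integral_def fun_eq_iff)

lemma elementary_process_append:
  "elementary_process (xs @ ys) r \<omega> = elementary_process xs r \<omega> + elementary_process ys r \<omega>"
  by (simp add: elementary_process_def)

lemma elementary_integral_append: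
  "elementary_integral W (xs @ ys) \<omega> = elementary_integral W xs \<omega> + elementary_integral W ys \<omega>"
  by (simp add: elementary_integral_def)

lemma elementary_on_Nil [simp]: "elementary_on F a b []"
  by (simp add: elementary_on_def)

lemma elementary_on_append [simp]:
  "elementary_on F a b (xs @ ys) \<longleftrightarrow> elementary_on F a b xs \<and> elementary_on F a b ys"
  unfolding elementary_on_def set_append by (rule ball_Un)

lemma elementary_on_Cons:
  "elementary_on F a b (x # xs) \<longleftrightarrow> elementary_on F a b [x] \<and> elementary_on F a b xs"
  using elementary_on_append[of F a b "[x]" xs] by simp

lemma elementary_on_mono: "elementary_on F a b xs \<Longrightarrow> a' \<le> a \<Longrightarrow> b \<le> b' \<Longrightarrow> elementary_on F a' b' xs"
  by (force simp: elementary_on_def)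

definition map_elementary :: "('h \<Rightarrow> 'g) \<Rightarrow> ('w, 'k, 'h) elementary \<Rightarrow> ('w, 'k, 'g) elementary" where
  "map_elementary B = map (\<lambda>(s, t, G, \<phi>, h). (s, t, G, \<phi>, B h))"

lemma elementary_on_map [simp]: "elementary_on F a b (map_elementary B xs) \<longleftrightarrow> elementary_on F a b xs"
  by (force simp: elementary_on_def map_elementary_def)

lemma elementary_process_map:
  "elementary_process (map_elementary (blinfun_apply B) xs) r \<omega> = hs_compose B (elementary_process xs r \<omega>)"
  by (induction xs)
    (auto simp: elementary_process_def map_elementary_def hs_compose_add hs_compose_scaleR hs_compose_rank_one)

lemma elementary_integral_map_linear:
  assumes "linear f"
  shows "elementary_integral W (map_elementary f xs) \<omega> = f (elementary_integral W xs \<omega>)"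
  by (induction xs)
    (auto simp: elementary_integral_def map_elementary_def linear_add[OF assms] linear_scale[OF assms] linear_0[OF assms])

lemma elementary_integral_map:
  "elementary_integral W (map_elementary (blinfun_apply B) xs) \<omega> = B (elementary_integral W xs \<omega>)"
  by (rule elementary_integral_map_linear) (rule bounded_linear.linear[OF blinfun.bounded_linear_right])

context wiener_filtration
begin

abbreviation Q :: "(real \<times> 'w) measure" where "Q \<equiv> lborel \<Otimes>\<^sub>M M"

abbreviation EI :: "('w, 'k, 'h::{real_inner, banach, second_countable_topology}) elementary \<Rightarrow> 'w \<Rightarrow> 'h" where
  "EI \<equiv> elementary_integral W"

abbreviation EP :: "('w, 'k, 'h::{real_inner, banach, second_countable_topology}) elementary \<Rightarrow> real \<times> 'w \<Rightarrow> ('k, 'h) hs" where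
  "EP xs \<equiv> \<lambda>p. elementary_process xs (fst p) (snd p)"

lemma EP_single: "EP [(s, t, G, \<phi>, h)] = (\<lambda>p. indicator ({s<..t} \<times> G) p *\<^sub>R rank_one h \<phi>)"
  by (auto simp: elementary_process_def indicator_def)

lemma EI_single: "EI [(s, t, G, \<phi>, h)] = (\<lambda>\<omega>. (indicator G \<omega> * D s t \<phi> \<omega>) *\<^sub>R h)"
  by (auto simp: elementary_integral_def)

lemma EP_single_L2:
  assumes "elementary_on F a b [x]" "0 \<le> a"
  shows "L2 Q (EP [x])"
proof -
  obtain s t G \<phi> h where x: "x = (s, t, G, \<phi>, h)" by (cases x)
  have G: "G \<in> sets M" "s \<le> t" using assms F_subset[of s] by (auto simp: x elementary_on_def)
  have "emeasure Q ({s<..t} \<times> G) < \<infinity>"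
    using G by (simp add: emeasure_pair_measure_Times ennreal_mult_less_top emeasure_eq_measure)
  then show ?thesis unfolding x EP_single using G by (intro L2_indicator) auto
qed

lemma EI_single_L2:
  assumes "elementary_on F a b [x]" "0 \<le> a"
  shows "L2 M (EI [x])" "EI [x] \<in> borel_measurable (F b)"
proof -
  obtain s t G \<phi> h where x: "x = (s, t, G, \<phi>, h)" by (cases x)
  have s: "0 \<le> s" "s \<le> t" "t \<le> b" and G: "G \<in> sets (F s)" "G \<in> sets M"
    using assms F_subset[of s] by (auto simp: x elementary_on_def)
  have "(indicator G :: 'w \<Rightarrow> real) \<in> borel_measurable (F s)" using G by simp
  then have "(indicator G :: 'w \<Rightarrow> real) \<in> borel_measurable (F b)"
    by (rule F_measurable_mono) (use s in auto)
  moreover have "D s t \<phi> \<in> borel_measurable (F b)"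
    using D_measurable[OF s(1,2)] by (rule F_measurable_mono) (use s in auto)
  ultimately show m: "EI [x] \<in> borel_measurable (F b)" unfolding x EI_single by simp
  show "L2 M (EI [x])"
  proof (rule L2_bound(1))
    show "EI [x] \<in> borel_measurable M" using F_measurable[OF m] s by simp
    show "L2 M (D s t \<phi>)" by (rule D_L2) (use s in auto)
    show "AE \<omega> in M. norm (EI [x] \<omega>) \<le> norm h * norm (D s t \<phi> \<omega>)"
      unfolding x EI_single by (auto simp: indicator_def)
  qed simp
qed

lemma E_L2:
  assumes "elementary_on F a b xs" "0 \<le> a"
  shows "L2 Q (EP xs)" "L2 M (EI xs)" "EI xs \<in> borel_measurable (F b)"
proof -
  have "L2 Q (EP xs) \<and> L2 M (EI xs) \<and> EI xs \<in> borel_measurable (F b)"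
    using assms(1)
  proof (induction xs)
    case Nil
    show ?case by simp
  next
    case (Cons x xs)
    then have 1: "elementary_on F a b [x]" and 2: "elementary_on F a b xs"
      using elementary_on_Cons by blast+
    show ?case
      using L2_add[of Q "EP [x]" "EP xs"] L2_add[of M "EI [x]" "EI xs"]
        borel_measurable_add[of "EI [x]" "F b" "EI xs"]
        EP_single_L2[OF 1 assms(2)] EI_single_L2[OF 1 assms(2)] Cons.IH[OF 2]
      by (simp add: elementary_process_append[of "[x]" xs, simplified]
          elementary_integral_append[of W "[x]" xs, simplified])
  qed
  then show "L2 Q (EP xs)" "L2 M (EI xs)" "EI xs \<in> borel_measurable (F b)" by auto
qed

text \<open>The covariance of two increments is the length of the overlap times the probability of
  the common event times the inner product of the directions. The first two factors are the
  \<open>Q\<close>-measure of the intersection of the two rectangles, the last is the inner product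
  of the rank one operators up to h . h'.\<close>

lemma ip_single:
  assumes x: "elementary_on F a b [x]" "0 \<le> a" and y: "elementary_on F a' b' [y]" "0 \<le> a'"
  shows "ip M (EI [x]) (EI [y]) = ip Q (EP [x]) (EP [y])"
proof -
  obtain s t G \<phi> h where x': "x = (s, t, G, \<phi>, h)" by (cases x)
  obtain s' t' G' \<phi>' h' where y': "y = (s', t', G', \<phi>', h')" by (cases y)
  have s: "0 \<le> s" "s \<le> t" and G: "G \<in> sets (F s)" "G \<in> sets M"
    using x F_subset[of s] by (auto simp: x' elementary_on_def)
  have s': "0 \<le> s'" "s' \<le> t'" and G': "G' \<in> sets (F s')" "G' \<in> sets M"
    using y F_subset[of s'] by (auto simp: y' elementary_on_def)
  have "ip M (EI [x]) (EI [y]) = expectation (\<lambda>\<omega>. (indicator G \<omega> * D s t \<phi> \<omega>) * (indicator G' \<omega> * D s' t' \<phi>' \<omega>) * (h \<bullet> h'))"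
    unfolding x' y' EI_single ip_def by (simp add: mult_ac)
  also have "\<dots> = max 0 (min t t' - max s s') * prob (G \<inter> G') * (\<phi> \<bullet> \<phi>') * (h \<bullet> h')"
    using D_covariance[OF s s' G(1) G'(1)] by (subst integral_mult_left_zero) simp
  also have "\<dots> = ip Q (EP [x]) (EP [y])"
  proof -
    have "({s<..t} \<times> G) \<inter> ({s'<..t'} \<times> G') = {max s s'<..min t t'} \<times> (G \<inter> G')" by auto
    moreover have "measure Q ({max s s'<..min t t'} \<times> (G \<inter> G')) = max 0 (min t t' - max s s') * prob (G \<inter> G')"
    proof -
      have m: "{max s s'<..min t t'} \<in> sets lborel" "G \<inter> G' \<in> sets M" using G G' by auto
      have "measure Q ({max s s'<..min t t'} \<times> (G \<inter> G')) = measure lborel {max s s'<..min t t'} * prob (G \<inter> G')"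
        unfolding measure_def emeasure_pair_measure_Times[OF m] enn2real_mult ..
      moreover have "measure lborel {c<..d} = max 0 (d - c)" for c d :: real
        by (cases "c \<le> d") (simp_all add: measure_def)
      ultimately show ?thesis by simp
    qed
    ultimately have "ip Q (EP [x]) (EP [y]) = max 0 (min t t' - max s s') * prob (G \<inter> G') * (rank_one h \<phi> \<bullet> rank_one h' \<phi>')"
      unfolding x' y' EP_single using G G' by (subst ip_indicator) auto
    then show ?thesis by (simp add: inner_rank_one mult_ac)
  qed
  finally show ?thesis .
qed

lemma ip_elementary:
  assumes xs: "elementary_on F a b xs" "0 \<le> a" and ys: "elementary_on F a' b' ys" "0 \<le> a'"
  shows "ip M (EI xs) (EI ys) = ip Q (EP xs) (EP ys)"
proof -
  have single: "ip M (EI xs) (EI [y]) = ip Q (EP xs) (EP [y])" if y: "elementary_on F a' b' [y]" for y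
    using xs(1)
  proof (induction xs)
    case (Cons x xs)
    then have 1: "elementary_on F a b [x]" and 2: "elementary_on F a b xs"
      using elementary_on_Cons by blast+
    show ?case
      using ip_add_left[OF E_L2(1)[OF 1 xs(2)] E_L2(1)[OF 2 xs(2)] E_L2(1)[OF y ys(2)]]
        ip_add_left[OF E_L2(2)[OF 1 xs(2)] E_L2(2)[OF 2 xs(2)] E_L2(2)[OF y ys(2)]]
        ip_single[OF 1 xs(2) y ys(2)] Cons.IH[OF 2]
      by (simp add: elementary_process_append[of "[x]" xs, simplified]
          elementary_integral_append[of W "[x]" xs, simplified])
  qed simp
  show ?thesis
    using ys(1)
  proof (induction ys)
    case (Cons y ys')
    then have 1: "elementary_on F a' b' [y]" and 2: "elementary_on F a' b' ys'"
      using elementary_on_Cons by blast+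
    show ?case
      using ip_add_right[OF E_L2(1)[OF 1 ys(2)] E_L2(1)[OF 2 ys(2)] E_L2(1)[OF xs]]
        ip_add_right[OF E_L2(2)[OF 1 ys(2)] E_L2(2)[OF 2 ys(2)] E_L2(2)[OF xs]]
        single[OF 1] Cons.IH[OF 2]
      by (simp add: elementary_process_append[of "[y]" ys', simplified]
          elementary_integral_append[of W "[y]" ys', simplified])
  qed simp
qed

lemma elementary_isometry:
  assumes "elementary_on F a b xs" "0 \<le> a"
  shows "n2 M (EI xs) = n2 Q (EP xs)"
  using ip_elementary[OF assms assms] by (simp add: ip_self)

definition scale_elementary :: "real \<Rightarrow> ('w, 'k, 'h::{real_inner, banach, second_countable_topology}) elementary \<Rightarrow> ('w, 'k, 'h) elementary" where
  "scale_elementary c = map_elementary (blinfun_apply (c *\<^sub>R id_blinfun))"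

lemma elementary_on_scale [simp]: "elementary_on F a b (scale_elementary c xs) \<longleftrightarrow> elementary_on F a b xs"
  by (simp add: scale_elementary_def)

lemma EP_scale:
  fixes xs :: "('w, 'k, 'h::{real_inner, banach, second_countable_topology}) elementary"
  shows "EP (scale_elementary c xs) = (\<lambda>p. c *\<^sub>R EP xs p)"
proof -
  have "hs_compose (c *\<^sub>R id_blinfun) Z = c *\<^sub>R Z" for Z :: "('k, 'h) hs"
    by (rule hs_eqI) (simp add: scaleR_hs.rep_eq blinfun.scaleR_left)
  then show ?thesis by (simp add: scale_elementary_def elementary_process_map)
qed

lemma EI_scale: "EI (scale_elementary c xs) = (\<lambda>\<omega>. c *\<^sub>R EI xs \<omega>)"
  by (rule ext) (simp add: scale_elementary_def elementary_integral_map blinfun.scaleR_left)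

lemma elementary_isometry_diff:
  assumes "elementary_on F a b xs" "elementary_on F a b ys" "0 \<le> a"
  shows "n2 M (\<lambda>\<omega>. EI xs \<omega> - EI ys \<omega>) = n2 Q (\<lambda>p. EP xs p - EP ys p)"
proof -
  have "EP (xs @ scale_elementary (-1) ys) = (\<lambda>p. EP xs p - EP ys p)"
    using EP_scale[of "-1" ys] by (simp add: elementary_process_append fun_eq_iff)
  moreover have "EI (xs @ scale_elementary (-1) ys) = (\<lambda>\<omega>. EI xs \<omega> - EI ys \<omega>)"
    using EI_scale[of "-1" ys] by (simp add: elementary_integral_append fun_eq_iff)
  ultimately show ?thesis
    using elementary_isometry[of a b "xs @ scale_elementary (-1) ys"] assms by simp
qed

text \<open>The martingale property, phrased as orthogonality to every square integrable variable
  known at time a. In this form it passes to limits by continuity of the inner product.\<close>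

lemma EI_orthogonal_past:
  assumes xs: "elementary_on F a b xs" "0 \<le> a" and U: "L2 M U" "U \<in> borel_measurable (F a)"
  shows "ip M U (EI xs) = 0"
  using xs(1)
proof (induction xs)
  case (Cons x xs)
  then have 1: "elementary_on F a b [x]" and 2: "elementary_on F a b xs"
    using elementary_on_Cons by blast+
  obtain s t G \<phi> h where x: "x = (s, t, G, \<phi>, h)" by (cases x)
  have s: "a \<le> s" "s \<le> t" and G: "G \<in> sets (F s)" "G \<in> sets M"
    using 1 xs(2) F_subset[of s] by (auto simp: x elementary_on_def)
  have s0: "0 \<le> s" using s xs by simp
  have "ip M U (EI [x]) = expectation (\<lambda>\<omega>. (indicator G \<omega> * (U \<omega> \<bullet> h)) * D s t \<phi> \<omega>)"
    unfolding ip_def x EI_single by (simp add: mult_ac)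
  also have "\<dots> = 0"
  proof (rule D_orthogonal_past(2)[OF s0 s(2)])
    have "(\<lambda>\<omega>. U \<omega> \<bullet> h) \<in> borel_measurable (F s)"
      using F_measurable_mono[OF U(2) xs(2) s(1)] by simp
    then show "(\<lambda>\<omega>. indicator G \<omega> * (U \<omega> \<bullet> h)) \<in> borel_measurable (F s)" using G by simp
    have "integrable M (\<lambda>\<omega>. U \<omega> \<bullet> h)"
      by (intro L2_inner_integrable U(1)) (simp add: L2_def)
    from integrable_real_mult_indicator[OF G(2) this]
    show "integrable M (\<lambda>\<omega>. indicator G \<omega> * (U \<omega> \<bullet> h))" by (simp add: mult.commute)
  qed
  finally have "ip M U (EI [x]) = 0" .
  then show ?case
    using ip_add_right[OF E_L2(2)[OF 1 xs(2)] E_L2(2)[OF 2 xs(2)] U(1)] Cons.IH[OF 2]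
    by (simp add: elementary_integral_append[of W "[x]" xs, simplified])
qed simp

end

section \<open>The stochastic integral\<close>

context wiener_filtration
begin

definition ito :: "real \<Rightarrow> real \<Rightarrow> (real \<times> 'w \<Rightarrow> ('k, 'h::{real_inner, banach, second_countable_topology}) hs) \<Rightarrow> ('w \<Rightarrow> 'h) \<Rightarrow> bool" where
  "ito a b \<Phi> I \<longleftrightarrow> (\<exists>xs. (\<forall>n. elementary_on F a b (xs n)) \<and> tends2 Q (\<lambda>n. EP (xs n)) \<Phi> \<and> tends2 M (\<lambda>n. EI (xs n)) I)"

text \<open>The closure of the elementary integrands. Inside the proof this closure describes the
  admissible integrands; progressive measurability is established only when the final versions are
  chosen.\<close>

definition approx :: "real \<Rightarrow> real \<Rightarrow> (real \<times> 'w \<Rightarrow> ('k, 'h::{real_inner, banach, second_countable_topology}) hs) \<Rightarrow> bool" where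
  "approx a b \<Phi> \<longleftrightarrow> (\<exists>xs. (\<forall>n. elementary_on F a b (xs n)) \<and> tends2 Q (\<lambda>n. EP (xs n)) \<Phi>)"

lemma ito_approx: "ito a b \<Phi> I \<Longrightarrow> approx a b \<Phi>"
  by (auto simp: ito_def approx_def)

lemma approx_L2: "approx a b \<Phi> \<Longrightarrow> L2 Q \<Phi>"
  by (auto simp: approx_def tends2_def)

lemma ito_L2: "ito a b \<Phi> I \<Longrightarrow> L2 Q \<Phi>" "ito a b \<Phi> I \<Longrightarrow> L2 M I"
  by (auto simp: ito_def tends2_def)

lemma ito_mono: "ito a b \<Phi> I \<Longrightarrow> a' \<le> a \<Longrightarrow> b \<le> b' \<Longrightarrow> ito a' b' \<Phi> I"
  unfolding ito_def using elementary_on_mono by blast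

lemma approx_mono: "approx a b \<Phi> \<Longrightarrow> a' \<le> a \<Longrightarrow> b \<le> b' \<Longrightarrow> approx a' b' \<Phi>"
  unfolding approx_def using elementary_on_mono by blast

lemma ito_elementary: "elementary_on F a b xs \<Longrightarrow> 0 \<le> a \<Longrightarrow> ito a b (EP xs) (EI xs)"
  unfolding ito_def by (intro exI[of _ "\<lambda>n. xs"]) (simp add: tends2_const E_L2)

lemma ito_isometry:
  assumes "ito a b \<Phi> I" "0 \<le> a"
  shows "n2 M I = n2 Q \<Phi>"
proof -
  obtain xs where xs: "\<And>n. elementary_on F a b (xs n)" "tends2 Q (\<lambda>n. EP (xs n)) \<Phi>" "tends2 M (\<lambda>n. EI (xs n)) I"
    using assms(1) by (auto simp: ito_def)
  show ?thesis
    using LIMSEQ_unique[OF tends2_n2[OF xs(3)]] tends2_n2[OF xs(2)] elementary_isometry[OF xs(1) assms(2)]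
    by simp
qed

lemma ito_add:
  assumes "ito a b \<Phi> I" "ito a b \<Psi> J"
  shows "ito a b (\<lambda>p. \<Phi> p + \<Psi> p) (\<lambda>\<omega>. I \<omega> + J \<omega>)"
proof -
  obtain xs where xs: "\<And>n. elementary_on F a b (xs n)" "tends2 Q (\<lambda>n. EP (xs n)) \<Phi>" "tends2 M (\<lambda>n. EI (xs n)) I"
    using assms(1) by (auto simp: ito_def)
  obtain ys where ys: "\<And>n. elementary_on F a b (ys n)" "tends2 Q (\<lambda>n. EP (ys n)) \<Psi>" "tends2 M (\<lambda>n. EI (ys n)) J"
    using assms(2) by (auto simp: ito_def)
  have "EI (xs n @ ys n) = (\<lambda>\<omega>. EI (xs n) \<omega> + EI (ys n) \<omega>)" for n
    by (simp add: elementary_integral_append fun_eq_iff)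
  then show ?thesis
    unfolding ito_def
    using tends2_add[OF xs(2) ys(2)] tends2_add[OF xs(3) ys(3)] xs(1) ys(1)
    by (intro exI[of _ "\<lambda>n. xs n @ ys n"]) (simp add: elementary_process_append)
qed

text \<open>A bounded operator acts on the vectors h of an elementary integrand, hence passes
  through elementary integrals exactly and through limits by boundedness.\<close>

lemma ito_compose:
  fixes B :: "'h::{real_inner, banach, second_countable_topology} \<Rightarrow>\<^sub>L 'h"
  assumes "ito a b \<Phi> I"
  shows "ito a b (\<lambda>p. hs_compose B (\<Phi> p)) (\<lambda>\<omega>. B (I \<omega>))"
proof -
  obtain xs where xs: "\<And>n. elementary_on F a b (xs n)" "tends2 Q (\<lambda>n. EP (xs n)) \<Phi>" "tends2 M (\<lambda>n. EI (xs n)) I"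
    using assms(1) by (auto simp: ito_def)
  have "EI (map_elementary (blinfun_apply B) (xs n)) = (\<lambda>\<omega>. B (EI (xs n) \<omega>))" for n
    by (simp add: elementary_integral_map fun_eq_iff)
  then show ?thesis
    unfolding ito_def
    using tends2_linear[OF xs(2) bounded_linear_hs_compose[of B]] tends2_linear[OF xs(3) blinfun.bounded_linear_right[of B]] xs(1)
    by (intro exI[of _ "\<lambda>n. map_elementary (blinfun_apply B) (xs n)"])
      (simp add: elementary_process_map)
qed

lemma ito_scaleR:
  fixes I :: "'w \<Rightarrow> 'h::{real_inner, banach, second_countable_topology}"
  assumes "ito a b \<Phi> I"
  shows "ito a b (\<lambda>p. c *\<^sub>R \<Phi> p) (\<lambda>\<omega>. c *\<^sub>R I \<omega>)"
proof -
  have "hs_compose (c *\<^sub>R id_blinfun) Z = c *\<^sub>R Z" for Z :: "('k, 'h) hs"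
    by (rule hs_eqI) (simp add: scaleR_hs.rep_eq blinfun.scaleR_left)
  then show ?thesis using ito_compose[OF assms, of "c *\<^sub>R id_blinfun"] by (simp add: blinfun.scaleR_left)
qed

lemma ito_diff:
  assumes "ito a b \<Phi> I" "ito a b \<Psi> J"
  shows "ito a b (\<lambda>p. \<Phi> p - \<Psi> p) (\<lambda>\<omega>. I \<omega> - J \<omega>)"
  using ito_add[OF assms(1) ito_scaleR[OF assms(2), of "-1"]] by simp

lemma ito_cong_AE:
  assumes "ito a b \<Phi> I" "AE p in Q. \<Phi> p = \<Psi> p" "L2 Q \<Psi>" "AE \<omega> in M. I \<omega> = J \<omega>" "L2 M J"
  shows "ito a b \<Psi> J"
proof -
  obtain xs where xs: "\<And>n. elementary_on F a b (xs n)" "tends2 Q (\<lambda>n. EP (xs n)) \<Phi>" "tends2 M (\<lambda>n. EI (xs n)) I"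
    using assms(1) by (auto simp: ito_def)
  have "tends2 Q (\<lambda>n. EP (xs n)) \<Psi>"
    by (rule tends2_cong_AE[OF xs(2) _ assms(2)]) (use tends2_L2[OF xs(2)] assms in auto)
  moreover have "tends2 M (\<lambda>n. EI (xs n)) J"
    by (rule tends2_cong_AE[OF xs(3) _ assms(4)]) (use tends2_L2[OF xs(3)] assms in auto)
  ultimately show ?thesis unfolding ito_def using xs(1) by blast
qed

lemma ito_unique_AE:
  assumes "ito a b \<Phi> I" "ito a b \<Psi> J" "AE p in Q. \<Phi> p = \<Psi> p" "0 \<le> a"
  shows "AE \<omega> in M. I \<omega> = J \<omega>"
proof -
  have "n2 M (\<lambda>\<omega>. I \<omega> - J \<omega>) = n2 Q (\<lambda>p. \<Phi> p - \<Psi> p)"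
    by (rule ito_isometry[OF ito_diff[OF assms(1,2)] assms(4)])
  also have "\<dots> = 0" using assms n2_diff_0_AE[of Q \<Phi> \<Psi>] by (simp add: ito_L2)
  finally show ?thesis using assms n2_diff_0_AE[of M I J] by (simp add: ito_L2)
qed

text \<open>By the isometry the elementary integrals form a Cauchy sequence together with the
  integrands. The pointwise \<open>lim\<close> along a subsequence is a version that is measurable
  for F b outright.\<close>

lemma approx_ito:
  assumes "approx a b \<Phi>" "0 \<le> a"
  obtains I where "ito a b \<Phi> I" "I \<in> borel_measurable (F b)"
proof -
  obtain xs where xs: "\<And>n. elementary_on F a b (xs n)" "tends2 Q (\<lambda>n. EP (xs n)) \<Phi>"
    using assms(1) by (auto simp: approx_def)
  note L = E_L2[OF xs(1) assms(2)]
  obtain r where r: "strict_mono (r :: nat \<Rightarrow> nat)" "tends2 M (\<lambda>n. EI (xs n)) (\<lambda>\<omega>. lim (\<lambda>n. EI (xs (r n)) \<omega>))"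
  proof (rule L2_complete[where f = "\<lambda>n. EI (xs n)" and N = M])
    fix e :: real assume "e > 0"
    then show "\<exists>k. \<forall>m\<ge>k. \<forall>n\<ge>k. n2 M (\<lambda>\<omega>. EI (xs m) \<omega> - EI (xs n) \<omega>) < e"
      using tends2_Cauchy[OF xs(2)] elementary_isometry_diff[OF xs(1) xs(1) assms(2)] by simp
  qed (use L in auto)
  have "(\<lambda>\<omega>. lim (\<lambda>n. EI (xs (r n)) \<omega>)) \<in> borel_measurable (F b)"
    by (intro borel_measurable_lim_metric L)
  then show thesis using that[of "\<lambda>\<omega>. lim (\<lambda>n. EI (xs (r n)) \<omega>)"] xs r(2) unfolding ito_def by blast
qed

lemma ito_measurable:
  assumes "ito a b \<Phi> I" "0 \<le> a" "a \<le> b"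
  shows "I \<in> borel_measurable (F b)"
proof -
  obtain J where J: "ito a b \<Phi> J" "J \<in> borel_measurable (F b)"
    using approx_ito[OF ito_approx[OF assms(1)] assms(2)] .
  have "AE \<omega> in M. J \<omega> = I \<omega>" using ito_unique_AE[OF J(1) assms(1) _ assms(2)] by simp
  then show ?thesis using F_measurable_AE[OF J(2)] assms by simp
qed

lemma ito_orthogonal:
  assumes "ito a b \<Phi> I" "0 \<le> a" "L2 M U" "U \<in> borel_measurable (F a)"
  shows "ip M U I = 0"
proof -
  obtain xs where xs: "\<And>n. elementary_on F a b (xs n)" "tends2 M (\<lambda>n. EI (xs n)) I"
    using assms(1) by (auto simp: ito_def)
  have "(\<lambda>n. ip M (EI (xs n)) U) \<longlonglongrightarrow> ip M I U" by (rule tends2_ip[OF xs(2) assms(3)])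
  then show ?thesis
    using EI_orthogonal_past[OF xs(1) assms(2-4)] by (simp add: ip_commute[of M _ U] LIMSEQ_const_iff)
qed

lemma approx_closed:
  assumes "\<And>n. approx a b (\<Phi> n)" "tends2 Q \<Phi> \<Psi>" "0 \<le> a"
  shows "approx a b \<Psi>"
proof -
  have "\<forall>n. \<exists>xs. elementary_on F a b xs \<and> n2 Q (\<lambda>p. EP xs p - \<Phi> n p) < 1 / real (Suc n)"
  proof
    fix n
    obtain xs where xs: "\<And>n. elementary_on F a b (xs n)" "tends2 Q (\<lambda>n. EP (xs n)) (\<Phi> n)"
      using assms(1)[of n] unfolding approx_def by blast
    then have "eventually (\<lambda>i. n2 Q (\<lambda>p. EP (xs i) p - \<Phi> n p) < 1 / real (Suc n)) sequentially"
      unfolding tends2_def by (intro order_tendstoD(2)[of _ 0]) auto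
    then show "\<exists>xs. elementary_on F a b xs \<and> n2 Q (\<lambda>p. EP xs p - \<Phi> n p) < 1 / real (Suc n)"
      using xs(1) by (auto simp: eventually_sequentially)
  qed
  from choice[OF this] obtain xs where xs: "\<And>n. elementary_on F a b (xs n)"
    "\<And>n. n2 Q (\<lambda>p. EP (xs n) p - \<Phi> n p) < 1 / real (Suc n)"
    by blast
  note L = E_L2(1)[OF xs(1) assms(3)]
  have "tends2 Q (\<lambda>n. EP (xs n)) \<Psi>"
  proof (rule tends2I)
    show "n2 Q (\<lambda>p. EP (xs n) p - \<Psi> p) \<le> 1 / real (Suc n) + n2 Q (\<lambda>p. \<Phi> n p - \<Psi> p)" for n
      using n2_triangle3[OF L tends2_L2[OF assms(2)], of n n] xs(2)[of n] by simp
    show "(\<lambda>n. 1 / real (Suc n) + n2 Q (\<lambda>p. \<Phi> n p - \<Psi> p)) \<longlonglongrightarrow> 0"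
      using tendsto_add[OF LIMSEQ_inverse_real_of_nat] assms(2)
      by (fastforce simp: tends2_def inverse_eq_divide)
  qed (use L tends2_L2[OF assms(2)] in auto)
  then show ?thesis unfolding approx_def using xs(1) by blast
qed

lemma approx_add:
  assumes "approx a b \<Phi>" "approx a b \<Psi>" "0 \<le> a"
  shows "approx a b (\<lambda>p. \<Phi> p + \<Psi> p)"
proof -
  obtain I where I: "ito a b \<Phi> I" using approx_ito[OF assms(1,3)] .
  obtain J where J: "ito a b \<Psi> J" using approx_ito[OF assms(2,3)] .
  show ?thesis by (rule ito_approx[OF ito_add[OF I J]])
qed

section \<open>Restriction of integrands to time intervals\<close>

definition cut :: "real \<Rightarrow> real \<Rightarrow> (real \<times> 'w \<Rightarrow> 'c::real_vector) \<Rightarrow> real \<times> 'w \<Rightarrow> 'c" where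
  "cut a b \<Phi> = (\<lambda>p. indicator {a<..b} (fst p) *\<^sub>R \<Phi> p)"

lemma norm_cut_le: "norm (cut a b \<Phi> p) \<le> norm (\<Phi> p :: 'c::real_normed_vector)"
  by (simp add: cut_def indicator_def)

lemma cut_measurable:
  fixes \<Phi> :: "real \<times> 'w \<Rightarrow> 'c::{real_inner, banach, second_countable_topology}"
  assumes "\<Phi> \<in> borel_measurable Q"
  shows "cut a b \<Phi> \<in> borel_measurable Q"
proof -
  have "(\<lambda>p::real \<times> 'w. indicator {a<..b} (fst p) :: real) \<in> borel_measurable Q" by measurable
  then show ?thesis unfolding cut_def using assms by (rule borel_measurable_scaleR)
qed

lemma L2_cut:
  assumes "L2 Q \<Phi>"
  shows "L2 Q (cut a b \<Phi>)" "n2 Q (cut a b \<Phi>) \<le> n2 Q \<Phi>"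
  using L2_bound[OF cut_measurable[OF L2_measurable[OF assms]] assms, of a b 1] by (simp_all add: norm_cut_le)

lemma cut_diff: "cut a b (\<lambda>p. \<Phi> p - \<Psi> p) = (\<lambda>p. cut a b \<Phi> p - cut a b \<Psi> p)"
  by (simp add: cut_def scaleR_diff_right)

lemma tends2_cut:
  assumes "tends2 Q f g"
  shows "tends2 Q (\<lambda>n. cut a b (f n)) (cut a b g)"
proof (rule tends2I)
  show "n2 Q (\<lambda>p. cut a b (f n) p - cut a b g p) \<le> n2 Q (\<lambda>p. f n p - g p)" for n
    unfolding cut_diff[symmetric] using assms by (intro L2_cut) (auto simp: tends2_def)
qed (use assms in \<open>auto simp: tends2_def L2_cut\<close>)

text \<open>A term that starts after b is replaced by an empty one at b, since its event G need not
  belong to F b. The outer \<open>max\<close> collapses a term that ends before a to an empty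
  interval at a.\<close>

definition cut_elementary :: "real \<Rightarrow> real \<Rightarrow> ('w, 'k, 'h::{real_inner, banach, second_countable_topology}) elementary \<Rightarrow> ('w, 'k, 'h) elementary" where
  "cut_elementary a b = map (\<lambda>(s, t, G, \<phi>, h).
    if s \<le> b then (max s a, max (max s a) (min t b), G, \<phi>, h) else (b, b, {}, \<phi>, h))"

lemma elementary_on_cut:
  assumes "elementary_on F a c xs" "0 \<le> a" "a \<le> a'" "a' \<le> b'"
  shows "elementary_on F a' b' (cut_elementary a' b' xs)"
  unfolding elementary_on_def
proof (safe)
  fix s' t' G' \<phi>' h' assume "(s', t', G', \<phi>', h') \<in> set (cut_elementary a' b' xs)"
  then obtain s t G \<phi> h where st: "(s, t, G, \<phi>, h) \<in> set xs"
    and eq: "(s', t', G', \<phi>', h') = (if s \<le> b' then (max s a', max (max s a') (min t b'), G, \<phi>, h) else (b', b', {}, \<phi>, h))"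
    unfolding cut_elementary_def by auto
  have "0 \<le> s" "G \<in> sets (F s)" using assms st by (auto simp: elementary_on_def)
  then have G: "G \<in> sets (F (max s a'))" using F_mono[of s "max s a'"] by auto
  show "a' \<le> s'" "s' \<le> t'" "t' \<le> b'" "G' \<in> sets (F s')"
    using eq G assms(3,4) by (auto split: if_splits)
qed

lemma EP_cut_elementary: "EP (cut_elementary a b xs) = cut a b (EP xs)"
proof (rule ext)
  fix p
  show "EP (cut_elementary a b xs) p = cut a b (EP xs) p"
  proof (induction xs)
    case Nil
    show ?case by (simp add: cut_elementary_def cut_def)
  next
    case (Cons x xs)
    obtain s t G \<phi> h where x: "x = (s, t, G, \<phi>, h)" by (cases x)
    have "EP (cut_elementary a b [x]) p = cut a b (EP [x]) p"
      by (auto simp: cut_elementary_def cut_def elementary_process_def x indicator_def)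
    then show ?case
      using Cons.IH elementary_process_append[of "[x]" xs "fst p" "snd p"]
        elementary_process_append[of "cut_elementary a b [x]" "cut_elementary a b xs" "fst p" "snd p"]
      by (simp add: cut_elementary_def cut_def scaleR_add_right)
  qed
qed

lemma approx_cut:
  assumes "approx a c \<Phi>" "0 \<le> a" "a \<le> a'" "a' \<le> b'"
  shows "approx a' b' (cut a' b' \<Phi>)"
proof -
  obtain xs where xs: "\<And>n. elementary_on F a c (xs n)" "tends2 Q (\<lambda>n. EP (xs n)) \<Phi>"
    using assms(1) by (auto simp: approx_def)
  show ?thesis
    unfolding approx_def
    using elementary_on_cut[OF xs(1) assms(2-4)] tends2_cut[OF xs(2), of a' b']
    by (intro exI[of _ "\<lambda>n. cut_elementary a' b' (xs n)"]) (simp add: EP_cut_elementary)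
qed

lemma EP_support:
  assumes "elementary_on F a b xs"
  shows "cut a b (EP xs) = EP xs"
proof (rule ext)
  fix p
  show "cut a b (EP xs) p = EP xs p"
    using assms
  proof (induction xs)
    case (Cons x xs)
    then have 1: "elementary_on F a b [x]" and 2: "elementary_on F a b xs"
      using elementary_on_Cons by blast+
    have "cut a b (EP [x]) p = EP [x] p"
      using 1 by (cases x) (auto simp: cut_def elementary_process_def elementary_on_def indicator_def)
    then show ?case
      using Cons.IH[OF 2] elementary_process_append[of "[x]" xs "fst p" "snd p"]
      by (simp add: cut_def scaleR_add_right)
  qed (simp add: cut_def)
qed

lemma approx_support:
  assumes "approx a b \<Phi>"
  shows "AE p in Q. cut a b \<Phi> p = \<Phi> p"
proof -
  obtain xs where xs: "\<And>n. elementary_on F a b (xs n)" "tends2 Q (\<lambda>n. EP (xs n)) \<Phi>"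
    using assms(1) by (auto simp: approx_def)
  show ?thesis
    using tends2_unique[OF tends2_cut[OF xs(2), of a b]] xs(2) by (simp add: EP_support[OF xs(1)])
qed

lemma ito_split:
  assumes I: "ito a c \<Phi> I" and a: "0 \<le> a" "a \<le> b" "b \<le> c"
  obtains I1 I2 where "ito a b (cut a b \<Phi>) I1" "ito b c (cut b c \<Phi>) I2" "AE \<omega> in M. I \<omega> = I1 \<omega> + I2 \<omega>"
proof -
  note ap = ito_approx[OF I]
  obtain I1 where I1: "ito a b (cut a b \<Phi>) I1"
    using approx_ito[OF approx_cut[OF ap a(1) order_refl a(2)] a(1)] by blast
  obtain I2 where I2: "ito b c (cut b c \<Phi>) I2"
    using approx_ito[OF approx_cut[OF ap a(1) a(2) a(3)]] a by (meson order_trans)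
  have "ito a c (\<lambda>p. cut a b \<Phi> p + cut b c \<Phi> p) (\<lambda>\<omega>. I1 \<omega> + I2 \<omega>)"
    by (intro ito_add ito_mono[OF I1] ito_mono[OF I2]) (use a in auto)
  moreover have "AE p in Q. \<Phi> p = cut a b \<Phi> p + cut b c \<Phi> p"
    using approx_support[OF ap] by eventually_elim (use a in \<open>auto simp: cut_def indicator_def split: if_splits\<close>)
  ultimately have "AE \<omega> in M. I \<omega> = I1 \<omega> + I2 \<omega>" using ito_unique_AE[OF I] a by blast
  then show thesis using that I1 I2 by blast
qed

lemma pair_identity_measurable:
  "(\<lambda>p. p) \<in> measurable (restrict_space Q ({a..b} \<times> space M)) (restrict_space borel {a..b} \<Otimes>\<^sub>M M)"
proof (rule measurable_pair)
  show "fst \<circ> (\<lambda>p. p) \<in> measurable (restrict_space Q ({a..b} \<times> space M)) (restrict_space borel {a..b})"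
    by (rule measurable_restrict_space2)
      (auto simp: space_restrict_space intro!: measurable_restrict_space1)
  show "snd \<circ> (\<lambda>p. p) \<in> measurable (restrict_space Q ({a..b} \<times> space M)) M"
    by (auto intro!: measurable_restrict_space1)
qed

lemma restricted_process_measurable:
  fixes f :: "real \<Rightarrow> 'w \<Rightarrow> 'c::{real_inner, banach, second_countable_topology}"
  assumes "(\<lambda>(r, \<omega>). f r \<omega>) \<in> borel_measurable (restrict_space borel {a..b} \<Otimes>\<^sub>M M)"
  shows "(\<lambda>p. indicator {a..b} (fst p) *\<^sub>R f (fst p) (snd p)) \<in> borel_measurable Q"
proof -
  have "(\<lambda>p. f (fst p) (snd p)) \<in> borel_measurable (restrict_space Q ({a..b} \<times> space M))"
    using measurable_compose[OF pair_identity_measurable assms] by (simp add: case_prod_unfold)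
  then have "(\<lambda>p. indicator ({a..b} \<times> space M) p *\<^sub>R f (fst p) (snd p)) \<in> borel_measurable Q"
    by (subst (asm) borel_measurable_restrict_space_iff) (auto simp: space_pair_measure)
  then show ?thesis
    by (rule measurable_cong[THEN iffD1, rotated]) (auto simp: space_pair_measure indicator_def)
qed

lemma nn_integral_Q_swap:
  assumes "f \<in> borel_measurable Q"
  shows "(\<integral>\<^sup>+\<omega>. \<integral>\<^sup>+r. f (r, \<omega>) \<partial>lborel \<partial>M) = (\<integral>\<^sup>+p. f p \<partial>Q)"
proof -
  interpret pair_sigma_finite lborel M ..
  show ?thesis using nn_integral_snd[of f] assms by simp
qed

lemma elementary_error:
  assumes f: "(\<lambda>(r, \<omega>). f r \<omega>) \<in> borel_measurable (restrict_space borel {a..b} \<Otimes>\<^sub>M M)"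
    and xs: "elementary_on F a b xs" "0 \<le> a"
  shows "(\<integral>\<^sup>+\<omega>. (\<integral>\<^sup>+r\<in>{a..b}. ennreal ((norm (elementary_process xs r \<omega> - f r \<omega>))\<^sup>2) \<partial>lborel) \<partial>M)
    = (\<integral>\<^sup>+p. ennreal ((norm (EP xs p - indicator {a..b} (fst p) *\<^sub>R f (fst p) (snd p)))\<^sup>2) \<partial>Q)"
proof -
  let ?g = "\<lambda>p. ennreal ((norm (EP xs p - indicator {a..b} (fst p) *\<^sub>R f (fst p) (snd p)))\<^sup>2)"
  have m: "?g \<in> borel_measurable Q"
    by (rule measurable_compose[OF borel_measurable_diff[OF L2_measurable[OF E_L2(1)[OF xs]]
      restricted_process_measurable[OF f]], of "\<lambda>x. ennreal ((norm x)\<^sup>2)"]) simp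
  have "ennreal ((norm (elementary_process xs r \<omega> - f r \<omega>))\<^sup>2) * indicator {a..b} r = ?g (r, \<omega>)" for r \<omega>
  proof (cases "r \<in> {a..b}")
    case False
    then have "elementary_process xs r \<omega> = 0"
      using fun_cong[OF EP_support[OF xs(1)], of "(r, \<omega>)"] by (auto simp: cut_def indicator_def split: if_splits)
    then show ?thesis using False by simp
  qed simp
  then show ?thesis using nn_integral_Q_swap[OF m] by simp
qed

text \<open>\<open>has_ito_integral\<close> constrains the integrand on [a, b] only, while
  \<open>ito\<close> compares functions on the whole product space; hence the extension by 0.
  Elementary processes vanish off (a, b], so both measure the same error.\<close>

lemma has_ito_integral_iff:
  assumes a: "0 \<le> a"
  shows "has_ito_integral M F W a b f I \<longleftrightarrow>
    (\<lambda>(r, \<omega>). f r \<omega>) \<in> borel_measurable (restrict_space borel {a..b} \<Otimes>\<^sub>M M) \<and>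
    ito a b (\<lambda>p. indicator {a..b} (fst p) *\<^sub>R f (fst p) (snd p)) I"
proof -
  let ?f = "\<lambda>p. indicator {a..b} (fst p) *\<^sub>R f (fst p) (snd p)"
  have "has_ito_integral M F W a b f I \<longleftrightarrow> ito a b ?f I"
    if f: "(\<lambda>(r, \<omega>). f r \<omega>) \<in> borel_measurable (restrict_space borel {a..b} \<Otimes>\<^sub>M M)"
  proof -
    have m: "?f \<in> borel_measurable Q" by (rule restricted_process_measurable[OF f])
    have 1: "(\<lambda>n. \<integral>\<^sup>+\<omega>. (\<integral>\<^sup>+r\<in>{a..b}. ennreal ((norm (elementary_process (xs n) r \<omega> - f r \<omega>))\<^sup>2) \<partial>lborel) \<partial>M) \<longlonglongrightarrow> 0
        \<longleftrightarrow> tends2 Q (\<lambda>n. EP (xs n)) ?f" if "\<And>n. elementary_on F a b (xs n)" for xs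
      using tends2_nn_iff[OF E_L2(1)[OF that a] m] elementary_error[OF f that a] by simp
    have 2: "(\<lambda>n. \<integral>\<^sup>+\<omega>. ennreal ((norm (EI (xs n) \<omega> - I \<omega>))\<^sup>2) \<partial>M) \<longlonglongrightarrow> 0 \<longleftrightarrow> tends2 M (\<lambda>n. EI (xs n)) I"
      if "\<And>n. elementary_on F a b (xs n)" "I \<in> borel_measurable M" for xs
      using tends2_nn_iff[OF E_L2(2)[OF that(1) a] that(2)] by simp
    have 3: "ito a b ?f I \<Longrightarrow> I \<in> borel_measurable M" using ito_L2(2) L2_measurable by blast
    show ?thesis
    proof
      assume "has_ito_integral M F W a b f I"
      then obtain xs where Im: "I \<in> borel_measurable M" and xs: "\<forall>n. elementary_on F a b (xs n)"
        and A: "(\<lambda>n. \<integral>\<^sup>+\<omega>. (\<integral>\<^sup>+r\<in>{a..b}. ennreal ((norm (elementary_process (xs n) r \<omega> - f r \<omega>))\<^sup>2) \<partial>lborel) \<partial>M) \<longlonglongrightarrow> 0"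
        and B: "(\<lambda>n. \<integral>\<^sup>+\<omega>. ennreal ((norm (EI (xs n) \<omega> - I \<omega>))\<^sup>2) \<partial>M) \<longlonglongrightarrow> 0"
        unfolding has_ito_integral_def by (elim conjE exE)
      note xs' = spec[OF xs]
      show "ito a b ?f I"
        unfolding ito_def by (intro exI[of _ xs] conjI xs 1[OF xs', THEN iffD1, OF A] 2[OF xs' Im, THEN iffD1, OF B])
    next
      assume i: "ito a b ?f I"
      then obtain xs where xs: "\<And>n. elementary_on F a b (xs n)" "tends2 Q (\<lambda>n. EP (xs n)) ?f" "tends2 M (\<lambda>n. EI (xs n)) I"
        unfolding ito_def by blast
      show "has_ito_integral M F W a b f I"
        unfolding has_ito_integral_def
        by (intro exI[of _ xs] conjI f 3[OF i] allI xs 1[OF xs(1), THEN iffD2, OF xs(2)]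
            2[OF xs(1) 3[OF i], THEN iffD2, OF xs(3)])
    qed
  qed
  moreover have "has_ito_integral M F W a b f I \<Longrightarrow> (\<lambda>(r, \<omega>). f r \<omega>) \<in> borel_measurable (restrict_space borel {a..b} \<Otimes>\<^sub>M M)"
    unfolding has_ito_integral_def by (elim conjE)
  ultimately show ?thesis by blast
qed

end

section \<open>Density of stochastic integrals\<close>

context wiener_filtration
begin

lemma L2_const [simp]: "L2 M (\<lambda>\<omega>. c)"
  by (simp add: L2_def)

lemma L2_bounded: "f \<in> borel_measurable M \<Longrightarrow> (\<And>\<omega>. norm (f \<omega>) \<le> B) \<Longrightarrow> L2 M f"
  by (rule L2_bound(1)[of f M "\<lambda>_. 1::real" "max B 0"]) (auto simp: le_max_iff_disj)

lemma L2_approx_simple: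
  fixes V :: "'w \<Rightarrow> 'h::{real_inner, banach, second_countable_topology}"
  assumes V: "L2 M V" "V \<in> borel_measurable (F p)" and p: "p \<ge> 0"
  obtains s where "\<And>n. simple_function (F p) (s n)" "tends2 M s V"
proof -
  obtain s where "\<forall>n. simple_function (F p) (s n)" "\<forall>x\<in>space (F p). (\<lambda>n. s n x) \<longlonglongrightarrow> V x"
    "\<forall>n. \<forall>x\<in>space (F p). dist (s n x) 0 \<le> 2 * dist (V x) 0"
    using borel_measurable_implies_sequence_metric[OF V(2), of 0] by blast
  then have s: "\<And>n. simple_function (F p) (s n)"
    and lim: "\<And>x. x \<in> space (F p) \<Longrightarrow> (\<lambda>n. s n x) \<longlonglongrightarrow> V x"
    and bnd: "\<And>n x. x \<in> space (F p) \<Longrightarrow> dist (s n x) 0 \<le> 2 * dist (V x) 0"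
    by blast+
  have sm: "s n \<in> borel_measurable M" for n
    using F_measurable[OF borel_measurable_simple_function[OF s] p] .
  have nb: "norm (s n x) \<le> 2 * norm (V x)" if "x \<in> space M" for n x
    using bnd[of x n] that by (simp add: space_F[OF p])
  have L: "L2 M (s n)" for n
    by (rule L2_bound(1)[OF sm V(1), of _ 2]) (use nb in auto)
  have Vm: "V \<in> borel_measurable M" using V(1) by (simp add: L2_def)
  have i0: "integrable M (\<lambda>x. 9 * (norm (V x))\<^sup>2)" using V(1) by (simp add: L2_def)
  have "(\<lambda>n. \<integral>x. (norm (s n x - V x))\<^sup>2 \<partial>M) \<longlonglongrightarrow> (\<integral>x. 0 \<partial>M)"
  proof (rule integral_dominated_convergence[OF _ _ i0])
    show "AE x in M. (\<lambda>n. (norm (s n x - V x))\<^sup>2) \<longlonglongrightarrow> 0"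
    proof (rule AE_I2)
      fix x assume "x \<in> space M"
      then have "(\<lambda>n. s n x - V x) \<longlonglongrightarrow> 0" using lim[of x] LIM_zero by (auto simp: space_F[OF p])
      then have "(\<lambda>n. (norm (s n x - V x))\<^sup>2) \<longlonglongrightarrow> (norm (0::'h))\<^sup>2" by (intro tendsto_intros)
      then show "(\<lambda>n. (norm (s n x - V x))\<^sup>2) \<longlonglongrightarrow> 0" by simp
    qed
    show "AE x in M. norm ((norm (s n x - V x))\<^sup>2) \<le> 9 * (norm (V x))\<^sup>2" for n
    proof (rule AE_I2)
      fix x assume "x \<in> space M"
      then have "norm (s n x - V x) \<le> 3 * norm (V x)"
        using norm_triangle_ineq4[of "s n x" "V x"] nb[of x n] by simp
      then have "(norm (s n x - V x))\<^sup>2 \<le> (3 * norm (V x))\<^sup>2" by (intro power_mono) auto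
      then show "norm ((norm (s n x - V x))\<^sup>2) \<le> 9 * (norm (V x))\<^sup>2" by (simp add: power_mult_distrib)
    qed
    show "(\<lambda>x. (norm (s n x - V x))\<^sup>2) \<in> borel_measurable M" for n
      using sm Vm by simp
  qed simp
  then have "(\<lambda>n. sqrt (\<integral>x. (norm (s n x - V x))\<^sup>2 \<partial>M)) \<longlonglongrightarrow> sqrt 0"
    by (intro tendsto_real_sqrt) simp
  then have "tends2 M s V" using L V(1) by (simp add: tends2_def n2_def)
  then show thesis using that s by blast
qed

text \<open>Induction over the square integrable F p-measurable variables through simple functions.
  The rule \<open>cong\<close> is present because a simple function agrees with its sum of
  indicators only on the space of M.\<close>

lemma L2_induct:
  fixes V :: "'w \<Rightarrow> 'h::{real_inner, banach, second_countable_topology}"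
  assumes V: "L2 M V" "V \<in> borel_measurable (F p)" and p: "p \<ge> 0"
    and ind: "\<And>G h. G \<in> sets (F p) \<Longrightarrow> P (\<lambda>\<omega>. indicator G \<omega> *\<^sub>R h)"
    and add: "\<And>f g. P f \<Longrightarrow> P g \<Longrightarrow> P (\<lambda>\<omega>. f \<omega> + g \<omega>)"
    and lim: "\<And>f g. (\<And>n. P (f n)) \<Longrightarrow> tends2 M f g \<Longrightarrow> g \<in> borel_measurable (F p) \<Longrightarrow> P g"
    and cong: "\<And>f g. P f \<Longrightarrow> (\<And>\<omega>. \<omega> \<in> space M \<Longrightarrow> f \<omega> = g \<omega>) \<Longrightarrow> P g"
  shows "P V"
proof -
  obtain s where s: "\<And>n. simple_function (F p) (s n)" "tends2 M s V"
    using L2_approx_simple[OF V p] by blast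
  have zero: "P (\<lambda>\<omega>. 0)" using ind[of "{}" 0] by simp
  have "P (s n)" for n
  proof -
    have fin: "finite (s n ` space M)" using s(1)[of n] by (simp add: simple_function_def space_F[OF p])
    have "P (\<lambda>\<omega>. \<Sum>v\<in>Y. indicator (s n -` {v} \<inter> space M) \<omega> *\<^sub>R v)" if "Y \<subseteq> s n ` space M" "finite Y" for Y
      using that(2,1)
    proof (induction Y rule: finite_induct)
      case empty
      show ?case using zero by simp
    next
      case (insert v Y)
      have "s n -` {v} \<inter> space M \<in> sets (F p)"
        using s(1)[of n] insert.prems by (auto simp: simple_function_def space_F[OF p])
      from add[OF ind[OF this] insert.IH] show ?case
        unfolding sum.insert[OF insert.hyps] using insert.prems by blast
    qed
    then have all: "P (\<lambda>\<omega>. \<Sum>v\<in>s n ` space M. indicator (s n -` {v} \<inter> space M) \<omega> *\<^sub>R v)"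
      using fin by blast
    show ?thesis
    proof (rule cong[OF all])
      fix \<omega> assume "\<omega> \<in> space M"
      then have "(\<Sum>v\<in>s n ` space M. indicator (s n -` {v} \<inter> space M) \<omega> *\<^sub>R v)
          = (\<Sum>v\<in>s n ` space M. if v = s n \<omega> then s n \<omega> else 0)"
        by (intro sum.cong) (auto simp: indicator_def)
      also have "\<dots> = s n \<omega>" using fin \<open>\<omega> \<in> space M\<close> by simp
      finally show "(\<Sum>v\<in>s n ` space M. indicator (s n -` {v} \<inter> space M) \<omega> *\<^sub>R v) = s n \<omega>" .
    qed
  qed
  then show ?thesis using lim s(2) V(2) by blast
qed

text \<open>The closure of constants plus elementary integrals over [0, a], for any Hilbert space of
  values. The values are allowed to be complex, since the density argument runs through
  characteristic functions.\<close>

definition rep :: "real \<Rightarrow> ('w \<Rightarrow> 'h::{real_inner, banach, second_countable_topology}) \<Rightarrow> bool" where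
  "rep a X \<longleftrightarrow> L2 M X \<and> (\<forall>e>0. \<exists>c xs. elementary_on F 0 a xs \<and> n2 M (\<lambda>\<omega>. X \<omega> - (c + EI xs \<omega>)) < e)"

lemma rep_L2: "rep a X \<Longrightarrow> L2 M X"
  by (simp add: rep_def)

lemma rep_elementary:
  assumes "elementary_on F 0 a xs"
  shows "rep a (EI xs)"
  unfolding rep_def
proof (intro conjI allI impI)
  fix e :: real assume "e > 0"
  then show "\<exists>c ys. elementary_on F 0 a ys \<and> n2 M (\<lambda>\<omega>. EI xs \<omega> - (c + EI ys \<omega>)) < e"
    by (intro exI[of _ 0] exI[of _ xs]) (simp add: assms)
qed (use E_L2[OF assms] in simp)

lemma rep_const: "rep a (\<lambda>\<omega>. c)"
  unfolding rep_def by (auto intro!: exI[of _ c] exI[of _ "[]"])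

lemma rep_closed:
  assumes X: "L2 M X" and ap: "\<And>e. e > 0 \<Longrightarrow> \<exists>Y. rep a Y \<and> n2 M (\<lambda>\<omega>. X \<omega> - Y \<omega>) < e"
  shows "rep a X"
  unfolding rep_def
proof (intro conjI X allI impI)
  fix e :: real assume e: "e > 0"
  obtain Y where Y: "rep a Y" "n2 M (\<lambda>\<omega>. X \<omega> - Y \<omega>) < e / 2" using ap[of "e/2"] e by auto
  obtain c xs where xs: "elementary_on F 0 a xs" "n2 M (\<lambda>\<omega>. Y \<omega> - (c + EI xs \<omega>)) < e / 2"
    using Y(1) e unfolding rep_def by (meson half_gt_zero)
  have "n2 M (\<lambda>\<omega>. X \<omega> - (c + EI xs \<omega>)) < e"
    using n2_triangle3[OF X rep_L2[OF Y(1)], of "\<lambda>\<omega>. c + EI xs \<omega>"] Y(2) xs(2)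
      L2_add[OF L2_const E_L2(2)[OF xs(1)]] by simp
  then show "\<exists>c xs. elementary_on F 0 a xs \<and> n2 M (\<lambda>\<omega>. X \<omega> - (c + EI xs \<omega>)) < e"
    using xs(1) by blast
qed

lemma rep_limit:
  assumes "\<And>n. rep a (X n)" "tends2 M X Y"
  shows "rep a Y"
proof (rule rep_closed)
  fix e :: real assume "e > 0"
  then have "eventually (\<lambda>n. n2 M (\<lambda>\<omega>. X n \<omega> - Y \<omega>) < e) sequentially"
    using assms(2) unfolding tends2_def by (intro order_tendstoD(2)[of _ 0]) auto
  then obtain n where "n2 M (\<lambda>\<omega>. X n \<omega> - Y \<omega>) < e" by (auto simp: eventually_sequentially)
  then show "\<exists>X. rep a X \<and> n2 M (\<lambda>\<omega>. Y \<omega> - X \<omega>) < e"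
    using assms(1)[of n] n2_minus_commute[of M Y] by auto
qed (use tends2_L2[OF assms(2)] in auto)

lemma rep_add:
  assumes "rep a X" "rep a Y"
  shows "rep a (\<lambda>\<omega>. X \<omega> + Y \<omega>)"
  unfolding rep_def
proof (intro conjI allI impI)
  fix e :: real assume e: "e > 0"
  obtain c xs where xs: "elementary_on F 0 a xs" "n2 M (\<lambda>\<omega>. X \<omega> - (c + EI xs \<omega>)) < e / 2"
    using assms(1) e unfolding rep_def by (meson half_gt_zero)
  obtain d ys where ys: "elementary_on F 0 a ys" "n2 M (\<lambda>\<omega>. Y \<omega> - (d + EI ys \<omega>)) < e / 2"
    using assms(2) e unfolding rep_def by (meson half_gt_zero)
  have L: "L2 M (\<lambda>\<omega>. X \<omega> - (c + EI xs \<omega>))" "L2 M (\<lambda>\<omega>. Y \<omega> - (d + EI ys \<omega>))"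
    by (intro L2_diff L2_add L2_const E_L2(2)[OF xs(1) order_refl] rep_L2[OF assms(1)],
        intro L2_diff L2_add L2_const E_L2(2)[OF ys(1) order_refl] rep_L2[OF assms(2)])
  have "n2 M (\<lambda>\<omega>. X \<omega> + Y \<omega> - ((c + d) + EI (xs @ ys) \<omega>)) < e"
    using n2_triangle[OF L] xs(2) ys(2) by (simp add: elementary_integral_append algebra_simps)
  then show "\<exists>c xs. elementary_on F 0 a xs \<and> n2 M (\<lambda>\<omega>. X \<omega> + Y \<omega> - (c + EI xs \<omega>)) < e"
    using xs(1) ys(1) by (intro exI[of _ "c + d"] exI[of _ "xs @ ys"]) simp
qed (use assms in \<open>auto simp: rep_L2\<close>)

lemma rep_linear:
  fixes X :: "'w \<Rightarrow> 'h::{real_inner, banach, second_countable_topology}"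
    and f :: "'h \<Rightarrow> 'g::{real_inner, banach, second_countable_topology}"
  assumes "rep a X" "bounded_linear f"
  shows "rep a (\<lambda>\<omega>. f (X \<omega>))"
  unfolding rep_def
proof (intro conjI allI impI)
  obtain B where B: "B > 0" "\<And>x. norm (f x) \<le> norm x * B"
    using bounded_linear.pos_bounded[OF assms(2)] by blast
  fix e :: real assume e: "e > 0"
  obtain c xs where xs: "elementary_on F 0 a xs" "n2 M (\<lambda>\<omega>. X \<omega> - (c + EI xs \<omega>)) < e / B"
    using assms(1) e B(1) unfolding rep_def by (meson divide_pos_pos)
  have L: "L2 M (\<lambda>\<omega>. X \<omega> - (c + EI xs \<omega>))"
    by (intro L2_diff L2_add L2_const E_L2(2)[OF xs(1) order_refl] rep_L2[OF assms(1)])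
  have "n2 M (\<lambda>\<omega>. f (X \<omega> - (c + EI xs \<omega>))) \<le> B * n2 M (\<lambda>\<omega>. X \<omega> - (c + EI xs \<omega>))"
    by (rule L2_bound(2)[OF L2_measurable[OF L2_linear[OF L assms(2)]] L])
      (use B in \<open>auto simp: mult.commute\<close>)
  also have "\<dots> < e" using xs(2) B(1) by (simp add: field_simps)
  finally have "n2 M (\<lambda>\<omega>. f (X \<omega>) - (f c + EI (map_elementary f xs) \<omega>)) < e"
    using bounded_linear.linear[OF assms(2)]
    by (simp add: elementary_integral_map_linear linear_diff linear_add)
  then show "\<exists>c xs. elementary_on F 0 a xs \<and> n2 M (\<lambda>\<omega>. f (X \<omega>) - (c + EI xs \<omega>)) < e"
    using xs(1) by (intro exI[of _ "f c"] exI[of _ "map_elementary f xs"]) simp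
qed (use L2_linear[OF rep_L2 assms(2)] assms in auto)

lemma rep_sum: "(\<And>i. i \<in> I \<Longrightarrow> rep a (X i)) \<Longrightarrow> rep a (\<lambda>\<omega>. \<Sum>i\<in>I. X i \<omega>)"
  by (induction I rule: infinite_finite_induct) (auto intro: rep_add rep_const)

lemma rep_cong_AE:
  assumes "rep a X" "AE \<omega> in M. X \<omega> = Y \<omega>" "Y \<in> borel_measurable M"
  shows "rep a Y"
proof (rule rep_closed)
  show Y: "L2 M Y" using L2_cong_AE(1)[OF rep_L2[OF assms(1)] assms(2,3)] .
  fix e :: real assume "e > 0"
  moreover have "n2 M (\<lambda>\<omega>. Y \<omega> - X \<omega>) = 0"
    using n2_diff_0_AE[OF rep_L2[OF assms(1)] Y] assms(2) n2_minus_commute[of M Y X] by simp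
  ultimately show "\<exists>X. rep a X \<and> n2 M (\<lambda>\<omega>. Y \<omega> - X \<omega>) < e" using assms(1) by auto
qed

text \<open>The coefficient is independent of the later increment, so the second moment of the
  product factorizes.\<close>

lemma L2_mult_increment:
  assumes V: "L2 M V" "V \<in> borel_measurable (F p)" and p: "0 \<le> p" "p \<le> q"
  shows "L2 M (\<lambda>\<omega>. D p q \<phi> \<omega> *\<^sub>R V \<omega>)" "n2 M (\<lambda>\<omega>. D p q \<phi> \<omega> *\<^sub>R V \<omega>) = norm \<phi> * sqrt (q - p) * n2 M V"
proof -
  have m: "(\<lambda>\<omega>. (norm (V \<omega>))\<^sup>2) \<in> borel_measurable (F p)" using V(2) by simp
  have i: "integrable M (\<lambda>\<omega>. (norm (V \<omega>))\<^sup>2)" using V(1) by (simp add: L2_def)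
  have "integrable M (\<lambda>\<omega>. (norm (V \<omega>))\<^sup>2 * (D p q \<phi> \<omega>)\<^sup>2)"
    "expectation (\<lambda>\<omega>. (norm (V \<omega>))\<^sup>2 * (D p q \<phi> \<omega>)\<^sup>2) = expectation (\<lambda>\<omega>. (norm (V \<omega>))\<^sup>2) * ((norm \<phi>)\<^sup>2 * (q - p))"
    using indep_product[OF p m i, of "\<lambda>x. x\<^sup>2"] D_moments(1,2)[OF p] by simp_all
  moreover have "(norm (D p q \<phi> \<omega> *\<^sub>R V \<omega>))\<^sup>2 = (norm (V \<omega>))\<^sup>2 * (D p q \<phi> \<omega>)\<^sup>2" for \<omega>
    by (simp add: power_mult_distrib mult.commute)
  ultimately show "L2 M (\<lambda>\<omega>. D p q \<phi> \<omega> *\<^sub>R V \<omega>)" "n2 M (\<lambda>\<omega>. D p q \<phi> \<omega> *\<^sub>R V \<omega>) = norm \<phi> * sqrt (q - p) * n2 M V"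
    using D_measurable_M[OF p] L2_measurable[OF V(1)]
    by (auto simp: L2_def n2_def real_sqrt_mult mult_ac)
qed

text \<open>For an indicator coefficient the product is itself an elementary integral. The general
  coefficient is reached by \<open>L2_induct\<close>, because multiplication by a later increment is
  an isometry up to a constant.\<close>

lemma rep_mult_increment:
  fixes V :: "'w \<Rightarrow> 'h::{real_inner, banach, second_countable_topology}"
  assumes V: "L2 M V" "V \<in> borel_measurable (F p)" and p: "0 \<le> p" "p \<le> q" "q \<le> a"
  shows "rep a (\<lambda>\<omega>. D p q \<phi> \<omega> *\<^sub>R V \<omega>)"
proof -
  have "L2 M V \<and> V \<in> borel_measurable (F p) \<and> rep a (\<lambda>\<omega>. D p q \<phi> \<omega> *\<^sub>R V \<omega>)"
    (is "?P V")
  proof (rule L2_induct[where P = ?P, OF V p(1)])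
    fix G and h :: 'h assume 1: "G \<in> sets (F p)"
    then have "G \<in> sets M" using F_subset p(1) by blast
    then have "L2 M (\<lambda>\<omega>. indicator G \<omega> *\<^sub>R h)" by (intro L2_indicator) (auto simp: emeasure_eq_measure)
    moreover have "elementary_on F 0 a [(p, q, G, \<phi>, h)]" using 1 p by (simp add: elementary_on_def)
    from rep_elementary[OF this] have "rep a (\<lambda>\<omega>. D p q \<phi> \<omega> *\<^sub>R (indicator G \<omega> *\<^sub>R h))"
      unfolding EI_single by (simp add: mult.commute)
    ultimately show "?P (\<lambda>\<omega>. indicator G \<omega> *\<^sub>R h)" using 1 by simp
  next
    fix f g :: "'w \<Rightarrow> 'h" assume "?P f" "?P g"
    then show "?P (\<lambda>\<omega>. f \<omega> + g \<omega>)" using rep_add[of a "\<lambda>\<omega>. D p q \<phi> \<omega> *\<^sub>R f \<omega>" "\<lambda>\<omega>. D p q \<phi> \<omega> *\<^sub>R g \<omega>"]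
      by (auto simp: scaleR_add_right)
  next
    fix f and g :: "'w \<Rightarrow> 'h"
    assume 3: "\<And>n. ?P (f n)" "tends2 M f g" "g \<in> borel_measurable (F p)"
    have g: "L2 M g" using tends2_L2(2)[OF 3(2)] .
    have d: "L2 M (\<lambda>\<omega>. f n \<omega> - g \<omega>)" "(\<lambda>\<omega>. f n \<omega> - g \<omega>) \<in> borel_measurable (F p)" for n
      using 3(1)[of n] 3(3) g by (auto intro: borel_measurable_diff)
    have "tends2 M (\<lambda>n \<omega>. D p q \<phi> \<omega> *\<^sub>R f n \<omega>) (\<lambda>\<omega>. D p q \<phi> \<omega> *\<^sub>R g \<omega>)"
    proof (rule tends2I)
      show "n2 M (\<lambda>\<omega>. D p q \<phi> \<omega> *\<^sub>R f n \<omega> - D p q \<phi> \<omega> *\<^sub>R g \<omega>) \<le> norm \<phi> * sqrt (q - p) * n2 M (\<lambda>\<omega>. f n \<omega> - g \<omega>)" for n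
        using L2_mult_increment(2)[OF d p(1,2), of \<phi> n] by (simp add: scaleR_diff_right)
      show "(\<lambda>n. norm \<phi> * sqrt (q - p) * n2 M (\<lambda>\<omega>. f n \<omega> - g \<omega>)) \<longlonglongrightarrow> 0"
        using 3(2) tendsto_mult_right_zero unfolding tends2_def by blast
    qed (use 3 in \<open>auto intro!: L2_mult_increment(1) g p\<close>)
    then have "rep a (\<lambda>\<omega>. D p q \<phi> \<omega> *\<^sub>R g \<omega>)"
      by (rule rep_limit[rotated]) (use 3(1) in blast)
    then show "?P g" using 3(3) g by blast
  next
    fix f g :: "'w \<Rightarrow> 'h" assume 4: "?P f" "\<And>\<omega>. \<omega> \<in> space M \<Longrightarrow> f \<omega> = g \<omega>"
    have eq: "AE \<omega> in M. D p q \<phi> \<omega> *\<^sub>R f \<omega> = D p q \<phi> \<omega> *\<^sub>R g \<omega>" "AE \<omega> in M. f \<omega> = g \<omega>" using 4(2) by auto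
    have g: "g \<in> borel_measurable (F p)"
      using 4 measurable_cong[of "F p" f g] by (simp add: space_F[OF p(1)])
    then have gM: "g \<in> borel_measurable M" using F_measurable p by blast
    then have "L2 M g" using L2_cong_AE(1)[OF _ eq(2)] 4 by blast
    moreover have "(\<lambda>\<omega>. D p q \<phi> \<omega> *\<^sub>R g \<omega>) \<in> borel_measurable M"
      using D_measurable_M[OF p(1,2)] gM by simp
    ultimately show "?P g" using rep_cong_AE[OF _ eq(1)] 4(1) g by blast
  qed
  then show ?thesis by blast
qed

subsection \<open>Exponentials of increments\<close>

lemma expectation_cis_increment:
  assumes s: "0 \<le> s" "s < t" and \<phi>: "\<phi> \<noteq> 0"
  shows "expectation (\<lambda>\<omega>. cis (D s t \<phi> \<omega>)) = of_real (exp (- ((norm \<phi>)\<^sup>2 * (t - s) / 2)))"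
proof -
  let ?\<sigma> = "norm \<phi> * sqrt (t - s)"
  have \<sigma>: "?\<sigma> > 0" using s \<phi> by simp
  have m: "D s t \<phi> \<in> borel_measurable M" using D_measurable_M s by simp
  have "distributed M lborel (\<lambda>\<omega>. (D s t \<phi> \<omega> - 0) / ?\<sigma>) std_normal_density"
    using D_distributed[OF \<phi> s] normal_standard_normal_convert[OF \<sigma>, of "D s t \<phi>" 0] by blast
  then have "distr M lborel (\<lambda>\<omega>. D s t \<phi> \<omega> / ?\<sigma>) = std_normal_distribution"
    using distributed_distr_eq_density by fastforce
  then have "char (distr M lborel (\<lambda>\<omega>. D s t \<phi> \<omega> / ?\<sigma>)) ?\<sigma> = of_real (exp (- (?\<sigma>\<^sup>2) / 2))"
    by (simp add: char_std_normal_distribution)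
  moreover have "char (distr M lborel (\<lambda>\<omega>. D s t \<phi> \<omega> / ?\<sigma>)) ?\<sigma> = expectation (\<lambda>\<omega>. iexp (?\<sigma> * (D s t \<phi> \<omega> / ?\<sigma>)))"
    unfolding char_def using m by (subst integral_distr) auto
  moreover have "iexp (?\<sigma> * (D s t \<phi> \<omega> / ?\<sigma>)) = cis (D s t \<phi> \<omega>)" for \<omega>
  proof -
    have "?\<sigma> * (D s t \<phi> \<omega> / ?\<sigma>) = D s t \<phi> \<omega>" using \<sigma> by (intro nonzero_mult_div_cancel_left[of ?\<sigma>, unfolded times_divide_eq_right[symmetric]]) linarith
    then show ?thesis by (simp only: cis_conv_exp)
  qed
  moreover have "?\<sigma>\<^sup>2 = (norm \<phi>)\<^sup>2 * (t - s)" using s by (simp add: power_mult_distrib)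
  ultimately show ?thesis by simp
qed

lemma increment_fourth_moment:
  assumes s: "0 \<le> s" "s < t" and \<phi>: "\<phi> \<noteq> 0"
  shows "integrable M (\<lambda>\<omega>. (D s t \<phi> \<omega>) ^ 4)" "expectation (\<lambda>\<omega>. (D s t \<phi> \<omega>) ^ 4) = 3 * ((norm \<phi>)\<^sup>2 * (t - s))\<^sup>2"
proof -
  let ?\<sigma> = "norm \<phi> * sqrt (t - s)"
  have \<sigma>: "?\<sigma> > 0" using s \<phi> by simp
  note d = D_distributed[OF \<phi> s]
  have h: "has_bochner_integral lborel (\<lambda>x. normal_density 0 ?\<sigma> x * x ^ 4) (fact 4 / ((2 / ?\<sigma>\<^sup>2) ^ 2 * fact 2))"
    using normal_moment_even[OF \<sigma>, of 0 2] by simp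
  show "integrable M (\<lambda>\<omega>. (D s t \<phi> \<omega>) ^ 4)"
    using distributed_integrable[OF d, of "\<lambda>x. x ^ 4"] has_bochner_integral_iff[THEN iffD1, OF h] by simp
  have "expectation (\<lambda>\<omega>. (D s t \<phi> \<omega>) ^ 4) = fact 4 / ((2 / ?\<sigma>\<^sup>2) ^ 2 * fact 2)"
    using distributed_integral[OF d, of "\<lambda>x. x ^ 4"] has_bochner_integral_iff[THEN iffD1, OF h] by simp
  also have "\<dots> = 3 * (?\<sigma>\<^sup>2)\<^sup>2" by (simp add: fact_numeral power_divide)
  also have "?\<sigma>\<^sup>2 = (norm \<phi>)\<^sup>2 * (t - s)" using s by (simp add: power_mult_distrib)
  finally show "expectation (\<lambda>\<omega>. (D s t \<phi> \<omega>) ^ 4) = 3 * ((norm \<phi>)\<^sup>2 * (t - s))\<^sup>2" .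
qed

text \<open>The second order remainder of \<open>exp (\<mu> + i x) - 1 - i x\<close>, where \<open>\<mu>\<close> compensates the mean.\<close>

definition exp_error :: "real \<Rightarrow> real \<Rightarrow> complex" where
  "exp_error \<mu> x = of_real (exp \<mu>) * cis x - 1 - \<i> * of_real x"

text \<open>The error is the sum of (exp \<mu> - 1) cis x, of size 2 \<mu>, and of the Taylor
  remainder of cis x, of size x^2 / 2.\<close>

lemma exp_error_bound:
  assumes "0 \<le> \<mu>" "\<mu> \<le> 1"
  shows "(cmod (exp_error \<mu> x))\<^sup>2 \<le> 8 * \<mu>\<^sup>2 + x ^ 4 / 2"
proof -
  have e: "exp \<mu> - 1 \<le> 2 * \<mu>"
  proof -
    have "exp \<mu> \<le> 1 + \<mu> + \<mu>\<^sup>2" using exp_bound[of \<mu>] assms by simp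
    also have "\<mu>\<^sup>2 \<le> \<mu>" using assms by (simp add: power2_eq_square mult_left_le)
    finally show ?thesis by simp
  qed
  have c: "cmod (cis x - 1 - \<i> * of_real x) \<le> x\<^sup>2 / 2"
    using iexp_approx1[of x 1] by (simp add: cis_conv_exp numeral_2_eq_2 algebra_simps power2_eq_square)
  have "exp_error \<mu> x = of_real (exp \<mu> - 1) * cis x + (cis x - 1 - \<i> * of_real x)"
    by (simp add: exp_error_def algebra_simps)
  then have "(cmod (exp_error \<mu> x))\<^sup>2 \<le> 2 * (cmod (of_real (exp \<mu> - 1) * cis x))\<^sup>2 + 2 * (cmod (cis x - 1 - \<i> * of_real x))\<^sup>2"
    using norm_add_square_le[of 1 "of_real (exp \<mu> - 1) * cis x" "cis x - 1 - \<i> * of_real x"] by simp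
  also have "\<dots> \<le> 2 * (2 * \<mu>)\<^sup>2 + 2 * (x\<^sup>2 / 2)\<^sup>2"
    using e c assms by (intro add_mono mult_left_mono power_mono) (auto simp: norm_mult simp del: of_real_diff)
  also have "\<dots> = 8 * \<mu>\<^sup>2 + x ^ 4 / 2" by (simp add: power_mult_distrib power_divide power2_eq_square power4_eq_xxxx)
  finally show ?thesis .
qed

text \<open>The increment has variance 2 \<mu>, hence fourth moment 12 \<mu>^2, and 8 + 12 / 2 = 14.
  The mean is zero because the characteristic function contributes exp (- \<mu>), which the factor
  exp \<mu> cancels.\<close>

lemma exp_error_moments:
  assumes s: "0 \<le> s" "s < t" and \<phi>: "\<phi> \<noteq> 0" and \<mu>: "\<mu> = (norm \<phi>)\<^sup>2 * (t - s) / 2" "\<mu> \<le> 1"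
  shows "L2 M (\<lambda>\<omega>. exp_error \<mu> (D s t \<phi> \<omega>))" "(n2 M (\<lambda>\<omega>. exp_error \<mu> (D s t \<phi> \<omega>)))\<^sup>2 \<le> 14 * \<mu>\<^sup>2"
    "expectation (\<lambda>\<omega>. exp_error \<mu> (D s t \<phi> \<omega>)) = 0"
proof -
  have \<mu>0: "\<mu> \<ge> 0" using s by (simp add: \<mu>(1))
  note F4 = increment_fourth_moment[OF s \<phi>]
  have m: "D s t \<phi> \<in> borel_measurable M" using D_measurable_M s by simp
  have mc: "(\<lambda>\<omega>. cis (D s t \<phi> \<omega>)) \<in> borel_measurable M"
    by (rule measurable_compose[OF m]) (intro borel_measurable_continuous_onI continuous_intros)
  have me: "(\<lambda>\<omega>. exp_error \<mu> (D s t \<phi> \<omega>)) \<in> borel_measurable M"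
    by (rule measurable_compose[OF m])
      (auto simp: exp_error_def[abs_def] intro!: borel_measurable_continuous_onI continuous_intros)
  have ib: "integrable M (\<lambda>\<omega>. 8 * \<mu>\<^sup>2 + (D s t \<phi> \<omega>) ^ 4 / 2)" using F4(1) by simp
  have b: "(cmod (exp_error \<mu> (D s t \<phi> \<omega>)))\<^sup>2 \<le> 8 * \<mu>\<^sup>2 + (D s t \<phi> \<omega>) ^ 4 / 2" for \<omega>
    by (rule exp_error_bound[OF \<mu>0 \<mu>(2)])
  have i: "integrable M (\<lambda>\<omega>. (cmod (exp_error \<mu> (D s t \<phi> \<omega>)))\<^sup>2)"
    by (rule Bochner_Integration.integrable_bound[OF ib])
      (use b me in \<open>auto intro!: AE_I2 order_trans[OF b]\<close>)
  then show L: "L2 M (\<lambda>\<omega>. exp_error \<mu> (D s t \<phi> \<omega>))" using me by (simp add: L2_def)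
  have "(n2 M (\<lambda>\<omega>. exp_error \<mu> (D s t \<phi> \<omega>)))\<^sup>2 \<le> expectation (\<lambda>\<omega>. 8 * \<mu>\<^sup>2 + (D s t \<phi> \<omega>) ^ 4 / 2)"
    unfolding n2_power2 by (rule integral_mono[OF i ib b])
  also have "\<dots> = 8 * \<mu>\<^sup>2 + expectation (\<lambda>\<omega>. (D s t \<phi> \<omega>) ^ 4) / 2"
    using F4(1) by (simp add: prob_space)
  also have "\<dots> = 14 * \<mu>\<^sup>2" unfolding F4(2) \<mu>(1) by (simp add: power2_eq_square)
  finally show "(n2 M (\<lambda>\<omega>. exp_error \<mu> (D s t \<phi> \<omega>)))\<^sup>2 \<le> 14 * \<mu>\<^sup>2" .
  have ic: "integrable M (\<lambda>\<omega>. cis (D s t \<phi> \<omega>))"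
    by (rule integrable_const_bound[of _ 1]) (use mc in auto)
  have iD: "integrable M (\<lambda>\<omega>. complex_of_real (D s t \<phi> \<omega>))"
    using integrable_of_real[OF D_moments(3)[of s t \<phi>]] s by (simp del: of_real_diff)
  have "expectation (\<lambda>\<omega>. exp_error \<mu> (D s t \<phi> \<omega>))
      = of_real (exp \<mu>) * expectation (\<lambda>\<omega>. cis (D s t \<phi> \<omega>)) - 1 - \<i> * expectation (\<lambda>\<omega>. complex_of_real (D s t \<phi> \<omega>))"
    unfolding exp_error_def using ic iD by (simp add: prob_space del: of_real_diff)
  also have "expectation (\<lambda>\<omega>. complex_of_real (D s t \<phi> \<omega>)) = 0"
    using D_moments(4)[of s t \<phi>] s by (simp add: integral_complex_of_real del: of_real_diff)
  also have "expectation (\<lambda>\<omega>. cis (D s t \<phi> \<omega>)) = of_real (exp (- \<mu>))"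
    using expectation_cis_increment[OF s \<phi>] by (simp add: \<mu>(1))
  finally show "expectation (\<lambda>\<omega>. exp_error \<mu> (D s t \<phi> \<omega>)) = 0"
    by (simp add: of_real_mult[symmetric] exp_minus del: of_real_mult)
qed


lemma L2_integrable: "L2 M X \<Longrightarrow> integrable M X"
proof (rule Bochner_Integration.integrable_bound)
  assume X: "L2 M X"
  then show "integrable M (\<lambda>\<omega>. 1 + (norm (X \<omega>))\<^sup>2)" "X \<in> borel_measurable M" by (auto simp: L2_def)
  have "r \<le> 1 + r\<^sup>2" for r :: real
    using zero_le_power2[of "r - 1/2"] by (simp add: power2_eq_square algebra_simps)
  then show "AE \<omega> in M. norm (X \<omega>) \<le> norm (1 + (norm (X \<omega>))\<^sup>2)" by simp
qed

text \<open>Complex numbers carry the real inner product Re (cnj x y). The factor cnj X V is known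
  at time p, the error is independent of it and has mean zero.\<close>

lemma exp_error_orthogonal:
  fixes X V :: "'w \<Rightarrow> complex"
  assumes X: "L2 M X" "X \<in> borel_measurable (F p)" and V: "V \<in> borel_measurable (F p)" "\<And>\<omega>. cmod (V \<omega>) \<le> B"
    and p: "0 \<le> p" "p \<le> q"
    and e: "L2 M (\<lambda>\<omega>. exp_error \<mu> (D p q \<phi> \<omega>))" "expectation (\<lambda>\<omega>. exp_error \<mu> (D p q \<phi> \<omega>)) = 0"
  shows "ip M X (\<lambda>\<omega>. V \<omega> * exp_error \<mu> (D p q \<phi> \<omega>)) = 0"
proof -
  have m: "(\<lambda>\<omega>. cnj (X \<omega>) * V \<omega>) \<in> borel_measurable (F p)"
  proof (rule borel_measurable_times[OF _ V(1)])
    have "cnj \<in> borel_measurable borel" by (intro borel_measurable_continuous_onI continuous_intros)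
    then show "(\<lambda>\<omega>. cnj (X \<omega>)) \<in> borel_measurable (F p)" by (rule measurable_compose[OF X(2)])
  qed
  have i: "integrable M (\<lambda>\<omega>. cnj (X \<omega>) * V \<omega>)"
  proof (rule Bochner_Integration.integrable_bound)
    show "integrable M (\<lambda>\<omega>. B * norm (X \<omega>))" using L2_integrable[OF X(1)] by simp
    show "(\<lambda>\<omega>. cnj (X \<omega>) * V \<omega>) \<in> borel_measurable M" using F_measurable[OF m p(1)] .
    have "B \<ge> 0" using order_trans[OF norm_ge_zero V(2)] .
    then show "AE \<omega> in M. norm (cnj (X \<omega>) * V \<omega>) \<le> norm (B * norm (X \<omega>))"
      using V(2) by (intro AE_I2) (auto simp: norm_mult mult.commute intro: mult_right_mono)
  qed
  have em: "exp_error \<mu> \<in> borel_measurable borel"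
    by (auto simp: exp_error_def[abs_def] intro!: borel_measurable_continuous_onI continuous_intros)
  note ind = indep_product[OF p m i em L2_integrable[OF e(1)]]
  have "ip M X (\<lambda>\<omega>. V \<omega> * exp_error \<mu> (D p q \<phi> \<omega>))
      = expectation (\<lambda>\<omega>. Re ((cnj (X \<omega>) * V \<omega>) * exp_error \<mu> (D p q \<phi> \<omega>)))"
    unfolding ip_def by (intro Bochner_Integration.integral_cong refl) (simp add: inner_complex_def algebra_simps)
  also have "\<dots> = Re (expectation (\<lambda>\<omega>. (cnj (X \<omega>) * V \<omega>) * exp_error \<mu> (D p q \<phi> \<omega>)))"
    by (rule integral_Re[OF ind(1)])
  also have "\<dots> = 0" unfolding ind(2) e(2) by simp
  finally show ?thesis .
qed

lemma cis_measurable: "f \<in> borel_measurable N \<Longrightarrow> (\<lambda>x. cis (f x)) \<in> borel_measurable N"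
  by (rule measurable_compose[where N = borel])
    (auto intro!: borel_measurable_continuous_onI continuous_intros)

text \<open>The compensated exponential is followed over N equal pieces of [s, t]. Each of its
  increments is a stochastic integral over one piece plus an error; the telescoping sum of the
  former is representable. Since the errors are mutually orthogonal, their squared norms add up to N
  times a multiple of 1 / N^2, which tends to 0; the triangle inequality alone would leave a bounded
  sum that need not vanish.\<close>

lemma rep_mult_cis_increment_strict:
  fixes U :: "'w \<Rightarrow> complex"
  assumes U: "rep a U" "U \<in> borel_measurable (F s)" "\<And>\<omega>. cmod (U \<omega>) \<le> B"
    and s: "0 \<le> s" "s < t" "t \<le> a" and \<phi>: "\<phi> \<noteq> 0"
  shows "rep a (\<lambda>\<omega>. U \<omega> * cis (D s t \<phi> \<omega>))"
proof -
  define \<nu> where "\<nu> = (norm \<phi>)\<^sup>2 * (t - s) / 2"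
  have \<nu>: "\<nu> > 0" using s \<phi> by (simp add: \<nu>_def)
  have B: "B \<ge> 0" using order_trans[OF norm_ge_zero U(3)] .
  have UM: "U \<in> borel_measurable M" using F_measurable[OF U(2) s(1)] .
  let ?X = "\<lambda>\<omega>. of_real (exp \<nu>) * (U \<omega> * cis (D s t \<phi> \<omega>))"
  have Xm: "?X \<in> borel_measurable M" using UM cis_measurable[OF D_measurable_M[of s t \<phi>]] s by simp
  have XL: "L2 M ?X" using Xm by (rule L2_bounded[of _ "exp \<nu> * B"]) (simp add: norm_mult U(3))
  have "rep a ?X"
  proof (rule rep_closed[OF XL])
    fix e :: real assume e: "e > 0"
    \<comment> \<open>The N orthogonal errors contribute at most (B exp \<nu>)^2 14 \<mu>^2 each,
      with \<mu> = \<nu> / N, hence c / N in total. The number of pieces is also at least \<nu>, so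
      that \<mu> <= 1 as \<open>exp_error_moments\<close> demands.\<close>
    define c where "c = 14 * (B * exp \<nu>)\<^sup>2 * \<nu>\<^sup>2"
    obtain n0 :: nat where n0: "max \<nu> (c / e\<^sup>2) < real n0" using reals_Archimedean2 by blast
    define N where "N = n0"
    have N: "0 < real N" "\<nu> \<le> real N" "c / real N < e\<^sup>2"
      using n0 e \<nu> by (auto simp: N_def field_simps)
    define h where "h = (t - s) / N"
    define \<mu> where "\<mu> = \<nu> / N"
    define \<tau> where "\<tau> k = s + real k * h" for k
    have h: "h > 0" using s N by (simp add: h_def)
    have \<mu>: "0 \<le> \<mu>" "\<mu> \<le> 1" "\<mu> = (norm \<phi>)\<^sup>2 * (\<tau> (Suc k) - \<tau> k) / 2" for k
      using N \<nu> by (auto simp: \<mu>_def \<nu>_def \<tau>_def h_def field_simps)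
    have \<tau>: "0 \<le> \<tau> k" "s \<le> \<tau> k" "\<tau> k < \<tau> (Suc k)" for k using s h by (auto simp: \<tau>_def algebra_simps)
    have \<tau>m: "\<tau> j \<le> \<tau> k" if "j \<le> k" for j k using that h by (simp add: \<tau>_def mult_right_mono)
    have \<tau>N: "\<tau> N = t" "\<tau> 0 = s" using N by (auto simp: \<tau>_def h_def)
    \<comment> \<open>The compensated exponential stopped at the k-th point: it starts at U for k =
      0 and reaches \<open>?X\<close> for k = N.\<close>
    define Mk where "Mk k \<omega> = U \<omega> * of_real (exp (real k * \<mu>)) * cis (D s (\<tau> k) \<phi> \<omega>)" for k \<omega>
    define err where "err k \<omega> = Mk k \<omega> * exp_error \<mu> (D (\<tau> k) (\<tau> (Suc k)) \<phi> \<omega>)" for k \<omega>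
    have Mm: "Mk k \<in> borel_measurable (F (\<tau> k))" for k
      unfolding Mk_def[abs_def]
      using F_measurable_mono[OF U(2) s(1) \<tau>(2)] cis_measurable[OF D_measurable[OF s(1) \<tau>(2)]]
      by (intro borel_measurable_times borel_measurable_const)
    have MM: "Mk k \<in> borel_measurable M" for k using F_measurable[OF Mm \<tau>(1)] .
    have Mb: "cmod (Mk k \<omega>) \<le> B * exp \<nu>" if "k \<le> N" for k \<omega>
    proof -
      have "real k * \<mu> \<le> real N * \<mu>" using that \<mu>(1) by (intro mult_right_mono) auto
      also have "\<dots> = \<nu>" using N by (simp add: \<mu>_def)
      finally show ?thesis using U(3)[of \<omega>] B by (simp add: Mk_def norm_mult mult_mono)
    qed
    have em: "exp_error \<mu> \<in> borel_measurable borel"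
      by (auto simp: exp_error_def[abs_def] intro!: borel_measurable_continuous_onI continuous_intros)
    note EE = exp_error_moments[OF \<tau>(1) \<tau>(3) \<phi> \<mu>(3) \<mu>(2)]
    have errL: "L2 M (err k)" "n2 M (err k) \<le> B * exp \<nu> * n2 M (\<lambda>\<omega>. exp_error \<mu> (D (\<tau> k) (\<tau> (Suc k)) \<phi> \<omega>))"
      if "k \<le> N" for k
    proof -
      have m: "err k \<in> borel_measurable M"
        unfolding err_def[abs_def] using MM L2_measurable[OF EE(1)] by (intro borel_measurable_times)
      have "AE \<omega> in M. norm (err k \<omega>) \<le> B * exp \<nu> * norm (exp_error \<mu> (D (\<tau> k) (\<tau> (Suc k)) \<phi> \<omega>))"
        unfolding err_def norm_mult using Mb[OF that] by (intro AE_I2 mult_right_mono) auto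
      then show "L2 M (err k)" "n2 M (err k) \<le> B * exp \<nu> * n2 M (\<lambda>\<omega>. exp_error \<mu> (D (\<tau> k) (\<tau> (Suc k)) \<phi> \<omega>))"
        using L2_bound[OF m EE(1), of "B * exp \<nu>"] B by auto
    qed
    have errm: "err k \<in> borel_measurable (F (\<tau> (Suc k)))" for k
      unfolding err_def[abs_def]
      using F_measurable_mono[OF Mm \<tau>(1) less_imp_le[OF \<tau>(3)]]
        measurable_compose[OF D_measurable[OF \<tau>(1) less_imp_le[OF \<tau>(3)]] em]
      by (intro borel_measurable_times)
    have orth: "ip M (err j) (err k) = 0" if "j < k" "k \<le> N" for j k
      unfolding err_def[of k, abs_def]
      using that F_measurable_mono[OF errm \<tau>(1) \<tau>m[of "Suc j" k]]
      by (intro exp_error_orthogonal[OF _ _ Mm Mb _ _ EE(1) EE(3)] errL) (auto intro: \<tau> less_imp_le)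
    have orth': "ip M (err j) (err k) = 0" if "j < N" "k < N" "j \<noteq> k" for j k
      using orth[of j k] orth[of k j] that ip_commute[of M "err j" "err k"] by (cases "j < k") auto
    have step: "Mk (Suc k) \<omega> - Mk k \<omega> = D (\<tau> k) (\<tau> (Suc k)) \<phi> \<omega> *\<^sub>R (\<i> * Mk k \<omega>) + err k \<omega>" for k \<omega>
    proof -
      have "cis (D s (\<tau> (Suc k)) \<phi> \<omega>) = cis (D s (\<tau> k) \<phi> \<omega>) * cis (D (\<tau> k) (\<tau> (Suc k)) \<phi> \<omega>)"
        by (simp add: cis_mult)
      moreover have "of_real (exp (real (Suc k) * \<mu>)) = complex_of_real (exp (real k * \<mu>)) * of_real (exp \<mu>)"
        by (simp add: exp_add[symmetric] algebra_simps flip: of_real_mult)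
      ultimately have "Mk (Suc k) \<omega> = Mk k \<omega> * (of_real (exp \<mu>) * cis (D (\<tau> k) (\<tau> (Suc k)) \<phi> \<omega>))"
        unfolding Mk_def by (simp only: mult_ac)
      then show ?thesis unfolding err_def exp_error_def scaleR_conv_of_real
        by (simp only: algebra_simps) simp
    qed
    define Y where "Y \<omega> = U \<omega> + (\<Sum>k<N. D (\<tau> k) (\<tau> (Suc k)) \<phi> \<omega> *\<^sub>R (\<i> * Mk k \<omega>))" for \<omega>
    have "rep a Y"
      unfolding Y_def[abs_def]
    proof (intro rep_add U(1) rep_sum rep_mult_increment)
      fix k assume k: "k \<in> {..<N}"
      show "L2 M (\<lambda>\<omega>. \<i> * Mk k \<omega>)"
        by (rule L2_bounded[of _ "B * exp \<nu>"]) (use MM Mb[of k] k in \<open>auto simp: norm_mult\<close>)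
      show "(\<lambda>\<omega>. \<i> * Mk k \<omega>) \<in> borel_measurable (F (\<tau> k))"
        using Mm by (intro borel_measurable_times borel_measurable_const)
      show "\<tau> (Suc k) \<le> a" using \<tau>m[of "Suc k" N] k s(3) by (simp add: \<tau>N)
    qed (use \<tau> in \<open>auto intro: less_imp_le\<close>)
    moreover have "?X \<omega> - Y \<omega> = (\<Sum>k<N. err k \<omega>)" for \<omega>
    proof -
      have "Mk N \<omega> - Mk 0 \<omega> = (\<Sum>k<N. D (\<tau> k) (\<tau> (Suc k)) \<phi> \<omega> *\<^sub>R (\<i> * Mk k \<omega>)) + (\<Sum>k<N. err k \<omega>)"
        unfolding sum.distrib[symmetric] step[symmetric] by (rule sum_lessThan_telescope[symmetric])
      moreover have "Mk N \<omega> = ?X \<omega>" using N by (simp add: Mk_def \<tau>N \<mu>_def)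
      moreover have "Mk 0 \<omega> = U \<omega>" by (simp add: Mk_def \<tau>N)
      ultimately show ?thesis by (simp add: Y_def algebra_simps)
    qed
    then have eq: "(\<lambda>\<omega>. ?X \<omega> - Y \<omega>) = (\<lambda>\<omega>. \<Sum>k<N. err k \<omega>)" by (rule ext)
    have "n2 M (\<lambda>\<omega>. ?X \<omega> - Y \<omega>) < e"
    proof (rule power2_less_imp_less)
      have "(n2 M (\<lambda>\<omega>. ?X \<omega> - Y \<omega>))\<^sup>2 = (\<Sum>k<N. (n2 M (err k))\<^sup>2)"
        unfolding eq by (rule n2_sum_orthogonal) (auto intro: errL orth')
      also have "\<dots> \<le> (\<Sum>k<N. (B * exp \<nu>)\<^sup>2 * (14 * \<mu>\<^sup>2))"
      proof (rule sum_mono)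
        fix k assume "k \<in> {..<N}"
        then have "(n2 M (err k))\<^sup>2 \<le> (B * exp \<nu> * n2 M (\<lambda>\<omega>. exp_error \<mu> (D (\<tau> k) (\<tau> (Suc k)) \<phi> \<omega>)))\<^sup>2"
          by (intro power_mono errL) auto
        also have "\<dots> \<le> (B * exp \<nu>)\<^sup>2 * (14 * \<mu>\<^sup>2)"
          unfolding power_mult_distrib[of "B * exp \<nu>"] by (intro mult_left_mono EE(2)) simp
        finally show "(n2 M (err k))\<^sup>2 \<le> (B * exp \<nu>)\<^sup>2 * (14 * \<mu>\<^sup>2)" .
      qed
      also have "\<dots> = c / N" using N by (simp add: c_def \<mu>_def power2_eq_square field_simps)
      also have "\<dots> < e\<^sup>2" by (rule N)
      finally show "(n2 M (\<lambda>\<omega>. ?X \<omega> - Y \<omega>))\<^sup>2 < e\<^sup>2" .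
    qed (use e in simp)
    ultimately show "\<exists>Y. rep a Y \<and> n2 M (\<lambda>\<omega>. ?X \<omega> - Y \<omega>) < e" by blast
  qed
  from rep_linear[OF this bounded_linear_mult_right[of "of_real (exp (- \<nu>))"]]
  show ?thesis by (simp add: mult.assoc[symmetric] exp_minus)
qed

lemma rep_mult_cis_increment:
  fixes U :: "'w \<Rightarrow> complex"
  assumes U: "rep a U" "U \<in> borel_measurable (F s)" "\<And>\<omega>. cmod (U \<omega>) \<le> B"
    and s: "0 \<le> s" "s \<le> t" "t \<le> a"
  shows "rep a (\<lambda>\<omega>. U \<omega> * cis (D s t \<phi> \<omega>))"
proof (cases "s < t \<and> \<phi> \<noteq> 0")
  case True
  then show ?thesis using rep_mult_cis_increment_strict[OF U] s by blast
next
  case False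
  have UM: "U \<in> borel_measurable M" using F_measurable[OF U(2) s(1)] .
  have "AE \<omega> in M. D s t \<phi> \<omega> = 0"
  proof (cases "s = t")
    case False
    then have "\<phi> = 0" using \<open>\<not> (s < t \<and> \<phi> \<noteq> 0)\<close> s by auto
    then show ?thesis using W_zero[of s] W_zero[of t] s by (auto elim: eventually_elim2)
  qed simp
  then have "AE \<omega> in M. U \<omega> = U \<omega> * cis (D s t \<phi> \<omega>)" by eventually_elim simp
  then show ?thesis
    by (rule rep_cong_AE[OF U(1)])
      (intro borel_measurable_times UM cis_measurable D_measurable_M s)
qed

section \<open>Trigonometric monomials of the Wiener process\<close>

definition trig :: "(real \<times> 'k) list \<Rightarrow> 'w \<Rightarrow> complex" where
  "trig L \<omega> = cis (\<Sum>(t, \<phi>)\<leftarrow>L. W t \<phi> \<omega>)"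

lemma norm_trig [simp]: "cmod (trig L \<omega>) = 1"
  by (simp add: trig_def)

lemma trig_measurable:
  assumes "\<And>t \<phi>. (t, \<phi>) \<in> set L \<Longrightarrow> 0 \<le> t \<and> t \<le> a"
  shows "trig L \<in> borel_measurable (F a)"
proof -
  have "(\<lambda>\<omega>. \<Sum>(t, \<phi>)\<leftarrow>L. W t \<phi> \<omega>) \<in> borel_measurable (F a)"
    using assms
  proof (induction L)
    case (Cons x L)
    obtain t \<phi> where x: "x = (t, \<phi>)" by (cases x)
    have "W t \<phi> \<in> borel_measurable (F a)"
      using F_measurable_mono[OF W_measurable[of t \<phi>], of a] Cons.prems[of t \<phi>] x by simp
    moreover have "(\<lambda>\<omega>. \<Sum>(t, \<phi>)\<leftarrow>L. W t \<phi> \<omega>) \<in> borel_measurable (F a)"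
      by (rule Cons.IH) (use Cons.prems in auto)
    ultimately have "(\<lambda>\<omega>. W t \<phi> \<omega> + (\<Sum>(t, \<phi>)\<leftarrow>L. W t \<phi> \<omega>)) \<in> borel_measurable (F a)"
      by (rule borel_measurable_add)
    then show ?case by (simp add: x)
  qed simp
  then show ?thesis unfolding trig_def[abs_def] by (rule cis_measurable)
qed

lemma trig_append: "trig (L @ L') \<omega> = trig L \<omega> * trig L' \<omega>"
  by (simp add: trig_def cis_mult)

text \<open>The latest time t is peeled off: W t \<phi> is the increment from s to t plus W s
  \<phi>, where s is the next time. The second part merges with W s \<psi> into W s (\<phi> +
  \<psi>), so the remaining list is shorter by one and known at time s.\<close>

lemma rep_trig_sorted:
  assumes "sorted_wrt (\<lambda>x y. fst x \<ge> fst y) L" "\<And>t \<phi>. (t, \<phi>) \<in> set L \<Longrightarrow> 0 \<le> t \<and> t \<le> a" "0 \<le> a"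
  shows "rep a (trig L)"
  using assms(1,2)
proof (induction "length L" arbitrary: L rule: less_induct)
  case less
  consider "L = []" | t \<phi> where "L = [(t, \<phi>)]" | t \<phi> s \<psi> L' where "L = (t, \<phi>) # (s, \<psi>) # L'"
    by (metis neq_Nil_conv surj_pair)
  then show ?case
  proof cases
    case 1
    then show ?thesis using rep_const[of a 1] by (simp add: trig_def[abs_def])
  next
    case 2
    have t: "0 \<le> t" "t \<le> a" using less.prems(2)[of t \<phi>] 2 by auto
    have "rep a (\<lambda>\<omega>. 1 * cis (D 0 t \<phi> \<omega>))"
      by (rule rep_mult_cis_increment[OF rep_const, where B = 1]) (use t in auto)
    moreover have "AE \<omega> in M. 1 * cis (D 0 t \<phi> \<omega>) = trig L \<omega>"
      using W_0[of \<phi>] by eventually_elim (simp add: trig_def 2)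
    moreover have "trig L \<in> borel_measurable M"
      using F_measurable[OF trig_measurable assms(3)] less.prems(2) by blast
    ultimately show ?thesis using rep_cong_AE by blast
  next
    case 3
    let ?L = "(s, \<phi> + \<psi>) # L'"
    have t: "0 \<le> s" "s \<le> t" "t \<le> a" using less.prems 3 by auto
    have sL: "sorted_wrt (\<lambda>x y. fst x \<ge> fst y) ?L" and len: "length ?L < length L"
      using less.prems(1) 3 by auto
    have m: "0 \<le> r \<and> r \<le> s" if "(r, \<theta>) \<in> set ?L" for r \<theta>
      using that less.prems 3 t by fastforce
    then have ma: "0 \<le> r \<and> r \<le> a" if "(r, \<theta>) \<in> set ?L" for r \<theta>
      using that t by fastforce
    have "rep a (\<lambda>\<omega>. trig ?L \<omega> * cis (D s t \<phi> \<omega>))"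
      by (rule rep_mult_cis_increment[OF less.hyps[OF len sL ma] trig_measurable[OF m], where B = 1])
        (use t in auto)
    moreover have "AE \<omega> in M. trig ?L \<omega> * cis (D s t \<phi> \<omega>) = trig L \<omega>"
      using W_add[OF t(1), of \<phi> \<psi>] by eventually_elim (simp add: trig_def 3 cis_mult add_ac)
    moreover have "trig L \<in> borel_measurable M"
      using F_measurable[OF trig_measurable assms(3)] less.prems(2) by blast
    ultimately show ?thesis using rep_cong_AE by blast
  qed
qed

lemma rep_trig:
  assumes "\<And>t \<phi>. (t, \<phi>) \<in> set L \<Longrightarrow> 0 \<le> t \<and> t \<le> a" "0 \<le> a"
  shows "rep a (trig L)"
proof -
  let ?L = "sort_key (\<lambda>x. - fst x) L"
  have "sorted_wrt (\<lambda>x y. - fst x \<le> - fst y) ?L"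
    using sorted_sort_key[of "\<lambda>x. - fst x" L] by (simp add: sorted_wrt_map)
  then have "rep a (trig ?L)" using rep_trig_sorted[of ?L a] assms by simp
  moreover have "trig ?L \<omega> = trig L \<omega>" for \<omega>
  proof -
    have "mset (map (\<lambda>(t, \<phi>). W t \<phi> \<omega>) ?L) = mset (map (\<lambda>(t, \<phi>). W t \<phi> \<omega>) L)" by simp
    then show ?thesis unfolding trig_def by (metis sum_mset_sum_list)
  qed
  ultimately show ?thesis by (simp add: fun_eq_iff[symmetric] ext[of "trig ?L" "trig L"])
qed


lemma tends2_bounded:
  fixes f :: "nat \<Rightarrow> 'w \<Rightarrow> 'h::{real_inner, banach, second_countable_topology}"
  assumes m: "\<And>n. f n \<in> borel_measurable M" "g \<in> borel_measurable M"
    and b: "\<And>n \<omega>. norm (f n \<omega>) \<le> B" "\<And>\<omega>. norm (g \<omega>) \<le> B"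
    and lim: "AE \<omega> in M. (\<lambda>n. f n \<omega>) \<longlonglongrightarrow> g \<omega>"
  shows "tends2 M f g"
proof -
  have "(\<lambda>n. \<integral>x. (norm (f n x - g x))\<^sup>2 \<partial>M) \<longlonglongrightarrow> (\<integral>x. 0 \<partial>M)"
  proof (rule integral_dominated_convergence[of _ _ _ "\<lambda>_. (2 * B)\<^sup>2"])
    show "AE x in M. (\<lambda>n. (norm (f n x - g x))\<^sup>2) \<longlonglongrightarrow> 0"
      using lim
    proof eventually_elim
      fix x assume "(\<lambda>n. f n x) \<longlonglongrightarrow> g x"
      then have "(\<lambda>n. f n x - g x) \<longlonglongrightarrow> 0" using LIM_zero by blast
      then have "(\<lambda>n. (norm (f n x - g x))\<^sup>2) \<longlonglongrightarrow> (norm (0::'h))\<^sup>2" by (intro tendsto_intros)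
      then show "(\<lambda>n. (norm (f n x - g x))\<^sup>2) \<longlonglongrightarrow> 0" by simp
    qed
    show "AE x in M. norm ((norm (f n x - g x))\<^sup>2) \<le> (2 * B)\<^sup>2" for n
    proof (rule AE_I2)
      fix x
      have "norm (f n x - g x) \<le> 2 * B"
        using norm_triangle_ineq4[of "f n x" "g x"] b(1)[of n x] b(2)[of x] by simp
      from power_mono[OF this norm_ge_zero, of 2]
      show "norm ((norm (f n x - g x))\<^sup>2) \<le> (2 * B)\<^sup>2" by simp
    qed
    show "(\<lambda>x. (norm (f n x - g x))\<^sup>2) \<in> borel_measurable M" for n using m by simp
  qed auto
  then have "(\<lambda>n. sqrt (\<integral>x. (norm (f n x - g x))\<^sup>2 \<partial>M)) \<longlonglongrightarrow> sqrt 0"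
    by (intro tendsto_real_sqrt) simp
  then show ?thesis
    using L2_bounded[OF m(1) b(1)] L2_bounded[OF m(2) b(2)] by (simp add: tends2_def n2_def)
qed

text \<open>Closed under multiplication by trigonometric monomials and under bounded limits, hence under multiplication by all indicators of the filtration.\<close>

definition trig_rep :: "real \<Rightarrow> ('w \<Rightarrow> complex) \<Rightarrow> bool" where
  "trig_rep a U \<longleftrightarrow> U \<in> borel_measurable M \<and> (\<exists>B. \<forall>\<omega>. cmod (U \<omega>) \<le> B) \<and>
    (\<forall>L. (\<forall>(t, \<phi>)\<in>set L. 0 \<le> t \<and> t \<le> a) \<longrightarrow> rep a (\<lambda>\<omega>. U \<omega> * trig L \<omega>))"

lemma trig_repI:
  assumes "U \<in> borel_measurable M" "\<And>\<omega>. cmod (U \<omega>) \<le> B"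
    "\<And>L. (\<And>t \<phi>. (t, \<phi>) \<in> set L \<Longrightarrow> 0 \<le> t \<and> t \<le> a) \<Longrightarrow> rep a (\<lambda>\<omega>. U \<omega> * trig L \<omega>)"
  shows "trig_rep a U"
  unfolding trig_rep_def using assms by blast

lemma trig_rep_measurable: "trig_rep a U \<Longrightarrow> U \<in> borel_measurable M"
  by (simp add: trig_rep_def)

lemma trig_rep_bounded: "trig_rep a U \<Longrightarrow> \<exists>B. \<forall>\<omega>. cmod (U \<omega>) \<le> B"
  by (simp add: trig_rep_def)

lemma trig_rep_rep:
  "trig_rep a U \<Longrightarrow> (\<And>t \<phi>. (t, \<phi>) \<in> set L \<Longrightarrow> 0 \<le> t \<and> t \<le> a) \<Longrightarrow> rep a (\<lambda>\<omega>. U \<omega> * trig L \<omega>)"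
  unfolding trig_rep_def by blast

lemma trig_measurable_M:
  "0 \<le> a \<Longrightarrow> (\<And>t \<phi>. (t, \<phi>) \<in> set L \<Longrightarrow> 0 \<le> t \<and> t \<le> a) \<Longrightarrow> trig L \<in> borel_measurable M"
  using F_measurable[OF trig_measurable] by blast

lemma trig_rep_one: "0 \<le> a \<Longrightarrow> trig_rep a (\<lambda>\<omega>. 1)"
  by (rule trig_repI[of _ 1]) (auto intro: rep_trig)

lemma trig_rep_cmult: "trig_rep a U \<Longrightarrow> trig_rep a (\<lambda>\<omega>. c * U \<omega>)"
proof -
  assume U: "trig_rep a U"
  obtain B where B: "\<And>\<omega>. cmod (U \<omega>) \<le> B" using trig_rep_bounded[OF U] by blast
  show ?thesis
  proof (rule trig_repI)
    show "cmod (c * U \<omega>) \<le> cmod c * B" for \<omega> using B by (simp add: norm_mult mult_left_mono)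
    show "rep a (\<lambda>\<omega>. c * U \<omega> * trig L \<omega>)" if "\<And>t \<phi>. (t, \<phi>) \<in> set L \<Longrightarrow> 0 \<le> t \<and> t \<le> a" for L
      using rep_linear[OF trig_rep_rep[OF U that] bounded_linear_mult_right[of c]] by (simp add: mult.assoc)
  qed (use trig_rep_measurable[OF U] in simp)
qed

lemma trig_rep_add: "trig_rep a U \<Longrightarrow> trig_rep a V \<Longrightarrow> trig_rep a (\<lambda>\<omega>. U \<omega> + V \<omega>)"
proof -
  assume U: "trig_rep a U" and V: "trig_rep a V"
  obtain B where B: "\<And>\<omega>. cmod (U \<omega>) \<le> B" using trig_rep_bounded[OF U] by blast
  obtain B' where B': "\<And>\<omega>. cmod (V \<omega>) \<le> B'" using trig_rep_bounded[OF V] by blast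
  show ?thesis
  proof (rule trig_repI)
    show "cmod (U \<omega> + V \<omega>) \<le> B + B'" for \<omega>
      using norm_triangle_ineq[of "U \<omega>" "V \<omega>"] B[of \<omega>] B'[of \<omega>] by linarith
    show "rep a (\<lambda>\<omega>. (U \<omega> + V \<omega>) * trig L \<omega>)" if "\<And>t \<phi>. (t, \<phi>) \<in> set L \<Longrightarrow> 0 \<le> t \<and> t \<le> a" for L
      using rep_add[OF trig_rep_rep[OF U that] trig_rep_rep[OF V that]] by (simp add: distrib_right)
  qed (use trig_rep_measurable[OF U] trig_rep_measurable[OF V] in simp)
qed

lemma trig_rep_trig:
  assumes U: "trig_rep a U" and a: "0 \<le> a" and L: "\<And>t \<phi>. (t, \<phi>) \<in> set L \<Longrightarrow> 0 \<le> t \<and> t \<le> a"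
  shows "trig_rep a (\<lambda>\<omega>. U \<omega> * trig L \<omega>)"
proof -
  obtain B where B: "\<And>\<omega>. cmod (U \<omega>) \<le> B" using trig_rep_bounded[OF U] by blast
  show ?thesis
  proof (rule trig_repI)
    show "cmod (U \<omega> * trig L \<omega>) \<le> B" for \<omega> using B by (simp add: norm_mult)
    show "rep a (\<lambda>\<omega>. U \<omega> * trig L \<omega> * trig L' \<omega>)"
      if "\<And>t \<phi>. (t, \<phi>) \<in> set L' \<Longrightarrow> 0 \<le> t \<and> t \<le> a" for L'
    proof -
      have "rep a (\<lambda>\<omega>. U \<omega> * trig (L @ L') \<omega>)"
        by (rule trig_rep_rep[OF U]) (use L that in auto)
      then show ?thesis by (simp add: trig_append mult.assoc)
    qed
  qed (intro borel_measurable_times trig_rep_measurable[OF U] trig_measurable_M[OF a L])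
qed

lemma trig_rep_limit:
  assumes U: "\<And>n. trig_rep a (U n)" and a: "0 \<le> a" and b: "\<And>n \<omega>. cmod (U n \<omega>) \<le> B" "\<And>\<omega>. cmod (V \<omega>) \<le> B"
    and V: "V \<in> borel_measurable M" and lim: "AE \<omega> in M. (\<lambda>n. U n \<omega>) \<longlonglongrightarrow> V \<omega>"
  shows "trig_rep a V"
proof (rule trig_repI[OF V b(2)])
  fix L :: "(real \<times> 'k) list" assume L: "\<And>t \<phi>. (t, \<phi>) \<in> set L \<Longrightarrow> 0 \<le> t \<and> t \<le> a"
  note t = trig_measurable_M[OF a L]
  have "tends2 M (\<lambda>n \<omega>. U n \<omega> * trig L \<omega>) (\<lambda>\<omega>. V \<omega> * trig L \<omega>)"
  proof (rule tends2_bounded[where B = B])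
    show "AE \<omega> in M. (\<lambda>n. U n \<omega> * trig L \<omega>) \<longlonglongrightarrow> V \<omega> * trig L \<omega>"
      using lim by eventually_elim (intro tendsto_intros)
  qed (use b t V trig_rep_measurable[OF U] in \<open>auto simp: norm_mult intro!: borel_measurable_times\<close>)
  then show "rep a (\<lambda>\<omega>. V \<omega> * trig L \<omega>)"
    by (rule rep_limit[rotated]) (rule trig_rep_rep[OF U L])
qed

lemma trig_rep_cong_AE:
  assumes U: "trig_rep a U" and a: "0 \<le> a" and eq: "AE \<omega> in M. U \<omega> = V \<omega>"
    and V: "V \<in> borel_measurable M" "\<And>\<omega>. cmod (V \<omega>) \<le> B"
  shows "trig_rep a V"
proof -
  obtain B' where B': "\<And>\<omega>. cmod (U \<omega>) \<le> B'" using trig_rep_bounded[OF U] by blast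
  show ?thesis
  proof (rule trig_rep_limit[of a "\<lambda>n. U" "max B B'"])
    show "AE \<omega> in M. (\<lambda>n. U \<omega>) \<longlonglongrightarrow> V \<omega>" using eq by eventually_elim simp
  qed (use U a V B' in \<open>auto simp: le_max_iff_disj\<close>)
qed

text \<open>Euler's formula writes the cosine as a combination of two monomials with coefficients
  cis d and cis (- d). Scaling by c happens inside the direction \<phi>, by almost sure linearity of
  W.\<close>

lemma trig_rep_mult_cos:
  assumes U: "trig_rep a U" and t: "0 \<le> t" "t \<le> a"
  shows "trig_rep a (\<lambda>\<omega>. U \<omega> * of_real (cos (c * W t \<phi> \<omega> - d)))"
proof -
  have a: "0 \<le> a" using t by simp
  obtain B where B: "\<And>\<omega>. cmod (U \<omega>) \<le> B" using trig_rep_bounded[OF U] by blast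
  have Wm: "W t \<phi> \<in> borel_measurable M" using F_measurable[OF W_measurable] t by blast
  let ?V = "\<lambda>\<omega>. (cis (- d) / 2) * (U \<omega> * trig [(t, c *\<^sub>R \<phi>)] \<omega>) + (cis d / 2) * (U \<omega> * trig [(t, (- c) *\<^sub>R \<phi>)] \<omega>)"
  have V: "trig_rep a ?V" by (intro trig_rep_add trig_rep_cmult trig_rep_trig U a) (use t in auto)
  have "AE \<omega> in M. W t (c *\<^sub>R \<phi>) \<omega> = c * W t \<phi> \<omega>" "AE \<omega> in M. W t ((- c) *\<^sub>R \<phi>) \<omega> = - c * W t \<phi> \<omega>"
    using W_linear[OF t(1), of c \<phi> 0 0] W_linear[OF t(1), of "-c" \<phi> 0 0] by simp_all
  then have eq: "AE \<omega> in M. ?V \<omega> = U \<omega> * of_real (cos (c * W t \<phi> \<omega> - d))"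
  proof eventually_elim
    fix \<omega> assume *: "W t (c *\<^sub>R \<phi>) \<omega> = c * W t \<phi> \<omega>" "W t ((- c) *\<^sub>R \<phi>) \<omega> = - c * W t \<phi> \<omega>"
    have "?V \<omega> = U \<omega> * ((cis (- d) * cis (c * W t \<phi> \<omega>) + cis d * cis (- c * W t \<phi> \<omega>)) / 2)"
      by (simp only: trig_def list.map sum_list.Cons sum_list.Nil prod.case * add_0_right) (simp add: algebra_simps)
    also have "cis (- d) * cis (c * W t \<phi> \<omega>) = cis (c * W t \<phi> \<omega> - d)" by (simp add: cis_mult)
    also have "cis d * cis (- c * W t \<phi> \<omega>) = cis (- (c * W t \<phi> \<omega> - d))" by (simp add: cis_mult)
    also have "cis (c * W t \<phi> \<omega> - d) + cis (- (c * W t \<phi> \<omega> - d)) = 2 * of_real (cos (c * W t \<phi> \<omega> - d))"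
      by (simp add: complex_eq_iff cos_diff sin_diff)
    finally show "?V \<omega> = U \<omega> * of_real (cos (c * W t \<phi> \<omega> - d))" by simp
  qed
  show ?thesis
  proof (rule trig_rep_cong_AE[OF V a eq])
    have "B \<ge> 0" using order_trans[OF norm_ge_zero B] .
    then show "cmod (U \<omega> * of_real (cos (c * W t \<phi> \<omega> - d))) \<le> B" for \<omega>
      using B[of \<omega>] mult_mono[of "cmod (U \<omega>)" B "\<bar>cos (c * W t \<phi> \<omega> - d)\<bar>" 1] by (simp add: norm_mult)
  qed (use trig_rep_measurable[OF U] Wm in simp)
qed

lemma trig_rep_mult_poly:
  assumes p: "real_polynomial_function p" and U: "trig_rep a U" and t: "0 \<le> t" "t \<le> a"
  shows "trig_rep a (\<lambda>\<omega>. U \<omega> * of_real (p (cos (c * W t \<phi> \<omega> - d))))"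
  using p U
proof (induction arbitrary: U rule: real_polynomial_function.induct)
  case (linear f)
  have "f x = x * f 1" for x :: real
    using linear.hyps by (metis bounded_linear.linear linear_scale mult.right_neutral real_scaleR_def)
  then have eq: "U \<omega> * of_real (f (cos (c * W t \<phi> \<omega> - d))) = of_real (f 1) * (U \<omega> * of_real (cos (c * W t \<phi> \<omega> - d)))" for \<omega>
    by (metis (no_types, lifting) mult.assoc mult.commute of_real_mult)
  show ?case unfolding eq by (intro trig_rep_cmult trig_rep_mult_cos linear t)
next
  case (const x)
  have "trig_rep a (\<lambda>\<omega>. of_real x * U \<omega>)" by (intro trig_rep_cmult const)
  then show ?case by (simp add: mult.commute)
next
  case (add f g)
  have "trig_rep a (\<lambda>\<omega>. U \<omega> * of_real (f (cos (c * W t \<phi> \<omega> - d))) + U \<omega> * of_real (g (cos (c * W t \<phi> \<omega> - d))))"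
    by (intro trig_rep_add add)
  then show ?case by (simp add: distrib_left)
next
  case (mult f g)
  have "trig_rep a (\<lambda>\<omega>. (U \<omega> * of_real (f (cos (c * W t \<phi> \<omega> - d)))) * of_real (g (cos (c * W t \<phi> \<omega> - d))))"
    by (intro mult)
  then show ?case by (simp add: mult.assoc)
qed

text \<open>The indicator of values above z is the pointwise limit of the continuous ramps
  \<open>f n\<close>, and each ramp is approximated on [-1, 1] by a polynomial up to 1 / (n + 1).
  Cosines keep the argument in this compact interval, where W itself would not; the bound 2 is 1 for
  the ramp plus 1 for the error.\<close>

lemma trig_rep_mult_above:
  assumes U: "trig_rep a U" and t: "0 \<le> t" "t \<le> a"
  shows "trig_rep a (\<lambda>\<omega>. U \<omega> * of_real (indicator {z<..} (cos (c * W t \<phi> \<omega> - d))))"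
proof -
  have a: "0 \<le> a" using t by simp
  obtain B where B: "\<And>\<omega>. cmod (U \<omega>) \<le> B" using trig_rep_bounded[OF U] by blast
  have B0: "B \<ge> 0" using order_trans[OF norm_ge_zero B] .
  have Wm: "W t \<phi> \<in> borel_measurable M" using F_measurable[OF W_measurable] t by blast
  define f where "f n x = min 1 (real n * max 0 (x - z))" for n :: nat and x :: real
  have "\<exists>p. real_polynomial_function p \<and> (\<forall>x\<in>{-1..1}. \<bar>f n x - p x\<bar> < 1 / real (Suc n))" for n
  proof -
    have "continuous_on {-1..1} (f n)" by (auto simp: f_def intro!: continuous_intros)
    from Stone_Weierstrass_real_polynomial_function[OF compact_Icc this, of "1 / real (Suc n)"]
    show ?thesis by (metis of_nat_0_less_iff zero_less_Suc zero_less_divide_1_iff)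
  qed
  then obtain p where p: "\<And>n. real_polynomial_function (p n)"
    and pf: "\<And>n x. x \<in> {-1..1} \<Longrightarrow> \<bar>f n x - p n x\<bar> < 1 / real (Suc n)"
    by metis
  let ?y = "\<lambda>\<omega>. cos (c * W t \<phi> \<omega> - d)"
  show ?thesis
  proof (rule trig_rep_limit[of a "\<lambda>n \<omega>. U \<omega> * of_real (p n (?y \<omega>))" "B * 2"])
    show "trig_rep a (\<lambda>\<omega>. U \<omega> * of_real (p n (?y \<omega>)))" for n by (rule trig_rep_mult_poly[OF p U t])
    show "cmod (U \<omega> * of_real (p n (?y \<omega>))) \<le> B * 2" for n \<omega>
    proof -
      have "\<bar>f n (?y \<omega>)\<bar> \<le> 1" by (simp add: f_def min_def)
      moreover have "\<bar>f n (?y \<omega>) - p n (?y \<omega>)\<bar> \<le> 1"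
        using pf[of "?y \<omega>" n] by (rule less_imp_le[OF less_le_trans]) auto
      ultimately have "\<bar>p n (?y \<omega>)\<bar> \<le> 2" by linarith
      then show ?thesis using B[of \<omega>] B0 by (simp add: norm_mult mult_mono)
    qed
    show "cmod (U \<omega> * of_real (indicator {z<..} (?y \<omega>))) \<le> B * 2" for \<omega>
      using B[of \<omega>] B0 by (simp add: norm_mult indicator_def)
    show "(\<lambda>\<omega>. U \<omega> * of_real (indicator {z<..} (?y \<omega>))) \<in> borel_measurable M"
      using trig_rep_measurable[OF U] Wm by simp
    have "(\<lambda>n. p n y) \<longlonglongrightarrow> indicator {z<..} y" if "y \<in> {-1..1}" for y
    proof -
      have "(\<lambda>n. f n y) \<longlonglongrightarrow> indicator {z<..} y"
      proof (cases "y > z")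
        case True
        obtain k :: nat where k: "1 / (y - z) \<le> real k" using real_arch_simple by blast
        have "f n y = 1" if "n \<ge> k" for n
        proof -
          have "1 / (y - z) \<le> real n" using k that by linarith
          then show ?thesis using True by (simp add: f_def field_simps)
        qed
        then have "eventually (\<lambda>n. f n y = 1) sequentially" by (auto simp: eventually_sequentially)
        then show ?thesis using True by (simp add: tendsto_eventually)
      qed (simp add: f_def)
      moreover have "(\<lambda>n. p n y - f n y) \<longlonglongrightarrow> 0"
      proof (rule Lim_null_comparison)
        show "(\<lambda>n. 1 / real (Suc n)) \<longlonglongrightarrow> 0" using LIMSEQ_inverse_real_of_nat by (simp add: inverse_eq_divide)
        show "\<forall>\<^sub>F n in sequentially. norm (p n y - f n y) \<le> 1 / real (Suc n)"
          using pf[OF that] by (intro always_eventually allI less_imp_le) (simp add: abs_minus_commute)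
      qed
      ultimately show ?thesis using tendsto_add by fastforce
    qed
    then have "(\<lambda>n. p n (?y \<omega>)) \<longlonglongrightarrow> indicator {z<..} (?y \<omega>)" for \<omega> by simp
    then show "AE \<omega> in M. (\<lambda>n. U \<omega> * of_real (p n (?y \<omega>))) \<longlonglongrightarrow> U \<omega> * of_real (indicator {z<..} (?y \<omega>))"
      by (intro AE_I2 tendsto_intros)
  qed (rule a)
qed

section \<open>Sets of the filtration as multipliers\<close>

text \<open>Asking that multiplication by the indicator preserve the whole class
  \<open>trig_rep\<close>, and not only that the indicator belong to it, makes stability under
  intersections immediate. Induction over \<open>sigma_sets\<close> then reaches every set of the
  filtration.\<close>

definition multiplier :: "real \<Rightarrow> 'w set \<Rightarrow> bool" where
  "multiplier a G \<longleftrightarrow> G \<in> sets M \<and> (\<forall>U. trig_rep a U \<longrightarrow> trig_rep a (\<lambda>\<omega>. indicator G \<omega> * U \<omega>))"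

lemma multiplier_sets: "multiplier a G \<Longrightarrow> G \<in> sets M"
  by (simp add: multiplier_def)

lemma trig_rep_indicator: "multiplier a G \<Longrightarrow> trig_rep a U \<Longrightarrow> trig_rep a (\<lambda>\<omega>. indicator G \<omega> * U \<omega>)"
  by (simp add: multiplier_def)

lemma trig_rep_cong: "trig_rep a U \<Longrightarrow> 0 \<le> a \<Longrightarrow> (\<And>\<omega>. \<omega> \<in> space M \<Longrightarrow> U \<omega> = V \<omega>) \<Longrightarrow> (\<And>\<omega>. cmod (V \<omega>) \<le> B) \<Longrightarrow> trig_rep a V"
  by (rule trig_rep_cong_AE[of a U V B]) (auto simp: trig_rep_measurable measurable_cong[of M V U])

lemma indicator_mult_le: "cmod (indicator G \<omega> * z) \<le> cmod z"
  by (simp add: indicator_def)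

lemma multiplier_empty: "multiplier a {}"
  using trig_rep_cmult[of a _ 0] by (simp add: multiplier_def)

lemma multiplier_compl:
  assumes G: "multiplier a G" and a: "0 \<le> a"
  shows "multiplier a (space M - G)"
  unfolding multiplier_def
proof (intro conjI allI impI)
  fix U assume U: "trig_rep a U"
  obtain B where B: "\<And>\<omega>. cmod (U \<omega>) \<le> B" using trig_rep_bounded[OF U] by blast
  have "trig_rep a (\<lambda>\<omega>. U \<omega> + (-1) * (indicator G \<omega> * U \<omega>))"
    by (intro trig_rep_add trig_rep_cmult U trig_rep_indicator G)
  then show "trig_rep a (\<lambda>\<omega>. indicator (space M - G) \<omega> * U \<omega>)"
  proof (rule trig_rep_cong[OF _ a])
    show "cmod (indicator (space M - G) \<omega> * U \<omega>) \<le> B" for \<omega>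
      by (rule order_trans[OF indicator_mult_le B])
  qed (auto simp: indicator_def)
qed (use multiplier_sets[OF G] in auto)

lemma multiplier_Int:
  assumes "multiplier a G" "multiplier a H"
  shows "multiplier a (G \<inter> H)"
proof -
  have "(\<lambda>\<omega>. indicator (G \<inter> H) \<omega> * U \<omega>) = (\<lambda>\<omega>. indicator G \<omega> * (indicator H \<omega> * U \<omega>))" for U :: "'w \<Rightarrow> complex"
    by (auto simp: indicator_def)
  then show ?thesis using assms by (simp add: multiplier_def sets.Int)
qed

lemma multiplier_UN:
  assumes G: "\<And>i::nat. multiplier a (G i)" and a: "0 \<le> a"
  shows "multiplier a (\<Union>i. G i)"
proof -
  have fin: "multiplier a (\<Union>i<n. G i)" for n
  proof (induction n)
    case 0
    show ?case using multiplier_empty by simp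
  next
    case (Suc n)
    have "(\<Union>i<Suc n. G i) = space M - ((space M - (\<Union>i<n. G i)) \<inter> (space M - G n))"
      using sets.sets_into_space[OF multiplier_sets[OF Suc]] sets.sets_into_space[OF multiplier_sets[OF G]]
      by (auto simp: lessThan_Suc)
    then show ?case using multiplier_compl[OF multiplier_Int[OF multiplier_compl[OF Suc a] multiplier_compl[OF G a]] a] by simp
  qed
  show ?thesis
    unfolding multiplier_def
  proof (intro conjI allI impI)
    fix U assume U: "trig_rep a U"
    obtain B where B: "\<And>\<omega>. cmod (U \<omega>) \<le> B" using trig_rep_bounded[OF U] by blast
    show "trig_rep a (\<lambda>\<omega>. indicator (\<Union>i. G i) \<omega> * U \<omega>)"
    proof (rule trig_rep_limit[of a "\<lambda>n \<omega>. indicator (\<Union>i<n. G i) \<omega> * U \<omega>" B])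
      show "trig_rep a (\<lambda>\<omega>. indicator (\<Union>i<n. G i) \<omega> * U \<omega>)" for n by (rule trig_rep_indicator[OF fin U])
      show "AE \<omega> in M. (\<lambda>n. indicator (\<Union>i<n. G i) \<omega> * U \<omega>) \<longlonglongrightarrow> indicator (\<Union>i. G i) \<omega> * U \<omega>"
        by (intro AE_I2 tendsto_mult tendsto_const LIMSEQ_indicator_UN)
      show "(\<lambda>\<omega>. indicator (\<Union>i. G i) \<omega> * U \<omega>) \<in> borel_measurable M"
        using multiplier_sets[OF G] trig_rep_measurable[OF U] by simp
    qed (use a in \<open>auto intro: order_trans[OF indicator_mult_le B]\<close>)
  qed (use multiplier_sets[OF G] in auto)
qed

lemma multiplier_INT:
  assumes G: "\<And>i::nat. multiplier a (G i)" and a: "0 \<le> a"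
  shows "multiplier a (\<Inter>i. G i)"
proof -
  have eq: "(\<Inter>i. G i) = space M - (\<Union>i. space M - G i)"
    using sets.sets_into_space[OF multiplier_sets[OF G]] by auto
  show ?thesis unfolding eq by (rule multiplier_compl[OF multiplier_UN[OF multiplier_compl[OF G a] a] a])
qed

lemma multiplier_null:
  assumes "N \<in> null_sets M" "0 \<le> a"
  shows "multiplier a N"
  unfolding multiplier_def
proof (intro conjI allI impI)
  fix U assume U: "trig_rep a U"
  obtain B where B: "\<And>\<omega>. cmod (U \<omega>) \<le> B" using trig_rep_bounded[OF U] by blast
  have "AE \<omega> in M. \<omega> \<notin> N" using assms(1) by (rule AE_not_in)
  then have eq: "AE \<omega> in M. 0 * U \<omega> = indicator N \<omega> * U \<omega>" by eventually_elim simp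
  show "trig_rep a (\<lambda>\<omega>. indicator N \<omega> * U \<omega>)"
    by (rule trig_rep_cong_AE[OF trig_rep_cmult[OF U] assms(2) eq, of B])
      (use assms trig_rep_measurable[OF U] in \<open>auto intro: order_trans[OF indicator_mult_le B]\<close>)
qed (use assms in auto)

lemma multiplier_cos_above:
  assumes t: "0 \<le> t" "t \<le> a"
  shows "multiplier a {\<omega>\<in>space M. z < cos (c * W t \<phi> \<omega> - d)}"
  unfolding multiplier_def
proof (intro conjI allI impI)
  have Wm: "W t \<phi> \<in> borel_measurable M" using F_measurable[OF W_measurable] t by blast
  then show "{\<omega>\<in>space M. z < cos (c * W t \<phi> \<omega> - d)} \<in> sets M" by measurable
  fix U assume U: "trig_rep a U"
  obtain B where B: "\<And>\<omega>. cmod (U \<omega>) \<le> B" using trig_rep_bounded[OF U] by blast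
  show "trig_rep a (\<lambda>\<omega>. indicator {\<omega>\<in>space M. z < cos (c * W t \<phi> \<omega> - d)} \<omega> * U \<omega>)"
  proof (rule trig_rep_cong[OF trig_rep_mult_above[OF U t, of z c \<phi> d]])
    show "cmod (indicator {\<omega>\<in>space M. z < cos (c * W t \<phi> \<omega> - d)} \<omega> * U \<omega>) \<le> B" for \<omega>
      by (rule order_trans[OF indicator_mult_le B])
  qed (use t in \<open>auto simp: indicator_def\<close>)
qed

text \<open>Cosines are periodic; small frequencies make them separate an interval from its complement.\<close>

lemma cos_less_iff_eventually:
  fixes x r :: real
  assumes r: "r > 0"
  shows "\<bar>x\<bar> < r \<longleftrightarrow> (\<exists>k. \<forall>n\<ge>k. cos (r / real (Suc n)) < cos (x / real (Suc n)))"
proof -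
  obtain k :: nat where k: "max r \<bar>x\<bar> \<le> real k" using real_arch_simple by blast
  have small: "r / real (Suc n) \<le> pi" "\<bar>x\<bar> / real (Suc n) \<le> pi" if "n \<ge> k" for n
  proof -
    have "r \<le> real (Suc n)" "\<bar>x\<bar> \<le> real (Suc n)" using k that by auto
    then have "r / real (Suc n) \<le> 1" "\<bar>x\<bar> / real (Suc n) \<le> 1" by (simp_all add: divide_le_eq)
    then show "r / real (Suc n) \<le> pi" "\<bar>x\<bar> / real (Suc n) \<le> pi" using pi_gt3 by linarith+
  qed
  have ab: "cos (x / real (Suc n)) = cos (\<bar>x\<bar> / real (Suc n))" for n
    by (metis abs_divide abs_of_nat cos_abs_real)
  have "cos (r / real (Suc n)) < cos (x / real (Suc n)) \<longleftrightarrow> \<bar>x\<bar> < r" if n: "n \<ge> k" for n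
  proof -
    have "cos (r / real (Suc n)) < cos (\<bar>x\<bar> / real (Suc n)) \<longleftrightarrow> \<bar>x\<bar> / real (Suc n) < r / real (Suc n)"
      using small[OF n] r by (intro cos_mono_less_eq) (auto simp del: of_nat_Suc)
    also have "\<dots> \<longleftrightarrow> \<bar>x\<bar> < r" by (simp add: divide_less_cancel del: of_nat_Suc)
    finally show ?thesis unfolding ab .
  qed
  then show ?thesis by (metis nat_le_linear)
qed

text \<open>With m the midpoint and r half the length, \<open>cos_less_iff_eventually\<close> writes
  the event as the lower limit of the cosine events \<open>Y n\<close>, a countable union of
  countable intersections of multipliers.\<close>

lemma multiplier_interval:
  assumes t: "0 \<le> t" "t \<le> a"
  shows "multiplier a (W t \<phi> -` {x<..<y} \<inter> space M)"
proof (cases "x < y")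
  case True
  have a: "0 \<le> a" using t by simp
  define m r where "m = (x + y) / 2" and "r = (y - x) / 2"
  have r: "r > 0" using True by (simp add: r_def)
  define Y where "Y n = {\<omega>\<in>space M. cos (r / real (Suc n)) < cos (1 / real (Suc n) * W t \<phi> \<omega> - m / real (Suc n))}" for n
  have Y: "multiplier a (Y n)" for n unfolding Y_def by (rule multiplier_cos_above[OF t])
  have "W t \<phi> -` {x<..<y} \<inter> space M = (\<Union>k. \<Inter>n. Y (k + n))"
  proof (rule set_eqI)
    fix \<omega>
    have iff: "W t \<phi> \<omega> \<in> {x<..<y} \<longleftrightarrow> \<bar>W t \<phi> \<omega> - m\<bar> < r" by (auto simp: m_def r_def abs_less_iff field_simps)
    have "cos (r / real (Suc n)) < cos ((W t \<phi> \<omega> - m) / real (Suc n)) \<longleftrightarrow> \<omega> \<in> Y n" if "\<omega> \<in> space M" for n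
      using that by (simp add: Y_def diff_divide_distrib)
    then have "\<bar>W t \<phi> \<omega> - m\<bar> < r \<longleftrightarrow> (\<exists>k. \<forall>n\<ge>k. \<omega> \<in> Y n)" if "\<omega> \<in> space M"
      using cos_less_iff_eventually[OF r, of "W t \<phi> \<omega> - m"] that by simp
    moreover have "(\<exists>k. \<forall>n\<ge>k. \<omega> \<in> Y n) \<longleftrightarrow> \<omega> \<in> (\<Union>k. \<Inter>n. Y (k + n))"
      by (auto simp: le_iff_add)
    moreover have "\<omega> \<in> Y n \<Longrightarrow> \<omega> \<in> space M" for n by (simp add: Y_def)
    ultimately show "\<omega> \<in> W t \<phi> -` {x<..<y} \<inter> space M \<longleftrightarrow> \<omega> \<in> (\<Union>k. \<Inter>n. Y (k + n))"
      using iff by auto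
  qed
  then show ?thesis using multiplier_UN[OF multiplier_INT[OF Y a] a] by simp
qed (use multiplier_empty in simp)

lemma multiplier_W:
  assumes t: "0 \<le> t" "t \<le> a" and B: "B \<in> sets borel"
  shows "multiplier a (W t \<phi> -` B \<inter> space M)"
proof -
  have a: "0 \<le> a" using t by simp
  have "B \<in> sigma_sets UNIV (range (\<lambda>(a, b). {a <..< b}))"
    using B unfolding borel_eq_box by (simp add: box_real case_prod_unfold)
  then show ?thesis
  proof induction
    case (Basic B)
    then show ?case using multiplier_interval[OF t] by auto
  next
    case Empty
    show ?case using multiplier_empty by simp
  next
    case (Compl B)
    have "W t \<phi> -` (UNIV - B) \<inter> space M = space M - (W t \<phi> -` B \<inter> space M)" by auto
    then show ?case using multiplier_compl[OF Compl.IH a] by simp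
  next
    case (Union B)
    have "W t \<phi> -` (\<Union>i. B i) \<inter> space M = (\<Union>i. W t \<phi> -` B i \<inter> space M)" by auto
    then show ?case using multiplier_UN[OF Union.IH a] by simp
  qed
qed

lemma multiplier_F:
  assumes a: "0 \<le> a" and G: "G \<in> sets (F a)"
  shows "multiplier a G"
proof -
  have "G \<in> sigma_sets (space M)
    (null_sets M \<union> {W s \<phi> -` B \<inter> space M |s \<phi> B. 0 \<le> s \<and> s \<le> a \<and> B \<in> sets borel})"
    using generated a G by (auto simp: generated_by_wiener_def)
  then show ?thesis
  proof induction
    case (Basic G)
    then show ?case using multiplier_null[OF _ a] multiplier_W by auto
  next
    case Empty
    show ?case by (rule multiplier_empty)
  next
    case (Compl G)
    then show ?case using multiplier_compl a by blast
  next
    case (Union G)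
    then show ?case using multiplier_UN a by blast
  qed
qed

text \<open>The empty monomial gives the complex indicator; the bounded linear map that sends z to
  Re z times h transfers representability to values in the Hilbert space.\<close>

theorem rep_indicator:
  fixes h :: "'h::{real_inner, banach, second_countable_topology}"
  assumes a: "0 \<le> a" and G: "G \<in> sets (F a)"
  shows "rep a (\<lambda>\<omega>. indicator G \<omega> *\<^sub>R h)"
proof -
  have "trig_rep a (\<lambda>\<omega>. indicator G \<omega> * 1)" by (rule trig_rep_indicator[OF multiplier_F[OF a G] trig_rep_one[OF a]])
  from trig_rep_rep[OF this, of "[]"] have r: "rep a (indicator G :: 'w \<Rightarrow> complex)" by (simp add: trig_def)
  have "bounded_linear (\<lambda>z. Re z *\<^sub>R h)"
    by (intro bounded_linear_scaleR_const bounded_linear_Re)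
  note bl = this
  have re: "Re (indicator G \<omega>) = indicator G \<omega>" for \<omega> by (simp add: indicator_def)
  from rep_linear[OF r bl] show ?thesis by (simp only: re)
qed

end

section \<open>The drift of the equation\<close>

text \<open>Strong continuity in t for each fixed vector becomes joint continuity once the Lipschitz
  constant in the vector is uniform in t. Joint measurability of the operators applied to random
  vectors rests on this.\<close>

lemma joint_continuous:
  fixes B :: "real \<Rightarrow> 'a::real_normed_vector \<Rightarrow> 'b::real_normed_vector"
  assumes cont: "\<And>x. continuous_on I (\<lambda>t. B t x)"
    and lip: "\<And>t x y. t \<in> I \<Longrightarrow> norm (B t x - B t y) \<le> c * norm (x - y)"
  shows "continuous_on (I \<times> UNIV) (\<lambda>p. B (fst p) (snd p))"
  unfolding continuous_on_def
proof (intro ballI)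
  fix p assume "p \<in> I \<times> (UNIV :: 'a set)"
  then obtain t x where p: "p = (t, x)" "t \<in> I" by auto
  let ?F = "at p within I \<times> UNIV"
  have 1: "((\<lambda>p. B (fst p) x) \<longlongrightarrow> B t x) ?F"
  proof -
    have "continuous_on (I \<times> (UNIV :: 'a set)) (\<lambda>p. B (fst p) x)"
      by (rule continuous_on_compose2[OF cont]) (auto intro!: continuous_intros)
    then show ?thesis using p by (auto simp: continuous_on_def)
  qed
  have s: "(snd \<longlongrightarrow> x) ?F" using tendsto_snd[OF tendsto_ident_at, of p] p by simp
  have "((\<lambda>p. B (fst p) (snd p) - B (fst p) x) \<longlongrightarrow> 0) ?F"
  proof (rule Lim_null_comparison)
    show "\<forall>\<^sub>F p in ?F. norm (B (fst p) (snd p) - B (fst p) x) \<le> c * norm (snd p - x)"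
      unfolding eventually_at_topological by (auto intro!: exI[of _ UNIV] lip)
    have "((\<lambda>p. c * norm (snd p - x)) \<longlongrightarrow> c * norm (x - x)) ?F" by (intro tendsto_intros s)
    then show "((\<lambda>p. c * norm (snd p - x)) \<longlongrightarrow> 0) ?F" by simp
  qed
  from tendsto_add[OF this 1] show "((\<lambda>p. B (fst p) (snd p)) \<longlongrightarrow> B (fst p) (snd p)) ?F"
    by (simp add: p)
qed

lemma joint_measurable:
  fixes B :: "real \<Rightarrow> 'a::{real_normed_vector, second_countable_topology} \<Rightarrow> 'b::real_normed_vector"
  assumes "continuous_on (I \<times> UNIV) (\<lambda>p. B (fst p) (snd p))" "I \<in> sets borel"
    and "f \<in> borel_measurable N" "g \<in> borel_measurable N"
  shows "(\<lambda>x. indicator I (f x) *\<^sub>R B (f x) (g x)) \<in> borel_measurable N"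
proof -
  have I: "I \<times> UNIV \<in> sets (borel :: (real \<times> 'a) measure)"
    using assms(2) unfolding borel_prod[symmetric] by (intro pair_measureI) auto
  have "(\<lambda>p. indicator (I \<times> UNIV) p *\<^sub>R B (fst p) (snd p)) \<in> borel_measurable borel"
    by (rule borel_measurable_continuous_on_indicator[OF I assms(1)])
  from measurable_compose[OF borel_measurable_Pair[OF assms(3,4)] this]
  show ?thesis by (simp add: indicator_times)
qed

lemma norm_rank_one: "norm (rank_one h \<phi>) = norm h * norm \<phi>"
  by (simp add: norm_eq_sqrt_inner inner_rank_one real_sqrt_mult)

lemma bounded_linear_rank_one: "bounded_linear (\<lambda>h. rank_one h \<phi>)"
proof (rule bounded_linear_intro[where K = "norm \<phi>"])
  show "rank_one (x + y) \<phi> = rank_one x \<phi> + rank_one y \<phi>" for x y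
    by (rule hs_eqI) (simp add: plus_hs.rep_eq blinfun.add_left scaleR_add_right)
  show "rank_one (r *\<^sub>R x) \<phi> = r *\<^sub>R rank_one x \<phi>" for r x
    by (rule hs_eqI) (simp add: scaleR_hs.rep_eq blinfun.scaleR_left)
qed (simp add: norm_rank_one)

text \<open>For an operator of finite rank this is strong continuity of B on finitely many vectors.
  Contractivity makes the finite rank approximation uniform in t, although B itself need not be
  continuous in operator norm.\<close>

lemma hs_compose_strongly_continuous:
  fixes B :: "real \<Rightarrow> 'b::real_inner \<Rightarrow>\<^sub>L 'c::real_inner" and Z :: "('a::{real_inner, second_countable_topology}, 'b) hs"
  assumes cont: "\<And>x. continuous_on I (\<lambda>t. B t x)" and contr: "\<And>t x. t \<in> I \<Longrightarrow> norm (B t x) \<le> norm x"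
  shows "continuous_on I (\<lambda>t. hs_compose (B t) Z)"
  unfolding continuous_on_iff
proof (intro ballI allI impI)
  fix t e :: real assume t: "t \<in> I" and e: "e > 0"
  obtain E where E: "finite E" "norm (Z - (\<Sum>x\<in>E. rank_one (blinfun_of_hs Z x) x)) \<le> e / 4"
    using hs_finite_rank_approx[OF onb_some_onb, of "e / 4" Z] e by auto
  define Y where "Y = (\<Sum>x\<in>E. rank_one (blinfun_of_hs Z x) x)"
  have lin: "linear (hs_compose (B s))" for s :: real by (rule bounded_linear.linear[OF bounded_linear_hs_compose])
  have "hs_compose (B s) Y = (\<Sum>x\<in>E. rank_one (B s (blinfun_of_hs Z x)) x)" for s
    by (simp add: Y_def linear_sum[OF lin] hs_compose_rank_one)
  then have "continuous_on I (\<lambda>s. hs_compose (B s) Y)"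
    by (simp, intro continuous_on_sum bounded_linear.continuous_on[OF bounded_linear_rank_one] cont)
  then obtain d where d: "d > 0" "\<And>s. s \<in> I \<Longrightarrow> dist s t < d \<Longrightarrow> dist (hs_compose (B s) Y) (hs_compose (B t) Y) < e / 2"
    using t e unfolding continuous_on_iff by (meson half_gt_zero)
  have app: "norm (hs_compose (B s) Z - hs_compose (B s) Y) \<le> e / 4" if "s \<in> I" for s
    using norm_hs_compose[of "B s" 1 "Z - Y"] contr[OF that] E(2) linear_diff[OF lin, of s Z Y]
    by (simp add: Y_def)
  show "\<exists>d>0. \<forall>s\<in>I. dist s t < d \<longrightarrow> dist (hs_compose (B s) Z) (hs_compose (B t) Z) < e"
  proof (intro exI[of _ d] conjI ballI impI)
    fix s assume s: "s \<in> I" "dist s t < d"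
    have "dist (hs_compose (B s) Z) (hs_compose (B t) Z)
        \<le> dist (hs_compose (B s) Z) (hs_compose (B s) Y) + dist (hs_compose (B s) Y) (hs_compose (B t) Z)"
      by (rule dist_triangle)
    also have "dist (hs_compose (B s) Y) (hs_compose (B t) Z)
        \<le> dist (hs_compose (B s) Y) (hs_compose (B t) Y) + dist (hs_compose (B t) Z) (hs_compose (B t) Y)"
      by (rule dist_triangle2)
    finally show "dist (hs_compose (B s) Z) (hs_compose (B t) Z) < e"
      using app[OF s(1)] app[OF t] d(2)[OF s] unfolding dist_norm by linarith
  qed (rule d)
qed

section \<open>The adjoint semigroup and the adjoint kernel\<close>

context kernel
begin

abbreviation Sa :: "real \<Rightarrow> 'h \<Rightarrow>\<^sub>L 'h" where "Sa t \<equiv> blinfun_adj (S t)"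
abbreviation Ka :: "real \<Rightarrow> ('k, 'h) hs \<Rightarrow>\<^sub>L 'h" where "Ka t \<equiv> blinfun_adj (K t)"

lemma Sa_add: "s \<ge> 0 \<Longrightarrow> t \<ge> 0 \<Longrightarrow> Sa (s + t) y = Sa t (Sa s y)"
  by (rule vector_eq_ldot[THEN iffD1]) (simp add: inner_blinfun_adj S_add)

lemma Ka_add: "u > 0 \<Longrightarrow> v \<ge> 0 \<Longrightarrow> Ka (u + v) z = Sa v (Ka u z)"
  by (rule vector_eq_ldot[THEN iffD1]) (simp add: inner_blinfun_adj K_add)

lemma Sa_0 [simp]: "Sa 0 y = y"
  by (rule vector_eq_ldot[THEN iffD1]) (simp add: inner_blinfun_adj S0)

lemma Sa_contraction: "t \<ge> 0 \<Longrightarrow> norm (Sa t y) \<le> norm y"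
  using norm_blinfun_adj_le[of "S t" 1 y] norm_blinfun_bound[of 1 "S t"] S_contraction by simp

lemma Ka_bound: "u > 0 \<Longrightarrow> norm (Ka u z) \<le> kap u * norm z"
  by (rule norm_blinfun_adj_le[OF K_bound])

lemma K_apply_bound: "u > 0 \<Longrightarrow> norm (K u x) \<le> kap u * norm x"
  using norm_blinfun[of "K u" x] mult_right_mono[OF K_bound, of u "norm x"] by simp

text \<open>Strong continuity passes to the adjoint by contractivity: expanding the square and using
  |Sa t y| <= |y| bounds |Sa t y - y|^2 by 2 (y . y - S t y . y), which tends to 0 by strong
  continuity of S.\<close>

lemma Sa_semigroup: "C0_semigroup Sa"
  unfolding C0_semigroup_def
proof (intro conjI allI impI)
  show "Sa 0 = id_blinfun" by (rule blinfun_eqI) simp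
  show "Sa (s + t) = Sa s o\<^sub>L Sa t" if "0 \<le> s" "0 \<le> t" for s t
    by (rule blinfun_eqI) (use that Sa_add[of t s] in \<open>simp add: add.commute\<close>)
  fix y
  have "((\<lambda>t. S t y) \<longlongrightarrow> S 0 y) (at 0 within {0..})"
    using S_continuous[of y] by (auto simp: continuous_on_def)
  then have S: "((\<lambda>t. S t y) \<longlongrightarrow> y) (at_right 0)"
    by (simp add: S0 at_within_Ici_at_right)
  have "((\<lambda>t. Sa t y - y) \<longlongrightarrow> 0) (at_right 0)"
  proof (rule Lim_null_comparison)
    show "\<forall>\<^sub>F t in at_right 0. norm (Sa t y - y) \<le> sqrt (2 * (y \<bullet> y - S t y \<bullet> y))"
      unfolding eventually_at_right_field
    proof (intro exI[of _ 1] conjI allI impI)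
      fix t :: real assume t: "t > 0"
      have "(norm (Sa t y - y))\<^sup>2 = (norm (Sa t y))\<^sup>2 + (norm y)\<^sup>2 - 2 * (S t y \<bullet> y)"
      proof -
        have "y \<bullet> Sa t y = S t y \<bullet> y" "Sa t y \<bullet> y = S t y \<bullet> y"
          using inner_blinfun_adj[of y "S t" y] by (simp_all add: inner_commute)
        then show ?thesis by (simp add: power2_norm_eq_inner inner_diff_left inner_diff_right)
      qed
      also have "\<dots> \<le> 2 * (y \<bullet> y - S t y \<bullet> y)"
        using power_mono[OF Sa_contraction[of t y], of 2] t by (simp add: power2_norm_eq_inner)
      finally show "norm (Sa t y - y) \<le> sqrt (2 * (y \<bullet> y - S t y \<bullet> y))" by (rule real_le_rsqrt)
    qed simp
    have "((\<lambda>t. sqrt (2 * (y \<bullet> y - S t y \<bullet> y))) \<longlongrightarrow> sqrt (2 * (y \<bullet> y - y \<bullet> y))) (at_right 0)"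
      by (intro tendsto_intros S)
    then show "((\<lambda>t. sqrt (2 * (y \<bullet> y - S t y \<bullet> y))) \<longlongrightarrow> 0) (at_right 0)" by simp
  qed
  then show "((\<lambda>t. Sa t y) \<longlongrightarrow> y) (at_right 0)" by (rule LIM_zero_cancel)
qed

lemma Sa_continuous: "continuous_on {0..} (\<lambda>t. Sa t y)"
  by (rule C0_semigroup_continuous_on[OF Sa_semigroup])

lemma hs_Sa_contraction: "t \<ge> 0 \<Longrightarrow> norm (hs_compose (Sa t) Z) \<le> norm (Z :: ('c::{real_inner, second_countable_topology}, 'h) hs)"
  using norm_hs_compose[of "Sa t" 1 Z] Sa_contraction by simp

lemma hs_Sa_continuous: "continuous_on {0..} (\<lambda>t. hs_compose (Sa t) Z)"
  by (rule hs_compose_strongly_continuous[OF Sa_continuous]) (simp add: Sa_contraction)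

lemma hs_Sa_joint_continuous:
  "continuous_on ({0..} \<times> UNIV) (\<lambda>p. hs_compose (Sa (fst p)) (snd p :: ('c::{real_inner, second_countable_topology}, 'h) hs))"
proof (rule joint_continuous[where c = 1 and B = "\<lambda>t. hs_compose (Sa t)"])
  fix t x y assume "t \<in> {0::real..}"
  then show "norm (hs_compose (Sa t) x - hs_compose (Sa t) y) \<le> 1 * norm (x - y :: ('c, 'h) hs)"
    using hs_Sa_contraction[of t "x - y"] linear_diff[OF bounded_linear.linear[OF bounded_linear_hs_compose], of "Sa t" x y]
    by simp
qed (rule hs_Sa_continuous)

text \<open>The kernel may blow up at 0, so a uniform Lipschitz constant exists only on [u,
  \<infinity>) with u > 0; these half lines exhaust (0, \<infinity>). The abstract L serves both K
  and its adjoint, which satisfy different flow identities.\<close>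

lemma K_joint_continuous_gen:
  fixes L :: "real \<Rightarrow> 'c::real_normed_vector \<Rightarrow> 'd::real_normed_vector"
  assumes c: "\<And>u v x. u > 0 \<Longrightarrow> v \<ge> 0 \<Longrightarrow> norm (L (u + v) x) \<le> c u * norm x"
    and cont: "\<And>u x. u > 0 \<Longrightarrow> continuous_on {0..} (\<lambda>v. L (u + v) x)" and lin: "\<And>u. linear (L u)"
  shows "continuous_on ({0<..} \<times> UNIV) (\<lambda>p. L (fst p) (snd p))"
proof -
  have "continuous_on ({u..} \<times> UNIV) (\<lambda>p. L (fst p) (snd p))" if u: "u > 0" for u
  proof (rule joint_continuous[where c = "c u" and B = L])
    fix x
    have "continuous_on {u..} (\<lambda>t. L (u + (t - u)) x)"
      by (rule continuous_on_compose2[OF cont[OF u]]) (auto intro!: continuous_intros)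
    then show "continuous_on {u..} (\<lambda>t. L t x)" by simp
    fix t y assume "t \<in> {u..}"
    then show "norm (L t x - L t y) \<le> c u * norm (x - y)"
      using c[OF u, of "t - u" "x - y"] by (simp add: linear_diff[OF lin])
  qed
  then have "continuous_on ({u<..} \<times> UNIV) (\<lambda>p. L (fst p) (snd p))" if "u > 0" for u
    by (rule continuous_on_subset) (use that in auto)
  then have "continuous_on (\<Union>u\<in>{0<..}. {u<..} \<times> UNIV) (\<lambda>p. L (fst p) (snd p))"
    by (intro continuous_on_open_UN open_Times) auto
  moreover have "(\<Union>u\<in>{0<..}. {u<..} \<times> UNIV) = {0::real<..} \<times> (UNIV :: 'c set)"
    using dense by fastforce
  ultimately show ?thesis by simp
qed

lemma K_joint_continuous: "continuous_on ({0<..} \<times> UNIV) (\<lambda>p. K (fst p) (snd p))"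
proof (rule K_joint_continuous_gen[where c = kap and L = "\<lambda>u. blinfun_apply (K u)"])
  show "norm (K (u + v) x) \<le> kap u * norm x" if "u > 0" "v \<ge> 0" for u v x
    using K_apply_bound[OF that(1), of "S v x"] mult_left_mono[OF S_contraction[OF that(2), of x] kap_nonneg[of u]]
    by (simp add: K_add[OF that])
  show "continuous_on {0..} (\<lambda>v. K (u + v) x)" if u: "u > 0" for u x
  proof -
    have "continuous_on {0..} (\<lambda>v. K u (S v x))" by (intro continuous_intros S_continuous)
    then show ?thesis by (rule continuous_on_cong[THEN iffD1, rotated -1]) (auto simp: K_add[OF u])
  qed
qed (rule bounded_linear.linear[OF blinfun.bounded_linear_right])

lemma Ka_joint_continuous: "continuous_on ({0<..} \<times> UNIV) (\<lambda>p. Ka (fst p) (snd p))"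
proof (rule K_joint_continuous_gen[where c = kap and L = "\<lambda>u. blinfun_apply (Ka u)"])
  show "norm (Ka (u + v) x) \<le> kap u * norm x" if "u > 0" "v \<ge> 0" for u v x
    using Sa_contraction[OF that(2), of "Ka u x"] Ka_bound[OF that(1), of x] by (simp add: Ka_add[OF that])
  show "continuous_on {0..} (\<lambda>v. Ka (u + v) x)" if u: "u > 0" for u x
  proof -
    have "continuous_on {0..} (\<lambda>v. Sa v (Ka u x))" by (intro Sa_continuous)
    then show ?thesis by (rule continuous_on_cong[THEN iffD1, rotated -1]) (auto simp: Ka_add[OF u])
  qed
qed (rule bounded_linear.linear[OF blinfun.bounded_linear_right])

text \<open>The norm of \<open>kap\<close> in L2 over (0, T], which bounds the drift map from L2 of
  the product space to L2 of M.\<close>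

definition kappa :: real where
  "kappa = sqrt (enn2real (\<integral>\<^sup>+u\<in>{0<..T}. ennreal ((kap u)\<^sup>2) \<partial>lborel))"

lemma kappa_nonneg [simp]: "0 \<le> kappa"
  by (simp add: kappa_def)

lemma shift_le:
  assumes [measurable]: "f \<in> borel_measurable borel" and t: "t \<ge> 0"
  shows "(\<integral>\<^sup>+s. f (s - t) * indicator {t<..T} s \<partial>lborel) \<le> (\<integral>\<^sup>+u\<in>{0<..T}. f u \<partial>lborel)"
proof -
  have "(\<integral>\<^sup>+s. f (s - t) * indicator {t<..T} s \<partial>lborel) = (\<integral>\<^sup>+u. f u * indicator {t<..T} (t + u) \<partial>lborel)"
    by (subst nn_integral_real_affine[where c = 1 and t = t]) auto
  also have "\<dots> \<le> (\<integral>\<^sup>+u\<in>{0<..T}. f u \<partial>lborel)"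
    by (intro nn_integral_mono) (use t in \<open>auto simp: indicator_def\<close>)
  finally show ?thesis .
qed

lemma kap_shift:
  assumes "t \<ge> 0"
  shows "(\<integral>\<^sup>+s. ennreal ((kap (s - t))\<^sup>2) * indicator {t<..T} s \<partial>lborel) \<le> ennreal (kappa\<^sup>2)"
proof -
  have "(\<integral>\<^sup>+s. ennreal ((kap (s - t))\<^sup>2) * indicator {t<..T} s \<partial>lborel) \<le> (\<integral>\<^sup>+u\<in>{0<..T}. ennreal ((kap u)\<^sup>2) \<partial>lborel)"
    by (rule shift_le[OF _ assms]) simp
  also have "\<dots> = ennreal (kappa\<^sup>2)" using kap_square by (simp add: kappa_def)
  finally show ?thesis .
qed

end

locale backward_equation = wiener_filtration M F W + kernel S K T lam q kap
  for M :: "'w measure" and F and W :: "real \<Rightarrow> 'k::{real_inner, banach, second_countable_topology} \<Rightarrow> 'w \<Rightarrow> real"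
    and S :: "real \<Rightarrow> 'h::{real_inner, banach, second_countable_topology} \<Rightarrow>\<^sub>L 'h"
    and K :: "real \<Rightarrow> 'h \<Rightarrow>\<^sub>L ('k, 'h) hs" and T lam q kap
begin

sublocale Q: pair_sigma_finite lborel M ..

text \<open>The interval is open at t because the assumptions bound K u for u > 0 only.\<close>

definition drift_integrand :: "real \<Rightarrow> (real \<times> 'w \<Rightarrow> ('k, 'h) hs) \<Rightarrow> real \<times> 'w \<Rightarrow> 'h" where
  "drift_integrand t \<zeta> p = indicator {t<..T} (fst p) *\<^sub>R Ka (fst p - t) (\<zeta> p)"

definition drift :: "real \<Rightarrow> (real \<times> 'w \<Rightarrow> ('k, 'h) hs) \<Rightarrow> 'w \<Rightarrow> 'h" where
  "drift t \<zeta> \<omega> = (\<integral>s. drift_integrand t \<zeta> (s, \<omega>) \<partial>lborel)"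

lemma drift_integrand_measurable:
  assumes "\<zeta> \<in> borel_measurable Q"
  shows "drift_integrand t \<zeta> \<in> borel_measurable Q"
proof -
  have "(\<lambda>p. indicator {0<..} (fst p - t) *\<^sub>R Ka (fst p - t) (\<zeta> p)) \<in> borel_measurable Q"
    by (rule joint_measurable[OF Ka_joint_continuous _ _ assms]) auto
  note m = this
  have "(\<lambda>p. (indicator {t<..T} (fst p) :: real) *\<^sub>R (indicator {0<..} (fst p - t) *\<^sub>R Ka (fst p - t) (\<zeta> p))) \<in> borel_measurable Q"
    by (rule borel_measurable_scaleR[OF _ m]) measurable
  moreover have "(indicator {t<..T} (fst p) :: real) *\<^sub>R (indicator {0<..} (fst p - t) *\<^sub>R Ka (fst p - t) (\<zeta> p)) = drift_integrand t \<zeta> p" for p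
    by (simp add: drift_integrand_def indicator_def)
  ultimately show ?thesis by simp
qed

lemma norm_drift_integrand:
  "norm (drift_integrand t \<zeta> p) \<le> (indicator {t<..T} (fst p) * kap (fst p - t)) * norm (\<zeta> p)"
  using Ka_bound[of "fst p - t" "\<zeta> p"] by (simp add: drift_integrand_def indicator_def)

lemma section_measurable:
  "f \<in> borel_measurable Q \<Longrightarrow> \<omega> \<in> space M \<Longrightarrow> (\<lambda>s. f (s, \<omega>)) \<in> borel_measurable lborel"
  by (rule measurable_compose[OF measurable_Pair2'])

lemma section_nn_measurable:
  assumes "f \<in> borel_measurable Q"
  shows "(\<lambda>\<omega>. \<integral>\<^sup>+s. f (s, \<omega>) \<partial>lborel) \<in> borel_measurable M"
proof -
  have "(\<lambda>(\<omega>, s). f (s, \<omega>)) \<in> borel_measurable (M \<Otimes>\<^sub>M lborel)"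
    using measurable_compose[OF measurable_pair_swap' assms] by (simp add: case_prod_unfold)
  from lborel.borel_measurable_nn_integral[OF this] show ?thesis by simp
qed

text \<open>Cauchy-Schwarz in time for a fixed outcome, between the majorant kap (s - t), of norm at
  most \<open>kappa\<close>, and the section of \<zeta>. The estimate for fixed \<omega> gives
  integrability of the section and the bound that is then integrated over \<omega>.\<close>

lemma drift_pointwise:
  assumes \<zeta>: "\<zeta> \<in> borel_measurable Q" and \<omega>: "\<omega> \<in> space M" and t: "t \<ge> 0"
    and fin: "(\<integral>\<^sup>+s. ennreal ((norm (\<zeta> (s, \<omega>)))\<^sup>2) \<partial>lborel) < \<infinity>"
  shows "integrable lborel (\<lambda>s. drift_integrand t \<zeta> (s, \<omega>))"
    and "ennreal ((norm (drift t \<zeta> \<omega>))\<^sup>2) \<le> ennreal (kappa\<^sup>2) * (\<integral>\<^sup>+s. ennreal ((norm (\<zeta> (s, \<omega>)))\<^sup>2) \<partial>lborel)"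
proof -
  let ?f = "\<lambda>s. drift_integrand t \<zeta> (s, \<omega>)"
  have m: "?f \<in> borel_measurable lborel"
    by (rule section_measurable[OF drift_integrand_measurable[OF \<zeta>] \<omega>])
  have mz: "(\<lambda>s. \<zeta> (s, \<omega>)) \<in> borel_measurable lborel" by (rule section_measurable[OF \<zeta> \<omega>])
  let ?k = "\<lambda>s. ennreal (indicator {t<..T} s * kap (s - t))" and ?z = "\<lambda>s. ennreal (norm (\<zeta> (s, \<omega>)))"
  have "(\<integral>\<^sup>+s. ennreal (norm (?f s)) \<partial>lborel) \<le> (\<integral>\<^sup>+s. ?k s * ?z s \<partial>lborel)"
  proof (rule nn_integral_mono)
    fix s
    show "ennreal (norm (?f s)) \<le> ?k s * ?z s"
      using norm_drift_integrand[of t \<zeta> "(s, \<omega>)"] kap_nonneg[of "s - t"]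
      by (simp add: ennreal_mult[symmetric] ennreal_leI)
  qed
  then have "(\<integral>\<^sup>+s. ennreal (norm (?f s)) \<partial>lborel)\<^sup>2 \<le> (\<integral>\<^sup>+s. ?k s * ?z s \<partial>lborel)\<^sup>2"
    by (rule power_mono) simp
  also have "\<dots> \<le> (\<integral>\<^sup>+s. (?k s)\<^sup>2 \<partial>lborel) * (\<integral>\<^sup>+s. (?z s)\<^sup>2 \<partial>lborel)"
    using mz by (intro Cauchy_Schwarz_nn_integral) auto
  also have "(\<integral>\<^sup>+s. (?k s)\<^sup>2 \<partial>lborel) = (\<integral>\<^sup>+s. ennreal ((kap (s - t))\<^sup>2) * indicator {t<..T} s \<partial>lborel)"
    using kap_nonneg by (intro nn_integral_cong) (auto simp: ennreal_power indicator_def)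
  also have "(\<integral>\<^sup>+s. (?z s)\<^sup>2 \<partial>lborel) = (\<integral>\<^sup>+s. ennreal ((norm (\<zeta> (s, \<omega>)))\<^sup>2) \<partial>lborel)"
    by (intro nn_integral_cong) (simp add: ennreal_power)
  also have "(\<integral>\<^sup>+s. ennreal ((kap (s - t))\<^sup>2) * indicator {t<..T} s \<partial>lborel) * (\<integral>\<^sup>+s. ennreal ((norm (\<zeta> (s, \<omega>)))\<^sup>2) \<partial>lborel)
      \<le> ennreal (kappa\<^sup>2) * (\<integral>\<^sup>+s. ennreal ((norm (\<zeta> (s, \<omega>)))\<^sup>2) \<partial>lborel)"
    by (intro mult_right_mono kap_shift[OF t]) simp
  finally have b: "(\<integral>\<^sup>+s. ennreal (norm (?f s)) \<partial>lborel)\<^sup>2 \<le> ennreal (kappa\<^sup>2) * (\<integral>\<^sup>+s. ennreal ((norm (\<zeta> (s, \<omega>)))\<^sup>2) \<partial>lborel)" .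
  also have "\<dots> < \<infinity>" using fin by (simp add: ennreal_mult_less_top)
  finally have "(\<integral>\<^sup>+s. ennreal (norm (?f s)) \<partial>lborel) < \<infinity>"
    by (simp add: power2_eq_square ennreal_mult_less_top) (auto simp: less_top)
  then show i: "integrable lborel ?f" using m by (simp add: integrable_iff_bounded)
  have "ennreal (norm (drift t \<zeta> \<omega>)) \<le> (\<integral>\<^sup>+s. ennreal (norm (?f s)) \<partial>lborel)"
    unfolding drift_def by (rule integral_norm_bound_ennreal[OF i])
  then have "(ennreal (norm (drift t \<zeta> \<omega>)))\<^sup>2 \<le> (\<integral>\<^sup>+s. ennreal (norm (?f s)) \<partial>lborel)\<^sup>2"
    by (rule power_mono) simp
  with b show "ennreal ((norm (drift t \<zeta> \<omega>))\<^sup>2) \<le> ennreal (kappa\<^sup>2) * (\<integral>\<^sup>+s. ennreal ((norm (\<zeta> (s, \<omega>)))\<^sup>2) \<partial>lborel)"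
    by (simp add: ennreal_power)
qed

lemma L2_section_finite:
  assumes "L2 Q \<zeta>"
  shows "AE \<omega> in M. (\<integral>\<^sup>+s. ennreal ((norm (\<zeta> (s, \<omega>)))\<^sup>2) \<partial>lborel) < \<infinity>"
proof -
  have m: "(\<lambda>p. ennreal ((norm (\<zeta> p))\<^sup>2)) \<in> borel_measurable Q" using L2_measurable[OF assms] by simp
  have "(\<integral>\<^sup>+\<omega>. \<integral>\<^sup>+s. ennreal ((norm (\<zeta> (s, \<omega>)))\<^sup>2) \<partial>lborel \<partial>M) \<noteq> \<infinity>"
    using nn_integral_Q_swap[OF m] assms by (simp add: L2_iff_nn less_top)
  then have "AE \<omega> in M. (\<integral>\<^sup>+s. ennreal ((norm (\<zeta> (s, \<omega>)))\<^sup>2) \<partial>lborel) \<noteq> \<infinity>"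
    by (rule nn_integral_PInf_AE[OF section_nn_measurable[OF m]])
  then show ?thesis by eventually_elim (simp add: less_top)
qed

lemma drift_integrable:
  assumes "L2 Q \<zeta>" "t \<ge> 0"
  shows "AE \<omega> in M. integrable lborel (\<lambda>s. drift_integrand t \<zeta> (s, \<omega>))"
  using L2_section_finite[OF assms(1)] AE_space
  by eventually_elim (rule drift_pointwise(1)[OF L2_measurable[OF assms(1)] _ assms(2)])

lemma drift_measurable:
  assumes "\<zeta> \<in> borel_measurable Q"
  shows "drift t \<zeta> \<in> borel_measurable M"
proof -
  have "(\<lambda>(\<omega>, s). drift_integrand t \<zeta> (s, \<omega>)) \<in> borel_measurable (M \<Otimes>\<^sub>M lborel)"
    using measurable_compose[OF measurable_pair_swap' drift_integrand_measurable[OF assms], of t]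
    by (simp add: case_prod_unfold)
  from lborel.borel_measurable_lebesgue_integral[OF this]
  show ?thesis unfolding drift_def[abs_def] .
qed

lemma drift_L2:
  assumes "L2 Q \<zeta>" "t \<ge> 0"
  shows "L2 M (drift t \<zeta>)" "n2 M (drift t \<zeta>) \<le> kappa * n2 Q \<zeta>"
proof -
  have m: "(\<lambda>p. ennreal ((norm (\<zeta> p))\<^sup>2)) \<in> borel_measurable Q" using L2_measurable[OF assms(1)] by simp
  have "(\<integral>\<^sup>+\<omega>. ennreal ((norm (drift t \<zeta> \<omega>))\<^sup>2) \<partial>M)
      \<le> (\<integral>\<^sup>+\<omega>. ennreal (kappa\<^sup>2) * (\<integral>\<^sup>+s. ennreal ((norm (\<zeta> (s, \<omega>)))\<^sup>2) \<partial>lborel) \<partial>M)"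
    using L2_section_finite[OF assms(1)] AE_space
    by (intro nn_integral_mono_AE, eventually_elim)
      (rule drift_pointwise(2)[OF L2_measurable[OF assms(1)] _ assms(2)])
  also have "\<dots> = ennreal (kappa\<^sup>2) * (\<integral>\<^sup>+\<omega>. \<integral>\<^sup>+s. ennreal ((norm (\<zeta> (s, \<omega>)))\<^sup>2) \<partial>lborel \<partial>M)"
    by (rule nn_integral_cmult[OF section_nn_measurable[OF m]])
  also have "\<dots> = ennreal (kappa\<^sup>2) * ennreal ((n2 Q \<zeta>)\<^sup>2)"
    using nn_integral_Q_swap[OF m] n2_nn[OF assms(1)] by simp
  also have "\<dots> = ennreal ((kappa * n2 Q \<zeta>)\<^sup>2)" by (simp add: ennreal_mult[symmetric] power_mult_distrib)
  finally show "L2 M (drift t \<zeta>)" "n2 M (drift t \<zeta>) \<le> kappa * n2 Q \<zeta>"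
    using L2_nn_le[OF drift_measurable[OF L2_measurable[OF assms(1)]]] by auto
qed

lemma drift_add:
  assumes "L2 Q \<zeta>" "L2 Q \<zeta>'" "t \<ge> 0"
  shows "AE \<omega> in M. drift t (\<lambda>p. \<zeta> p + \<zeta>' p) \<omega> = drift t \<zeta> \<omega> + drift t \<zeta>' \<omega>"
  using drift_integrable[OF assms(1,3)] drift_integrable[OF assms(2,3)]
proof eventually_elim
  fix \<omega> assume "integrable lborel (\<lambda>s. drift_integrand t \<zeta> (s, \<omega>))" "integrable lborel (\<lambda>s. drift_integrand t \<zeta>' (s, \<omega>))"
  from Bochner_Integration.integral_add[OF this]
  show "drift t (\<lambda>p. \<zeta> p + \<zeta>' p) \<omega> = drift t \<zeta> \<omega> + drift t \<zeta>' \<omega>"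
    by (simp add: drift_def drift_integrand_def blinfun.add_right scaleR_add_right)
qed

lemma drift_scaleR: "drift t (\<lambda>p. c *\<^sub>R \<zeta> p) \<omega> = c *\<^sub>R drift t \<zeta> \<omega>"
proof -
  have "drift_integrand t (\<lambda>p. c *\<^sub>R \<zeta> p) p = c *\<^sub>R drift_integrand t \<zeta> p" for p
    by (simp add: drift_integrand_def blinfun.scaleR_right)
  then show ?thesis by (simp add: drift_def)
qed

lemma drift_diff:
  assumes "L2 Q \<zeta>" "L2 Q \<zeta>'" "t \<ge> 0"
  shows "AE \<omega> in M. drift t (\<lambda>p. \<zeta> p - \<zeta>' p) \<omega> = drift t \<zeta> \<omega> - drift t \<zeta>' \<omega>"
  using drift_add[OF assms(1) L2_scaleR[OF assms(2), of "-1"] assms(3)] drift_scaleR[of t "-1" \<zeta>'] by simp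

lemma n2_drift_diff:
  assumes "L2 Q \<zeta>" "L2 Q \<zeta>'" "t \<ge> 0"
  shows "n2 M (\<lambda>\<omega>. drift t \<zeta> \<omega> - drift t \<zeta>' \<omega>) \<le> kappa * n2 Q (\<lambda>p. \<zeta> p - \<zeta>' p)"
proof -
  have "n2 M (\<lambda>\<omega>. drift t \<zeta> \<omega> - drift t \<zeta>' \<omega>) = n2 M (drift t (\<lambda>p. \<zeta> p - \<zeta>' p))"
    by (rule L2_cong_AE(2)[OF drift_L2(1)[OF L2_diff[OF assms(1,2)] assms(3)] drift_diff[OF assms]])
      (intro borel_measurable_diff drift_measurable L2_measurable assms)
  then show ?thesis using drift_L2(2)[OF L2_diff[OF assms(1,2)] assms(3)] by simp
qed

lemma drift_cong_AE:
  assumes "L2 Q \<zeta>" "L2 Q \<zeta>'" "t \<ge> 0" "AE p in Q. \<zeta> p = \<zeta>' p"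
  shows "AE \<omega> in M. drift t \<zeta> \<omega> = drift t \<zeta>' \<omega>"
proof -
  have "n2 M (\<lambda>\<omega>. drift t \<zeta> \<omega> - drift t \<zeta>' \<omega>) \<le> 0"
    using n2_drift_diff[OF assms(1-3)] n2_diff_0_AE[OF assms(1,2)] assms(4) by simp
  then show ?thesis
    using n2_diff_0_AE[OF drift_L2(1)[OF assms(1,3)] drift_L2(1)[OF assms(2,3)]] by (simp add: order_antisym)
qed

text \<open>The adjoint of the map from \<zeta> to \<open>drift t \<zeta>\<close>, see
  \<open>drift_ip\<close>; through it the kernel moves from the unknown integrand to the variables
  J.\<close>

definition KU :: "real \<Rightarrow> ('w \<Rightarrow> 'h) \<Rightarrow> real \<times> 'w \<Rightarrow> ('k, 'h) hs" where
  "KU t U p = indicator {t<..T} (fst p) *\<^sub>R K (fst p - t) (U (snd p))"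

lemma KU_measurable:
  assumes "U \<in> borel_measurable M"
  shows "KU t U \<in> borel_measurable Q"
proof -
  have "(\<lambda>p. indicator {0<..} (fst p - t) *\<^sub>R K (fst p - t) (U (snd p))) \<in> borel_measurable Q"
    by (rule joint_measurable[OF K_joint_continuous]) (use measurable_compose[OF measurable_snd assms] in auto)
  note m = this
  have "(\<lambda>p. (indicator {t<..T} (fst p) :: real) *\<^sub>R (indicator {0<..} (fst p - t) *\<^sub>R K (fst p - t) (U (snd p)))) \<in> borel_measurable Q"
    by (rule borel_measurable_scaleR[OF _ m]) measurable
  moreover have "(indicator {t<..T} (fst p) :: real) *\<^sub>R (indicator {0<..} (fst p - t) *\<^sub>R K (fst p - t) (U (snd p))) = KU t U p" for p
    by (simp add: KU_def indicator_def)
  ultimately show ?thesis by simp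
qed

lemma nn_integral_section_le:
  assumes m: "f \<in> borel_measurable Q" and U: "L2 M U" and t: "t \<ge> 0" and c: "c \<ge> 0"
    and le: "\<And>\<omega>. \<omega> \<in> space M \<Longrightarrow> (\<integral>\<^sup>+s. ennreal ((norm (f (s, \<omega>)))\<^sup>2) \<partial>lborel) \<le> ennreal (c\<^sup>2 * (norm (U \<omega>))\<^sup>2)"
  shows "L2 Q f" "n2 Q f \<le> c * n2 M U"
proof -
  have m2: "(\<lambda>p. ennreal ((norm (f p))\<^sup>2)) \<in> borel_measurable Q" using m by simp
  have "(\<integral>\<^sup>+p. ennreal ((norm (f p))\<^sup>2) \<partial>Q) = (\<integral>\<^sup>+\<omega>. \<integral>\<^sup>+s. ennreal ((norm (f (s, \<omega>)))\<^sup>2) \<partial>lborel \<partial>M)"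
    using nn_integral_Q_swap[OF m2] by simp
  also have "\<dots> \<le> (\<integral>\<^sup>+\<omega>. ennreal (c\<^sup>2) * ennreal ((norm (U \<omega>))\<^sup>2) \<partial>M)"
    by (intro nn_integral_mono) (simp add: le ennreal_mult[symmetric])
  also have "\<dots> = ennreal (c\<^sup>2) * ennreal ((n2 M U)\<^sup>2)"
    using L2_measurable[OF U] by (subst nn_integral_cmult) (auto simp: n2_nn[OF U])
  also have "\<dots> = ennreal ((c * n2 M U)\<^sup>2)" by (simp add: ennreal_mult[symmetric] power_mult_distrib)
  finally show "L2 Q f" "n2 Q f \<le> c * n2 M U" using L2_nn_le[OF m] c by auto
qed

lemma KU_L2:
  assumes U: "L2 M U" and t: "t \<ge> 0"
  shows "L2 Q (KU t U)" "n2 Q (KU t U) \<le> kappa * n2 M U"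
proof -
  have "(\<integral>\<^sup>+s. ennreal ((norm (KU t U (s, \<omega>)))\<^sup>2) \<partial>lborel) \<le> ennreal (kappa\<^sup>2 * (norm (U \<omega>))\<^sup>2)" for \<omega>
  proof -
    have "(\<integral>\<^sup>+s. ennreal ((norm (KU t U (s, \<omega>)))\<^sup>2) \<partial>lborel)
        \<le> (\<integral>\<^sup>+s. ennreal ((kap (s - t))\<^sup>2) * indicator {t<..T} s * ennreal ((norm (U \<omega>))\<^sup>2) \<partial>lborel)"
    proof (intro nn_integral_mono)
      fix s
      show "ennreal ((norm (KU t U (s, \<omega>)))\<^sup>2) \<le> ennreal ((kap (s - t))\<^sup>2) * indicator {t<..T} s * ennreal ((norm (U \<omega>))\<^sup>2)"
        using power_mono[OF K_apply_bound[of "s - t" "U \<omega>"], of 2]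
        by (auto simp: KU_def indicator_def ennreal_mult[symmetric] power_mult_distrib ennreal_leI)
    qed
    also have "\<dots> = (\<integral>\<^sup>+s. ennreal ((kap (s - t))\<^sup>2) * indicator {t<..T} s \<partial>lborel) * ennreal ((norm (U \<omega>))\<^sup>2)"
      by (rule nn_integral_multc) simp
    also have "\<dots> \<le> ennreal (kappa\<^sup>2) * ennreal ((norm (U \<omega>))\<^sup>2)"
      by (intro mult_right_mono kap_shift t) simp
    finally show ?thesis by (simp add: ennreal_mult[symmetric])
  qed
  from nn_integral_section_le[OF KU_measurable[OF L2_measurable[OF U]] U t kappa_nonneg this]
  show "L2 Q (KU t U)" "n2 Q (KU t U) \<le> kappa * n2 M U" by auto
qed

text \<open>The energy bound of the kernel, applied for each outcome to the vector U \<omega> and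
  shifted in time. This is the only gate through which q < 1 enters the stochastic
  estimates.\<close>

lemma KU_weighted:
  assumes U: "L2 M U" and t: "t \<ge> 0"
  shows "L2 Q (\<lambda>p. exp (- lam * (fst p - t)) *\<^sub>R KU t U p)"
    and "n2 Q (\<lambda>p. exp (- lam * (fst p - t)) *\<^sub>R KU t U p) \<le> q * n2 M U"
proof -
  have m: "(\<lambda>p. exp (- lam * (fst p - t)) *\<^sub>R KU t U p) \<in> borel_measurable Q"
    by (rule borel_measurable_scaleR[OF _ KU_measurable[OF L2_measurable[OF U]]]) measurable
  have "(\<integral>\<^sup>+s. ennreal ((norm (exp (- lam * (fst (s, \<omega>) - t)) *\<^sub>R KU t U (s, \<omega>)))\<^sup>2) \<partial>lborel) \<le> ennreal (q\<^sup>2 * (norm (U \<omega>))\<^sup>2)"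
    for \<omega>
  proof -
    have km: "(\<lambda>u. indicator {0<..} u *\<^sub>R K u (U \<omega>)) \<in> borel_measurable borel"
      by (rule joint_measurable[OF K_joint_continuous]) auto
    define f where "f u = ennreal (exp (- 2 * lam * u) * (norm (indicator {0<..} u *\<^sub>R K u (U \<omega>)))\<^sup>2)" for u
    have fm: "f \<in> borel_measurable borel"
      unfolding f_def[abs_def] using measurable_compose[OF km borel_measurable_norm]
      by (intro measurable_compose[OF _ measurable_ennreal] borel_measurable_times borel_measurable_power) auto
    have "(\<integral>\<^sup>+s. ennreal ((norm (exp (- lam * (fst (s, \<omega>) - t)) *\<^sub>R KU t U (s, \<omega>)))\<^sup>2) \<partial>lborel)
        = (\<integral>\<^sup>+s. f (s - t) * indicator {t<..T} s \<partial>lborel)"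
      by (intro nn_integral_cong)
        (auto simp: KU_def f_def indicator_def power_mult_distrib exp_double[symmetric] algebra_simps)
    also have "\<dots> \<le> (\<integral>\<^sup>+u\<in>{0<..T}. f u \<partial>lborel)" by (rule shift_le[OF fm t])
    also have "\<dots> = (\<integral>\<^sup>+u\<in>{0<..T}. ennreal (exp (- 2 * lam * u) * (norm (K u (U \<omega>)))\<^sup>2) \<partial>lborel)"
      by (intro nn_integral_cong) (auto simp: f_def indicator_def)
    also have "\<dots> \<le> ennreal (q\<^sup>2 * (norm (U \<omega>))\<^sup>2)" by (rule K_energy)
    finally show ?thesis .
  qed
  from nn_integral_section_le[OF m U t q(1) this]
  show "L2 Q (\<lambda>p. exp (- lam * (fst p - t)) *\<^sub>R KU t U p)"
    "n2 Q (\<lambda>p. exp (- lam * (fst p - t)) *\<^sub>R KU t U p) \<le> q * n2 M U" by auto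
qed

lemma drift_ip:
  assumes U: "L2 M U" and \<zeta>: "L2 Q \<zeta>" and t: "t \<ge> 0"
  shows "ip M U (drift t \<zeta>) = ip Q (KU t U) \<zeta>"
proof -
  have eq: "KU t U (s, \<omega>) \<bullet> \<zeta> (s, \<omega>) = U \<omega> \<bullet> drift_integrand t \<zeta> (s, \<omega>)" for s \<omega>
    by (simp add: KU_def drift_integrand_def inner_blinfun_adj)
  have i: "integrable Q (\<lambda>(s, \<omega>). KU t U (s, \<omega>) \<bullet> \<zeta> (s, \<omega>))"
    using L2_inner_integrable[OF KU_L2(1)[OF U t] \<zeta>] by (simp add: case_prod_unfold)
  have "ip Q (KU t U) \<zeta> = (\<integral>\<omega>. \<integral>s. KU t U (s, \<omega>) \<bullet> \<zeta> (s, \<omega>) \<partial>lborel \<partial>M)"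
    unfolding ip_def using Q.integral_snd[OF i] by (simp add: case_prod_unfold)
  also have "\<dots> = (\<integral>\<omega>. U \<omega> \<bullet> drift t \<zeta> \<omega> \<partial>M)"
  proof (rule integral_cong_AE)
    show "(\<lambda>\<omega>. \<integral>s. KU t U (s, \<omega>) \<bullet> \<zeta> (s, \<omega>) \<partial>lborel) \<in> borel_measurable M"
      using Q.integrable_snd[OF i] by simp
    show "(\<lambda>\<omega>. U \<omega> \<bullet> drift t \<zeta> \<omega>) \<in> borel_measurable M"
      using L2_measurable[OF U] drift_measurable[OF L2_measurable[OF \<zeta>]] by (rule borel_measurable_inner)
    show "AE \<omega> in M. (\<integral>s. KU t U (s, \<omega>) \<bullet> \<zeta> (s, \<omega>) \<partial>lborel) = U \<omega> \<bullet> drift t \<zeta> \<omega>"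
      using drift_integrable[OF \<zeta> t]
      by eventually_elim (simp add: eq drift_def)
  qed
  finally show ?thesis by (simp add: ip_def)
qed

text \<open>At a fixed time s the two kernels combine to one bounded operator applied to U, and the
  result is still known at time r, hence orthogonal to V. Fubini in the order first \<omega>, then
  s, finishes.\<close>

lemma KU_orthogonal:
  assumes U: "L2 M U" "U \<in> borel_measurable (F r)" and r: "r \<ge> 0"
    and V: "L2 M V" "\<And>X. L2 M X \<Longrightarrow> X \<in> borel_measurable (F r) \<Longrightarrow> ip M X V = 0"
    and L: "L2 Q (\<lambda>p. c (fst p) *\<^sub>R KU t U p)" "L2 Q (\<lambda>p. c' (fst p) *\<^sub>R KU t' V p)"
  shows "ip Q (\<lambda>p. c (fst p) *\<^sub>R KU t U p) (\<lambda>p. c' (fst p) *\<^sub>R KU t' V p) = 0"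
proof -
  let ?f = "\<lambda>p. (c (fst p) *\<^sub>R KU t U p) \<bullet> (c' (fst p) *\<^sub>R KU t' V p)"
  have i: "integrable Q ?f" by (rule L2_inner_integrable[OF L])
  have "(\<integral>\<omega>. ?f (s, \<omega>) \<partial>M) = 0" for s
  proof -
    let ?B = "blinfun_adj (K (s - t')) o\<^sub>L K (s - t)"
    have LX: "L2 M (\<lambda>\<omega>. ?B (U \<omega>))" by (rule L2_linear[OF U(1) blinfun.bounded_linear_right])
    have "blinfun_apply ?B \<in> borel_measurable borel"
      by (intro borel_measurable_continuous_onI linear_continuous_on blinfun.bounded_linear_right)
    then have "(\<lambda>\<omega>. ?B (U \<omega>)) \<in> borel_measurable (F r)" by (rule measurable_compose[OF U(2)])
    from V(2)[OF LX this] have 0: "expectation (\<lambda>\<omega>. ?B (U \<omega>) \<bullet> V \<omega>) = 0" by (simp add: ip_def)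
    have "?f (s, \<omega>) = (c s * c' s * indicator {t<..T} s * indicator {t'<..T} s) * (?B (U \<omega>) \<bullet> V \<omega>)" for \<omega>
      using inner_blinfun_adj[of "V \<omega>" "K (s - t')" "K (s - t) (U \<omega>)"]
      by (simp add: KU_def inner_commute)
    then show ?thesis by (simp only: integral_mult_right_zero 0 mult_zero_right)
  qed
  note z = this
  show ?thesis unfolding ip_def Q.integral_fst'[OF i, symmetric] by (simp only: z Bochner_Integration.integral_zero)
qed

end

section \<open>The a priori estimate\<close>

lemma tends2_dominated:
  fixes f :: "nat \<Rightarrow> 'a \<Rightarrow> 'h::{real_inner, banach, second_countable_topology}"
    and b :: "'a \<Rightarrow> 'g::{real_inner, banach, second_countable_topology}"
  assumes m: "\<And>n. f n \<in> borel_measurable N" "g \<in> borel_measurable N" and b: "L2 N b" and c: "c \<ge> 0"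
    and le: "\<And>n x. norm (f n x) \<le> c * norm (b x)" "\<And>x. norm (g x) \<le> c * norm (b x)"
    and lim: "AE x in N. (\<lambda>n. f n x) \<longlonglongrightarrow> g x"
  shows "tends2 N f g"
proof -
  have i0: "integrable N (\<lambda>x. (2 * c)\<^sup>2 * (norm (b x))\<^sup>2)" using b by (simp add: L2_def)
  have "(\<lambda>n. \<integral>x. (norm (f n x - g x))\<^sup>2 \<partial>N) \<longlonglongrightarrow> (\<integral>x. 0 \<partial>N)"
  proof (rule integral_dominated_convergence[OF _ _ i0])
    show "AE x in N. (\<lambda>n. (norm (f n x - g x))\<^sup>2) \<longlonglongrightarrow> 0"
      using lim
    proof eventually_elim
      fix x assume "(\<lambda>n. f n x) \<longlonglongrightarrow> g x"
      then have "(\<lambda>n. f n x - g x) \<longlonglongrightarrow> 0" using LIM_zero by blast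
      then have "(\<lambda>n. (norm (f n x - g x))\<^sup>2) \<longlonglongrightarrow> (norm (0::'h))\<^sup>2" by (intro tendsto_intros)
      then show "(\<lambda>n. (norm (f n x - g x))\<^sup>2) \<longlonglongrightarrow> 0" by simp
    qed
    show "AE x in N. norm ((norm (f n x - g x))\<^sup>2) \<le> (2 * c)\<^sup>2 * (norm (b x))\<^sup>2" for n
    proof (rule AE_I2)
      fix x
      have "norm (f n x - g x) \<le> (2 * c) * norm (b x)"
        using norm_triangle_ineq4[of "f n x" "g x"] le(1)[of n x] le(2)[of x] by simp
      from power_mono[OF this norm_ge_zero, of 2]
      show "norm ((norm (f n x - g x))\<^sup>2) \<le> (2 * c)\<^sup>2 * (norm (b x))\<^sup>2" by (simp add: power_mult_distrib)
    qed
    show "(\<lambda>x. (norm (f n x - g x))\<^sup>2) \<in> borel_measurable N" for n using m by simp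
  qed auto
  then have "(\<lambda>n. sqrt (\<integral>x. (norm (f n x - g x))\<^sup>2 \<partial>N)) \<longlonglongrightarrow> sqrt 0"
    by (intro tendsto_real_sqrt) simp
  then show ?thesis
    using L2_bound(1)[OF m(1) b AE_I2[OF le(1)] c] L2_bound(1)[OF m(2) b AE_I2[OF le(2)] c]
    by (simp add: tends2_def n2_def)
qed

text \<open>For orthogonal terms the Euclidean norm of the sizes replaces their sum, so a bound for
  a single kernel becomes a bound with the same constant for the whole partition.\<close>

lemma n2_sum_orthogonal_le:
  fixes f :: "nat \<Rightarrow> 'a \<Rightarrow> 'h::{real_inner, banach, second_countable_topology}"
  assumes "\<And>i. i < N \<Longrightarrow> L2 Q (f i)" "\<And>i j. i < j \<Longrightarrow> j < N \<Longrightarrow> ip Q (f i) (f j) = 0"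
    "\<And>i. i < N \<Longrightarrow> n2 Q (f i) \<le> c * d i" "c \<ge> 0"
  shows "n2 Q (\<lambda>x. \<Sum>i<N. f i x) \<le> c * sqrt (\<Sum>i<N. (d i)\<^sup>2)"
proof (rule power2_le_imp_le)
  have orth: "ip Q (f i) (f j) = 0" if "i < N" "j < N" "i \<noteq> j" for i j
    using assms(2)[of i j] assms(2)[of j i] that ip_commute[of Q "f i" "f j"] by (cases "i < j") auto
  have "(n2 Q (\<lambda>x. \<Sum>i<N. f i x))\<^sup>2 = (\<Sum>i<N. (n2 Q (f i))\<^sup>2)"
    by (rule n2_sum_orthogonal) (use assms orth in auto)
  also have "\<dots> \<le> (\<Sum>i<N. (c * d i)\<^sup>2)"
    by (intro sum_mono power_mono assms) auto
  also have "\<dots> = (c * sqrt (\<Sum>i<N. (d i)\<^sup>2))\<^sup>2"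
    by (simp add: power_mult_distrib sum_distrib_left sum_nonneg)
  finally show "(n2 Q (\<lambda>x. \<Sum>i<N. f i x))\<^sup>2 \<le> (c * sqrt (\<Sum>i<N. (d i)\<^sup>2))\<^sup>2" .
qed (use assms in \<open>simp add: sum_nonneg\<close>)

context backward_equation
begin

definition SZ :: "real \<Rightarrow> (real \<times> 'w \<Rightarrow> ('k, 'h) hs) \<Rightarrow> real \<times> 'w \<Rightarrow> ('k, 'h) hs" where
  "SZ t Z p = indicator {t<..T} (fst p) *\<^sub>R hs_compose (Sa (fst p - t)) (Z p)"

lemma SZ_measurable:
  assumes "Z \<in> borel_measurable Q"
  shows "SZ t Z \<in> borel_measurable Q"
proof -
  have m: "(\<lambda>p. indicator {0..} (fst p - t) *\<^sub>R hs_compose (Sa (fst p - t)) (Z p)) \<in> borel_measurable Q"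
    by (rule joint_measurable[where B = "\<lambda>t. hs_compose (Sa t)", OF hs_Sa_joint_continuous _ _ assms]) auto
  have "(\<lambda>p. (indicator {t<..T} (fst p) :: real) *\<^sub>R (indicator {0..} (fst p - t) *\<^sub>R hs_compose (Sa (fst p - t)) (Z p))) \<in> borel_measurable Q"
    by (rule borel_measurable_scaleR[OF _ m]) measurable
  moreover have "(indicator {t<..T} (fst p) :: real) *\<^sub>R (indicator {0..} (fst p - t) *\<^sub>R hs_compose (Sa (fst p - t)) (Z p)) = SZ t Z p" for p
    by (simp add: SZ_def indicator_def)
  ultimately show ?thesis by simp
qed

lemma norm_SZ_le: "norm (SZ t Z p) \<le> norm (Z p)"
  using hs_Sa_contraction[of "fst p - t" "Z p"] by (simp add: SZ_def indicator_def)

lemma SZ_L2: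
  assumes "L2 Q Z"
  shows "L2 Q (SZ t Z)" "n2 Q (SZ t Z) \<le> n2 Q Z"
  using L2_bound[OF SZ_measurable[OF L2_measurable[OF assms]] assms, of t 1] norm_SZ_le by auto

lemma SZ_diff: "SZ t (\<lambda>p. Z p - Z' p) = (\<lambda>p. SZ t Z p - SZ t Z' p)"
  by (simp add: SZ_def fun_eq_iff linear_diff[OF bounded_linear.linear[OF bounded_linear_hs_compose]] scaleR_diff_right)

text \<open>The equation with a drift integrand \<open>\<zeta>\<close> decoupled from \<open>Z\<close>. Here \<open>Y\<close> and \<open>Z\<close> are determined only up
  to modification; progressive versions are chosen at the end.\<close>

definition drift_solution where
  "drift_solution \<xi> \<zeta> Y Z \<longleftrightarrow> L2 M \<xi> \<and> L2 Q \<zeta> \<and> L2 Q Z \<and>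
    (\<forall>t\<in>{0..T}. L2 M (Y t) \<and> Y t \<in> borel_measurable (F t) \<and>
      (\<exists>I. ito t T (SZ t Z) I \<and> (AE \<omega> in M. Y t \<omega> = Sa (T - t) (\<xi> \<omega>) + drift t \<zeta> \<omega> - I \<omega>)))"

abbreviation weighted :: "real \<Rightarrow> (real \<times> 'w \<Rightarrow> 'c::real_vector) \<Rightarrow> real \<times> 'w \<Rightarrow> 'c" where
  "weighted \<mu> Z \<equiv> \<lambda>p. exp (\<mu> * fst p) *\<^sub>R cut 0 T Z p"

lemma weighted_measurable:
  fixes Z :: "real \<times> 'w \<Rightarrow> 'c::{real_inner, banach, second_countable_topology}"
  assumes "Z \<in> borel_measurable Q"
  shows "weighted \<mu> Z \<in> borel_measurable Q"
  by (rule borel_measurable_scaleR[OF _ cut_measurable[OF assms]]) measurable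

lemma norm_weighted_le: "\<mu> \<ge> 0 \<Longrightarrow> norm (weighted \<mu> Z p) \<le> exp (\<mu> * T) * norm (Z p :: 'c::real_normed_vector)"
  by (simp add: cut_def indicator_def mult_left_mono mult_right_mono)

lemma weighted_L2:
  fixes Z :: "real \<times> 'w \<Rightarrow> 'c::{real_inner, banach, second_countable_topology}"
  assumes Z: "L2 Q Z" and \<mu>: "\<mu> \<ge> 0"
  shows "L2 Q (weighted \<mu> Z)" "n2 Q (weighted \<mu> Z) \<le> exp (\<mu> * T) * n2 Q Z" "n2 Q (cut 0 T Z) \<le> n2 Q (weighted \<mu> Z)"
proof -
  show L: "L2 Q (weighted \<mu> Z)" and "n2 Q (weighted \<mu> Z) \<le> exp (\<mu> * T) * n2 Q Z"
    using L2_bound[OF weighted_measurable[OF L2_measurable[OF Z]] Z AE_I2[OF norm_weighted_le[OF \<mu>]]] by simp_all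
  have "norm (cut 0 T Z p) \<le> norm (weighted \<mu> Z p)" for p
    using \<mu> by (simp add: cut_def indicator_def mult_right_le_one_le mult_ge1_I mult_le_cancel_right1)
  then show "n2 Q (cut 0 T Z) \<le> n2 Q (weighted \<mu> Z)"
    using L2_bound(2)[OF cut_measurable[OF L2_measurable[OF Z]] L, of 0 T 1] by simp
qed

text \<open>The equation controls only the integrands \<open>SZ t Z\<close>; on the intervals of a fine partition, with \<open>t\<close> the
  left end point, they approximate \<open>Z\<close>.\<close>

definition step :: "real \<Rightarrow> nat \<Rightarrow> (real \<times> 'w \<Rightarrow> ('k, 'h) hs) \<Rightarrow> real \<times> 'w \<Rightarrow> ('k, 'h) hs" where
  "step \<mu> n Z p = (\<Sum>i<Suc n. exp (\<mu> * (T * i / Suc n)) *\<^sub>R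
    cut (T * i / Suc n) (T * Suc i / Suc n) (SZ (T * i / Suc n) Z) p)"

lemma step_eq:
  "\<exists>r. \<forall>n. step \<mu> n Z (s, \<omega>) = indicator {0<..T} s *\<^sub>R (exp (\<mu> * r n) *\<^sub>R hs_compose (Sa (s - r n)) (Z (s, \<omega>)))
    \<and> (s \<in> {0<..T} \<longrightarrow> 0 \<le> r n \<and> r n \<le> s \<and> s - r n \<le> T / Suc n)"
proof -
  \<comment> \<open>The index of the interval, open on the left and closed on the right, that
    contains s; hence a ceiling minus one instead of a floor. Then r n is its left end
    point.\<close>
  define k where "k n = nat (\<lceil>s * Suc n / T\<rceil> - 1)" for n :: nat
  define r where "r n = T * k n / Suc n" for n
  have mem: "s \<in> {T * i / Suc n<..T * Suc i / Suc n} \<longleftrightarrow> i = k n" if s: "s \<in> {0<..T}" for i n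
  proof -
    have "s \<in> {T * i / Suc n<..T * Suc i / Suc n} \<longleftrightarrow> real i < s * Suc n / T \<and> s * Suc n / T \<le> real (Suc i)"
      using T by (auto simp: field_simps simp del: of_nat_Suc)
    also have "\<dots> \<longleftrightarrow> \<lceil>s * Suc n / T\<rceil> = int i + 1"
      by (auto simp: ceiling_eq_iff)
    also have "\<dots> \<longleftrightarrow> i = k n"
    proof -
      have "0 < s * Suc n / T" using s T by simp
      then have "\<lceil>s * Suc n / T\<rceil> \<ge> 1" by simp
      then show ?thesis by (auto simp: k_def)
    qed
    finally show ?thesis .
  qed
  have kn: "k n < Suc n" if s: "s \<in> {0<..T}" for n
  proof -
    have "T * k n / Suc n < s" using mem[OF s, of "k n" n] by simp
    then have "T * real (k n) < s * real (Suc n)" by (simp add: divide_less_eq del: of_nat_Suc)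
    also have "\<dots> \<le> T * real (Suc n)" using s by (intro mult_right_mono) auto
    finally show ?thesis using T by (simp add: mult_less_cancel_left_pos del: of_nat_Suc)
  qed
  show ?thesis
  proof (intro exI[of _ r] allI conjI impI)
    fix n
    show "step \<mu> n Z (s, \<omega>) = indicator {0<..T} s *\<^sub>R (exp (\<mu> * r n) *\<^sub>R hs_compose (Sa (s - r n)) (Z (s, \<omega>)))"
    proof (cases "s \<in> {0<..T}")
      case s: True
      have "step \<mu> n Z (s, \<omega>) = (\<Sum>i<Suc n. if i = k n then exp (\<mu> * (T * i / Suc n)) *\<^sub>R SZ (T * i / Suc n) Z (s, \<omega>) else 0)"
        unfolding step_def cut_def using mem[OF s, of _ n] by (intro sum.cong) (auto simp: indicator_def)
      also have "\<dots> = exp (\<mu> * r n) *\<^sub>R SZ (r n) Z (s, \<omega>)" using kn[OF s, of n] by (simp add: r_def del: of_nat_Suc)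
      also have "SZ (r n) Z (s, \<omega>) = hs_compose (Sa (s - r n)) (Z (s, \<omega>))"
        using s mem[OF s, of "k n" n] by (simp add: SZ_def r_def)
      finally show ?thesis using s by simp
    next
      case s: False
      have "cut (T * i / Suc n) (T * Suc i / Suc n) (SZ (T * i / Suc n) Z) (s, \<omega>) = 0" if "i < Suc n" for i
      proof -
        have "0 \<le> T * i / Suc n" using T by simp
        then show ?thesis using s by (auto simp: cut_def SZ_def indicator_def)
      qed
      then show ?thesis using s by (simp add: step_def)
    qed
    assume s: "s \<in> {0<..T}"
    have "T * k n / Suc n < s" "s \<le> T * Suc (k n) / Suc n" using mem[OF s, of "k n" n] by auto
    moreover have "T * Suc (k n) / Suc n = r n + T / Suc n"
      by (simp only: r_def of_nat_Suc[of "k n"] distrib_left mult_1_right add_divide_distrib add.commute)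
    ultimately show "0 \<le> r n" "r n \<le> s" "s - r n \<le> T / Suc n" using T by (auto simp: r_def)
  qed
qed

lemma norm_step_le:
  assumes \<mu>: "\<mu> \<ge> 0"
  shows "norm (step \<mu> n Z p) \<le> exp (\<mu> * T) * norm (Z p)"
proof -
  obtain s \<omega> where p: "p = (s, \<omega>)" by (cases p)
  obtain r where r0: "\<forall>m. step \<mu> m Z (s, \<omega>) = indicator {0<..T} s *\<^sub>R (exp (\<mu> * r m) *\<^sub>R hs_compose (Sa (s - r m)) (Z (s, \<omega>)))
    \<and> (s \<in> {0<..T} \<longrightarrow> 0 \<le> r m \<and> r m \<le> s \<and> s - r m \<le> T / Suc m)"
    using step_eq[of \<mu> Z s \<omega>] by blast
  have r: "step \<mu> m Z (s, \<omega>) = indicator {0<..T} s *\<^sub>R (exp (\<mu> * r m) *\<^sub>R hs_compose (Sa (s - r m)) (Z (s, \<omega>)))"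
    "s \<in> {0<..T} \<Longrightarrow> 0 \<le> r m \<and> r m \<le> s \<and> s - r m \<le> T / Suc m" for m
    using r0[rule_format, of m] by auto
  show ?thesis
  proof (cases "s \<in> {0<..T}")
    case True
    then have "\<mu> * r n \<le> \<mu> * T" using r(2)[OF True, of n] \<mu> by (intro mult_left_mono) auto
    then show ?thesis using True r(2)[OF True, of n] hs_Sa_contraction[of "s - r n" "Z (s, \<omega>)"]
      by (simp add: p r(1) mult_mono)
  qed (simp add: p r(1))
qed

text \<open>The distance from s to the left end point of its interval tends to 0, so strong
  continuity of the adjoint semigroup at 0 gives pointwise convergence; a constant multiple of |Z|
  dominates.\<close>

lemma step_limit:
  assumes Z: "L2 Q Z" and \<mu>: "\<mu> \<ge> 0"
  shows "tends2 Q (\<lambda>n. step \<mu> n Z) (weighted \<mu> Z)"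
proof (rule tends2_dominated[OF _ _ Z, where c = "exp (\<mu> * T)"])
  show "step \<mu> n Z \<in> borel_measurable Q" for n
    unfolding step_def[abs_def]
    by (intro borel_measurable_sum borel_measurable_scaleR borel_measurable_const cut_measurable SZ_measurable L2_measurable[OF Z])
  show "weighted \<mu> Z \<in> borel_measurable Q" by (rule weighted_measurable[OF L2_measurable[OF Z]])
  show "norm (weighted \<mu> Z p) \<le> exp (\<mu> * T) * norm (Z p)" for p by (rule norm_weighted_le[OF \<mu>])
  show "norm (step \<mu> n Z p) \<le> exp (\<mu> * T) * norm (Z p)" for n p by (rule norm_step_le[OF \<mu>])
  show "AE p in Q. (\<lambda>n. step \<mu> n Z p) \<longlonglongrightarrow> weighted \<mu> Z p"
  proof (rule AE_I2)
    fix p :: "real \<times> 'w"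
    obtain s \<omega> where p: "p = (s, \<omega>)" by (cases p)
    obtain r where r0: "\<forall>m. step \<mu> m Z (s, \<omega>) = indicator {0<..T} s *\<^sub>R (exp (\<mu> * r m) *\<^sub>R hs_compose (Sa (s - r m)) (Z (s, \<omega>)))
    \<and> (s \<in> {0<..T} \<longrightarrow> 0 \<le> r m \<and> r m \<le> s \<and> s - r m \<le> T / Suc m)"
    using step_eq[of \<mu> Z s \<omega>] by blast
  have r: "step \<mu> m Z (s, \<omega>) = indicator {0<..T} s *\<^sub>R (exp (\<mu> * r m) *\<^sub>R hs_compose (Sa (s - r m)) (Z (s, \<omega>)))"
    "s \<in> {0<..T} \<Longrightarrow> 0 \<le> r m \<and> r m \<le> s \<and> s - r m \<le> T / Suc m" for m
    using r0[rule_format, of m] by auto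
    show "(\<lambda>n. step \<mu> n Z p) \<longlonglongrightarrow> weighted \<mu> Z p"
    proof (cases "s \<in> {0<..T}")
      case True
      have "(\<lambda>n. T / real (Suc n)) \<longlonglongrightarrow> 0"
        using tendsto_mult_right_zero[OF LIMSEQ_inverse_real_of_nat, of T] by (simp add: divide_inverse)
      then have d: "(\<lambda>n. s - r n) \<longlonglongrightarrow> 0"
        by (rule real_tendsto_sandwich[OF _ _ tendsto_const, rotated 2]) (use r(2)[OF True] in auto)
      from tendsto_diff[OF tendsto_const[of s] d] have rs: "r \<longlonglongrightarrow> s" by simp
      have "(\<lambda>n. hs_compose (Sa (s - r n)) (Z (s, \<omega>))) \<longlonglongrightarrow> hs_compose (Sa 0) (Z (s, \<omega>))"
        using hs_Sa_continuous[of "Z (s, \<omega>)"] r(2)[OF True] d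
        unfolding continuous_on_sequentially by (auto simp: o_def)
      also have "hs_compose (Sa 0) (Z (s, \<omega>)) = Z (s, \<omega>)" by (rule hs_eqI) simp
      finally have "(\<lambda>n. exp (\<mu> * r n) *\<^sub>R hs_compose (Sa (s - r n)) (Z (s, \<omega>))) \<longlonglongrightarrow> exp (\<mu> * s) *\<^sub>R Z (s, \<omega>)"
        by (intro tendsto_intros rs)
      then show ?thesis using True by (simp add: p r(1) cut_def)
    qed (simp add: p r(1) cut_def)
  qed
qed simp

text \<open>A solution provides integrals of \<open>SZ t Z\<close> only. The step process with \<mu>
  = 0 is assembled from restrictions of these to short intervals, so it is approximable, and its
  limit is Z on (0, T].\<close>

lemma drift_solution_approx:
  assumes "drift_solution \<xi> \<zeta> Y Z"
  shows "approx 0 T (cut 0 T Z)"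
proof (rule approx_closed)
  have Z: "L2 Q Z" using assms by (simp add: drift_solution_def)
  show "approx 0 T (step 0 n Z)" for n
  proof -
    have ap: "approx 0 T (cut (T * i / Suc n) (T * Suc i / Suc n) (SZ (T * i / Suc n) Z))" if i: "i < Suc n" for i
    proof -
      have t: "0 \<le> T * i / Suc n" "T * i / Suc n \<le> T * Suc i / Suc n" "T * i / Suc n \<le> T" "T * Suc i / Suc n \<le> T"
        using T i by (auto simp: field_simps simp del: of_nat_Suc)
      have "\<forall>t\<in>{0..T}. \<exists>I. ito t T (SZ t Z) I" using assms unfolding drift_solution_def by blast
      then obtain I where "ito (T * i / Suc n) T (SZ (T * i / Suc n) Z) I"
        using t(1,3) by (meson atLeastAtMost_iff)
      from approx_cut[OF ito_approx[OF this] t(1) order_refl t(2)] show ?thesis by (rule approx_mono) (use t in auto)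
    qed
    have "approx 0 T (\<lambda>p. \<Sum>i<m. cut (T * i / Suc n) (T * Suc i / Suc n) (SZ (T * i / Suc n) Z) p)"
      if "m \<le> Suc n" for m
      using that
    proof (induction m)
      case 0
      have "approx 0 T (EP ([] :: ('w, 'k, 'h) elementary))"
        by (rule ito_approx[OF ito_elementary]) simp_all
      then show ?case by simp
    next
      case (Suc m)
      from approx_add[OF Suc.IH ap] Suc.prems show ?case by simp
    qed
    from this[OF order_refl] show ?thesis unfolding step_def[abs_def] by simp
  qed
  show "tends2 Q (\<lambda>n. step 0 n Z) (cut 0 T Z)" using step_limit[OF Z order_refl] by simp
qed simp

text \<open>\<open>B'\<close> moves to the other side as its adjoint; what it meets there is still a
  bounded operator applied to U and therefore known at time r.\<close>

lemma ip_blinfun_orthogonal: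
  fixes B B' :: "'h \<Rightarrow>\<^sub>L 'h"
  assumes U: "L2 M U" "U \<in> borel_measurable (F r)"
    and V: "\<And>X. L2 M X \<Longrightarrow> X \<in> borel_measurable (F r) \<Longrightarrow> ip M X V = 0"
  shows "ip M (\<lambda>\<omega>. c *\<^sub>R B (U \<omega>)) (\<lambda>\<omega>. c' *\<^sub>R B' (V \<omega>)) = 0"
proof -
  let ?B = "blinfun_adj B' o\<^sub>L B"
  have L: "L2 M (\<lambda>\<omega>. ?B (U \<omega>))" by (rule L2_linear[OF U(1) blinfun.bounded_linear_right])
  have "blinfun_apply ?B \<in> borel_measurable borel"
    by (intro borel_measurable_continuous_onI linear_continuous_on blinfun.bounded_linear_right)
  from V[OF L measurable_compose[OF U(2) this]]
  have "expectation (\<lambda>\<omega>. ?B (U \<omega>) \<bullet> V \<omega>) = 0" by (simp add: ip_def)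
  moreover have "B (U \<omega>) \<bullet> B' (V \<omega>) = ?B (U \<omega>) \<bullet> V \<omega>" for \<omega>
    using inner_blinfun_adj[of "V \<omega>" B' "B (U \<omega>)"] by (simp add: inner_commute)
  ultimately show ?thesis unfolding ip_scaleR_left ip_scaleR_right by (simp add: ip_def)
qed

theorem apriori_step:
  assumes sol: "drift_solution \<xi> \<zeta> Y Z"
  shows "n2 Q (step lam n Z) \<le> exp (lam * T) * n2 M \<xi> + q * n2 Q (weighted lam \<zeta>)"
proof -
  have \<xi>: "L2 M \<xi>" and \<zeta>: "L2 Q \<zeta>" and Z: "L2 Q Z" using sol by (auto simp: drift_solution_def)
  define N where "N = Suc n"
  define \<tau> where "\<tau> i = T * real i / Suc n" for i :: nat
  have \<tau>: "0 \<le> \<tau> i" "\<tau> i \<le> \<tau> (Suc i)" "i < N \<Longrightarrow> \<tau> i \<le> T" "i < N \<Longrightarrow> \<tau> (Suc i) \<le> T" for i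
    using T by (auto simp: \<tau>_def N_def field_simps simp del: of_nat_Suc)
  have \<tau>m: "\<tau> i \<le> \<tau> j" if "i \<le> j" for i j
    using T that by (simp add: \<tau>_def divide_right_mono mult_left_mono)
  have "\<exists>I. ito (\<tau> i) T (SZ (\<tau> i) Z) I \<and> (AE \<omega> in M. Y (\<tau> i) \<omega> = Sa (T - \<tau> i) (\<xi> \<omega>) + drift (\<tau> i) \<zeta> \<omega> - I \<omega>)"
    if "i < N" for i using sol \<tau>(3)[OF that] \<tau>(1)[of i] by (auto simp: drift_solution_def)
  then have "\<forall>i\<in>{..<N}. \<exists>I. ito (\<tau> i) T (SZ (\<tau> i) Z) I \<and> (AE \<omega> in M. Y (\<tau> i) \<omega> = Sa (T - \<tau> i) (\<xi> \<omega>) + drift (\<tau> i) \<zeta> \<omega> - I \<omega>)"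
    by blast
  from bchoice[OF this] obtain I where I0: "\<forall>i\<in>{..<N}. ito (\<tau> i) T (SZ (\<tau> i) Z) (I i) \<and>
      (AE \<omega> in M. Y (\<tau> i) \<omega> = Sa (T - \<tau> i) (\<xi> \<omega>) + drift (\<tau> i) \<zeta> \<omega> - I i \<omega>)" ..
  have I: "ito (\<tau> i) T (SZ (\<tau> i) Z) (I i)"
    "AE \<omega> in M. Y (\<tau> i) \<omega> = Sa (T - \<tau> i) (\<xi> \<omega>) + drift (\<tau> i) \<zeta> \<omega> - I i \<omega>" if "i < N" for i
    using bspec[OF I0, of i] that by simp_all
  let ?c = "\<lambda>i. cut (\<tau> i) (\<tau> (Suc i)) (SZ (\<tau> i) Z)"
  have "\<forall>i\<in>{..<N}. \<exists>J. ito (\<tau> i) (\<tau> (Suc i)) (?c i) (fst J) \<and> ito (\<tau> (Suc i)) T (cut (\<tau> (Suc i)) T (SZ (\<tau> i) Z)) (snd J)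
      \<and> (AE \<omega> in M. I i \<omega> = fst J \<omega> + snd J \<omega>)"
  proof
    fix i assume "i \<in> {..<N}"
    then have i: "i < N" by simp
    obtain J R where "ito (\<tau> i) (\<tau> (Suc i)) (?c i) J" "ito (\<tau> (Suc i)) T (cut (\<tau> (Suc i)) T (SZ (\<tau> i) Z)) R"
      "AE \<omega> in M. I i \<omega> = J \<omega> + R \<omega>"
      using ito_split[OF I(1)[OF i] \<tau>(1) \<tau>(2) \<tau>(4)[OF i]] by blast
    then show "\<exists>J. ito (\<tau> i) (\<tau> (Suc i)) (?c i) (fst J) \<and> ito (\<tau> (Suc i)) T (cut (\<tau> (Suc i)) T (SZ (\<tau> i) Z)) (snd J)
      \<and> (AE \<omega> in M. I i \<omega> = fst J \<omega> + snd J \<omega>)"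
      by (intro exI[of _ "(J, R)"]) simp
  qed
  from bchoice[OF this] obtain JR where JR: "\<forall>i\<in>{..<N}. ito (\<tau> i) (\<tau> (Suc i)) (?c i) (fst (JR i)) \<and>
      ito (\<tau> (Suc i)) T (cut (\<tau> (Suc i)) T (SZ (\<tau> i) Z)) (snd (JR i)) \<and> (AE \<omega> in M. I i \<omega> = fst (JR i) \<omega> + snd (JR i) \<omega>)" ..
  define J where "J i = fst (JR i)" for i
  define R where "R i = snd (JR i)" for i
  have J: "ito (\<tau> i) (\<tau> (Suc i)) (?c i) (J i)" and R: "ito (\<tau> (Suc i)) T (cut (\<tau> (Suc i)) T (SZ (\<tau> i) Z)) (R i)"
    and IJ: "AE \<omega> in M. I i \<omega> = J i \<omega> + R i \<omega>" if "i < N" for i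
    using bspec[OF JR, of i] that by (simp_all add: J_def R_def)
  have JL: "L2 M (J i)" "J i \<in> borel_measurable (F (\<tau> (Suc i)))" if "i < N" for i
    using ito_L2(2)[OF J[OF that]] ito_measurable[OF J[OF that] \<tau>(1,2)] by auto
  have Jo: "ip M X (J i) = 0" if "i < N" "L2 M X" "X \<in> borel_measurable (F (\<tau> i))" for i X
    using ito_orthogonal[OF J[OF that(1)] \<tau>(1) that(2,3)] .
  have Jo': "ip M X (J j) = 0" if "i < j" "j < N" "L2 M X" "X \<in> borel_measurable (F (\<tau> (Suc i)))" for i j X
    using Jo[OF that(2,3) F_measurable_mono[OF that(4) \<tau>(1) \<tau>m]] that(1) by simp
  have key: "(n2 M (J i))\<^sup>2 = ip M (J i) (\<lambda>\<omega>. Sa (T - \<tau> i) (\<xi> \<omega>)) + ip M (J i) (drift (\<tau> i) \<zeta>)" if i: "i < N" for i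
  proof -
    have Y: "L2 M (Y (\<tau> i))" "Y (\<tau> i) \<in> borel_measurable (F (\<tau> i))"
      using sol \<tau>(1)[of i] \<tau>(3)[OF i] by (auto simp: drift_solution_def)
    have RL: "L2 M (R i)" using ito_L2(2)[OF R[OF i]] .
    have SL: "L2 M (\<lambda>\<omega>. Sa (T - \<tau> i) (\<xi> \<omega>))" by (rule L2_linear[OF \<xi> blinfun.bounded_linear_right])
    note DL = drift_L2(1)[OF \<zeta> \<tau>(1)[of i]]
    have "AE \<omega> in M. Sa (T - \<tau> i) (\<xi> \<omega>) + drift (\<tau> i) \<zeta> \<omega> = Y (\<tau> i) \<omega> + J i \<omega> + R i \<omega>"
      using I(2)[OF i] IJ[OF i] by eventually_elim simp
    then have "ip M (J i) (\<lambda>\<omega>. Sa (T - \<tau> i) (\<xi> \<omega>) + drift (\<tau> i) \<zeta> \<omega>) = ip M (J i) (\<lambda>\<omega>. Y (\<tau> i) \<omega> + J i \<omega> + R i \<omega>)"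
      by (intro ip_cong_AE) (use JL[OF i] SL DL Y RL in auto)
    moreover have "ip M (J i) (Y (\<tau> i)) = 0" using Jo[OF i Y] by (simp add: ip_commute)
    moreover have "ip M (J i) (R i) = 0" using ito_orthogonal[OF R[OF i] \<tau>(1) JL[OF i]] .
    ultimately show ?thesis
      using JL(1)[OF i] SL DL Y(1) RL by (simp add: ip_add_right L2_add ip_self)
  qed
  define w where "w i = exp (lam * \<tau> i)" for i
  have w0: "0 \<le> w i" for i by (simp add: w_def)
  \<comment> \<open>The weighted norm of the step process. Both sums estimated below are linear in
    \<open>a\<close>, so a^2 <= a (...) may be divided by \<open>a\<close>; the case a = 0 is
    trivial.\<close>
  define a where "a = sqrt (\<Sum>i<N. (w i * n2 M (J i))\<^sup>2)"
  have a2: "a\<^sup>2 = (\<Sum>i<N. (w i)\<^sup>2 * (n2 M (J i))\<^sup>2)" by (simp add: a_def sum_nonneg power_mult_distrib)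
  have a0: "a \<ge> 0" by (simp add: a_def sum_nonneg)
  have step2: "n2 Q (step lam n Z) = a"
  proof -
    have Lc: "L2 Q (\<lambda>p. w i *\<^sub>R ?c i p)" for i by (intro L2_scaleR L2_cut SZ_L2 Z)
    have o: "ip Q (\<lambda>p. w i *\<^sub>R ?c i p) (\<lambda>p. w j *\<^sub>R ?c j p) = 0" if "i \<noteq> j" for i j
    proof -
      have d: "\<tau> (Suc i) \<le> \<tau> j \<or> \<tau> (Suc j) \<le> \<tau> i" using that \<tau>m[of "Suc i" j] \<tau>m[of "Suc j" i] by linarith
      have "(w i *\<^sub>R ?c i p) \<bullet> (w j *\<^sub>R ?c j p) = 0" for p
        using d by (auto simp: cut_def indicator_def)
      then show ?thesis unfolding ip_def by (simp only: Bochner_Integration.integral_zero)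
    qed
    have "(n2 Q (\<lambda>p. \<Sum>i<N. w i *\<^sub>R ?c i p))\<^sup>2 = (\<Sum>i<N. (n2 Q (\<lambda>p. w i *\<^sub>R ?c i p))\<^sup>2)"
      by (rule n2_sum_orthogonal) (auto intro: Lc o)
    also have "\<dots> = a\<^sup>2" unfolding a2
      by (intro sum.cong) (simp_all add: n2_scaleR power_mult_distrib ito_isometry[OF J \<tau>(1)])
    finally have "n2 Q (\<lambda>p. \<Sum>i<N. w i *\<^sub>R ?c i p) = a" using a0 by simp
    moreover have "step lam n Z = (\<lambda>p. \<Sum>i<N. w i *\<^sub>R ?c i p)" by (simp add: step_def N_def w_def \<tau>_def fun_eq_iff)
    ultimately show ?thesis by simp
  qed
  have A: "(\<Sum>i<N. (w i)\<^sup>2 * ip M (J i) (\<lambda>\<omega>. Sa (T - \<tau> i) (\<xi> \<omega>))) \<le> exp (lam * T) * a * n2 M \<xi>"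
  proof -
    \<comment> \<open>Of the two weights one is bounded by exp (lam T); the other stays with J i and
      is absorbed by \<open>a\<close>.\<close>
    let ?X = "\<lambda>i \<omega>. (w i)\<^sup>2 *\<^sub>R S (T - \<tau> i) (J i \<omega>)"
    have XL: "L2 M (?X i)" if "i < N" for i
      by (intro L2_scaleR L2_linear[OF JL(1)[OF that] blinfun.bounded_linear_right])
    have "(w i)\<^sup>2 * ip M (J i) (\<lambda>\<omega>. Sa (T - \<tau> i) (\<xi> \<omega>)) = ip M (?X i) \<xi>" for i
      unfolding ip_scaleR_left by (simp add: ip_def inner_blinfun_adj)
    then have "(\<Sum>i<N. (w i)\<^sup>2 * ip M (J i) (\<lambda>\<omega>. Sa (T - \<tau> i) (\<xi> \<omega>))) = ip M (\<lambda>\<omega>. \<Sum>i<N. ?X i \<omega>) \<xi>"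
      using ip_sum_left[of "{..<N}" M ?X \<xi>] XL \<xi> by simp
    also have "\<dots> \<le> n2 M (\<lambda>\<omega>. \<Sum>i<N. ?X i \<omega>) * n2 M \<xi>"
      by (rule order_trans[OF abs_ge_self ip_le[OF L2_sum \<xi>]]) (rule XL, simp)
    also have "n2 M (\<lambda>\<omega>. \<Sum>i<N. ?X i \<omega>) \<le> exp (lam * T) * sqrt (\<Sum>i<N. (w i * n2 M (J i))\<^sup>2)"
    proof (rule n2_sum_orthogonal_le[OF XL])
      show "ip M (?X i) (?X j) = 0" if "i < j" "j < N" for i j
        by (rule ip_blinfun_orthogonal[OF JL Jo']) (use that in auto)
      fix i assume i: "i < N"
      have "n2 M (\<lambda>\<omega>. S (T - \<tau> i) (J i \<omega>)) \<le> 1 * n2 M (J i)"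
        by (rule L2_bound(2)[OF L2_measurable[OF L2_linear[OF JL(1)[OF i] blinfun.bounded_linear_right]] JL(1)[OF i]])
          (use S_contraction \<tau>(3)[OF i] in auto)
      then have "n2 M (?X i) \<le> w i * (w i * n2 M (J i))"
        using w0[of i] by (simp add: n2_scaleR power2_eq_square mult_left_mono mult.assoc)
      also have "\<dots> \<le> exp (lam * T) * (w i * n2 M (J i))"
        using \<tau>(3)[OF i] lam by (intro mult_right_mono) (auto simp: w_def)
      finally show "n2 M (?X i) \<le> exp (lam * T) * (w i * n2 M (J i))" .
    qed simp_all
    finally show ?thesis by (simp add: a_def mult_right_mono)
  qed
  have B: "(\<Sum>i<N. (w i)\<^sup>2 * ip M (J i) (drift (\<tau> i) \<zeta>)) \<le> q * a * n2 Q (weighted lam \<zeta>)"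
  proof -
    \<comment> \<open>The square of the weight at the left end point is distributed as w i times exp
      (- lam (s - \<tau> i)) times exp (lam s): the first goes to J i, the second to the kernel,
      where it is the weight of the energy bound, and the third to \<zeta>.\<close>
    let ?X = "\<lambda>i p. w i *\<^sub>R (exp (- lam * (fst p - \<tau> i)) *\<^sub>R KU (\<tau> i) (J i) p)"
    have XL: "L2 Q (?X i)" if "i < N" for i
      by (intro L2_scaleR KU_weighted(1)[OF JL(1)[OF that] \<tau>(1)])
    have \<zeta>w: "L2 Q (weighted lam \<zeta>)" using weighted_L2(1)[OF \<zeta>] lam by simp
    have "(w i)\<^sup>2 * ip M (J i) (drift (\<tau> i) \<zeta>) = ip Q (?X i) (weighted lam \<zeta>)" if i: "i < N" for i
    proof -
      have "(w i)\<^sup>2 * (KU (\<tau> i) (J i) p \<bullet> \<zeta> p) = ?X i p \<bullet> weighted lam \<zeta> p" for p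
      proof (cases "fst p \<in> {\<tau> i<..T}")
        case True
        have "w i * exp (- lam * (fst p - \<tau> i)) * exp (lam * fst p) = (w i)\<^sup>2"
          by (simp add: w_def power2_eq_square exp_add[symmetric] algebra_simps)
        moreover have "cut 0 T \<zeta> p = \<zeta> p" using True \<tau>(1)[of i] by (simp add: cut_def)
        ultimately show ?thesis by (simp add: mult_ac)
      qed (simp add: KU_def)
      then show ?thesis unfolding drift_ip[OF JL(1)[OF i] \<zeta> \<tau>(1)] by (simp add: ip_def flip: integral_mult_right_zero)
    qed
    then have "(\<Sum>i<N. (w i)\<^sup>2 * ip M (J i) (drift (\<tau> i) \<zeta>)) = ip Q (\<lambda>p. \<Sum>i<N. ?X i p) (weighted lam \<zeta>)"
      using ip_sum_left[of "{..<N}" Q ?X "weighted lam \<zeta>"] XL \<zeta>w by simp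
    also have "\<dots> \<le> n2 Q (\<lambda>p. \<Sum>i<N. ?X i p) * n2 Q (weighted lam \<zeta>)"
      by (rule order_trans[OF abs_ge_self ip_le[OF L2_sum \<zeta>w]]) (rule XL, simp)
    also have "n2 Q (\<lambda>p. \<Sum>i<N. ?X i p) \<le> q * sqrt (\<Sum>i<N. (w i * n2 M (J i))\<^sup>2)"
    proof (rule n2_sum_orthogonal_le[OF XL])
      show "ip Q (?X i) (?X j) = 0" if ij: "i < j" "j < N" for i j
      proof -
        have "ip Q (\<lambda>p. (w i * exp (- lam * (fst p - \<tau> i))) *\<^sub>R KU (\<tau> i) (J i) p)
            (\<lambda>p. (w j * exp (- lam * (fst p - \<tau> j))) *\<^sub>R KU (\<tau> j) (J j) p) = 0"
        proof (rule KU_orthogonal[of _ "\<tau> (Suc i)" _ "\<lambda>s. w i * exp (- lam * (s - \<tau> i))" _ "\<lambda>s. w j * exp (- lam * (s - \<tau> j))"])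
          show "ip M X (J j) = 0" if "L2 M X" "X \<in> borel_measurable (F (\<tau> (Suc i)))" for X
            using Jo'[OF ij that] .
        qed (use JL[of i] JL[of j] ij \<tau>(1) XL[of i] XL[of j] in auto)
        then show ?thesis by simp
      qed
      fix i assume i: "i < N"
      have "w i * n2 Q (\<lambda>p. exp (- lam * (fst p - \<tau> i)) *\<^sub>R KU (\<tau> i) (J i) p) \<le> w i * (q * n2 M (J i))"
        by (intro mult_left_mono KU_weighted(2)[OF JL(1)[OF i] \<tau>(1)]) (simp add: w_def)
      then show "n2 Q (?X i) \<le> q * (w i * n2 M (J i))"
        unfolding n2_scaleR by (simp add: w_def mult_ac)
    qed (simp_all add: q)
    finally show ?thesis by (simp add: a_def mult_right_mono)
  qed
  have "a * a = (\<Sum>i<N. (w i)\<^sup>2 * ip M (J i) (\<lambda>\<omega>. Sa (T - \<tau> i) (\<xi> \<omega>))) + (\<Sum>i<N. (w i)\<^sup>2 * ip M (J i) (drift (\<tau> i) \<zeta>))"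
    unfolding power2_eq_square[symmetric, of a] a2 using key by (simp add: distrib_left sum.distrib)
  also have "\<dots> \<le> a * (exp (lam * T) * n2 M \<xi> + q * n2 Q (weighted lam \<zeta>))"
    using A B by (simp add: algebra_simps)
  finally have "a * a \<le> a * (exp (lam * T) * n2 M \<xi> + q * n2 Q (weighted lam \<zeta>))" .
  then show ?thesis
    unfolding step2 using a0 q(1) by (cases "a = 0") (auto simp: mult_le_cancel_left)
qed

theorem apriori:
  assumes "drift_solution \<xi> \<zeta> Y Z"
  shows "n2 Q (weighted lam Z) \<le> exp (lam * T) * n2 M \<xi> + q * n2 Q (weighted lam \<zeta>)"
proof (rule LIMSEQ_le_const2)
  show "(\<lambda>n. n2 Q (step lam n Z)) \<longlonglongrightarrow> n2 Q (weighted lam Z)"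
    using tends2_n2[OF step_limit[of Z lam]] assms lam by (simp add: drift_solution_def)
qed (use apriori_step[OF assms] in auto)

end

section \<open>Solvability\<close>

context backward_equation
begin

lemma SZ_lin: "SZ t (\<lambda>p. Z p + c *\<^sub>R Z' p) = (\<lambda>p. SZ t Z p + c *\<^sub>R SZ t Z' p)"
  by (simp add: SZ_def fun_eq_iff hs_compose_add hs_compose_scaleR scaleR_add_right)

lemma drift_solutionD:
  assumes "drift_solution \<xi> \<zeta> Y Z"
  shows "L2 M \<xi>" "L2 Q \<zeta>" "L2 Q Z" "t \<in> {0..T} \<Longrightarrow> L2 M (Y t)" "t \<in> {0..T} \<Longrightarrow> Y t \<in> borel_measurable (F t)"
    "t \<in> {0..T} \<Longrightarrow> \<exists>I. ito t T (SZ t Z) I \<and> (AE \<omega> in M. Y t \<omega> = Sa (T - t) (\<xi> \<omega>) + drift t \<zeta> \<omega> - I \<omega>)"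
  using assms by (simp_all add: drift_solution_def)

lemma drift_solutionI:
  assumes "L2 M \<xi>" "L2 Q \<zeta>" "L2 Q Z" "\<And>t. t \<in> {0..T} \<Longrightarrow> L2 M (Y t)" "\<And>t. t \<in> {0..T} \<Longrightarrow> Y t \<in> borel_measurable (F t)"
    "\<And>t. t \<in> {0..T} \<Longrightarrow> \<exists>I. ito t T (SZ t Z) I \<and> (AE \<omega> in M. Y t \<omega> = Sa (T - t) (\<xi> \<omega>) + drift t \<zeta> \<omega> - I \<omega>)"
  shows "drift_solution \<xi> \<zeta> Y Z"
  using assms by (simp add: drift_solution_def)

lemma drift_solution_lin:
  assumes 1: "drift_solution \<xi> \<zeta> Y Z" and 2: "drift_solution \<xi>' \<zeta>' Y' Z'"
  shows "drift_solution (\<lambda>\<omega>. \<xi> \<omega> + c *\<^sub>R \<xi>' \<omega>) (\<lambda>p. \<zeta> p + c *\<^sub>R \<zeta>' p) (\<lambda>t \<omega>. Y t \<omega> + c *\<^sub>R Y' t \<omega>) (\<lambda>p. Z p + c *\<^sub>R Z' p)"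
proof (rule drift_solutionI)
  fix t assume t: "t \<in> {0..T}"
  show "L2 M (\<lambda>\<omega>. Y t \<omega> + c *\<^sub>R Y' t \<omega>)" by (intro L2_add L2_scaleR drift_solutionD(4)[OF 1 t] drift_solutionD(4)[OF 2 t])
  show "(\<lambda>\<omega>. Y t \<omega> + c *\<^sub>R Y' t \<omega>) \<in> borel_measurable (F t)"
    by (intro borel_measurable_add borel_measurable_scaleR borel_measurable_const drift_solutionD(5)[OF 1 t] drift_solutionD(5)[OF 2 t])
  obtain I where I: "ito t T (SZ t Z) I" "AE \<omega> in M. Y t \<omega> = Sa (T - t) (\<xi> \<omega>) + drift t \<zeta> \<omega> - I \<omega>"
    using drift_solutionD(6)[OF 1 t] by blast
  obtain I' where I': "ito t T (SZ t Z') I'" "AE \<omega> in M. Y' t \<omega> = Sa (T - t) (\<xi>' \<omega>) + drift t \<zeta>' \<omega> - I' \<omega>"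
    using drift_solutionD(6)[OF 2 t] by blast
  have "AE \<omega> in M. drift t (\<lambda>p. \<zeta> p + c *\<^sub>R \<zeta>' p) \<omega> = drift t \<zeta> \<omega> + c *\<^sub>R drift t \<zeta>' \<omega>"
    using drift_add[OF drift_solutionD(2)[OF 1] L2_scaleR[OF drift_solutionD(2)[OF 2]], of t c] t drift_scaleR[of t c \<zeta>'] by simp
  then have "AE \<omega> in M. Y t \<omega> + c *\<^sub>R Y' t \<omega> = Sa (T - t) (\<xi> \<omega> + c *\<^sub>R \<xi>' \<omega>)
      + drift t (\<lambda>p. \<zeta> p + c *\<^sub>R \<zeta>' p) \<omega> - (I \<omega> + c *\<^sub>R I' \<omega>)"
    using I(2) I'(2)
    by eventually_elim (simp add: blinfun.add_right blinfun.scaleR_right scaleR_add_right scaleR_diff_right)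
  then show "\<exists>I. ito t T (SZ t (\<lambda>p. Z p + c *\<^sub>R Z' p)) I \<and> (AE \<omega> in M. Y t \<omega> + c *\<^sub>R Y' t \<omega> = Sa (T - t) (\<xi> \<omega> + c *\<^sub>R \<xi>' \<omega>)
      + drift t (\<lambda>p. \<zeta> p + c *\<^sub>R \<zeta>' p) \<omega> - I \<omega>)"
    using ito_add[OF I(1) ito_scaleR[OF I'(1), of c]] unfolding SZ_lin by (intro exI conjI)
qed (use drift_solutionD[OF 1] drift_solutionD[OF 2] in \<open>auto intro!: L2_add L2_scaleR\<close>)

lemma drift_solution_diff:
  assumes "drift_solution \<xi> \<zeta> Y Z" "drift_solution \<xi>' \<zeta>' Y' Z'"
  shows "drift_solution (\<lambda>\<omega>. \<xi> \<omega> - \<xi>' \<omega>) (\<lambda>p. \<zeta> p - \<zeta>' p) (\<lambda>t \<omega>. Y t \<omega> - Y' t \<omega>) (\<lambda>p. Z p - Z' p)"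
  using drift_solution_lin[OF assms, of "-1"] by simp

lemma SZ_cut: "t \<ge> 0 \<Longrightarrow> SZ t (cut 0 T Z) = SZ t Z"
  by (auto simp: SZ_def cut_def fun_eq_iff indicator_def)

lemma drift_solution_cut: "drift_solution \<xi> \<zeta> Y Z \<Longrightarrow> drift_solution \<xi> \<zeta> Y (cut 0 T Z)"
  by (simp add: drift_solution_def L2_cut SZ_cut)

lemma drift_solution_cong:
  assumes 1: "drift_solution \<xi> \<zeta> Y Z" and \<xi>: "AE \<omega> in M. \<xi> \<omega> = \<xi>' \<omega>" "L2 M \<xi>'" and \<zeta>: "AE p in Q. \<zeta> p = \<zeta>' p" "L2 Q \<zeta>'"
  shows "drift_solution \<xi>' \<zeta>' Y Z"
proof (rule drift_solutionI)
  fix t assume t: "t \<in> {0..T}"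
  obtain I where I: "ito t T (SZ t Z) I" "AE \<omega> in M. Y t \<omega> = Sa (T - t) (\<xi> \<omega>) + drift t \<zeta> \<omega> - I \<omega>"
    using drift_solutionD(6)[OF 1 t] by blast
  have "AE \<omega> in M. drift t \<zeta> \<omega> = drift t \<zeta>' \<omega>" by (rule drift_cong_AE[OF drift_solutionD(2)[OF 1] \<zeta>(2) _ \<zeta>(1)]) (use t in simp)
  with I(2) \<xi>(1) have "AE \<omega> in M. Y t \<omega> = Sa (T - t) (\<xi>' \<omega>) + drift t \<zeta>' \<omega> - I \<omega>" by eventually_elim simp
  with I(1) show "\<exists>I. ito t T (SZ t Z) I \<and> (AE \<omega> in M. Y t \<omega> = Sa (T - t) (\<xi>' \<omega>) + drift t \<zeta>' \<omega> - I \<omega>)" by blast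
qed (use drift_solutionD[OF 1] assms in auto)

text \<open>The weights are removed at the cost of exp (lam T), and q is replaced by 1. This form is
  enough for limits; the contraction keeps the weighted norm.\<close>

lemma apriori_diff:
  assumes "drift_solution \<xi> \<zeta> Y Z" "drift_solution \<xi>' \<zeta>' Y' Z'"
  shows "n2 Q (cut 0 T (\<lambda>p. Z p - Z' p))
    \<le> exp (lam * T) * n2 M (\<lambda>\<omega>. \<xi> \<omega> - \<xi>' \<omega>) + exp (lam * T) * n2 Q (\<lambda>p. \<zeta> p - \<zeta>' p)"
proof -
  note d = drift_solution_diff[OF assms]
  have "n2 Q (cut 0 T (\<lambda>p. Z p - Z' p)) \<le> n2 Q (weighted lam (\<lambda>p. Z p - Z' p))"
    using weighted_L2(3)[OF drift_solutionD(3)[OF d]] lam by simp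
  also have "\<dots> \<le> exp (lam * T) * n2 M (\<lambda>\<omega>. \<xi> \<omega> - \<xi>' \<omega>) + q * n2 Q (weighted lam (\<lambda>p. \<zeta> p - \<zeta>' p))"
    by (rule apriori[OF d])
  also have "q * n2 Q (weighted lam (\<lambda>p. \<zeta> p - \<zeta>' p)) \<le> 1 * (exp (lam * T) * n2 Q (\<lambda>p. \<zeta> p - \<zeta>' p))"
    using weighted_L2(2)[OF drift_solutionD(2)[OF d]] lam q by (intro mult_mono) auto
  finally show ?thesis by simp
qed

text \<open>The limit agrees almost surely with the pointwise limit of a subsequence, and F t
  contains the null sets.\<close>

lemma tends2_F_measurable:
  assumes f: "tends2 M f g" and m: "\<And>n. f n \<in> borel_measurable (F t)" and t: "t \<ge> 0"
  shows "g \<in> borel_measurable (F t)"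
proof -
  obtain r :: "nat \<Rightarrow> nat" where r: "tends2 M f (\<lambda>\<omega>. lim (\<lambda>n. f (r n) \<omega>))"
    using L2_complete[OF tends2_L2(1)[OF f] tends2_Cauchy[OF f]] by metis
  have "(\<lambda>\<omega>. lim (\<lambda>n. f (r n) \<omega>)) \<in> borel_measurable (F t)" by (rule borel_measurable_lim_metric) (rule m)
  then show ?thesis by (rule F_measurable_AE[OF _ t tends2_unique[OF r f]])
qed

lemma tends2_diff_const:
  assumes "tends2 N f g" "tends2 N f' g'"
  shows "tends2 N (\<lambda>n x. f n x - f' n x) (\<lambda>x. g x - g' x)"
  using tends2_add[OF assms(1) tends2_linear[OF assms(2) bounded_linear_minus[OF bounded_linear_ident]]] by simp

lemma tends2_SZ:
  assumes "tends2 Q Z' Z"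
  shows "tends2 Q (\<lambda>n. SZ t (Z' n)) (SZ t Z)"
proof (rule tends2I)
  show "n2 Q (\<lambda>p. SZ t (Z' n) p - SZ t Z p) \<le> n2 Q (\<lambda>p. Z' n p - Z p)" for n
    using SZ_L2(2)[OF L2_diff[OF tends2_L2(1)[OF assms] tends2_L2(2)[OF assms]], of t] by (simp add: SZ_diff)
  show "(\<lambda>n. n2 Q (\<lambda>p. Z' n p - Z p)) \<longlonglongrightarrow> 0" using assms by (simp add: tends2_def)
qed (use tends2_L2[OF assms] SZ_L2 in auto)

lemma ito_tends2:
  assumes I: "\<And>n. ito a b (\<Phi> n) (I n)" "ito a b \<Psi> J" and \<Phi>: "tends2 Q \<Phi> \<Psi>" and a: "0 \<le> a"
  shows "tends2 M I J"
proof (rule tends2I[OF ito_L2(2)[OF I(1)] ito_L2(2)[OF I(2)]])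
  show "n2 M (\<lambda>\<omega>. I n \<omega> - J \<omega>) \<le> n2 Q (\<lambda>p. \<Phi> n p - \<Psi> p)" for n
    using ito_isometry[OF ito_diff[OF I(1) I(2)] a] by simp
  show "(\<lambda>n. n2 Q (\<lambda>p. \<Phi> n p - \<Psi> p)) \<longlonglongrightarrow> 0" using \<Phi> by (simp add: tends2_def)
qed

definition solvable where "solvable \<xi> \<zeta> \<longleftrightarrow> (\<exists>Y Z. drift_solution \<xi> \<zeta> Y Z)"

lemma solvable_lin:
  "solvable \<xi> \<zeta> \<Longrightarrow> solvable \<xi>' \<zeta>' \<Longrightarrow> solvable (\<lambda>\<omega>. \<xi> \<omega> + c *\<^sub>R \<xi>' \<omega>) (\<lambda>p. \<zeta> p + c *\<^sub>R \<zeta>' p)"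
  unfolding solvable_def using drift_solution_lin by blast

lemma solvable_cong:
  "solvable \<xi> \<zeta> \<Longrightarrow> AE \<omega> in M. \<xi> \<omega> = \<xi>' \<omega> \<Longrightarrow> L2 M \<xi>' \<Longrightarrow> AE p in Q. \<zeta> p = \<zeta>' p \<Longrightarrow> L2 Q \<zeta>' \<Longrightarrow> solvable \<xi>' \<zeta>'"
  unfolding solvable_def using drift_solution_cong by blast

text \<open>The a priori estimate makes the Z parts Cauchy once they are restricted to (0, T],
  outside of which the equation says nothing about them. The stochastic integrals and the drift
  converge with them, and Y is defined from the equation; its adaptedness is inherited from the
  approximating solutions.\<close>

lemma solvable_closed:
  assumes sol: "\<And>n. solvable (\<xi>' n) (\<zeta>' n)" and \<xi>: "tends2 M \<xi>' \<xi>" and \<zeta>: "tends2 Q \<zeta>' \<zeta>"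
  shows "solvable \<xi> \<zeta>"
proof -
  have "\<forall>n. \<exists>Y Z. drift_solution (\<xi>' n) (\<zeta>' n) Y Z" using sol by (simp add: solvable_def)
  then obtain Y Z0 where S0: "\<And>n. drift_solution (\<xi>' n) (\<zeta>' n) (Y n) (Z0 n)" by metis
  define Z' where "Z' n = cut 0 T (Z0 n)" for n
  have S: "drift_solution (\<xi>' n) (\<zeta>' n) (Y n) (Z' n)" for n unfolding Z'_def by (rule drift_solution_cut[OF S0])
  have bound: "n2 Q (\<lambda>p. Z' m p - Z' n p) \<le> exp (lam * T) * n2 M (\<lambda>\<omega>. \<xi>' m \<omega> - \<xi>' n \<omega>) + exp (lam * T) * n2 Q (\<lambda>p. \<zeta>' m p - \<zeta>' n p)"
    for m n using apriori_diff[OF S0 S0, of m n] by (simp add: Z'_def cut_diff)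
  have C: "\<exists>k. \<forall>m\<ge>k. \<forall>n\<ge>k. n2 Q (\<lambda>p. Z' m p - Z' n p) < e" if e: "e > 0" for e
  proof -
    define d where "d = e / (2 * exp (lam * T))"
    have d: "d > 0" using e by (simp add: d_def)
    obtain k1 where k1: "\<forall>m\<ge>k1. \<forall>n\<ge>k1. n2 M (\<lambda>\<omega>. \<xi>' m \<omega> - \<xi>' n \<omega>) < d" using tends2_Cauchy[OF \<xi> d] by blast
    obtain k2 where k2: "\<forall>m\<ge>k2. \<forall>n\<ge>k2. n2 Q (\<lambda>p. \<zeta>' m p - \<zeta>' n p) < d" using tends2_Cauchy[OF \<zeta> d] by blast
    have "n2 Q (\<lambda>p. Z' m p - Z' n p) < e" if "m \<ge> max k1 k2" "n \<ge> max k1 k2" for m n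
    proof -
      have "exp (lam * T) * n2 M (\<lambda>\<omega>. \<xi>' m \<omega> - \<xi>' n \<omega>) + exp (lam * T) * n2 Q (\<lambda>p. \<zeta>' m p - \<zeta>' n p) < exp (lam * T) * d + exp (lam * T) * d"
        using k1 k2 that by (intro add_strict_mono mult_strict_left_mono) auto
      also have "\<dots> = e" by (simp add: d_def)
      finally show ?thesis using bound[of m n] by simp
    qed
    then show ?thesis by blast
  qed
  obtain Z where Z: "tends2 Q Z' Z"
    using L2_complete[OF drift_solutionD(3)[OF S] C] by metis
  have "\<exists>I. ito t T (SZ t Z) I \<and> L2 M I \<and> (\<lambda>\<omega>. Sa (T - t) (\<xi> \<omega>) + drift t \<zeta> \<omega> - I \<omega>) \<in> borel_measurable (F t)" if t: "t \<in> {0..T}" for t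
  proof -
    have t0: "0 \<le> t" using t by simp
    have "\<forall>n. \<exists>I. ito t T (SZ t (Z' n)) I \<and> (AE \<omega> in M. Y n t \<omega> = Sa (T - t) (\<xi>' n \<omega>) + drift t (\<zeta>' n) \<omega> - I \<omega>)"
      using drift_solutionD(6)[OF S t] by blast
    from choice[OF this] obtain I' where I': "\<forall>n. ito t T (SZ t (Z' n)) (I' n) \<and> (AE \<omega> in M. Y n t \<omega> = Sa (T - t) (\<xi>' n \<omega>) + drift t (\<zeta>' n) \<omega> - I' n \<omega>)" ..
    then have i: "ito t T (SZ t (Z' n)) (I' n)" and y: "AE \<omega> in M. Y n t \<omega> = Sa (T - t) (\<xi>' n \<omega>) + drift t (\<zeta>' n) \<omega> - I' n \<omega>" for n
      by auto
    have "approx t T (SZ t Z)" by (rule approx_closed[OF ito_approx[OF i] tends2_SZ[OF Z] t0])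
    from approx_ito[OF this t0] obtain I where I: "ito t T (SZ t Z) I" by blast
    have dr: "tends2 M (\<lambda>n. drift t (\<zeta>' n)) (drift t \<zeta>)"
    proof (rule tends2I)
      show "n2 M (\<lambda>\<omega>. drift t (\<zeta>' n) \<omega> - drift t \<zeta> \<omega>) \<le> kappa * n2 Q (\<lambda>p. \<zeta>' n p - \<zeta> p)" for n
        by (rule n2_drift_diff[OF tends2_L2(1)[OF \<zeta>] tends2_L2(2)[OF \<zeta>] t0])
      show "(\<lambda>n. kappa * n2 Q (\<lambda>p. \<zeta>' n p - \<zeta> p)) \<longlonglongrightarrow> 0"
        using \<zeta> by (intro tendsto_mult_right_zero) (simp add: tends2_def)
    qed (use drift_L2(1)[OF tends2_L2(1)[OF \<zeta>] t0] drift_L2(1)[OF tends2_L2(2)[OF \<zeta>] t0] in auto)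
    have lim: "tends2 M (\<lambda>n \<omega>. Sa (T - t) (\<xi>' n \<omega>) + drift t (\<zeta>' n) \<omega> - I' n \<omega>) (\<lambda>\<omega>. Sa (T - t) (\<xi> \<omega>) + drift t \<zeta> \<omega> - I \<omega>)"
      by (intro tends2_diff_const tends2_add tends2_linear[OF \<xi>] dr blinfun.bounded_linear_right
          ito_tends2[OF i I tends2_SZ[OF Z] t0])
    have "tends2 M (\<lambda>n. Y n t) (\<lambda>\<omega>. Sa (T - t) (\<xi> \<omega>) + drift t \<zeta> \<omega> - I \<omega>)"
    proof (rule tends2_cong_AE[OF lim])
      show "AE \<omega> in M. Sa (T - t) (\<xi>' n \<omega>) + drift t (\<zeta>' n) \<omega> - I' n \<omega> = Y n t \<omega>" for n
        using y[of n] by eventually_elim simp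
    qed (use drift_solutionD(4)[OF S t] tends2_L2(2)[OF lim] in auto)
    from tends2_F_measurable[OF this drift_solutionD(5)[OF S t] t0] I ito_L2(2)[OF I] show ?thesis by blast
  qed
  then have "\<forall>t\<in>{0..T}. \<exists>I. ito t T (SZ t Z) I \<and> L2 M I \<and> (\<lambda>\<omega>. Sa (T - t) (\<xi> \<omega>) + drift t \<zeta> \<omega> - I \<omega>) \<in> borel_measurable (F t)"
    by blast
  from bchoice[OF this] obtain I where I: "\<forall>t\<in>{0..T}. ito t T (SZ t Z) (I t) \<and> L2 M (I t) \<and> (\<lambda>\<omega>. Sa (T - t) (\<xi> \<omega>) + drift t \<zeta> \<omega> - I t \<omega>) \<in> borel_measurable (F t)" ..
  have "drift_solution \<xi> \<zeta> (\<lambda>t \<omega>. Sa (T - t) (\<xi> \<omega>) + drift t \<zeta> \<omega> - I t \<omega>) Z"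
  proof (rule drift_solutionI)
    fix t assume t: "t \<in> {0..T}"
    note It = bspec[OF I t]
    show "L2 M (\<lambda>\<omega>. Sa (T - t) (\<xi> \<omega>) + drift t \<zeta> \<omega> - I t \<omega>)"
      using It t by (intro L2_diff L2_add L2_linear[OF tends2_L2(2)[OF \<xi>]] blinfun.bounded_linear_right drift_L2(1)[OF tends2_L2(2)[OF \<zeta>]]) auto
    show "\<exists>J. ito t T (SZ t Z) J \<and> (AE \<omega> in M. Sa (T - t) (\<xi> \<omega>) + drift t \<zeta> \<omega> - I t \<omega> = Sa (T - t) (\<xi> \<omega>) + drift t \<zeta> \<omega> - J \<omega>)"
      using It by (intro exI[of _ "I t"]) simp
  qed (use I tends2_L2(2)[OF \<xi>] tends2_L2(2)[OF \<zeta>] tends2_L2(2)[OF Z] in auto)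
  then show ?thesis unfolding solvable_def by blast
qed

text \<open>The flow property of \<open>g\<close> makes all integrands \<open>SZ t Z\<close> elementary, with coefficient \<open>g t\<close>, if \<open>Z\<close> is
  the integrand of the increment times \<open>g\<close>.\<close>

lemma solvable_increment:
  assumes s: "0 \<le> s" "s \<le> r" "r \<le> T" and G: "G \<in> sets (F s)"
    and g: "continuous_on {0..T} g" "\<And>u v. 0 \<le> u \<Longrightarrow> u \<le> v \<Longrightarrow> v \<le> r \<Longrightarrow> Sa (v - u) (g v) = g u"
    and L: "L2 M \<xi>" "L2 Q \<zeta>"
    and eq: "\<And>t. t \<in> {0..T} \<Longrightarrow> AE \<omega> in M. Sa (T - t) (\<xi> \<omega>) + drift t \<zeta> \<omega> = (indicator G \<omega> * D s r \<phi> \<omega>) *\<^sub>R g t"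
  shows "solvable \<xi> \<zeta>"
proof -
  define Z where "Z p = indicator ({s<..r} \<times> G) p *\<^sub>R rank_one (indicator {0..T} (fst p) *\<^sub>R g (fst p)) \<phi>" for p
  \<comment> \<open>At time t only the part of the increment after t is integrated. The right end
    \<open>max (u t) r\<close> makes this part empty when t is beyond r.\<close>
  define u where "u t = max s t" for t
  define I where "I t = EI [(u t, max (u t) r, G, \<phi>, g t)]" for t
  define Y where "Y t \<omega> = (indicator G \<omega> * D s r \<phi> \<omega>) *\<^sub>R g t - I t \<omega>" for t \<omega>
  have GM: "G \<in> sets M" using F_subset[OF s(1)] G by blast
  have u: "0 \<le> u t" "t \<le> u t" "s \<le> u t" for t using s by (auto simp: u_def)
  have el: "elementary_on F t T [(u t, max (u t) r, G, \<phi>, g t)]" if "t \<in> {0..T}" for t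
    using u[of t] s that F_mono[OF s(1) u(3)[of t]] G by (auto simp: elementary_on_def u_def)
  have gm: "(\<lambda>x. indicator {0..T} x *\<^sub>R g x) \<in> borel_measurable borel"
    by (rule borel_measurable_continuous_on_indicator[OF _ g(1)]) simp
  have Zm: "Z \<in> borel_measurable Q"
  proof -
    have gQ: "(\<lambda>p. indicator {0..T} (fst p) *\<^sub>R g (fst p)) \<in> borel_measurable Q"
      using gm by (intro measurable_compose[OF measurable_fst]) simp
    have "(\<lambda>h. rank_one h \<phi>) \<in> borel_measurable borel"
      by (intro borel_measurable_continuous_onI linear_continuous_on bounded_linear_rank_one)
    from measurable_compose[OF gQ this]
    have "(\<lambda>p. rank_one (indicator {0..T} (fst p) *\<^sub>R g (fst p)) \<phi>) \<in> borel_measurable Q" .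
    moreover have "{s<..r} \<times> G \<in> sets Q" using GM by simp
    ultimately show ?thesis unfolding Z_def[abs_def] by (intro borel_measurable_scaleR borel_measurable_indicator)
  qed
  have "bounded (g ` {0..T})" by (rule compact_imp_bounded[OF compact_continuous_image[OF g(1) compact_Icc]])
  then obtain B where B': "\<forall>y\<in>g ` {0..T}. norm y \<le> B" unfolding bounded_iff by blast
  then have B: "norm (g x) \<le> B" if "x \<in> {0..T}" for x using that by blast
  have B0: "B \<ge> 0" using B[of 0] T norm_ge_zero[of "g 0"] by (simp del: norm_ge_zero)
  have ZL: "L2 Q Z"
  proof (rule L2_bound(1)[OF Zm])
    have "emeasure Q ({s<..r} \<times> G) < \<infinity>" using GM s by (simp add: emeasure_pair_measure_Times ennreal_mult_less_top emeasure_eq_measure)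
    then show "L2 Q (\<lambda>p. indicator ({s<..r} \<times> G) p *\<^sub>R (1::real))" using GM by (intro L2_indicator) auto
    show "AE p in Q. norm (Z p) \<le> (B * norm \<phi>) * norm (indicator ({s<..r} \<times> G) p *\<^sub>R (1::real))"
      using B B0 s by (intro AE_I2) (auto simp: Z_def norm_rank_one indicator_def mult_right_mono)
  qed (use B0 in simp)
  have SZ: "SZ t Z = EP [(u t, max (u t) r, G, \<phi>, g t)]" if t: "t \<in> {0..T}" for t
  proof
    fix p :: "real \<times> 'w"
    have ep: "EP [(u t, max (u t) r, G, \<phi>, g t)] p = indicator ({u t<..max (u t) r} \<times> G) p *\<^sub>R rank_one (g t) \<phi>"
      by (rule fun_cong[OF EP_single])
    show "SZ t Z p = EP [(u t, max (u t) r, G, \<phi>, g t)] p"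
    proof (cases "fst p \<in> {u t<..r} \<and> snd p \<in> G")
      case True
      then have "Sa (fst p - t) (g (fst p)) = g t" using t u[of t] by (intro g(2)) auto
      then show ?thesis unfolding ep using True t u[of t] s(3) s(1)
        by (cases p) (simp add: SZ_def Z_def hs_compose_rank_one indicator_def)
    next
      case False
      then have "p \<notin> {u t<..max (u t) r} \<times> G" by (cases p) auto
      moreover have "SZ t Z p = 0" using False by (cases p) (auto simp: SZ_def Z_def indicator_def u_def)
      ultimately show ?thesis unfolding ep by simp
    qed
  qed
  have I: "ito t T (SZ t Z) (I t)" if "t \<in> {0..T}" for t
    unfolding SZ[OF that] I_def using ito_elementary[OF el[OF that]] that by simp
  have Dm: "D s r' \<phi> \<in> borel_measurable (F t)" if "s \<le> r'" "r' \<le> t" for r' t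
    using F_measurable_mono[OF D_measurable[OF s(1) that(1)]] s(1) that by simp
  have Ym: "Y t \<in> borel_measurable (F t)" if t: "t \<in> {0..T}" for t
  proof (cases "s \<le> t")
    case True
    \<comment> \<open>Subtracting the integral after t leaves the increment up to min r t, which is
      known at time t.\<close>
    have "Y t = (\<lambda>\<omega>. (indicator G \<omega> * D s (min r t) \<phi> \<omega>) *\<^sub>R g t)"
      using True by (auto simp: Y_def I_def EI_single u_def fun_eq_iff max_def min_def scaleR_diff_left[symmetric] right_diff_distrib)
    moreover have "G \<in> sets (F t)" using G F_mono[OF s(1) True] by blast
    ultimately show ?thesis using Dm[of "min r t" t] s True
      by simp
  next
    case False
    then have "Y t = (\<lambda>\<omega>. 0)" using s by (auto simp: Y_def I_def EI_single u_def fun_eq_iff max_def)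
    then show ?thesis by simp
  qed
  have XL: "L2 M (\<lambda>\<omega>. (indicator G \<omega> * D s r \<phi> \<omega>) *\<^sub>R g t)" for t
    using EI_single_L2(1)[of s r "(s, r, G, \<phi>, g t)"] s G by (simp add: EI_single elementary_on_def)
  have "drift_solution \<xi> \<zeta> Y Z"
  proof (rule drift_solutionI[OF L ZL])
    fix t assume t: "t \<in> {0..T}"
    show "L2 M (Y t)" unfolding Y_def[abs_def] by (intro L2_diff XL ito_L2(2)[OF I[OF t]])
    show "Y t \<in> borel_measurable (F t)" by (rule Ym[OF t])
    show "\<exists>I. ito t T (SZ t Z) I \<and> (AE \<omega> in M. Y t \<omega> = Sa (T - t) (\<xi> \<omega>) + drift t \<zeta> \<omega> - I \<omega>)"
      using I[OF t] eq[OF t] unfolding Y_def by auto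
  qed
  then show ?thesis unfolding solvable_def by blast
qed

lemma solvable_deterministic:
  assumes L: "L2 M \<xi>" "L2 Q \<zeta>"
    and eq: "\<And>t. t \<in> {0..T} \<Longrightarrow> AE \<omega> in M. Sa (T - t) (\<xi> \<omega>) + drift t \<zeta> \<omega> = g t"
  shows "solvable \<xi> \<zeta>"
proof -
  have "drift_solution \<xi> \<zeta> (\<lambda>t \<omega>. g t) (\<lambda>p. 0)"
  proof (rule drift_solutionI[OF L])
    fix t assume t: "t \<in> {0..T}"
    have "ito t T (EP []) (EI ([] :: ('w, 'k, 'h) elementary))" by (rule ito_elementary) (use t in simp_all)
    then have "ito t T (SZ t (\<lambda>p. 0)) (\<lambda>\<omega>. 0)" by (simp add: SZ_def[abs_def])
    then show "\<exists>I. ito t T (SZ t (\<lambda>p. 0)) I \<and> (AE \<omega> in M. g t = Sa (T - t) (\<xi> \<omega>) + drift t \<zeta> \<omega> - I \<omega>)"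
      using eq[OF t] by (intro exI[of _ "\<lambda>\<omega>. 0"]) auto
  qed auto
  then show ?thesis unfolding solvable_def by blast
qed


lemma AE_fst_neq: "AE p in Q. fst p \<noteq> t"
proof (rule AE_I')
  show "{t} \<times> space M \<in> null_sets Q"
    by (rule null_setsI) (simp_all add: emeasure_pair_measure_Times)
  show "{p \<in> space Q. \<not> fst p \<noteq> t} \<subseteq> {t} \<times> space M" by (auto simp: space_pair_measure)
qed

section \<open>Drift integrands that are tensor products\<close>

text \<open>The drift at time t of the integrand that equals z on (a, b] and 0 elsewhere, after the
  substitution u = s - t; compare \<open>drift_tensor\<close>.\<close>

definition dual :: "real \<Rightarrow> real \<Rightarrow> ('k, 'h) hs \<Rightarrow> real \<Rightarrow> 'h" where
  "dual a b z t = (\<integral>u. indicator {a - t<..b - t} u *\<^sub>R (indicator {0<..T} u *\<^sub>R Ka u z) \<partial>lborel)"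

lemma Ka_integrable: "integrable lborel (\<lambda>u. indicator {0<..T} u *\<^sub>R Ka u z)"
proof -
  obtain \<omega> where \<omega>: "\<omega> \<in> space M" using not_empty by blast
  let ?z = "\<lambda>p :: real \<times> 'w. (indicator {0<..T} (fst p) :: real) *\<^sub>R z"
  have "?z \<in> borel_measurable Q" by measurable
  moreover have "(\<integral>\<^sup>+s. ennreal ((norm (?z (s, \<omega>)))\<^sup>2) \<partial>lborel) < \<infinity>"
  proof -
    have "(\<integral>\<^sup>+s. ennreal ((norm (?z (s, \<omega>)))\<^sup>2) \<partial>lborel) = (\<integral>\<^sup>+s. ennreal ((norm z)\<^sup>2) * indicator {0<..T} s \<partial>lborel)"
      by (intro nn_integral_cong) (simp add: indicator_def)
    also have "\<dots> = ennreal ((norm z)\<^sup>2) * ennreal T" using T by (simp add: nn_integral_cmult_indicator)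
    finally show ?thesis by (simp add: ennreal_mult_less_top)
  qed
  ultimately have "integrable lborel (\<lambda>s. drift_integrand 0 ?z (s, \<omega>))" by (rule drift_pointwise(1)[OF _ \<omega> order_refl])
  moreover have "drift_integrand 0 ?z (s, \<omega>) = indicator {0<..T} s *\<^sub>R Ka s z" for s
    by (simp add: drift_integrand_def indicator_def)
  ultimately show ?thesis by simp
qed

lemma dual_integrable: "integrable lborel (\<lambda>u. indicator {a - t<..b - t} u *\<^sub>R (indicator {0<..T} u *\<^sub>R Ka u z))"
  by (intro integrable_mult_indicator Ka_integrable) simp

text \<open>The adjoint semigroup shifts the kernel, so the window (a - v, b - v] moves to (a - p, b
  - p]. The condition v <= a keeps the first window in the positive times, where
  \<open>Ka_add\<close> applies and nothing is cut off at 0.\<close>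

lemma dual_flow:
  assumes "0 \<le> p" "p \<le> v" "v \<le> a" "b \<le> T"
  shows "Sa (v - p) (dual a b z v) = dual a b z p"
proof -
  have "Sa (v - p) (dual a b z v) = (\<integral>u. Sa (v - p) (indicator {a - v<..b - v} u *\<^sub>R (indicator {0<..T} u *\<^sub>R Ka u z)) \<partial>lborel)"
    unfolding dual_def by (rule integral_bounded_linear[OF blinfun.bounded_linear_right dual_integrable, symmetric])
  also have "\<dots> = (\<integral>u. indicator {a - p<..b - p} ((v - p) + 1 * u) *\<^sub>R (indicator {0<..T} ((v - p) + 1 * u) *\<^sub>R Ka ((v - p) + 1 * u) z) \<partial>lborel)"
  proof (rule Bochner_Integration.integral_cong[OF refl])
    fix u :: real
    show "Sa (v - p) (indicator {a - v<..b - v} u *\<^sub>R (indicator {0<..T} u *\<^sub>R Ka u z))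
        = indicator {a - p<..b - p} ((v - p) + 1 * u) *\<^sub>R (indicator {0<..T} ((v - p) + 1 * u) *\<^sub>R Ka ((v - p) + 1 * u) z)"
    proof (cases "a - v < u \<and> u \<le> b - v")
      case True
      then have "Ka (u + (v - p)) z = Sa (v - p) (Ka u z)" using assms by (intro Ka_add) auto
      then show ?thesis using True assms by (simp add: indicator_def add.commute)
    next
      case False
      then show ?thesis using assms by (auto simp: indicator_def)
    qed
  qed
  also have "\<dots> = dual a b z p"
    unfolding dual_def
    using lborel_integral_real_affine[of 1 "\<lambda>u. indicator {a - p<..b - p} u *\<^sub>R (indicator {0<..T} u *\<^sub>R Ka u z)" "v - p"] by simp
  finally show ?thesis .
qed

text \<open>The indicator of the moving window converges except at its two end points, and the
  kernel is integrable over (0, T].\<close>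

lemma dual_continuous: "continuous_on {0..T} (dual a b z)"
  unfolding continuous_on_sequentially
proof (intro allI ballI impI, elim conjE)
  fix X :: "nat \<Rightarrow> real" and t assume X: "X \<longlonglongrightarrow> t"
  have "(\<lambda>n. dual a b z (X n)) \<longlonglongrightarrow> dual a b z t"
    unfolding dual_def
  proof (rule integral_dominated_convergence[where w = "\<lambda>u. norm (indicator {0<..T} u *\<^sub>R Ka u z)"])
    show "AE u in lborel. (\<lambda>n. indicator {a - X n<..b - X n} u *\<^sub>R (indicator {0<..T} u *\<^sub>R Ka u z))
        \<longlonglongrightarrow> indicator {a - t<..b - t} u *\<^sub>R (indicator {0<..T} u *\<^sub>R Ka u z)"
      using AE_lborel_singleton[of "a - t"] AE_lborel_singleton[of "b - t"]
    proof eventually_elim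
      case (elim u)
      have "\<forall>\<^sub>F n in sequentially. indicator {a - X n<..b - X n} u = (indicator {a - t<..b - t} u :: real)"
      proof -
        have "\<forall>\<^sub>F n in sequentially. (a - X n < u) = (a - t < u)"
        proof (cases "a - t < u")
          case True
          then have "\<forall>\<^sub>F n in sequentially. a - u < X n" by (intro order_tendstoD(1)[OF X]) simp
          then show ?thesis by (rule eventually_mono) (use True in auto)
        next
          case False
          then have "\<forall>\<^sub>F n in sequentially. X n < a - u" using elim by (intro order_tendstoD(2)[OF X]) simp
          then show ?thesis by (rule eventually_mono) (use False in auto)
        qed
        moreover have "\<forall>\<^sub>F n in sequentially. (u \<le> b - X n) = (u \<le> b - t)"
        proof (cases "u < b - t")
          case True
          then have "\<forall>\<^sub>F n in sequentially. X n < b - u" by (intro order_tendstoD(2)[OF X]) simp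
          then show ?thesis by (rule eventually_mono) (use True in auto)
        next
          case False
          then have "\<forall>\<^sub>F n in sequentially. b - u < X n" using elim by (intro order_tendstoD(1)[OF X]) simp
          then show ?thesis by (rule eventually_mono) (use False elim in auto)
        qed
        ultimately show ?thesis by eventually_elim (simp add: indicator_def)
      qed
      then show ?case by (intro tendsto_scaleR tendsto_const tendsto_eventually)
    qed
    show "integrable lborel (\<lambda>u. norm (indicator {0<..T} u *\<^sub>R Ka u z))" by (rule integrable_norm[OF Ka_integrable])
    show "AE u in lborel. norm (indicator {a - X n<..b - X n} u *\<^sub>R (indicator {0<..T} u *\<^sub>R Ka u z))
        \<le> norm (indicator {0<..T} u *\<^sub>R Ka u z)" for n
      by (intro AE_I2) (simp add: indicator_def)
  qed (rule borel_measurable_integrable[OF dual_integrable])+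
  then show "(dual a b z \<circ> X) \<longlonglongrightarrow> dual a b z t" by (simp add: o_def)
qed

abbreviation tensor :: "real \<Rightarrow> real \<Rightarrow> ('w \<Rightarrow> real) \<Rightarrow> ('k, 'h) hs \<Rightarrow> real \<times> 'w \<Rightarrow> ('k, 'h) hs" where
  "tensor a b X z \<equiv> \<lambda>p. indicator {a<..b} (fst p) *\<^sub>R (X (snd p) *\<^sub>R z)"

lemma drift_tensor:
  assumes "0 \<le> t" "b \<le> T"
  shows "drift t (tensor a b X z) \<omega> = X \<omega> *\<^sub>R dual a b z t"
proof -
  have "drift t (tensor a b X z) \<omega> = (\<integral>s. X \<omega> *\<^sub>R (indicator {t<..T} s *\<^sub>R (indicator {a<..b} s *\<^sub>R Ka (s - t) z)) \<partial>lborel)"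
    unfolding drift_def
    by (intro Bochner_Integration.integral_cong) (simp_all add: drift_integrand_def blinfun.scaleR_right mult_ac)
  also have "\<dots> = X \<omega> *\<^sub>R (\<integral>s. indicator {t<..T} s *\<^sub>R (indicator {a<..b} s *\<^sub>R Ka (s - t) z) \<partial>lborel)"
    by (simp only: integral_scaleR_right)
  also have "(\<integral>s. indicator {t<..T} s *\<^sub>R (indicator {a<..b} s *\<^sub>R Ka (s - t) z) \<partial>lborel)
      = (\<integral>u. indicator {t<..T} (t + 1 * u) *\<^sub>R (indicator {a<..b} (t + 1 * u) *\<^sub>R Ka (t + 1 * u - t) z) \<partial>lborel)"
    using lborel_integral_real_affine[of 1 "\<lambda>s. indicator {t<..T} s *\<^sub>R (indicator {a<..b} s *\<^sub>R Ka (s - t) z)" t] by simp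
  also have "\<dots> = dual a b z t"
    unfolding dual_def by (intro Bochner_Integration.integral_cong refl) (use assms in \<open>auto simp: indicator_def\<close>)
  finally show ?thesis .
qed

lemma tensor_L2:
  assumes X: "L2 M X" and ab: "a \<le> b"
  shows "L2 Q (tensor a b X z)" "n2 Q (tensor a b X z) \<le> (sqrt (b - a) * norm z) * n2 M X"
proof -
  have "(\<lambda>p :: real \<times> 'w. X (snd p)) \<in> borel_measurable Q" by (rule measurable_compose[OF measurable_snd L2_measurable[OF X]])
  then have m: "tensor a b X z \<in> borel_measurable Q"
    by (intro borel_measurable_scaleR borel_measurable_const measurable_compose[OF measurable_fst borel_measurable_indicator]) auto
  have "(\<integral>\<^sup>+s. ennreal ((norm (tensor a b X z (s, \<omega>)))\<^sup>2) \<partial>lborel) \<le> ennreal ((sqrt (b - a) * norm z)\<^sup>2 * (norm (X \<omega>))\<^sup>2)" for \<omega>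
  proof -
    have "(\<integral>\<^sup>+s. ennreal ((norm (tensor a b X z (s, \<omega>)))\<^sup>2) \<partial>lborel) = (\<integral>\<^sup>+s. ennreal ((norm z * norm (X \<omega>))\<^sup>2) * indicator {a<..b} s \<partial>lborel)"
      by (intro nn_integral_cong) (simp add: indicator_def mult.commute)
    also have "\<dots> = ennreal ((norm z * norm (X \<omega>))\<^sup>2) * ennreal (b - a)"
      using ab by (simp add: nn_integral_cmult_indicator)
    also have "\<dots> = ennreal ((sqrt (b - a) * norm z)\<^sup>2 * (norm (X \<omega>))\<^sup>2)"
      using ab by (simp add: ennreal_mult[symmetric] power_mult_distrib mult_ac)
    finally show ?thesis by simp
  qed
  from nn_integral_section_le[OF m X order_refl _ this] ab
  show "L2 Q (tensor a b X z)" "n2 Q (tensor a b X z) \<le> (sqrt (b - a) * norm z) * n2 M X" by simp_all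
qed

text \<open>Reduces a linear and closed property of representable variables to constants and to
  single increments with an event of their past, the cases in which the equation is solved
  explicitly.\<close>

lemma rep_induct [consumes 2, case_names const inc lin lim]:
  fixes X :: "'w \<Rightarrow> real"
  assumes X: "rep a X" and a: "0 \<le> a"
    and const: "\<And>c. P (\<lambda>\<omega>. c)"
    and inc: "\<And>s r G \<phi>. 0 \<le> s \<Longrightarrow> s \<le> r \<Longrightarrow> r \<le> a \<Longrightarrow> G \<in> sets (F s) \<Longrightarrow> P (\<lambda>\<omega>. indicator G \<omega> * D s r \<phi> \<omega>)"
    and lin: "\<And>Y Z c. P Y \<Longrightarrow> P Z \<Longrightarrow> P (\<lambda>\<omega>. Y \<omega> + c * Z \<omega>)"
    and lim: "\<And>f g. (\<And>n. P (f n)) \<Longrightarrow> tends2 M f g \<Longrightarrow> P g"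
  shows "P X"
proof -
  have el: "P (\<lambda>\<omega>. c + EI xs \<omega>)" if "elementary_on F 0 a xs" for c xs
    using that
  proof (induction xs)
    case (Cons x xs)
    obtain s r G \<phi> h where x: "x = (s, r, G, \<phi>, h)" by (cases x)
    have on: "elementary_on F 0 a [x]" "elementary_on F 0 a xs" using iffD1[OF elementary_on_Cons Cons.prems] by auto
    have "P (\<lambda>\<omega>. indicator G \<omega> * D s r \<phi> \<omega>)" using on(1) by (intro inc) (auto simp: x elementary_on_def)
    note P = lin[OF Cons.IH[OF on(2)] this, of h]
    have "c + EI (x # xs) \<omega> = c + EI xs \<omega> + h * (indicator G \<omega> * D s r \<phi> \<omega>)" for \<omega>
      by (simp add: x elementary_integral_def)
    with P show ?case by (simp only:)
  qed (simp add: const)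
  have "\<forall>n. \<exists>c xs. elementary_on F 0 a xs \<and> n2 M (\<lambda>\<omega>. X \<omega> - (c + EI xs \<omega>)) < 1 / Suc n"
    using X unfolding rep_def by (metis zero_less_divide_1_iff of_nat_0_less_iff zero_less_Suc)
  then obtain c xs where xs: "\<And>n. elementary_on F 0 a (xs n)" "\<And>n. n2 M (\<lambda>\<omega>. X \<omega> - (c n + EI (xs n) \<omega>)) < 1 / Suc n"
    by metis
  have "tends2 M (\<lambda>n \<omega>. c n + EI (xs n) \<omega>) X"
  proof (rule tends2I)
    show "L2 M (\<lambda>\<omega>. c n + EI (xs n) \<omega>)" for n using E_L2(2)[OF xs(1)] by (intro L2_add) auto
    show "n2 M (\<lambda>\<omega>. c n + EI (xs n) \<omega> - X \<omega>) \<le> 1 / Suc n" for n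
      using xs(2)[of n] by (subst n2_minus_commute) simp
    show "(\<lambda>n. 1 / real (Suc n)) \<longlonglongrightarrow> 0" using LIMSEQ_inverse_real_of_nat by (simp add: inverse_eq_divide)
  qed (use rep_L2[OF X] in auto)
  then show ?thesis by (rule lim[rotated]) (rule el[OF xs(1)])
qed

text \<open>The random factor is known at time a, before the drift begins to act. All increments of
  its representation therefore end by time a, which is the range in which \<open>dual_flow\<close>
  gives the flow property that \<open>solvable_increment\<close> asks for.\<close>

lemma solvable_tensor:
  assumes X: "rep a X" and ab: "0 \<le> a" "a \<le> b" "b \<le> T"
  shows "solvable (\<lambda>\<omega>. 0) (tensor a b X z)"
  using X ab(1)
proof (induction rule: rep_induct)
  case (const c)
  show ?case
  proof (rule solvable_deterministic[OF L2_zero tensor_L2(1)[OF L2_const ab(2)]])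
    fix t assume "t \<in> {0..T}"
    then show "AE \<omega> in M. Sa (T - t) 0 + drift t (tensor a b (\<lambda>\<omega>. c) z) \<omega> = c *\<^sub>R dual a b z t"
      using drift_tensor[of t b a "\<lambda>\<omega>. c" z] ab by simp
  qed
next
  case (inc s r G \<phi>)
  have "L2 M (\<lambda>\<omega>. indicator G \<omega> * D s r \<phi> \<omega>)"
    using EI_single_L2(1)[of s r "(s, r, G, \<phi>, 1 :: real)"] inc by (simp add: EI_single elementary_on_def)
  then have L: "L2 Q (tensor a b (\<lambda>\<omega>. indicator G \<omega> * D s r \<phi> \<omega>) z)" by (rule tensor_L2(1)[OF _ ab(2)])
  have r: "r \<le> T" using inc(3) ab by simp
  show ?case
  proof (rule solvable_increment[OF inc(1,2) r inc(4) dual_continuous[of a b z] _ L2_zero L])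
    show "Sa (v - u) (dual a b z v) = dual a b z u" if "0 \<le> u" "u \<le> v" "v \<le> r" for u v
      using inc(3) ab that by (intro dual_flow) auto
    fix t assume "t \<in> {0..T}"
    then have "drift t (tensor a b (\<lambda>\<omega>. indicator G \<omega> * D s r \<phi> \<omega>) z) \<omega> = (indicator G \<omega> * D s r \<phi> \<omega>) *\<^sub>R dual a b z t" for \<omega>
      using ab by (intro drift_tensor) auto
    then show "AE \<omega> in M. Sa (T - t) 0 + drift t (tensor a b (\<lambda>\<omega>. indicator G \<omega> * D s r \<phi> \<omega>) z) \<omega>
        = (indicator G \<omega> * D s r \<phi> \<omega>) *\<^sub>R dual a b z t"
      by (intro AE_I2) (simp only: blinfun.zero_right add_0_left)
  qed
next
  case (lin Y Z c)
  from solvable_lin[OF lin, of c] show ?case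
    by (simp add: scaleR_add_left scaleR_add_right) (simp add: mult_ac)
next
  case (lim f g)
  have "tends2 Q (\<lambda>n. tensor a b (f n) z) (tensor a b g z)"
  proof (rule tends2I)
    show "n2 Q (\<lambda>p. tensor a b (f n) z p - tensor a b g z p) \<le> (sqrt (b - a) * norm z) * n2 M (\<lambda>\<omega>. f n \<omega> - g \<omega>)" for n
      using tensor_L2(2)[OF L2_diff[OF tends2_L2(1)[OF lim(2)] tends2_L2(2)[OF lim(2)]] ab(2), where z = z]
      by (simp add: scaleR_diff_left scaleR_diff_right)
    show "(\<lambda>n. (sqrt (b - a) * norm z) * n2 M (\<lambda>\<omega>. f n \<omega> - g \<omega>)) \<longlonglongrightarrow> 0"
      using lim(2) by (intro tendsto_mult_right_zero) (simp add: tends2_def)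
  qed (use tensor_L2(1)[OF tends2_L2(1)[OF lim(2)] ab(2)] tensor_L2(1)[OF tends2_L2(2)[OF lim(2)] ab(2)] in auto)
  then show ?case by (rule solvable_closed[OF lim(1) tends2_const[OF L2_zero]])
qed

text \<open>Here the coefficient of the increment is Sa (T - t) h, and its flow property is the
  semigroup law.\<close>

lemma solvable_terminal_scalar:
  assumes X: "rep T X"
  shows "solvable (\<lambda>\<omega>. X \<omega> *\<^sub>R h) (\<lambda>p. 0)"
  using X less_imp_le[OF T]
proof (induction rule: rep_induct)
  case (const c)
  show ?case
    by (rule solvable_deterministic[where g = "\<lambda>t. Sa (T - t) (c *\<^sub>R h)"]) (simp_all add: drift_def drift_integrand_def)
next
  case (inc s r G \<phi>)
  have L: "L2 M (\<lambda>\<omega>. (indicator G \<omega> * D s r \<phi> \<omega>) *\<^sub>R h)"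
    using EI_single_L2(1)[of s r "(s, r, G, \<phi>, h)"] inc by (simp add: EI_single elementary_on_def)
  have c: "continuous_on {0..T} (\<lambda>t. Sa (T - t) h)"
    by (rule continuous_on_compose2[OF Sa_continuous]) (auto intro!: continuous_intros)
  have f: "Sa (v - u) (Sa (T - v) h) = Sa (T - u) h" if "0 \<le> u" "u \<le> v" "v \<le> r" for u v
    using Sa_add[of "T - v" "v - u" h] that inc(3) by simp
  show ?case
    by (rule solvable_increment[OF inc c f L, where \<phi> = \<phi>]) (simp_all add: drift_def drift_integrand_def blinfun.scaleR_right)
next
  case (lin Y Z c)
  from solvable_lin[OF lin, of c] show ?case by (simp add: scaleR_add_left)
next
  case (lim f g)
  have "tends2 M (\<lambda>n \<omega>. f n \<omega> *\<^sub>R h) (\<lambda>\<omega>. g \<omega> *\<^sub>R h)"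
    by (rule tends2_linear[OF lim(2) bounded_linear_scaleR_left])
  then show ?case by (rule solvable_closed[OF lim(1) _ tends2_const[OF L2_zero]])
qed

text \<open>An elementary term on (s, r] is a tensor whose random factor, the indicator of an event
  of F s, is representable at time s by the density theorem.\<close>

lemma solvable_approx:
  assumes "approx 0 T \<zeta>"
  shows "solvable (\<lambda>\<omega>. 0) \<zeta>"
proof -
  have el: "solvable (\<lambda>\<omega>. 0) (EP xs)" if "elementary_on F 0 T xs" for xs
    using that
  proof (induction xs)
    case Nil
    show ?case by (rule solvable_deterministic[where g = "\<lambda>t. 0"]) (simp_all add: drift_def drift_integrand_def)
  next
    case (Cons x xs)
    obtain s r G \<phi> h where x: "x = (s, r, G, \<phi>, h)" by (cases x)
    have on: "elementary_on F 0 T [x]" "elementary_on F 0 T xs" using iffD1[OF elementary_on_Cons Cons.prems] by auto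
    have "solvable (\<lambda>\<omega>. 0) (tensor s r (\<lambda>\<omega>. indicator G \<omega> *\<^sub>R 1) (rank_one h \<phi>))"
      using on(1) by (intro solvable_tensor rep_indicator) (auto simp: x elementary_on_def)
    from solvable_lin[OF Cons.IH[OF on(2)] this, of 1]
    show ?case using elementary_process_append[of "[x]" xs] by (simp add: x elementary_process_def add.commute)
  qed
  obtain xs where xs: "\<And>n. elementary_on F 0 T (xs n)" "tends2 Q (\<lambda>n. EP (xs n)) \<zeta>" using assms by (auto simp: approx_def)
  show ?thesis by (rule solvable_closed[OF el[OF xs(1)] tends2_const[OF L2_zero] xs(2)])
qed

lemma solvable_terminal:
  assumes "L2 M \<xi>" "\<xi> \<in> borel_measurable (F T)"
  shows "solvable \<xi> (\<lambda>p. 0)"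
  using assms less_imp_le[OF T]
proof (induction rule: L2_induct[consumes 3, case_names ind add lim cong])
  case (ind G h)
  have "rep T (\<lambda>\<omega>. indicator G \<omega> *\<^sub>R (1::real))" using ind T by (intro rep_indicator) auto
  from solvable_terminal_scalar[OF this, of h] show ?case by simp
next
  case (add f g)
  from solvable_lin[OF add, of 1] show ?case by simp
next
  case (lim f g)
  show ?case by (rule solvable_closed[OF lim(1,2) tends2_const[OF L2_zero]])
next
  case (cong f g)
  have "L2 M f" using cong(1) drift_solutionD(1) unfolding solvable_def by blast
  moreover have "g \<in> borel_measurable M" using L2_measurable[OF \<open>L2 M f\<close>] cong(2) by (simp cong: measurable_cong)
  ultimately have "L2 M g" using cong(2) by (intro L2_cong_AE(1)[of M f g] AE_I2) auto
  then show ?case using cong by (intro solvable_cong[OF cong(1)] AE_I2) auto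
qed

lemma solvable:
  assumes "L2 M \<xi>" "\<xi> \<in> borel_measurable (F T)" "approx 0 T \<zeta>"
  shows "solvable \<xi> \<zeta>"
  using solvable_lin[OF solvable_terminal[OF assms(1,2)] solvable_approx[OF assms(3)], of 1] by simp

lemma cut_cut [simp]: "cut a b (cut a b Z) = cut a b (Z :: real \<times> 'w \<Rightarrow> 'c::real_vector)"
  by (simp add: cut_def fun_eq_iff indicator_def)

text \<open>Picard iteration in the weighted norm, where the a priori estimate for differences with
  equal terminal value is a contraction with constant q.\<close>

theorem drift_solution_exists:
  assumes \<xi>: "L2 M \<xi>" "\<xi> \<in> borel_measurable (F T)"
  shows "\<exists>Y Z. drift_solution \<xi> Z Y Z \<and> approx 0 T Z \<and> cut 0 T Z = Z"
proof -
  have ex: "\<exists>Z. (approx 0 T Z \<and> cut 0 T Z = Z) \<and> (\<exists>Y. drift_solution \<xi> z Y Z)" if z: "approx 0 T z" for z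
  proof -
    obtain Y Z where S: "drift_solution \<xi> z Y Z" using solvable[OF \<xi> z] by (auto simp: solvable_def)
    show ?thesis using drift_solution_cut[OF S] drift_solution_approx[OF S] by (intro exI[of _ "cut 0 T Z"]) auto
  qed
  \<comment> \<open>\<open>drift_solution\<close> is a relation, so the iterates come from dependent
    choice. Two properties are carried along: approximability, in order to solve again, and
    vanishing off (0, T], so that the weighted norm controls the whole norm.\<close>
  have "\<exists>f :: nat \<Rightarrow> real \<times> 'w \<Rightarrow> ('k, 'h) hs. \<forall>n. (approx 0 T (f n) \<and> cut 0 T (f n) = f n \<and> (n = 0 \<longrightarrow> f n = (\<lambda>p. 0))) \<and> (\<exists>Y. drift_solution \<xi> (f n) Y (f (Suc n)))"
  proof (rule dependent_nat_choice)
    have "approx 0 T (EP ([] :: ('w, 'k, 'h) elementary))" by (rule ito_approx[OF ito_elementary]) simp_all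
    then show "\<exists>z :: real \<times> 'w \<Rightarrow> ('k, 'h) hs. approx 0 T z \<and> cut 0 T z = z \<and> (0 = 0 \<longrightarrow> z = (\<lambda>p. 0))"
      by (intro exI[of _ "\<lambda>p. 0"]) (simp add: cut_def)
  qed (use ex in blast)
  then obtain f where f: "\<And>n. approx 0 T (f n)" "\<And>n. cut 0 T (f n) = f n" "f 0 = (\<lambda>p. 0)"
    and "\<And>n. \<exists>Y. drift_solution \<xi> (f n) Y (f (Suc n))" by blast
  then have "\<forall>n. \<exists>Y. drift_solution \<xi> (f n) Y (f (Suc n))" by blast
  from choice[OF this] obtain Y where Y: "\<And>n. drift_solution \<xi> (f n) (Y n) (f (Suc n))" by blast
  define w where "w = (\<lambda>z :: real \<times> 'w \<Rightarrow> ('k, 'h) hs. n2 Q (weighted lam z))"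
  \<comment> \<open>The fixed point of x = exp (lam T) |\<xi>| + q x, hence a bound for all iterates
    that start at 0.\<close>
  define B where "B = exp (lam * T) * n2 M \<xi> / (1 - q)"
  have B: "B \<ge> 0" "exp (lam * T) * n2 M \<xi> + q * B = B" using q by (auto simp: B_def field_simps)
  have fL: "L2 Q (f n)" for n by (rule approx_L2[OF f(1)])
  have bound: "w (f k) \<le> B" for k
  proof (induction k)
    case 0
    show ?case using B(1) by (simp add: w_def f(3) cut_def)
  next
    case (Suc k)
    have "w (f (Suc k)) \<le> exp (lam * T) * n2 M \<xi> + q * w (f k)" unfolding w_def by (rule apriori[OF Y])
    also have "\<dots> \<le> exp (lam * T) * n2 M \<xi> + q * B" using Suc q by (intro add_left_mono mult_left_mono) auto
    finally show ?case using B(2) by simp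
  qed
  have geo: "w (\<lambda>p. f (n + k) p - f n p) \<le> q ^ n * B" for n k
  proof (induction n)
    case 0
    show ?case using bound[of k] by (simp add: f(3))
  next
    case (Suc n)
    have "w (\<lambda>p. f (Suc (n + k)) p - f (Suc n) p) \<le> q * w (\<lambda>p. f (n + k) p - f n p)"
      unfolding w_def using apriori[OF drift_solution_diff[OF Y[of "n + k"] Y[of n]]] by simp
    also have "\<dots> \<le> q * (q ^ n * B)" using Suc q by (intro mult_left_mono) auto
    finally show ?case by simp
  qed
  have cauchy: "n2 Q (\<lambda>p. f m p - f n p) \<le> q ^ n * B" if "n \<le> m" for m n
  proof -
    have "n2 Q (\<lambda>p. f m p - f n p) = n2 Q (cut 0 T (\<lambda>p. f m p - f n p))" by (simp add: cut_diff f(2))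
    also have "\<dots> \<le> w (\<lambda>p. f m p - f n p)" unfolding w_def using lam by (intro weighted_L2(3) L2_diff fL) simp
    also have "\<dots> \<le> q ^ n * B" using geo[of n "m - n"] that by simp
    finally show ?thesis .
  qed
  have "\<exists>k. \<forall>m\<ge>k. \<forall>n\<ge>k. n2 Q (\<lambda>p. f m p - f n p) < e" if e: "e > 0" for e
  proof -
    have "(\<lambda>n. q ^ n * B) \<longlonglongrightarrow> 0 * B" using q by (intro tendsto_mult tendsto_const LIMSEQ_power_zero) simp
    then have "\<forall>\<^sub>F n in sequentially. q ^ n * B < e" using e by (intro order_tendstoD(2)) auto
    then obtain k where k: "\<And>n. n \<ge> k \<Longrightarrow> q ^ n * B < e" by (auto simp: eventually_sequentially)
    have "n2 Q (\<lambda>p. f m p - f n p) < e" if "m \<ge> k" "n \<ge> k" for m n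
    proof (cases "n \<le> m")
      case True
      then show ?thesis using cauchy[OF True] k[OF that(2)] by simp
    next
      case False
      then show ?thesis using cauchy[of m n] k[OF that(1)] n2_minus_commute[of Q "f m" "f n"] by simp
    qed
    then show ?thesis by blast
  qed
  then obtain Z where Z: "tends2 Q f Z" using L2_complete[of Q f, OF fL] by metis
  have apZ: "approx 0 T Z" by (rule approx_closed[OF f(1) Z order_refl])
  \<comment> \<open>The equation is solved once more with the limit Z as frozen integrand. The
    iterates converge to the new \<open>Z'\<close> as well, so the two agree almost
    everywhere.\<close>
  obtain Y' Z' where S: "drift_solution \<xi> Z Y' Z'" and Z': "cut 0 T Z' = Z'" "approx 0 T Z'" using ex[OF apZ] by blast
  have "tends2 Q (\<lambda>n. f (Suc n)) Z'"
  proof (rule tends2I)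
    show "n2 Q (\<lambda>p. f (Suc n) p - Z' p) \<le> exp (lam * T) * n2 Q (\<lambda>p. f n p - Z p)" for n
      using apriori_diff[OF Y[of n] S] by (simp add: cut_diff f(2) Z'(1))
    show "(\<lambda>n. exp (lam * T) * n2 Q (\<lambda>p. f n p - Z p)) \<longlonglongrightarrow> 0"
      using Z by (intro tendsto_mult_right_zero) (simp add: tends2_def)
  qed (use fL approx_L2[OF Z'(2)] in auto)
  moreover have "tends2 Q (\<lambda>n. f (Suc n)) Z" using Z by (simp add: tends2_def LIMSEQ_Suc[of "\<lambda>n. n2 Q (\<lambda>p. f n p - Z p)"])
  ultimately have "AE p in Q. Z p = Z' p" by (rule tends2_unique[rotated])
  from drift_solution_cong[OF S _ \<xi>(1) this approx_L2[OF Z'(2)]] Z' show ?thesis by auto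
qed

section \<open>Mean square continuity of solutions in time\<close>

text \<open>For an elementary integrand continuity reduces to \<open>dual_continuous\<close>. The
  general case follows by approximation, since the constant \<open>kappa\<close> in the drift bound
  is the same for all times.\<close>

lemma drift_continuous_approx:
  assumes \<zeta>: "approx 0 T \<zeta>" and X: "\<And>n. X n \<in> {0..T}" "t \<in> {0..T}" "X \<longlonglongrightarrow> t"
  shows "tends2 M (\<lambda>n. drift (X n) \<zeta>) (drift t \<zeta>)"
proof -
  have el: "tends2 M (\<lambda>n. drift (X n) (EP xs)) (drift t (EP xs))" if "elementary_on F 0 T xs" for xs
    using that
  proof (induction xs)
    case Nil
    show ?case using tends2_const[OF L2_zero] by (simp add: drift_def[abs_def] drift_integrand_def)
  next
    case (Cons x xs)
    obtain s r G \<phi> h where x: "x = (s, r, G, \<phi>, h)" by (cases x)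
    have on: "elementary_on F 0 T [x]" "elementary_on F 0 T xs" using iffD1[OF elementary_on_Cons Cons.prems] by auto
    then have "0 \<le> s" "s \<le> r" "r \<le> T" "G \<in> sets (F s)" by (auto simp: x elementary_on_def)
    then have GM: "G \<in> sets M" using F_subset by blast
    have e: "EP [x] = tensor s r (indicator G) (rank_one h \<phi>)" by (simp add: x elementary_process_def)
    let ?v = "dual s r (rank_one h \<phi>)"
    have d: "drift u (EP [x]) = (\<lambda>\<omega>. indicator G \<omega> *\<^sub>R ?v u)" if "u \<in> {0..T}" for u
      unfolding e using drift_tensor[of u r s] that \<open>r \<le> T\<close> by auto
    have L1: "L2 M (\<lambda>\<omega>. indicator G \<omega> *\<^sub>R v)" for v :: 'h using GM by (intro L2_indicator) (auto simp: emeasure_eq_measure)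
    have 1: "tends2 M (\<lambda>n. drift (X n) (EP [x])) (drift t (EP [x]))"
      unfolding d[OF X(1)] d[OF X(2)]
    proof (rule tends2I[OF L1 L1])
      show "n2 M (\<lambda>\<omega>. indicator G \<omega> *\<^sub>R ?v (X n) - indicator G \<omega> *\<^sub>R ?v t) \<le> norm (?v (X n) - ?v t) * n2 M (\<lambda>\<omega>. 1 :: real)" for n
        unfolding scaleR_diff_right[symmetric]
        by (rule L2_bound(2)[OF L2_measurable[OF L1] L2_const]) (auto simp: indicator_def)
      have "(\<lambda>n. ?v (X n)) \<longlonglongrightarrow> ?v t"
        using dual_continuous[of s r "rank_one h \<phi>"] X unfolding continuous_on_sequentially by (auto simp: o_def)
      then show "(\<lambda>n. norm (?v (X n) - ?v t) * n2 M (\<lambda>\<omega>. 1 :: real)) \<longlonglongrightarrow> 0"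
        by (intro tendsto_mult_left_zero tendsto_norm_zero) (rule LIM_zero)
    qed
    have EL: "L2 Q (EP [x])" "L2 Q (EP xs)" using E_L2(1)[OF on(1)] E_L2(1)[OF on(2)] by auto
    have ap: "EP (x # xs) = (\<lambda>p. EP [x] p + EP xs p)" using elementary_process_append[of "[x]" xs] by simp
    have EL': "L2 Q (EP (x # xs))" unfolding ap by (intro L2_add EL)
    have ae: "AE \<omega> in M. drift u (EP [x]) \<omega> + drift u (EP xs) \<omega> = drift u (EP (x # xs)) \<omega>" if "u \<in> {0..T}" for u
    proof -
      have "AE \<omega> in M. drift u (EP (x # xs)) \<omega> = drift u (EP [x]) \<omega> + drift u (EP xs) \<omega>"
        unfolding ap by (rule drift_add[OF EL]) (use that in simp)
      then show ?thesis by eventually_elim simp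
    qed
    show ?case
      by (rule tends2_cong_AE[OF tends2_add[OF 1 Cons.IH[OF on(2)]] ae[OF X(1)] ae[OF X(2)]])
        (use X drift_L2(1)[OF EL'] in auto)
  qed
  obtain xs where xs: "\<And>n. elementary_on F 0 T (xs n)" "tends2 Q (\<lambda>n. EP (xs n)) \<zeta>" using \<zeta> by (auto simp: approx_def)
  note L = approx_L2[OF \<zeta>]
  have dL: "L2 M (drift (X n) \<zeta>)" "L2 M (drift t \<zeta>)" for n using drift_L2(1)[OF L] X by auto
  have "(\<lambda>n. n2 M (\<lambda>\<omega>. drift (X n) \<zeta> \<omega> - drift t \<zeta> \<omega>)) \<longlonglongrightarrow> 0"
  proof (rule LIMSEQ_I)
    fix e :: real assume e: "e > 0"
    \<comment> \<open>The summand 1 covers the case kappa = 0.\<close>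
    define d where "d = e / (4 * (kappa + 1))"
    have d: "d > 0" "kappa * d \<le> e / 4"
    proof -
      show "d > 0" using e kappa_nonneg by (simp add: d_def add_nonneg_pos)
      have "kappa * d \<le> (kappa + 1) * d" using \<open>d > 0\<close> by simp
      also have "kappa + 1 \<noteq> 0" using kappa_nonneg by linarith
      then have "(kappa + 1) * d = e / 4" by (simp add: d_def divide_simps)
      finally show "kappa * d \<le> e / 4" .
    qed
    have "(\<lambda>n. n2 Q (\<lambda>p. EP (xs n) p - \<zeta> p)) \<longlonglongrightarrow> 0" using xs(2) by (simp add: tends2_def)
    from LIMSEQ_D[OF this d(1)] obtain m where m: "n2 Q (\<lambda>p. EP (xs m) p - \<zeta> p) < d" by auto
    have EL: "L2 Q (EP (xs m))" using E_L2(1)[OF xs(1)] by simp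
    have close: "n2 M (\<lambda>\<omega>. drift u (EP (xs m)) \<omega> - drift u \<zeta> \<omega>) \<le> e / 4" if "u \<in> {0..T}" for u
    proof -
      have "n2 M (\<lambda>\<omega>. drift u (EP (xs m)) \<omega> - drift u \<zeta> \<omega>) \<le> kappa * n2 Q (\<lambda>p. EP (xs m) p - \<zeta> p)"
        by (rule n2_drift_diff[OF EL L]) (use that in simp)
      also have "\<dots> \<le> kappa * d" using m by (intro mult_left_mono) auto
      finally show ?thesis using d(2) by simp
    qed
    have "(\<lambda>n. n2 M (\<lambda>\<omega>. drift (X n) (EP (xs m)) \<omega> - drift t (EP (xs m)) \<omega>)) \<longlonglongrightarrow> 0"
      using el[OF xs(1)] by (simp add: tends2_def)
    from LIMSEQ_D[OF this, of "e / 4"] e obtain N where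
      N: "\<And>n. n \<ge> N \<Longrightarrow> n2 M (\<lambda>\<omega>. drift (X n) (EP (xs m)) \<omega> - drift t (EP (xs m)) \<omega>) < e / 4" by auto
    have "n2 M (\<lambda>\<omega>. drift (X n) \<zeta> \<omega> - drift t \<zeta> \<omega>) < e" if n: "n \<ge> N" for n
    proof -
      have eL: "L2 M (drift (X n) (EP (xs m)))" "L2 M (drift t (EP (xs m)))" using drift_L2(1)[OF EL] X by auto
      have "n2 M (\<lambda>\<omega>. drift (X n) \<zeta> \<omega> - drift t \<zeta> \<omega>)
          \<le> n2 M (\<lambda>\<omega>. drift (X n) \<zeta> \<omega> - drift (X n) (EP (xs m)) \<omega>) + n2 M (\<lambda>\<omega>. drift (X n) (EP (xs m)) \<omega> - drift t \<zeta> \<omega>)"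
        by (rule n2_triangle3[OF dL(1) eL(1) dL(2)])
      also have "n2 M (\<lambda>\<omega>. drift (X n) (EP (xs m)) \<omega> - drift t \<zeta> \<omega>)
          \<le> n2 M (\<lambda>\<omega>. drift (X n) (EP (xs m)) \<omega> - drift t (EP (xs m)) \<omega>) + n2 M (\<lambda>\<omega>. drift t (EP (xs m)) \<omega> - drift t \<zeta> \<omega>)"
        by (rule n2_triangle3[OF eL dL(2)])
      also have "n2 M (\<lambda>\<omega>. drift (X n) \<zeta> \<omega> - drift (X n) (EP (xs m)) \<omega>) \<le> e / 4"
        using close[OF X(1)[of n]] by (subst n2_minus_commute)
      finally show ?thesis using N[OF n] close[OF X(2)] e by simp
    qed
    then show "\<exists>N. \<forall>n\<ge>N. norm (n2 M (\<lambda>\<omega>. drift (X n) \<zeta> \<omega> - drift t \<zeta> \<omega>) - 0) < e" by auto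
  qed
  then show ?thesis using dL by (simp add: tends2_def)
qed

text \<open>The integrand converges pointwise except where s = t, the jump of the indicator, and
  such points form a null set.\<close>

lemma SZ_continuous:
  assumes Z: "L2 Q Z" and X: "X \<longlonglongrightarrow> t"
  shows "tends2 Q (\<lambda>n. SZ (X n) Z) (SZ t Z)"
proof (rule tends2_dominated[OF _ _ Z, where c = 1])
  show "AE p in Q. (\<lambda>n. SZ (X n) Z p) \<longlonglongrightarrow> SZ t Z p"
    using AE_fst_neq[of t]
  proof eventually_elim
    case (elim p)
    show ?case
    proof (cases "t < fst p")
      case True
      have ev: "\<forall>\<^sub>F n in sequentially. X n < fst p" by (rule order_tendstoD(2)[OF X True])
      have "((\<lambda>n. hs_compose (Sa (fst p - X n)) (Z p)) \<longlongrightarrow> hs_compose (Sa (fst p - t)) (Z p)) sequentially"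
        by (rule continuous_on_tendsto_compose[OF hs_Sa_continuous])
          (use True ev in \<open>auto intro!: tendsto_intros X elim: eventually_mono\<close>)
      then have "(\<lambda>n. indicator {..T} (fst p) *\<^sub>R hs_compose (Sa (fst p - X n)) (Z p)) \<longlonglongrightarrow> indicator {..T} (fst p) *\<^sub>R hs_compose (Sa (fst p - t)) (Z p)"
        by (intro tendsto_intros)
      moreover have "\<forall>\<^sub>F n in sequentially. SZ (X n) Z p = indicator {..T} (fst p) *\<^sub>R hs_compose (Sa (fst p - X n)) (Z p)"
        using ev by eventually_elim (simp add: SZ_def indicator_def)
      moreover have "indicator {..T} (fst p) *\<^sub>R hs_compose (Sa (fst p - t)) (Z p) = SZ t Z p"
        using True by (simp add: SZ_def indicator_def)
      ultimately show ?thesis by (simp only: tendsto_cong)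
    next
      case False
      then have "fst p < t" using elim by simp
      from order_tendstoD(1)[OF X this] have "\<forall>\<^sub>F n in sequentially. SZ (X n) Z p = SZ t Z p"
        by eventually_elim (use False in \<open>simp add: SZ_def indicator_def\<close>)
      then show ?thesis by (rule tendsto_eventually)
    qed
  qed
qed (use SZ_measurable[OF L2_measurable[OF Z]] norm_SZ_le in auto)

lemma drift_solution_continuous:
  assumes S: "drift_solution \<xi> \<zeta> Y Z" and \<zeta>: "approx 0 T \<zeta>" and X: "\<And>n. X n \<in> {0..T}" "t \<in> {0..T}" "X \<longlonglongrightarrow> t"
  shows "tends2 M (\<lambda>n. Y (X n)) (Y t)"
proof -
  have "\<forall>u\<in>{0..T}. \<exists>I. ito u T (SZ u Z) I \<and> (AE \<omega> in M. Y u \<omega> = Sa (T - u) (\<xi> \<omega>) + drift u \<zeta> \<omega> - I \<omega>)"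
    using drift_solutionD(6)[OF S] by blast
  from bchoice[OF this] obtain I where I0: "\<forall>u\<in>{0..T}. ito u T (SZ u Z) (I u) \<and> (AE \<omega> in M. Y u \<omega> = Sa (T - u) (\<xi> \<omega>) + drift u \<zeta> \<omega> - I u \<omega>)" ..
  have I: "ito 0 T (SZ u Z) (I u)" "AE \<omega> in M. Sa (T - u) (\<xi> \<omega>) + drift u \<zeta> \<omega> - I u \<omega> = Y u \<omega>" if "u \<in> {0..T}" for u
    using bspec[OF I0 that] ito_mono[of u T "SZ u Z" "I u" 0 T] that by auto
  have 1: "tends2 M (\<lambda>n \<omega>. Sa (T - X n) (\<xi> \<omega>)) (\<lambda>\<omega>. Sa (T - t) (\<xi> \<omega>))"
  proof (rule tends2_dominated[OF _ _ drift_solutionD(1)[OF S], where c = 1])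
    show "AE \<omega> in M. (\<lambda>n. Sa (T - X n) (\<xi> \<omega>)) \<longlonglongrightarrow> Sa (T - t) (\<xi> \<omega>)"
    proof (rule AE_I2)
      fix \<omega>
      show "(\<lambda>n. Sa (T - X n) (\<xi> \<omega>)) \<longlonglongrightarrow> Sa (T - t) (\<xi> \<omega>)"
        by (rule continuous_on_tendsto_compose[OF Sa_continuous]) (use X in \<open>auto intro!: tendsto_intros\<close>)
    qed
  qed (use X Sa_contraction L2_measurable[OF L2_linear[OF drift_solutionD(1)[OF S] blinfun.bounded_linear_right]] in auto)
  have "tends2 M (\<lambda>n \<omega>. Sa (T - X n) (\<xi> \<omega>) + drift (X n) \<zeta> \<omega> - I (X n) \<omega>) (\<lambda>\<omega>. Sa (T - t) (\<xi> \<omega>) + drift t \<zeta> \<omega> - I t \<omega>)"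
    by (intro tends2_diff_const tends2_add 1 drift_continuous_approx[OF \<zeta> X]
        ito_tends2[OF I(1)[OF X(1)] I(1)[OF X(2)] SZ_continuous[OF drift_solutionD(3)[OF S] X(3)] order_refl])
  from tends2_cong_AE[OF this I(2)[OF X(1)] I(2)[OF X(2)]] show ?thesis using drift_solutionD(4)[OF S] X by blast
qed

end

section \<open>Mild solutions\<close>

context wiener_filtration
begin

lemma progressiveI:
  "(\<And>t. 0 \<le> t \<Longrightarrow> t \<le> T \<Longrightarrow> (\<lambda>p. X (fst p) (snd p)) \<in> borel_measurable (restrict_space borel {0..t} \<Otimes>\<^sub>M F t)) \<Longrightarrow> progressive T F X"
  by (simp add: progressive_def case_prod_unfold)

lemma progressiveD:
  "progressive T F X \<Longrightarrow> 0 \<le> t \<Longrightarrow> t \<le> T \<Longrightarrow> (\<lambda>p. X (fst p) (snd p)) \<in> borel_measurable (restrict_space borel {0..t} \<Otimes>\<^sub>M F t)"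
  by (simp add: progressive_def case_prod_unfold)

lemma progressive_lim:
  fixes X :: "nat \<Rightarrow> real \<Rightarrow> 'w \<Rightarrow> 'c::{banach, second_countable_topology}"
  assumes "\<And>n. progressive T F (X n)"
  shows "progressive T F (\<lambda>s \<omega>. lim (\<lambda>n. X n s \<omega>))"
  by (rule progressiveI, rule borel_measurable_lim_metric) (rule progressiveD[OF assms])

lemma progressive_elementary:
  fixes xs :: "('w, 'k, 'h::{real_inner, banach, second_countable_topology}) elementary"
  assumes "elementary_on F 0 T xs"
  shows "progressive T F (elementary_process xs)"
proof (rule progressiveI)
  fix t assume t: "0 \<le> t" "t \<le> T"
  let ?R = "restrict_space borel {0..t} \<Otimes>\<^sub>M F t"
  show "(\<lambda>p. elementary_process xs (fst p) (snd p)) \<in> borel_measurable ?R"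
    using assms
  proof (induction xs)
    case (Cons x xs)
    obtain s r G \<phi> h where x: "x = (s, r, G, \<phi>, h)" by (cases x)
    have on: "elementary_on F 0 T [x]" "elementary_on F 0 T xs" using iffD1[OF elementary_on_Cons Cons.prems] by auto
    have "(\<lambda>p. (indicator {s<..r} (fst p) * indicator G (snd p)) *\<^sub>R rank_one h \<phi>) \<in> borel_measurable ?R"
    proof (cases "s \<le> t")
      case True
      have "0 \<le> s" "G \<in> sets (F s)" using on(1) by (auto simp: x elementary_on_def)
      then have "G \<in> sets (F t)" using F_mono[of s t] True by blast
      moreover have "fst \<in> borel_measurable ?R"
        by (rule measurable_compose[OF measurable_fst measurable_restrict_space1]) simp
      ultimately show ?thesis
        by (intro borel_measurable_scaleR borel_measurable_times borel_measurable_const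
            measurable_compose[OF _ borel_measurable_indicator, of fst] measurable_compose[OF measurable_snd borel_measurable_indicator]) auto
    next
      case False
      \<comment> \<open>A term that starts after t vanishes on [0, t]; its event belongs to F s and
        possibly not to F t.\<close>
      have "(\<lambda>p. (indicator {s<..r} (fst p) * indicator G (snd p)) *\<^sub>R rank_one h \<phi>) \<in> borel_measurable ?R
          \<longleftrightarrow> (\<lambda>p. 0 :: ('k, 'h) hs) \<in> borel_measurable ?R"
        by (rule measurable_cong) (use False in \<open>auto simp: space_pair_measure space_restrict_space\<close>)
      then show ?thesis by simp
    qed
    from borel_measurable_add[OF this Cons.IH[OF on(2)]]
    show ?case by (simp add: x elementary_process_def)
  qed simp
qed

lemma progressive_section:
  assumes X: "progressive T F X" and t: "0 \<le> t" "t \<le> T"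
  shows "X t \<in> borel_measurable (F t)"
proof -
  have "Pair t \<in> measurable (F t) (restrict_space borel {0..t} \<Otimes>\<^sub>M F t)"
    by (rule measurable_Pair1') (use t in \<open>simp add: space_restrict_space\<close>)
  from measurable_compose[OF this progressiveD[OF X t]] show ?thesis by simp
qed

lemma progressive_measurable:
  assumes X: "progressive T F X" and T: "0 \<le> T"
  shows "(\<lambda>(s, \<omega>). X s \<omega>) \<in> borel_measurable (restrict_space borel {0..T} \<Otimes>\<^sub>M M)"
proof -
  have id: "(\<lambda>p. p) \<in> measurable (restrict_space borel {0..T} \<Otimes>\<^sub>M M) (restrict_space borel {0..T} \<Otimes>\<^sub>M F T)"
    by (rule measurable_pair)
      (auto simp: o_def intro!: measurable_compose[OF measurable_snd measurable_from_subalg[OF F_subalgebra[OF T]]])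
  from measurable_compose[OF id progressiveD[OF X T order_refl]] show ?thesis by (simp add: case_prod_unfold)
qed

section \<open>Progressive versions of mean square continuous processes\<close>

text \<open>The Heine-Cantor argument for the path t to Y t in mean square: pairs of times that
  violate uniformity approach each other, and along a subsequence both converge to the same time l,
  where Y is continuous.\<close>

lemma uniformly_continuous_L2:
  fixes Y :: "real \<Rightarrow> 'w \<Rightarrow> 'h::{real_inner, banach, second_countable_topology}"
  assumes Y: "\<And>t. t \<in> {0..T} \<Longrightarrow> L2 M (Y t)"
    and cont: "\<And>X t. (\<And>n. X n \<in> {0..T}) \<Longrightarrow> t \<in> {0..T} \<Longrightarrow> X \<longlonglongrightarrow> t \<Longrightarrow> tends2 M (\<lambda>n. Y (X n)) (Y t)"
    and e: "e > 0"
  shows "\<exists>d>0. \<forall>s\<in>{0..T}. \<forall>t\<in>{0..T}. \<bar>s - t\<bar> < d \<longrightarrow> n2 M (\<lambda>\<omega>. Y s \<omega> - Y t \<omega>) < e"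
proof (rule ccontr)
  assume neg: "\<not> ?thesis"
  have "\<forall>n. \<exists>p. fst p \<in> {0..T} \<and> snd p \<in> {0..T} \<and> \<bar>fst p - snd p\<bar> < 1 / Suc n \<and> e \<le> n2 M (\<lambda>\<omega>. Y (fst p) \<omega> - Y (snd p) \<omega>)"
  proof
    fix n
    have "(0::real) < 1 / Suc n" by simp
    then obtain s t where "s \<in> {0..T}" "t \<in> {0..T}" "\<bar>s - t\<bar> < 1 / Suc n" "\<not> n2 M (\<lambda>\<omega>. Y s \<omega> - Y t \<omega>) < e"
      using neg by blast
    then show "\<exists>p. fst p \<in> {0..T} \<and> snd p \<in> {0..T} \<and> \<bar>fst p - snd p\<bar> < 1 / Suc n \<and> e \<le> n2 M (\<lambda>\<omega>. Y (fst p) \<omega> - Y (snd p) \<omega>)"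
      by (intro exI[of _ "(s, t)"]) simp
  qed
  from choice[OF this] obtain p where p: "\<And>n. fst (p n) \<in> {0..T}" "\<And>n. snd (p n) \<in> {0..T}"
    "\<And>n. \<bar>fst (p n) - snd (p n)\<bar> < 1 / Suc n" "\<And>n. e \<le> n2 M (\<lambda>\<omega>. Y (fst (p n)) \<omega> - Y (snd (p n)) \<omega>)" by blast
  have "seq_compact {0..T}" using compact_Icc[of 0 T] by (simp add: compact_eq_seq_compact_metric)
  from seq_compactE[OF this, of "\<lambda>n. fst (p n)"] p(1) obtain r l where r: "l \<in> {0..T}" "strict_mono (r :: nat \<Rightarrow> nat)" "((\<lambda>n. fst (p n)) \<circ> r) \<longlonglongrightarrow> l"
    by blast
  have d0: "(\<lambda>n. fst (p n) - snd (p n)) \<longlonglongrightarrow> 0"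
  proof (rule Lim_null_comparison)
    show "\<forall>\<^sub>F n in sequentially. norm (fst (p n) - snd (p n)) \<le> 1 / Suc n"
      using p(3) by (intro always_eventually allI) (simp add: less_imp_le)
    show "(\<lambda>n. 1 / real (Suc n)) \<longlonglongrightarrow> 0" using LIMSEQ_inverse_real_of_nat by (simp add: inverse_eq_divide)
  qed
  have f: "(\<lambda>n. fst (p (r n))) \<longlonglongrightarrow> l" using r(3) by (simp add: o_def)
  have "(\<lambda>n. fst (p (r n)) - (fst (p (r n)) - snd (p (r n)))) \<longlonglongrightarrow> l - 0"
    using LIMSEQ_subseq_LIMSEQ[OF d0 r(2)] by (intro tendsto_diff f) (simp add: o_def)
  then have s: "(\<lambda>n. snd (p (r n))) \<longlonglongrightarrow> l" by simp
  have "tends2 M (\<lambda>n. Y (fst (p (r n)))) (Y l)" "tends2 M (\<lambda>n. Y (snd (p (r n)))) (Y l)"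
    by (rule cont[OF _ r(1) f], rule p(1)) (rule cont[OF _ r(1) s], rule p(2))
  then have lim: "(\<lambda>n. n2 M (\<lambda>\<omega>. Y (fst (p (r n))) \<omega> - Y l \<omega>) + n2 M (\<lambda>\<omega>. Y (snd (p (r n))) \<omega> - Y l \<omega>)) \<longlonglongrightarrow> 0 + 0"
    unfolding tends2_def by (intro tendsto_add) auto
  have "e \<le> 0 + 0"
  proof (rule LIMSEQ_le_const[OF lim], intro exI allI impI)
    fix n
    have "n2 M (\<lambda>\<omega>. Y (fst (p (r n))) \<omega> - Y (snd (p (r n))) \<omega>)
        \<le> n2 M (\<lambda>\<omega>. Y (fst (p (r n))) \<omega> - Y l \<omega>) + n2 M (\<lambda>\<omega>. Y l \<omega> - Y (snd (p (r n))) \<omega>)"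
      by (rule n2_triangle3[OF Y[OF p(1)] Y[OF r(1)] Y[OF p(2)]])
    then show "e \<le> n2 M (\<lambda>\<omega>. Y (fst (p (r n))) \<omega> - Y l \<omega>) + n2 M (\<lambda>\<omega>. Y (snd (p (r n))) \<omega> - Y l \<omega>)"
      using p(4)[of "r n"] n2_minus_commute[of M "Y l" "Y (snd (p (r n)))"] by simp
  qed
  then show False using e by simp
qed

text \<open>Rounding down matters: for s in [0, t] the grid point is at most t, so only the
  countably many variables at grid points up to t occur, and all of them are measurable for F
  t.\<close>

lemma progressive_step:
  fixes Y :: "real \<Rightarrow> 'w \<Rightarrow> 'h::{real_inner, banach, second_countable_topology}"
  assumes Y: "\<And>t. t \<in> {0..T} \<Longrightarrow> Y t \<in> borel_measurable (F t)" and d: "d > 0"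
  shows "progressive T F (\<lambda>s. Y (d * real (nat \<lfloor>s / d\<rfloor>)))"
proof (rule progressiveI)
  fix t assume t: "0 \<le> t" "t \<le> T"
  let ?R = "restrict_space borel {0..t} \<Otimes>\<^sub>M F t" and ?I = "{i. d * real i \<le> t}"
  have k: "(\<lambda>p. nat \<lfloor>fst p / d\<rfloor>) \<in> measurable ?R (count_space ?I)"
  proof (subst measurable_count_space_eq_countable)
    have "fst \<in> borel_measurable ?R"
      by (rule measurable_compose[OF measurable_fst measurable_restrict_space1]) simp
    then have "(\<lambda>p. fst p / d) \<in> borel_measurable ?R" by (intro borel_measurable_divide) auto
    from measurable_compose[OF measurable_compose[OF this measurable_real_floor] measurable_count_space]
    have m: "(\<lambda>p. nat \<lfloor>fst p / d\<rfloor>) \<in> measurable ?R (count_space UNIV)" .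
    have "d * real (nat \<lfloor>s / d\<rfloor>) \<le> t" if "s \<in> {0..t}" for s
    proof -
      have "d * real (nat \<lfloor>s / d\<rfloor>) = d * real_of_int \<lfloor>s / d\<rfloor>" using that d by simp
      also have "\<dots> \<le> d * (s / d)" using d by (intro mult_left_mono of_int_floor_le) simp
      finally show ?thesis using that d by simp
    qed
    then show "(\<lambda>p. nat \<lfloor>fst p / d\<rfloor>) \<in> space ?R \<rightarrow> ?I \<and> (\<forall>a\<in>?I. (\<lambda>p. nat \<lfloor>fst p / d\<rfloor>) -` {a} \<inter> space ?R \<in> sets ?R)"
      using measurable_sets[OF m] by (auto simp: space_pair_measure space_restrict_space)
  qed auto
  have "(\<lambda>p. Y (d * real i) (snd p)) \<in> borel_measurable ?R" if "i \<in> ?I" for i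
  proof -
    have "Y (d * real i) \<in> borel_measurable (F t)"
      using that t d by (intro F_measurable_mono[OF Y]) auto
    from measurable_compose[OF measurable_snd this] show ?thesis .
  qed
  from measurable_compose_countable'[where f = "\<lambda>i p. Y (d * real i) (snd p)", OF this k]
  show "(\<lambda>p. Y (d * real (nat \<lfloor>fst p / d\<rfloor>)) (snd p)) \<in> borel_measurable ?R" by simp
qed

text \<open>Uniform continuity provides one grid width per n that serves all t, with error below
  (1/8)^n. At this rate the values at the grid points converge almost surely to Y t for every single
  t, while their pointwise limit is progressive.\<close>

lemma progressive_modification:
  fixes Y :: "real \<Rightarrow> 'w \<Rightarrow> 'h::{real_inner, banach, second_countable_topology}"
  assumes L: "\<And>t. t \<in> {0..T} \<Longrightarrow> L2 M (Y t)" and m: "\<And>t. t \<in> {0..T} \<Longrightarrow> Y t \<in> borel_measurable (F t)"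
    and cont: "\<And>X t. (\<And>n. X n \<in> {0..T}) \<Longrightarrow> t \<in> {0..T} \<Longrightarrow> X \<longlonglongrightarrow> t \<Longrightarrow> tends2 M (\<lambda>n. Y (X n)) (Y t)"
  obtains Y' where "progressive T F Y'" "\<And>t. t \<in> {0..T} \<Longrightarrow> AE \<omega> in M. Y t \<omega> = Y' t \<omega>"
proof -
  have "\<forall>n. \<exists>d>0. \<forall>s\<in>{0..T}. \<forall>t\<in>{0..T}. \<bar>s - t\<bar> < d \<longrightarrow> n2 M (\<lambda>\<omega>. Y s \<omega> - Y t \<omega>) < (1/8) ^ n"
    by (intro allI uniformly_continuous_L2[OF L cont]) auto
  from choice[OF this] obtain d where d: "\<And>n. 0 < d n"
    "\<And>n s t. s \<in> {0..T} \<Longrightarrow> t \<in> {0..T} \<Longrightarrow> \<bar>s - t\<bar> < d n \<Longrightarrow> n2 M (\<lambda>\<omega>. Y s \<omega> - Y t \<omega>) < (1/8) ^ n" by blast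
  define g where "g n s = d n * real (nat \<lfloor>s / d n\<rfloor>)" for n s
  define Y' where "Y' s \<omega> = lim (\<lambda>n. Y (g n s) \<omega>)" for s \<omega>
  show ?thesis
  proof
    show "progressive T F Y'" unfolding Y'_def[abs_def] g_def by (rule progressive_lim, rule progressive_step[OF m d(1)])
    fix t assume t: "t \<in> {0..T}"
    have g: "0 \<le> g n t" "g n t \<le> t" "t - g n t < d n" for n
    proof -
      have e: "g n t = d n * real_of_int \<lfloor>t / d n\<rfloor>" using t d(1)[of n] by (simp add: g_def)
      show "0 \<le> g n t" using d(1)[of n] by (simp add: g_def)
      have "d n * real_of_int \<lfloor>t / d n\<rfloor> \<le> d n * (t / d n)" using d(1)[of n] by (intro mult_left_mono of_int_floor_le) simp
      then show "g n t \<le> t" using d(1)[of n] by (simp add: e)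
      have "d n * (t / d n) < d n * (real_of_int \<lfloor>t / d n\<rfloor> + 1)" using d(1)[of n] by (intro mult_strict_left_mono) linarith+
      then show "t - g n t < d n" using d(1)[of n] by (simp add: e distrib_left)
    qed
    have gm: "g n t \<in> {0..T}" for n using g(1,2)[of n] t by auto
    have "AE \<omega> in M. \<exists>c. \<forall>n. norm (Y (g n t) \<omega> - Y t \<omega>) \<le> c * (1/2) ^ n"
    proof (rule AE_fast_bound)
      show "L2 M (\<lambda>\<omega>. Y (g n t) \<omega> - Y t \<omega>)" for n by (intro L2_diff L gm t)
      show "n2 M (\<lambda>\<omega>. Y (g n t) \<omega> - Y t \<omega>) \<le> (1/8) ^ n" for n
        using d(2)[OF gm t, of n n] g[of n] by auto
    qed
    then show "AE \<omega> in M. Y t \<omega> = Y' t \<omega>"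
    proof eventually_elim
      fix \<omega> assume "\<exists>c. \<forall>n. norm (Y (g n t) \<omega> - Y t \<omega>) \<le> c * (1/2) ^ n"
      then obtain c where c: "\<And>n. norm (Y (g n t) \<omega> - Y t \<omega>) \<le> c * (1/2) ^ n" by blast
      have "(\<lambda>n. Y (g n t) \<omega> - Y t \<omega>) \<longlonglongrightarrow> 0"
      proof (rule Lim_null_comparison)
        show "\<forall>\<^sub>F n in sequentially. norm (Y (g n t) \<omega> - Y t \<omega>) \<le> c * (1/2) ^ n" using c by simp
        show "(\<lambda>n. c * (1/2) ^ n) \<longlonglongrightarrow> 0" by (intro tendsto_mult_right_zero LIMSEQ_power_zero) simp
      qed
      then have "(\<lambda>n. Y (g n t) \<omega>) \<longlonglongrightarrow> Y t \<omega>" by (rule LIM_zero_cancel)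
      then show "Y t \<omega> = Y' t \<omega>" by (simp add: Y'_def limI)
    qed
  qed
qed

text \<open>Null sets of \<open>Q\<close> and of the product with restricted time are compared
  through their time sections: Fubini is applied once in each direction.\<close>

lemma AE_restrict_time:
  fixes f g :: "real \<Rightarrow> 'w \<Rightarrow> 'c::{real_inner, banach, second_countable_topology}"
  assumes m: "(\<lambda>(s, \<omega>). f s \<omega>) \<in> borel_measurable (restrict_space borel {a..b} \<Otimes>\<^sub>M M)"
      "(\<lambda>(s, \<omega>). g s \<omega>) \<in> borel_measurable (restrict_space borel {a..b} \<Otimes>\<^sub>M M)"
    and ae: "AE p in Q. fst p \<in> {a..b} \<longrightarrow> f (fst p) (snd p) = g (fst p) (snd p)"
  shows "AE (s, \<omega>) in restrict_space lborel {a..b} \<Otimes>\<^sub>M M. f s \<omega> = g s \<omega>"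
proof -
  interpret Q: pair_sigma_finite lborel M ..
  interpret r: sigma_finite_measure "restrict_space lborel {a..b}"
    by (rule sigma_finite_measure_restrict_space[OF sigma_finite_lborel]) simp
  interpret R: pair_sigma_finite "restrict_space lborel {a..b}" M ..
  have s: "sets (restrict_space lborel {a..b} \<Otimes>\<^sub>M M) = sets (restrict_space borel {a..b} \<Otimes>\<^sub>M M)"
    by (intro sets_pair_measure_cong sets_restrict_space_cong) simp_all
  have "AE p in restrict_space lborel {a..b} \<Otimes>\<^sub>M M. (\<lambda>(s, \<omega>). f s \<omega>) p = (\<lambda>(s, \<omega>). g s \<omega>) p"
  proof (rule R.AE_pair_measure)
    have m': "(\<lambda>(s, \<omega>). f s \<omega>) \<in> borel_measurable (restrict_space lborel {a..b} \<Otimes>\<^sub>M M)"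
        "(\<lambda>(s, \<omega>). g s \<omega>) \<in> borel_measurable (restrict_space lborel {a..b} \<Otimes>\<^sub>M M)"
      using m by (simp_all cong: measurable_cong_sets[OF s refl])
    have "(\<lambda>p. dist ((\<lambda>(s, \<omega>). f s \<omega>) p) ((\<lambda>(s, \<omega>). g s \<omega>) p)) \<in> borel_measurable (restrict_space lborel {a..b} \<Otimes>\<^sub>M M)"
      by (rule borel_measurable_dist[OF m'])
    from measurable_sets[OF this, of "{0}"]
    show "{p \<in> space (restrict_space lborel {a..b} \<Otimes>\<^sub>M M). (\<lambda>(s, \<omega>). f s \<omega>) p = (\<lambda>(s, \<omega>). g s \<omega>) p}
        \<in> sets (restrict_space lborel {a..b} \<Otimes>\<^sub>M M)"
      by (simp add: vimage_def Int_def conj_commute)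
    have "AE s in lborel. AE \<omega> in M. s \<in> {a..b} \<longrightarrow> f s \<omega> = g s \<omega>" using Q.AE_pair[OF ae] by simp
    then have "AE s in lborel. s \<in> {a..b} \<longrightarrow> (AE \<omega> in M. f s \<omega> = g s \<omega>)" by eventually_elim auto
    then show "AE s in restrict_space lborel {a..b}. AE \<omega> in M. (\<lambda>(s, \<omega>). f s \<omega>) (s, \<omega>) = (\<lambda>(s, \<omega>). g s \<omega>) (s, \<omega>)"
      by (simp add: AE_restrict_space_iff)
  qed
  then show ?thesis by (simp add: case_prod_unfold)
qed

end

text \<open>The a priori estimate with \<zeta> = Z reads |Z| <= exp (lam T) |\<xi>| + q |Z|; solving
  for |Z| gives this factor.\<close>

definition (in kernel) gain :: real where "gain = exp (lam * T) / (1 - q)"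

text \<open>The sum of the squared factors for Y and for Z. The equation bounds |Y t| by |\<xi>| for
  the semigroup term, kappa |Z| for the drift and |Z| for the stochastic integral.\<close>

definition (in kernel) bound :: real where "bound = (1 + (kappa + 1) * gain)\<^sup>2 + gain\<^sup>2"

lemma (in kernel) gain_nonneg: "0 \<le> gain" using q by (simp add: gain_def)

lemma (in kernel) bound_pos: "0 < bound"
proof -
  have "1 \<le> 1 + (kappa + 1) * gain" using gain_nonneg kappa_nonneg by simp
  then have "0 < (1 + (kappa + 1) * gain)\<^sup>2" by simp
  then show ?thesis unfolding bound_def by (intro add_pos_nonneg) auto
qed

context backward_equation
begin

lemma drift_cut: "0 \<le> t \<Longrightarrow> drift t (cut 0 T \<zeta>) = drift t \<zeta>"
  unfolding drift_def[abs_def] by (intro ext Bochner_Integration.integral_cong) (auto simp: drift_integrand_def cut_def indicator_def)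

lemma drift_solution_estimate:
  assumes S: "drift_solution \<xi> Z Y Z"
  shows "n2 Q (cut 0 T Z) \<le> gain * n2 M \<xi>"
    and "t \<in> {0..T} \<Longrightarrow> n2 M (Y t) \<le> (1 + (kappa + 1) * gain) * n2 M \<xi>"
proof -
  note L = drift_solutionD(1,3)[OF S]
  have "(1 - q) * n2 Q (weighted lam Z) \<le> exp (lam * T) * n2 M \<xi>"
    using apriori[OF S] by (simp add: left_diff_distrib)
  then have "n2 Q (weighted lam Z) \<le> gain * n2 M \<xi>"
    using q by (simp add: gain_def le_divide_eq mult.commute)
  then show Z: "n2 Q (cut 0 T Z) \<le> gain * n2 M \<xi>"
    using weighted_L2(3)[OF L(2), of lam] lam by simp
  assume t: "t \<in> {0..T}"
  obtain I where I: "ito t T (SZ t Z) I" "AE \<omega> in M. Y t \<omega> = Sa (T - t) (\<xi> \<omega>) + drift t Z \<omega> - I \<omega>"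
    using drift_solutionD(6)[OF S t] by blast
  have SL: "L2 M (\<lambda>\<omega>. Sa (T - t) (\<xi> \<omega>))" by (rule L2_linear[OF L(1) blinfun.bounded_linear_right])
  have DL: "L2 M (drift t Z)" using drift_L2(1)[OF L(2)] t by simp
  have IL: "L2 M I" by (rule ito_L2(2)[OF I(1)])
  have "n2 M (Y t) = n2 M (\<lambda>\<omega>. Sa (T - t) (\<xi> \<omega>) + drift t Z \<omega> - I \<omega>)"
    using L2_cong_AE(2)[OF drift_solutionD(4)[OF S t] I(2)] SL DL IL by (simp add: L2_measurable L2_add L2_diff)
  also have "\<dots> \<le> n2 M (\<lambda>\<omega>. Sa (T - t) (\<xi> \<omega>) + drift t Z \<omega>) + n2 M I"
    by (rule n2_triangle_diff[OF L2_add[OF SL DL] IL])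
  also have "n2 M (\<lambda>\<omega>. Sa (T - t) (\<xi> \<omega>) + drift t Z \<omega>) \<le> n2 M (\<lambda>\<omega>. Sa (T - t) (\<xi> \<omega>)) + n2 M (drift t Z)"
    by (rule n2_triangle[OF SL DL])
  also have "n2 M (\<lambda>\<omega>. Sa (T - t) (\<xi> \<omega>)) \<le> 1 * n2 M \<xi>"
    by (rule L2_bound(2)[OF L2_measurable[OF SL] L(1)]) (use Sa_contraction t in auto)
  also have "n2 M (drift t Z) \<le> kappa * n2 Q (cut 0 T Z)"
    using drift_L2(2)[OF L2_cut(1)[OF L(2)], of t 0 T] t by (simp add: drift_cut)
  also have "n2 M I \<le> n2 Q (cut 0 T Z)"
    using ito_isometry[OF I(1)] SZ_L2(2)[OF L2_cut(1)[OF L(2)], of t 0 T] t by (simp add: SZ_cut)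
  also have "1 * n2 M \<xi> + kappa * n2 Q (cut 0 T Z) + n2 Q (cut 0 T Z) = n2 M \<xi> + (kappa + 1) * n2 Q (cut 0 T Z)"
    by (simp add: distrib_right)
  also have "\<dots> \<le> n2 M \<xi> + (kappa + 1) * (gain * n2 M \<xi>)"
    using Z kappa_nonneg by (intro add_left_mono mult_left_mono) auto
  finally show "n2 M (Y t) \<le> (1 + (kappa + 1) * gain) * n2 M \<xi>" by (simp add: distrib_right mult.assoc)
qed

text \<open>The equation is linear, so the difference solves it with terminal value 0 and the
  estimate makes it vanish. Off (0, T] no equality of the Z parts can be expected, hence the
  \<open>cut\<close>.\<close>

lemma drift_solution_unique:
  assumes 1: "drift_solution \<xi> Z Y Z" and 2: "drift_solution \<xi> Z' Y' Z'"
  shows "t \<in> {0..T} \<Longrightarrow> AE \<omega> in M. Y t \<omega> = Y' t \<omega>" and "AE p in Q. cut 0 T Z p = cut 0 T Z' p"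
proof -
  have S: "drift_solution (\<lambda>\<omega>. 0) (\<lambda>p. Z p - Z' p) (\<lambda>t \<omega>. Y t \<omega> - Y' t \<omega>) (\<lambda>p. Z p - Z' p)"
    using drift_solution_diff[OF 1 2] by simp
  have "n2 Q (\<lambda>p. cut 0 T Z p - cut 0 T Z' p) = 0"
    using drift_solution_estimate(1)[OF S] by (simp add: cut_diff order_antisym)
  then show "AE p in Q. cut 0 T Z p = cut 0 T Z' p"
    using n2_diff_0_AE[OF L2_cut(1)[OF drift_solutionD(3)[OF 1]] L2_cut(1)[OF drift_solutionD(3)[OF 2]]] by simp
  assume t: "t \<in> {0..T}"
  then have "n2 M (\<lambda>\<omega>. Y t \<omega> - Y' t \<omega>) = 0"
    using drift_solution_estimate(2)[OF S t] by (simp add: order_antisym)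
  then show "AE \<omega> in M. Y t \<omega> = Y' t \<omega>"
    using n2_diff_0_AE[OF drift_solutionD(4)[OF 1 t] drift_solutionD(4)[OF 2 t]] by simp
qed

lemma drift_solution_cong_solution:
  assumes S: "drift_solution \<xi> \<zeta> Y Z" and Z: "AE p in Q. Z p = Z' p" "L2 Q Z'"
    and Y: "\<And>t. t \<in> {0..T} \<Longrightarrow> AE \<omega> in M. Y t \<omega> = Y' t \<omega>" "\<And>t. t \<in> {0..T} \<Longrightarrow> Y' t \<in> borel_measurable (F t)"
  shows "drift_solution \<xi> \<zeta> Y' Z'"
proof (rule drift_solutionI[OF drift_solutionD(1,2)[OF S] Z(2)])
  fix t assume t: "t \<in> {0..T}"
  show "L2 M (Y' t)" using F_measurable[OF Y(2)[OF t]] t by (intro L2_cong_AE(1)[OF drift_solutionD(4)[OF S t] Y(1)[OF t]]) auto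
  show "Y' t \<in> borel_measurable (F t)" by (rule Y(2)[OF t])
  obtain I where I: "ito t T (SZ t Z) I" "AE \<omega> in M. Y t \<omega> = Sa (T - t) (\<xi> \<omega>) + drift t \<zeta> \<omega> - I \<omega>"
    using drift_solutionD(6)[OF S t] by blast
  have "AE p in Q. SZ t Z p = SZ t Z' p" using Z(1) by eventually_elim (simp add: SZ_def)
  from ito_cong_AE[OF I(1) this SZ_L2(1)[OF Z(2)] _ ito_L2(2)[OF I(1)]] have "ito t T (SZ t Z') I" by simp
  moreover have "AE \<omega> in M. Y' t \<omega> = Sa (T - t) (\<xi> \<omega>) + drift t \<zeta> \<omega> - I \<omega>" using I(2) Y(1)[OF t] by eventually_elim simp
  ultimately show "\<exists>I. ito t T (SZ t Z') I \<and> (AE \<omega> in M. Y' t \<omega> = Sa (T - t) (\<xi> \<omega>) + drift t \<zeta> \<omega> - I \<omega>)" by blast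
qed

text \<open>The stochastic integral of the definitions lives on the closed interval,
  \<open>SZ\<close> on the interval open at t; the difference is the null set s = t.\<close>

lemma SZ_closed_interval:
  fixes Z :: "real \<Rightarrow> 'w \<Rightarrow> ('k, 'h) hs"
  assumes "0 \<le> t"
  shows "AE p in Q. indicator {t..T} (fst p) *\<^sub>R hs_compose (Sa (fst p - t)) (Z (fst p) (snd p))
    = SZ t (\<lambda>p. indicator {0..T} (fst p) *\<^sub>R Z (fst p) (snd p)) p"
  using AE_fst_neq[of t] by eventually_elim (use assms in \<open>auto simp: SZ_def indicator_def\<close>)

lemma drift_eq_LINT:
  assumes "0 \<le> t"
  shows "(LINT s:{t<..T}|lborel. Ka (s - t) (Z s \<omega>)) = drift t (\<lambda>p. indicator {0..T} (fst p) *\<^sub>R Z (fst p) (snd p)) \<omega>"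
  unfolding drift_def set_lebesgue_integral_def
  by (intro Bochner_Integration.integral_cong refl) (use assms in \<open>auto simp: drift_integrand_def indicator_def\<close>)

lemma nn_integral_closed_interval:
  assumes "Z' \<in> borel_measurable Q" "\<And>p. Z' p = indicator {0..T} (fst p) *\<^sub>R (Z (fst p) (snd p) :: ('k, 'h) hs)"
  shows "(\<integral>\<^sup>+\<omega>. (\<integral>\<^sup>+s\<in>{0..T}. ennreal ((norm (Z s \<omega>))\<^sup>2) \<partial>lborel) \<partial>M) = (\<integral>\<^sup>+p. ennreal ((norm (Z' p))\<^sup>2) \<partial>Q)"
proof -
  have "(\<integral>\<^sup>+p. ennreal ((norm (Z' p))\<^sup>2) \<partial>Q) = (\<integral>\<^sup>+\<omega>. \<integral>\<^sup>+s. ennreal ((norm (Z' (s, \<omega>)))\<^sup>2) \<partial>lborel \<partial>M)"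
    using assms(1) by (intro nn_integral_Q_swap[symmetric]) simp
  also have "\<dots> = (\<integral>\<^sup>+\<omega>. (\<integral>\<^sup>+s\<in>{0..T}. ennreal ((norm (Z s \<omega>))\<^sup>2) \<partial>lborel) \<partial>M)"
    by (intro nn_integral_cong) (auto simp: assms(2) indicator_def)
  finally show ?thesis ..
qed

lemma cut_fixed_eq:
  fixes Z :: "real \<Rightarrow> 'w \<Rightarrow> ('k, 'h) hs"
  assumes "cut 0 T Z' = Z'" "Z' = (\<lambda>p. Z (fst p) (snd p))"
  shows "Z' = (\<lambda>p. indicator {0..T} (fst p) *\<^sub>R Z (fst p) (snd p))"
proof
  fix p
  have "cut 0 T Z' p = Z' p" using assms(1) by simp
  then have "Z' p = indicator {0..T} (fst p) *\<^sub>R Z' p" by (auto simp: cut_def indicator_def split: if_splits)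
  then show "Z' p = indicator {0..T} (fst p) *\<^sub>R Z (fst p) (snd p)" using assms(2) by simp
qed

text \<open>Progressive measurability controls Z on [0, T] only, so Z is replaced by 0 outside
  before it is treated as a function on the product space.\<close>

lemma mild_imp_wsol:
  assumes K: "K = op_exp DC C S" and \<xi>: "L2 M \<xi>" and mild: "mild_solution M F W S DC C T \<xi> Y Z"
  defines "Z' \<equiv> \<lambda>p. indicator {0..T} (fst p) *\<^sub>R Z (fst p) (snd p)"
  shows "drift_solution \<xi> Z' Y Z'"
proof -
  have prog: "progressive T F Y" "progressive T F Z" and fin: "solution_norm_sq M T Y Z < \<infinity>"
    using mild by (simp_all add: mild_solution_def)
  have T0: "0 \<le> T" using T by simp
  have Zm: "Z' \<in> borel_measurable Q"
    unfolding Z'_def by (rule restricted_process_measurable[OF progressive_measurable[OF prog(2) T0]])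
  have ZL: "L2 Q Z'"
    using fin nn_integral_closed_interval[OF Zm, of Z] Zm
    by (simp add: L2_iff_nn solution_norm_sq_def Z'_def less_top)
  show ?thesis
  proof (rule drift_solutionI[OF \<xi> ZL ZL])
    fix t assume t: "t \<in> {0..T}"
    then have t0: "0 \<le> t" "t \<le> T" by auto
    show m: "Y t \<in> borel_measurable (F t)" by (rule progressive_section[OF prog(1) t0])
    have "(\<integral>\<^sup>+\<omega>. ennreal ((norm (Y t \<omega>))\<^sup>2) \<partial>M) \<le> (SUP t\<in>{0..T}. \<integral>\<^sup>+\<omega>. ennreal ((norm (Y t \<omega>))\<^sup>2) \<partial>M)"
      using t by (rule SUP_upper)
    also have "\<dots> < \<infinity>" using fin by (simp add: solution_norm_sq_def)
    finally show "L2 M (Y t)" using F_measurable[OF m t0(1)] by (simp add: L2_iff_nn)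
    obtain I where I: "has_ito_integral M F W t T (\<lambda>s \<omega>. hs_compose (Sa (s - t)) (Z s \<omega>)) I"
      "AE \<omega> in M. Y t \<omega> = Sa (T - t) (\<xi> \<omega>) + (LINT s:{t<..T}|lborel. blinfun_adj (op_exp DC C S (s - t)) (Z s \<omega>)) - I \<omega>"
      using mild t unfolding mild_solution_def by blast
    have i: "ito t T (\<lambda>p. indicator {t..T} (fst p) *\<^sub>R hs_compose (Sa (fst p - t)) (Z (fst p) (snd p))) I"
      using I(1) unfolding has_ito_integral_iff[OF t0(1)] by blast
    from ito_cong_AE[OF this SZ_closed_interval[OF t0(1)] SZ_L2(1)[OF ZL[unfolded Z'_def]] _ ito_L2(2)[OF i]]
    have "ito t T (SZ t Z') I" by (simp add: Z'_def)
    then show "\<exists>I. ito t T (SZ t Z') I \<and> (AE \<omega> in M. Y t \<omega> = Sa (T - t) (\<xi> \<omega>) + drift t Z' \<omega> - I \<omega>)"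
      using I(2) unfolding K[symmetric] drift_eq_LINT[OF t0(1)] Z'_def by blast
  qed
qed

lemma drift_solution_solution_norm:
  assumes S: "drift_solution \<xi> Z' Y Z'" and Z': "cut 0 T Z' = Z'" "Z' = (\<lambda>p. Z (fst p) (snd p))"
  shows "solution_norm_sq M T Y Z \<le> ennreal bound * (\<integral>\<^sup>+\<omega>. ennreal ((norm (\<xi> \<omega>))\<^sup>2) \<partial>M)"
proof -
  note Z0 = fun_cong[OF cut_fixed_eq[OF Z']]
  have "(SUP t\<in>{0..T}. \<integral>\<^sup>+\<omega>. ennreal ((norm (Y t \<omega>))\<^sup>2) \<partial>M) \<le> ennreal (((1 + (kappa + 1) * gain) * n2 M \<xi>)\<^sup>2)"
  proof (rule SUP_least)
    fix t assume t: "t \<in> {0..T}"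
    show "(\<integral>\<^sup>+\<omega>. ennreal ((norm (Y t \<omega>))\<^sup>2) \<partial>M) \<le> ennreal (((1 + (kappa + 1) * gain) * n2 M \<xi>)\<^sup>2)"
      unfolding n2_nn[OF drift_solutionD(4)[OF S t]] by (intro ennreal_leI power_mono drift_solution_estimate(2)[OF S t]) simp
  qed
  moreover have "(\<integral>\<^sup>+\<omega>. (\<integral>\<^sup>+s\<in>{0..T}. ennreal ((norm (Z s \<omega>))\<^sup>2) \<partial>lborel) \<partial>M) \<le> ennreal ((gain * n2 M \<xi>)\<^sup>2)"
    unfolding nn_integral_closed_interval[OF L2_measurable[OF drift_solutionD(3)[OF S]] Z0] n2_nn[OF drift_solutionD(3)[OF S]]
    using drift_solution_estimate(1)[OF S] by (intro ennreal_leI power_mono) (simp_all add: Z'(1))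
  ultimately have "solution_norm_sq M T Y Z \<le> ennreal (((1 + (kappa + 1) * gain) * n2 M \<xi>)\<^sup>2) + ennreal ((gain * n2 M \<xi>)\<^sup>2)"
    unfolding solution_norm_sq_def by (rule add_mono)
  also have "\<dots> = ennreal (((1 + (kappa + 1) * gain) * n2 M \<xi>)\<^sup>2 + (gain * n2 M \<xi>)\<^sup>2)"
    by (rule ennreal_plus[symmetric]) simp_all
  also have "((1 + (kappa + 1) * gain) * n2 M \<xi>)\<^sup>2 + (gain * n2 M \<xi>)\<^sup>2 = bound * (n2 M \<xi>)\<^sup>2"
    unfolding bound_def power_mult_distrib by (rule distrib_right[symmetric])
  also have "ennreal (bound * (n2 M \<xi>)\<^sup>2) = ennreal bound * (\<integral>\<^sup>+\<omega>. ennreal ((norm (\<xi> \<omega>))\<^sup>2) \<partial>M)"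
    unfolding n2_nn[OF drift_solutionD(1)[OF S]] using bound_pos by (simp add: ennreal_mult)
  finally show ?thesis .
qed

lemma drift_solution_imp_mild:
  assumes K: "K = op_exp DC C S" and S: "drift_solution \<xi> Z' Y Z'" and ap: "approx 0 T Z'"
    and Z': "cut 0 T Z' = Z'" "Z' = (\<lambda>p. Z (fst p) (snd p))" and prog: "progressive T F Y" "progressive T F Z"
  shows "mild_solution M F W S DC C T \<xi> Y Z"
  unfolding mild_solution_def
proof (intro conjI ballI)
  note Z0 = cut_fixed_eq[OF Z']
  have "ennreal bound * (\<integral>\<^sup>+\<omega>. ennreal ((norm (\<xi> \<omega>))\<^sup>2) \<partial>M) < \<infinity>"
    unfolding n2_nn[OF drift_solutionD(1)[OF S]] by (simp add: ennreal_mult_less_top)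
  then show "solution_norm_sq M T Y Z < \<infinity>" using drift_solution_solution_norm[OF S Z'] by (rule le_less_trans[rotated])
  fix t assume t: "t \<in> {0..T}"
  then have t0: "0 \<le> t" by simp
  show "((\<lambda>s. \<integral>\<^sup>+\<omega>. ennreal ((norm (Y s \<omega> - Y t \<omega>))\<^sup>2) \<partial>M) \<longlongrightarrow> 0) (at t within {0..T})"
    unfolding tendsto_at_iff_sequentially
  proof (intro allI impI)
    fix X assume X: "\<forall>i. X i \<in> {0..T} - {t}" "X \<longlonglongrightarrow> t"
    have "tends2 M (\<lambda>n. Y (X n)) (Y t)" by (rule drift_solution_continuous[OF S ap _ t X(2)]) (use X(1) in blast)
    then show "((\<lambda>s. \<integral>\<^sup>+\<omega>. ennreal ((norm (Y s \<omega> - Y t \<omega>))\<^sup>2) \<partial>M) \<circ> X) \<longlonglongrightarrow> 0"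
      using iffD1[OF tends2_nn_iff[OF tends2_L2(1)[OF \<open>tends2 M (\<lambda>n. Y (X n)) (Y t)\<close>] L2_measurable[OF drift_solutionD(4)[OF S t]]]]
      by (simp add: o_def)
  qed
  show "AE \<omega> in M. set_integrable lborel {t<..T} (\<lambda>s. blinfun_adj (op_exp DC C S (s - t)) (Z s \<omega>))"
    using drift_integrable[OF drift_solutionD(3)[OF S] t0]
    by eventually_elim (simp add: set_integrable_def drift_integrand_def Z'(2) K[symmetric])
  obtain I where I: "ito t T (SZ t Z') I" "AE \<omega> in M. Y t \<omega> = Sa (T - t) (\<xi> \<omega>) + drift t Z' \<omega> - I \<omega>"
    using drift_solutionD(6)[OF S t] by blast
  let ?R = "restrict_space borel {t..T} \<Otimes>\<^sub>M M"
  have id: "(\<lambda>p. p) \<in> measurable ?R Q"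
    by (rule measurable_pair)
      (auto simp: o_def intro!: measurable_compose[OF measurable_fst measurable_restrict_space1])
  have mQ: "(\<lambda>p. indicator {0..} (fst p - t) *\<^sub>R hs_compose (Sa (fst p - t)) (Z' p)) \<in> borel_measurable Q"
    by (rule joint_measurable[where B = "\<lambda>t. hs_compose (Sa t)", OF hs_Sa_joint_continuous _ _ L2_measurable[OF drift_solutionD(3)[OF S]]]) auto
  have mR: "(\<lambda>(s, \<omega>). hs_compose (Sa (s - t)) (Z s \<omega>)) \<in> borel_measurable ?R"
    by (rule measurable_cong[THEN iffD1, OF _ measurable_compose[OF id mQ]])
      (auto simp: space_pair_measure space_restrict_space Z'(2))
  have "ito t T (\<lambda>p. indicator {t..T} (fst p) *\<^sub>R hs_compose (Sa (fst p - t)) (Z (fst p) (snd p))) I"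
  proof (rule ito_cong_AE[OF I(1)])
    show ae: "AE p in Q. SZ t Z' p = indicator {t..T} (fst p) *\<^sub>R hs_compose (Sa (fst p - t)) (Z (fst p) (snd p))"
      using SZ_closed_interval[OF t0, of Z] unfolding Z0 by eventually_elim simp
    show "L2 Q (\<lambda>p. indicator {t..T} (fst p) *\<^sub>R hs_compose (Sa (fst p - t)) (Z (fst p) (snd p)))"
      by (rule L2_cong_AE(1)[OF SZ_L2(1)[OF drift_solutionD(3)[OF S]] ae restricted_process_measurable[OF mR]])
    show "L2 M I" by (rule ito_L2(2)[OF I(1)])
  qed simp
  then have "has_ito_integral M F W t T (\<lambda>s \<omega>. hs_compose (Sa (s - t)) (Z s \<omega>)) I"
    unfolding has_ito_integral_iff[OF t0] using mR by blast
  moreover have "AE \<omega> in M. Y t \<omega> = Sa (T - t) (\<xi> \<omega>) + (LINT s:{t<..T}|lborel. blinfun_adj (op_exp DC C S (s - t)) (Z s \<omega>)) - I \<omega>"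
    using I(2) unfolding K[symmetric] drift_eq_LINT[OF t0] Z0[symmetric] .
  ultimately show "\<exists>I. has_ito_integral M F W t T (\<lambda>s \<omega>. hs_compose (Sa (s - t)) (Z s \<omega>)) I \<and>
      (AE \<omega> in M. Y t \<omega> = Sa (T - t) (\<xi> \<omega>) + (LINT s:{t<..T}|lborel. blinfun_adj (op_exp DC C S (s - t)) (Z s \<omega>)) - I \<omega>)"
    by blast
qed (rule prog)+

theorem mild_solution_exists:
  assumes K: "K = op_exp DC C S" and \<xi>: "L2 M \<xi>" "\<xi> \<in> borel_measurable (F T)"
  obtains Y Z where "mild_solution M F W S DC C T \<xi> Y Z"
    "solution_norm_sq M T Y Z \<le> ennreal bound * (\<integral>\<^sup>+\<omega>. ennreal ((norm (\<xi> \<omega>))\<^sup>2) \<partial>M)"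
proof -
  obtain Y0 Z0 where S0: "drift_solution \<xi> Z0 Y0 Z0" and ap0: "approx 0 T Z0" using drift_solution_exists[OF \<xi>] by blast
  obtain xs where xs: "\<And>n. elementary_on F 0 T (xs n)" "tends2 Q (\<lambda>n. EP (xs n)) Z0" using ap0 by (auto simp: approx_def)
  obtain r :: "nat \<Rightarrow> nat" where r: "tends2 Q (\<lambda>n. EP (xs n)) (\<lambda>p. lim (\<lambda>n. EP (xs (r n)) p))"
    by (rule L2_complete[OF tends2_L2(1)[OF xs(2)] tends2_Cauchy[OF xs(2)]]) (assumption, rule that)
  \<comment> \<open>A pointwise limit of elementary processes, so that progressive measurability
    holds outright and not just up to a null set. Since elementary processes vanish off (0, T], so
    does the limit, which lets the global norm be compared with the norm on [0, T].\<close>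
  define Z where "Z s \<omega> = lim (\<lambda>n. elementary_process (xs (r n)) s \<omega>)" for s \<omega>
  define Z' where "Z' = (\<lambda>p. Z (fst p) (snd p))"
  have r': "tends2 Q (\<lambda>n. EP (xs n)) Z'" using r by (simp add: Z'_def Z_def)
  have pZ: "progressive T F Z" unfolding Z_def[abs_def] by (rule progressive_lim, rule progressive_elementary[OF xs(1)])
  have ap: "approx 0 T Z'" using xs(1) r' by (auto simp: approx_def)
  have cut: "cut 0 T Z' = Z'"
  proof
    fix p :: "real \<times> 'w"
    have "EP (xs (r n)) p = 0" if "fst p \<notin> {0<..T}" for n
      using fun_cong[OF EP_support[OF xs(1)[of "r n"]], of p] that by (simp add: cut_def)
    then show "cut 0 T Z' p = Z' p" by (auto simp: cut_def Z'_def Z_def indicator_def)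
  qed
  have ae: "AE p in Q. Z0 p = Z' p" by (rule tends2_unique[OF xs(2) r'])
  obtain Y where pY: "progressive T F Y" and Y: "\<And>t. t \<in> {0..T} \<Longrightarrow> AE \<omega> in M. Y0 t \<omega> = Y t \<omega>"
    using progressive_modification[OF drift_solutionD(4)[OF S0] drift_solutionD(5)[OF S0] drift_solution_continuous[OF S0 ap0]] by blast
  have S: "drift_solution \<xi> Z' Y Z'"
    by (rule drift_solution_cong_solution[OF drift_solution_cong[OF S0 _ \<xi>(1) ae approx_L2[OF ap]] ae approx_L2[OF ap] Y])
      (use progressive_section[OF pY] in auto)
  show ?thesis
    by (rule that[OF drift_solution_imp_mild[OF K S ap cut Z'_def pY pZ] drift_solution_solution_norm[OF S cut Z'_def]])
qed

theorem mild_solution_unique: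
  assumes K: "K = op_exp DC C S" and \<xi>: "L2 M \<xi>"
    and 1: "mild_solution M F W S DC C T \<xi> Y Z" and 2: "mild_solution M F W S DC C T \<xi> Y' Z'"
  shows "same_solution M T Y Z Y' Z'"
proof -
  note S = mild_imp_wsol[OF K \<xi> 1] mild_imp_wsol[OF K \<xi> 2]
  have T0: "0 \<le> T" using T by simp
  have p: "progressive T F Z" "progressive T F Z'" using 1 2 by (simp_all add: mild_solution_def)
  \<comment> \<open>Uniqueness speaks of (0, T]; the instant s = 0 is a null set.\<close>
  have "AE p in Q. fst p \<in> {0..T} \<longrightarrow> Z (fst p) (snd p) = Z' (fst p) (snd p)"
    using drift_solution_unique(2)[OF S] AE_fst_neq[of 0] by eventually_elim (auto simp: cut_def indicator_def split: if_splits)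
  from AE_restrict_time[OF progressive_measurable[OF p(1) T0] progressive_measurable[OF p(2) T0] this]
  show ?thesis using drift_solution_unique(1)[OF S] by (simp add: same_solution_def)
qed

end

theorem theorem1:
  fixes DA DC :: "'h::{real_inner, banach, second_countable_topology} set"
    and A :: "'h \<Rightarrow> 'h"
    and S :: "real \<Rightarrow> 'h \<Rightarrow>\<^sub>L 'h"
    and C C1 :: "'h \<Rightarrow> 'k::{real_inner, banach, second_countable_topology} \<Rightarrow>\<^sub>L 'h"
    and C2 :: "'h \<Rightarrow>\<^sub>L ('k, 'h) hs"
    and T :: real
  assumes "linear_operator DA A" "dissipative DA A" "generates DA A S"
    and "linear_operator DC C"
    and "\<exists>\<gamma> L. 0 \<le> \<gamma> \<and> \<gamma> < 1/2 \<and> L > 0 \<and>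
      (\<forall>t>0. \<exists>K. has_exp_op DC C S t K \<and> norm K \<le> L * t powr (- \<gamma>))"
    and "\<forall>t>0. \<exists>K. has_op_exp DC C S t K"
    and "assumption_A1 DA A S DC C C1 C2"
    and "assumption_A2 DA A DC C1"
    and "T > 0"
  shows "\<exists>k>0. \<forall>(M :: 'w measure) F W.
    stochastic_basis M F \<longrightarrow> cylindrical_wiener M F W \<longrightarrow> generated_by_wiener M F W \<longrightarrow>
    (\<forall>\<xi>. L2_variable M (F T) \<xi> \<longrightarrow>
      (\<exists>Y Z. mild_solution M F W S DC C T \<xi> Y Z \<and>
        (\<forall>Y' Z'. mild_solution M F W S DC C T \<xi> Y' Z' \<longrightarrow> same_solution M T Y Z Y' Z') \<and>
        solution_norm_sq M T Y Z \<le> ennreal k * (\<integral>\<^sup>+\<omega>. ennreal ((norm (\<xi> \<omega>))\<^sup>2) \<partial>M)))"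
proof -
  \<comment> \<open>The kernel data, and with them the constant \<open>k.bound\<close>, are fixed
    from A, C and T before the probability space, the Wiener process and \<xi> are
    introduced.\<close>
  obtain lam q kap where "kernel S (op_exp DC C S) T lam q kap"
    using kernel_exists assms by blast
  then interpret k: kernel S "op_exp DC C S" T lam q kap .
  show ?thesis
  proof (intro exI[of _ k.bound] conjI allI impI)
    show "0 < k.bound" by (rule k.bound_pos)
    fix M :: "'w measure" and F and W :: "real \<Rightarrow> 'k \<Rightarrow> 'w \<Rightarrow> real" and \<xi> :: "'w \<Rightarrow> 'h"
    assume M: "stochastic_basis M F" and W: "cylindrical_wiener M F W" and g: "generated_by_wiener M F W"
      and L: "L2_variable M (F T) \<xi>"
    interpret prob_space M using M by (simp add: stochastic_basis_def)
    interpret backward_equation M F W S "op_exp DC C S" T lam q kap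
      by (intro backward_equation.intro wiener_filtration.intro wiener_filtration_axioms.intro k.kernel_axioms prob_space_axioms)
        (use M W g in \<open>simp_all add: stochastic_basis_def\<close>)
    have m: "\<xi> \<in> borel_measurable (F T)" using L by (simp add: L2_variable_def)
    have \<xi>: "L2 M \<xi>" using L F_measurable[OF m] \<open>T > 0\<close> by (simp add: L2_variable_def L2_iff_nn)
    obtain Y Z where "mild_solution M F W S DC C T \<xi> Y Z"
      "solution_norm_sq M T Y Z \<le> ennreal k.bound * (\<integral>\<^sup>+\<omega>. ennreal ((norm (\<xi> \<omega>))\<^sup>2) \<partial>M)"
      by (rule mild_solution_exists[OF refl \<xi> m])
    then show "\<exists>Y Z. mild_solution M F W S DC C T \<xi> Y Z \<and>
        (\<forall>Y' Z'. mild_solution M F W S DC C T \<xi> Y' Z' \<longrightarrow> same_solution M T Y Z Y' Z') \<and>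
        solution_norm_sq M T Y Z \<le> ennreal k.bound * (\<integral>\<^sup>+\<omega>. ennreal ((norm (\<xi> \<omega>))\<^sup>2) \<partial>M)"
      using mild_solution_unique[OF refl \<xi>] by blast
  qed
qed

end
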